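(* Let $\mathfrak g$ be a semisimple simply laced Lie algebra with an admissible diagram automorphism $\sigma$, and let $\mathbf i=(r_1,\dots,r_m)\in R(w_\circ)$, where $w_\circ$ is the longest element of $W({\mathfrak g^\sigma}^\vee)$. Let $\hat{\mathbf i}\in R(\hat w_\circ)$ be a lifting of $\mathbf i$. Then the natural $\mathbb C(q)$-linear map $$\iota_{\mathbf i}:U_q^+({\mathfrak g^\sigma}^\vee)\to U_q^+(\mathfrak g),\qquad \iota_{\mathbf i}(X_1^{a_1}\cdots X_m^{a_m})=\hat X_1^{a_1}\cdots\hat X_m^{a_m}\quad(a_1,\dots,a_m\in\mathbb Z_{\ge0})$$ is injective, has image contained in $U_q^+(\mathfrak g)^\sigma$, and maps the modified PBW basis $M(X_{\mathbf i})$ of $U_q^+({\mathfrak g^\sigma}^\vee)$ bijectively onto the fixed point set $M(X_{\hat{\mathbf i}})^\sigma$ of the modified PBW basis $M(X_{\hat{\mathbf i}})$ of $U_q^+(\mathfrak g)$.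
   Context: Let $A=(a_{ij})_{i,j\in I}$ be the Cartan matrix of $\mathfrak g$. A bijection $\sigma:I\to I$ is a diagram automorphism if $a_{\sigma(i)\sigma(j)}=a_{ij}$; it is admissible if $a_{i,\sigma^k(i)}=0$ whenever $\sigma^k(i)\ne i$. $I/\sigma$ indexes the $\sigma$-orbits $\mathcal O_r$. $U_q(\mathfrak g)$ over $\mathbb C(q)$ has generators $E_i,F_i,K_i^{\pm1}$ and the standard relations with $q_i=q^{d_i}$ ($[E_i,F_j]=\delta_{ij}\frac{K_i-K_i^{-1}}{q_i-q_i^{-1}}$, $K_iE_jK_i^{-1}=q_i^{a_{ij}}E_j$, $K_iF_jK_i^{-1}=q_i^{-a_{ij}}F_j$, quantum Serre); for $\mathfrak g$ simply laced $d_i=1$. $U_q^+$ is the subalgebra generated by the $E_i$; $\sigma$ acts by $E_i\mapsto E_{\sigma(i)}$. $U_q({\mathfrak g^\sigma}^\vee)$ is defined with index set $I/\sigma$, symmetrizers $d_r=|\mathcal O_r|$ and Cartan matrix $a_{rs}=|\mathcal O_r|^{-1}\sum_{i\in\mathcal O_r,j\in\mathcal O_s}a_{ij}$. For any semisimple Lie algebra, the braid group acts on $U_q$ by Lusztig's automorphisms: $T_i(K_j^{\pm1})=K_j^{\pm1}K_i^{\mp a_{ij}}$, $T_i(E_i)=-K_i^{-1}F_i$, $T_i(F_i)=-E_iK_i$, and for $i\ne j$, $T_i(E_j)=\sum_{s+r=-a_{ij}}(-1)^rq_i^{-r}E_i^{(r)}E_jE_i^{(s)}$, $T_i(F_j)=\sum_{s+r=-a_{ij}}(-1)^rq_i^{r}F_i^{(s)}F_jF_i^{(r)}$,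 with $Y_i^{(k)}=Y_i^k/[k]_{q_i}!$. $R(w)$ is the set of reduced words of a Weyl group element $w$. For $\mathbf i=(i_1,\dots,i_m)\in R(w_\circ)$, the modified PBW generators are $X_{\mathbf i}=\{X_1,\dots,X_m\}$ (in this order), $X_k=c_k^{-1}T_{i_1}\cdots T_{i_{k-1}}(E_{i_k})$, where $c_k=\gamma(s_{i_1}\cdots s_{i_{k-1}}(\alpha_{i_k})-\alpha_{i_k})$ and $\gamma:Q\to\mathbb C(q)^\times$ is the group homomorphism on the root lattice with $\gamma(\alpha_i)=q_i-q_i^{-1}$; $M(X_{\mathbf i})$ is the set of ordered monomials $X_1^{a_1}\cdots X_m^{a_m}$, a basis of $U_q^+$. The same definitions apply to both $\mathfrak g$ and ${\mathfrak g^\sigma}^\vee$. $W({\mathfrak g^\sigma}^\vee)$ is identified with $W(\mathfrak g)^\sigma$ via $s_r\mapsto\hat s_r=\prod_{i\in\mathcal O_r}s_i$; $w_\circ$ corresponds to the longest element $\hat w_\circ$ of $W(\mathfrak g)$. A lifting of $\mathbf i=(r_1,\dots,r_m)$ is $\hat{\mathbf i}=(\mathcal O_{r_1},\dots,\mathcal O_{r_m})\in R(\hat w_\circ)$, each orbit being listed in some order. Put $\hat T_r=\prod_{i\in\mathcal O_r}T_i$, $\hat E_r=\prod_{i\in\mathcal O_r}E_i$, and $\hat X_k=\hat c_k^{-1}\hat T_{r_1}\cdots\hat T_{r_{k-1}}(\hat E_{r_k})$ with $\hat c_k=\prod_{i\in\mathcal O_{r_k}}\gamma(\hat s_{r_1}\cdots\hat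 s_{r_{k-1}}(\alpha_i)-\alpha_i)$. *)

theory Defs
  imports
    "HOL-Library.Poly_Mapping"
    "HOL-Library.FuncSet"
    "HOL-Computational_Algebra.Polynomial"
    "HOL-Computational_Algebra.Fraction_Field"
    "HOL-Combinatorics.Orbits"
    "HOL-Algebra.QuotRing"
    "HOL-Algebra.Module"
    "HOL-Algebra.Generated_Rings"
begin

section \<open>The field of rational functions in q and quantum integers\<close>

type_synonym Cq = "complex poly fract"

definition q_var :: Cq where
  "q_var = Fraction_Field.Fract [:0, 1:] 1"

definition qint :: "Cq \<Rightarrow> nat \<Rightarrow> Cq" where
  "qint v n = (v ^ n - inverse v ^ n) / (v - inverse v)"

definition qfact :: "Cq \<Rightarrow> nat \<Rightarrow> Cq" where
  "qfact v n = (\<Prod>k=1..n. qint v k)"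

definition qbinom :: "Cq \<Rightarrow> nat \<Rightarrow> nat \<Rightarrow> Cq" where
  "qbinom v n k = qfact v n / (qfact v k * qfact v (n - k))"


section \<open>Cartan data\<close>

text \<open>An index set \<open>I\<close>, a matrix \<open>(a i j)\<close> and symmetrizers \<open>d i\<close>. A semisimple complex Lie algebra
  is given, up to isomorphism, by its Cartan matrix; these are exactly the matrices of finite type.\<close>

record 'i cartan_datum =
  idx :: "'i set"
  cm :: "'i \<Rightarrow> 'i \<Rightarrow> int"
  sym :: "'i \<Rightarrow> nat"

definition finite_type :: "'i cartan_datum \<Rightarrow> bool" where
  "finite_type G \<longleftrightarrow>
     finite (idx G) \<and>
     (\<forall>i\<in>idx G. cm G i i = 2 \<and> sym G i > 0) \<and>
     (\<forall>i\<in>idx G. \<forall>j\<in>idx G. i \<noteq> j \<longrightarrow> cm G i j \<le> 0 \<and> (cm G i j = 0 \<longleftrightarrow> cm G j i = 0)) \<and>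
     (\<forall>i\<in>idx G. \<forall>j\<in>idx G. int (sym G i) * cm G i j = int (sym G j) * cm G j i) \<and>
     (\<forall>x :: 'i \<Rightarrow> real. (\<exists>i\<in>idx G. x i \<noteq> 0) \<longrightarrow>
        0 < (\<Sum>i\<in>idx G. \<Sum>j\<in>idx G. real (sym G i) * real_of_int (cm G i j) * x i * x j))"

definition simply_laced :: "'i cartan_datum \<Rightarrow> bool" where
  "simply_laced G \<longleftrightarrow>
     (\<forall>i\<in>idx G. sym G i = 1) \<and>
     (\<forall>i\<in>idx G. \<forall>j\<in>idx G. i \<noteq> j \<longrightarrow> cm G i j \<in> {0, - 1})"

definition diagram_automorphism :: "'i cartan_datum \<Rightarrow> ('i \<Rightarrow> 'i) \<Rightarrow> bool" where
  "diagram_automorphism G \<sigma> \<longleftrightarrow>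
     bij_betw \<sigma> (idx G) (idx G) \<and>
     (\<forall>i\<in>idx G. \<forall>j\<in>idx G. cm G (\<sigma> i) (\<sigma> j) = cm G i j)"

definition admissible :: "'i cartan_datum \<Rightarrow> ('i \<Rightarrow> 'i) \<Rightarrow> bool" where
  "admissible G \<sigma> \<longleftrightarrow>
     (\<forall>i\<in>idx G. \<forall>k. (\<sigma> ^^ k) i \<noteq> i \<longrightarrow> cm G i ((\<sigma> ^^ k) i) = 0)"

text \<open>The datum of the Langlands dual of the fixed Lie algebra. Its indices are the orbits
  themselves. The integer division is exact: the inner sum over \<open>j\<close> does not depend on the
  choice of \<open>i\<close> in the orbit.\<close>

definition folded :: "'i cartan_datum \<Rightarrow> ('i \<Rightarrow> 'i) \<Rightarrow> 'i set cartan_datum" where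
  "folded G \<sigma> =
     \<lparr>idx = orbit \<sigma> ` idx G,
      cm = (\<lambda>r s. (\<Sum>i\<in>r. \<Sum>j\<in>s. cm G i j) div int (card r)),
      sym = card\<rparr>"

definition q_at :: "'i cartan_datum \<Rightarrow> 'i \<Rightarrow> Cq" where
  "q_at G i = q_var ^ sym G i"


section \<open>Root lattice, Weyl group, reduced words\<close>

text \<open>A root lattice element is its coefficient function with respect to the simple roots.\<close>

definition simple_root :: "'i \<Rightarrow> 'i \<Rightarrow> int" where
  "simple_root i = (\<lambda>j. if j = i then 1 else 0)"

definition reflection :: "'i cartan_datum \<Rightarrow> 'i \<Rightarrow> ('i \<Rightarrow> int) \<Rightarrow> ('i \<Rightarrow> int)" where
  "reflection G i \<beta> = (\<lambda>k. \<beta> k - (\<Sum>j\<in>idx G. cm G i j * \<beta> j) * simple_root i k)"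

definition weyl_word :: "'i cartan_datum \<Rightarrow> 'i list \<Rightarrow> ('i \<Rightarrow> int) \<Rightarrow> ('i \<Rightarrow> int)" where
  "weyl_word G ws = foldr (reflection G) ws"

definition weyl_group :: "'i cartan_datum \<Rightarrow> (('i \<Rightarrow> int) \<Rightarrow> ('i \<Rightarrow> int)) set" where
  "weyl_group G = weyl_word G ` lists (idx G)"

definition weyl_length :: "'i cartan_datum \<Rightarrow> (('i \<Rightarrow> int) \<Rightarrow> ('i \<Rightarrow> int)) \<Rightarrow> nat" where
  "weyl_length G w = (LEAST n. \<exists>ws\<in>lists (idx G). length ws = n \<and> weyl_word G ws = w)"

definition reduced_words :: "'i cartan_datum \<Rightarrow> (('i \<Rightarrow> int) \<Rightarrow> ('i \<Rightarrow> int)) \<Rightarrow> 'i list set" where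
  "reduced_words G w = {ws \<in> lists (idx G). weyl_word G ws = w \<and> length ws = weyl_length G w}"

definition longest_element :: "'i cartan_datum \<Rightarrow> (('i \<Rightarrow> int) \<Rightarrow> ('i \<Rightarrow> int)) \<Rightarrow> bool" where
  "longest_element G w \<longleftrightarrow>
     w \<in> weyl_group G \<and> (\<forall>v\<in>weyl_group G. weyl_length G v \<le> weyl_length G w)"

text \<open>A lifting of a word in the orbits lists each of its letters in some order; the lifted word
  is the concatenation.\<close>

definition is_lifting :: "'i set list \<Rightarrow> 'i list \<Rightarrow> bool" where
  "is_lifting rs ws \<longleftrightarrow>
     (\<exists>oss. list_all2 (\<lambda>r os. distinct os \<and> set os = r) rs oss \<and> ws = concat oss)"

definition gamma :: "'i cartan_datum \<Rightarrow> ('i \<Rightarrow> int) \<Rightarrow> Cq" where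
  "gamma G \<beta> = (\<Prod>i\<in>idx G. (q_at G i - inverse (q_at G i)) powi \<beta> i)"


section \<open>The free algebra on the Chevalley generators\<close>

datatype 'i gen = GenE 'i | GenF 'i | GenK 'i | GenKinv 'i

datatype 'a free_word = FW (letters: "'a list")

instantiation free_word :: (type) monoid_add
begin

definition zero_free_word :: "'a free_word" where
  "zero_free_word = FW []"

definition plus_free_word :: "'a free_word \<Rightarrow> 'a free_word \<Rightarrow> 'a free_word" where
  "plus_free_word v w = FW (letters v @ letters w)"

instance
  by standard (simp_all add: zero_free_word_def plus_free_word_def)

end

text \<open>Since words form a monoid (written additively) under concatenation, multiplication of
  finitely supported functions on words is the convolution product of the free associative
  algebra.\<close>

type_synonym 'i free_alg = "'i gen free_word \<Rightarrow>\<^sub>0 Cq"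

definition fgen :: "'i gen \<Rightarrow> 'i free_alg" where
  "fgen g = Poly_Mapping.single (FW [g]) 1"

definition fconst :: "Cq \<Rightarrow> 'i free_alg" where
  "fconst c = Poly_Mapping.single 0 c"

definition free_ring :: "'i set \<Rightarrow> 'i free_alg ring" where
  "free_ring I =
     \<lparr>carrier = {x. \<forall>w\<in>Poly_Mapping.keys x. \<forall>g\<in>set (letters w). set_gen g \<subseteq> I},
      mult = (*), one = 1, zero = 0, add = (+)\<rparr>"

text \<open>The relabelling of generators, as an algebra endomorphism of the free algebra.\<close>

definition frelabel :: "('i \<Rightarrow> 'i) \<Rightarrow> 'i free_alg \<Rightarrow> 'i free_alg" where
  "frelabel \<sigma> x =
     (\<Sum>w\<in>Poly_Mapping.keys x.
        Poly_Mapping.single (map_free_word (map_gen \<sigma>) w) (Poly_Mapping.lookup x w))"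


section \<open>The quantized enveloping algebra\<close>

text \<open>The quantum Serre element obtained from two families of letters (all \<open>E\<close> or all \<open>F\<close>).\<close>

definition serre :: "'i cartan_datum \<Rightarrow> ('i \<Rightarrow> 'i gen) \<Rightarrow> 'i \<Rightarrow> 'i \<Rightarrow> 'i free_alg" where
  "serre G X i j =
     (let n = nat (1 - cm G i j) in
      \<Sum>k=0..n. fconst ((- 1) ^ k * qbinom (q_at G i) n k)
                 * fgen (X i) ^ (n - k) * fgen (X j) * fgen (X i) ^ k)"

text \<open>Each relation \<open>x = y\<close> is represented by \<open>x - y\<close>.\<close>

definition uq_relations :: "'i cartan_datum \<Rightarrow> 'i free_alg set" where
  "uq_relations G =
     {fgen (GenK i) * fgen (GenKinv i) - 1 | i. i \<in> idx G} \<union>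
     {fgen (GenKinv i) * fgen (GenK i) - 1 | i. i \<in> idx G} \<union>
     {fgen (GenK i) * fgen (GenK j) - fgen (GenK j) * fgen (GenK i) | i j.
        i \<in> idx G \<and> j \<in> idx G} \<union>
     {fgen (GenK i) * fgen (GenE j) * fgen (GenKinv i)
        - fconst (q_at G i powi cm G i j) * fgen (GenE j) | i j. i \<in> idx G \<and> j \<in> idx G} \<union>
     {fgen (GenK i) * fgen (GenF j) * fgen (GenKinv i)
        - fconst (q_at G i powi (- cm G i j)) * fgen (GenF j) | i j. i \<in> idx G \<and> j \<in> idx G} \<union>
     {fgen (GenE i) * fgen (GenF j) - fgen (GenF j) * fgen (GenE i)
        - (if i = j
           then fconst (inverse (q_at G i - inverse (q_at G i)))
                  * (fgen (GenK i) - fgen (GenKinv i))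
           else 0) | i j. i \<in> idx G \<and> j \<in> idx G} \<union>
     {serre G GenE i j | i j. i \<in> idx G \<and> j \<in> idx G \<and> i \<noteq> j} \<union>
     {serre G GenF i j | i j. i \<in> idx G \<and> j \<in> idx G \<and> i \<noteq> j}"

definition uq_ideal :: "'i cartan_datum \<Rightarrow> 'i free_alg set" where
  "uq_ideal G = Idl\<^bsub>free_ring (idx G)\<^esub> (uq_relations G)"

definition uq_class :: "'i cartan_datum \<Rightarrow> 'i free_alg \<Rightarrow> 'i free_alg set" where
  "uq_class G x = uq_ideal G +>\<^bsub>free_ring (idx G)\<^esub> x"

text \<open>The quotient ring, with the scalar multiplication by rational functions added, so that its
  elements are cosets in the free algebra.\<close>

definition Uq :: "'i cartan_datum \<Rightarrow> (Cq, 'i free_alg set) module" where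
  "Uq G =
     (let R = free_ring (idx G) Quot uq_ideal G in
      \<lparr>carrier = carrier R, mult = mult R, one = one R, zero = zero R, add = add R,
       smult = (\<lambda>c u. uq_class G (fconst c) \<otimes>\<^bsub>R\<^esub> u)\<rparr>)"

definition uE :: "'i cartan_datum \<Rightarrow> 'i \<Rightarrow> 'i free_alg set" where
  "uE G i = uq_class G (fgen (GenE i))"

definition uF :: "'i cartan_datum \<Rightarrow> 'i \<Rightarrow> 'i free_alg set" where
  "uF G i = uq_class G (fgen (GenF i))"

definition uK :: "'i cartan_datum \<Rightarrow> 'i \<Rightarrow> 'i free_alg set" where
  "uK G i = uq_class G (fgen (GenK i))"

definition uKinv :: "'i cartan_datum \<Rightarrow> 'i \<Rightarrow> 'i free_alg set" where
  "uKinv G i = uq_class G (fgen (GenKinv i))"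

definition uKpow :: "'i cartan_datum \<Rightarrow> 'i \<Rightarrow> int \<Rightarrow> 'i free_alg set" where
  "uKpow G i n =
     (if n \<ge> 0 then uK G i [^]\<^bsub>Uq G\<^esub> nat n else uKinv G i [^]\<^bsub>Uq G\<^esub> nat (- n))"

text \<open>The subalgebra generated by the \<open>E i\<close> is the subring generated by them and the scalars.\<close>

definition Uq_plus :: "'i cartan_datum \<Rightarrow> 'i free_alg set set" where
  "Uq_plus G =
     generate_ring (Uq G) (range (\<lambda>c. c \<odot>\<^bsub>Uq G\<^esub> \<one>\<^bsub>Uq G\<^esub>) \<union> uE G ` idx G)"

text \<open>Action of a diagram automorphism: the image of a coset under relabelling is again a coset,
  because the set of defining relations is preserved.\<close>

definition uq_aut :: "('i \<Rightarrow> 'i) \<Rightarrow> 'i free_alg set \<Rightarrow> 'i free_alg set" where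
  "uq_aut \<sigma> u = frelabel \<sigma> ` u"

definition fixed_points :: "('a \<Rightarrow> 'a) \<Rightarrow> 'a set \<Rightarrow> 'a set" where
  "fixed_points f S = {x \<in> S. f x = x}"

definition linear_map_on ::
  "(Cq, 'a) module \<Rightarrow> 'a set \<Rightarrow> (Cq, 'b) module \<Rightarrow> ('a \<Rightarrow> 'b) \<Rightarrow> bool" where
  "linear_map_on M V N f \<longleftrightarrow>
     (\<forall>x\<in>V. \<forall>y\<in>V. f (x \<oplus>\<^bsub>M\<^esub> y) = f x \<oplus>\<^bsub>N\<^esub> f y) \<and>
     (\<forall>c. \<forall>x\<in>V. f (c \<odot>\<^bsub>M\<^esub> x) = c \<odot>\<^bsub>N\<^esub> f x)"


section \<open>Lusztig's braid group action\<close>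

definition algebra_automorphism :: "(Cq, 'a) module \<Rightarrow> ('a \<Rightarrow> 'a) \<Rightarrow> bool" where
  "algebra_automorphism A f \<longleftrightarrow>
     f \<in> ring_iso A A \<and> (\<forall>c. \<forall>x\<in>carrier A. f (c \<odot>\<^bsub>A\<^esub> x) = c \<odot>\<^bsub>A\<^esub> f x)"

definition divided_power ::
  "'i cartan_datum \<Rightarrow> 'i \<Rightarrow> 'i free_alg set \<Rightarrow> nat \<Rightarrow> 'i free_alg set" where
  "divided_power G i y k = inverse (qfact (q_at G i) k) \<odot>\<^bsub>Uq G\<^esub> (y [^]\<^bsub>Uq G\<^esub> k)"

fun alternating :: "'a \<Rightarrow> 'a \<Rightarrow> nat \<Rightarrow> 'a list" where
  "alternating i j 0 = []"
| "alternating i j (Suc n) = i # alternating j i n"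

text \<open>Order of the product of two distinct simple reflections (finite type).\<close>

definition coxeter_number :: "'i cartan_datum \<Rightarrow> 'i \<Rightarrow> 'i \<Rightarrow> nat" where
  "coxeter_number G i j =
     (let p = cm G i j * cm G j i in if p = 0 then 2 else if p = 1 then 3 else if p = 2 then 4 else 6)"

text \<open>\<open>T\<close> is the action of the braid group by algebra automorphisms whose values on the generators
  are given by Lusztig's formulas. Since the algebra is generated by them, these values determine every
  \<open>T i\<close> on the carrier.\<close>

definition lusztig_action ::
  "'i cartan_datum \<Rightarrow> ('i \<Rightarrow> 'i free_alg set \<Rightarrow> 'i free_alg set) \<Rightarrow> bool" where
  "lusztig_action G T \<longleftrightarrow>
     (\<forall>i\<in>idx G. algebra_automorphism (Uq G) (T i)) \<and>
     (\<forall>i\<in>idx G. \<forall>j\<in>idx G. i \<noteq> j \<longrightarrow>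
        (\<forall>x\<in>carrier (Uq G). foldr T (alternating i j (coxeter_number G i j)) x =
                              foldr T (alternating j i (coxeter_number G i j)) x)) \<and>
     (\<forall>i\<in>idx G. \<forall>j\<in>idx G.
        T i (uK G j) = uK G j \<otimes>\<^bsub>Uq G\<^esub> uKpow G i (- cm G i j) \<and>
        T i (uKinv G j) = uKinv G j \<otimes>\<^bsub>Uq G\<^esub> uKpow G i (cm G i j)) \<and>
     (\<forall>i\<in>idx G.
        T i (uE G i) = \<ominus>\<^bsub>Uq G\<^esub> (uKinv G i \<otimes>\<^bsub>Uq G\<^esub> uF G i) \<and>
        T i (uF G i) = \<ominus>\<^bsub>Uq G\<^esub> (uE G i \<otimes>\<^bsub>Uq G\<^esub> uK G i)) \<and>
     (\<forall>i\<in>idx G. \<forall>j\<in>idx G. i \<noteq> j \<longrightarrow>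
        (let n = nat (- cm G i j); v = q_at G i in
         T i (uE G j) =
           (\<Oplus>\<^bsub>Uq G\<^esub>r\<in>{0..n}. ((- 1) ^ r * inverse v ^ r) \<odot>\<^bsub>Uq G\<^esub>
              (divided_power G i (uE G i) r \<otimes>\<^bsub>Uq G\<^esub> uE G j
                 \<otimes>\<^bsub>Uq G\<^esub> divided_power G i (uE G i) (n - r))) \<and>
         T i (uF G j) =
           (\<Oplus>\<^bsub>Uq G\<^esub>r\<in>{0..n}. ((- 1) ^ r * v ^ r) \<odot>\<^bsub>Uq G\<^esub>
              (divided_power G i (uF G i) (n - r) \<otimes>\<^bsub>Uq G\<^esub> uF G j
                 \<otimes>\<^bsub>Uq G\<^esub> divided_power G i (uF G i) r))))"


section \<open>Modified PBW generators and their folded counterparts\<close>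

definition pbw_coeff :: "'i cartan_datum \<Rightarrow> 'i list \<Rightarrow> nat \<Rightarrow> Cq" where
  "pbw_coeff G ws k =
     gamma G (\<lambda>j. weyl_word G (take k ws) (simple_root (ws ! k)) j - simple_root (ws ! k) j)"

definition pbw_gens ::
  "'i cartan_datum \<Rightarrow> ('i \<Rightarrow> 'i free_alg set \<Rightarrow> 'i free_alg set) \<Rightarrow> 'i list \<Rightarrow> 'i free_alg set list"
  where
  "pbw_gens G T ws =
     map (\<lambda>k. inverse (pbw_coeff G ws k) \<odot>\<^bsub>Uq G\<^esub> foldr T (take k ws) (uE G (ws ! k)))
       [0..<length ws]"

definition ordered_monomial :: "('a, 'm) ring_scheme \<Rightarrow> 'a list \<Rightarrow> nat list \<Rightarrow> 'a" where
  "ordered_monomial R xs as = foldr (\<lambda>(x, a) y. x [^]\<^bsub>R\<^esub> a \<otimes>\<^bsub>R\<^esub> y) (zip xs as) \<one>\<^bsub>R\<^esub>"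

definition ordered_monomials :: "('a, 'm) ring_scheme \<Rightarrow> 'a list \<Rightarrow> 'a set" where
  "ordered_monomials R xs = {ordered_monomial R xs as | as. length as = length xs}"

text \<open>Products over an orbit are taken along an arbitrary enumeration: for an admissible
  automorphism all the factors involved commute.\<close>

definition orbit_list :: "'i set \<Rightarrow> 'i list" where
  "orbit_list r = (SOME os. distinct os \<and> set os = r)"

definition reflection_hat :: "'i cartan_datum \<Rightarrow> 'i set \<Rightarrow> ('i \<Rightarrow> int) \<Rightarrow> ('i \<Rightarrow> int)" where
  "reflection_hat G r = foldr (reflection G) (orbit_list r)"

definition T_hat ::
  "('i \<Rightarrow> 'i free_alg set \<Rightarrow> 'i free_alg set) \<Rightarrow> 'i set \<Rightarrow> 'i free_alg set \<Rightarrow> 'i free_alg set" where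
  "T_hat T r = foldr T (orbit_list r)"

definition E_hat :: "'i cartan_datum \<Rightarrow> 'i set \<Rightarrow> 'i free_alg set" where
  "E_hat G r = foldr (\<lambda>i y. uE G i \<otimes>\<^bsub>Uq G\<^esub> y) (orbit_list r) \<one>\<^bsub>Uq G\<^esub>"

definition pbw_coeff_hat :: "'i cartan_datum \<Rightarrow> 'i set list \<Rightarrow> nat \<Rightarrow> Cq" where
  "pbw_coeff_hat G rs k =
     (\<Prod>i\<in>rs ! k.
        gamma G (\<lambda>j. foldr (reflection_hat G) (take k rs) (simple_root i) j - simple_root i j))"

definition pbw_gens_hat ::
  "'i cartan_datum \<Rightarrow> ('i \<Rightarrow> 'i free_alg set \<Rightarrow> 'i free_alg set) \<Rightarrow> 'i set list
     \<Rightarrow> 'i free_alg set list" where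
  "pbw_gens_hat G T rs =
     map (\<lambda>k. inverse (pbw_coeff_hat G rs k) \<odot>\<^bsub>Uq G\<^esub> foldr (T_hat T) (take k rs) (E_hat G (rs ! k)))
       [0..<length rs]"

text \<open>The defining property of the map \<open>\<iota>\<close>; it is \<^const>\<open>undefined\<close> outside the positive part,
  so that it can be determined uniquely.\<close>

definition is_iota ::
  "'i cartan_datum \<Rightarrow> ('i \<Rightarrow> 'i) \<Rightarrow> ('i \<Rightarrow> 'i free_alg set \<Rightarrow> 'i free_alg set)
     \<Rightarrow> ('i set \<Rightarrow> 'i set free_alg set \<Rightarrow> 'i set free_alg set) \<Rightarrow> 'i set list
     \<Rightarrow> ('i set free_alg set \<Rightarrow> 'i free_alg set) \<Rightarrow> bool" where
  "is_iota G \<sigma> T T' rs \<iota> \<longleftrightarrow>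
     \<iota> \<in> Uq_plus (folded G \<sigma>) \<rightarrow>\<^sub>E Uq_plus G \<and>
     linear_map_on (Uq (folded G \<sigma>)) (Uq_plus (folded G \<sigma>)) (Uq G) \<iota> \<and>
     (\<forall>as. length as = length rs \<longrightarrow>
        \<iota> (ordered_monomial (Uq (folded G \<sigma>)) (pbw_gens (folded G \<sigma>) T' rs) as) =
          ordered_monomial (Uq G) (pbw_gens_hat G T rs) as)"

end

theory Submission
  imports Defs
begin

text \<open>Everything follows from the PBW theorem for \<open>G\<close> and for \<open>folded G \<sigma>\<close>, that is, from the fact that
  the ordered monomials in the root vectors of a reduced word are linearly independent and, for the
  longest element, span the positive part. Root vectors are positive by an induction on the length which
  passes to cosets of dihedral subgroups, where the chains of root vectors are explicit.
  For independence, apply \<open>T\<^sub>i\<inverse>\<close> to a relation \<open>\<Sum> E\<^sub>i^a T\<^sub>i (y\<^sub>a) = 0\<close>: since \<open>E\<^sub>i\<close> becomes a multiple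
  of \<open>F\<^sub>i K\<^sub>i\<close>, the element \<open>y\<^sub>0\<close> lies in the right ideal generated by the \<open>F\<^sub>i\<close> and the \<open>K\<^sub>i - 1\<close>, which
  meets the positive part trivially because of the Verma module; then cancel one \<open>E\<^sub>i\<close> and iterate.
  For spanning, \<open>U\<^sup>+\<close> is the sum of the \<open>E\<^sub>i^a T\<^sub>i (U\<^sup>+)\<close>; after iterating along a word of the longest
  element the remaining factors contribute only scalars modulo the left ideal of the Verma module.

  The automorphism \<open>\<sigma>\<close> permutes the letters of each orbit, which commute, so it permutes the monomials of
  a lifted word by permuting the exponents inside each block. A monomial is therefore fixed iff its exponents are
  constant on blocks, and these monomials are exactly the ones in the folded root vectors.\<close>

section \<open>Quantum integers\<close>

text \<open>\<open>Uq\<close> is a ring on a carrier set of cosets, while the computations want a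
  type of class \<open>ring_1\<close>. The algebra is therefore embedded as a set \<open>eU\<close>
  of linear operators on the free algebra, by choosing a linear complement of the ideal of
  relations, and the braid operators are transported to \<open>eU\<close>.

  The divided power sums of Lusztig are awkward to compute with. They are rewritten as iterated
  q-commutators, for which one commutator formula with F_i yields both the compatibility of the
  Serre elements with F_i on the Verma module and the way T_i reverses such a chain; the rank two
  root vectors follow from it.

  The weight \<kappa> of the Verma module is a parameter because comparing two values of it
  separates the coefficients of K_i and of its inverse, and this is what cancelling E_i requires.

  The normalisation by \<gamma> is harmless: nonzero scalars affect neither independence nor
  spanning, \<gamma> is \<sigma>-invariant, and the constant of a folded root vector is the product
  of the constants over the orbit, so that folded root vectors are exactly products of root vectors
  of the lifted word.\<close>

definition qi :: "Cq \<Rightarrow> int \<Rightarrow> Cq" where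
  "qi v z = (v powi z - v powi (- z)) / (v - inverse v)"

definition generic :: "Cq \<Rightarrow> bool" where
  "generic v \<longleftrightarrow> v \<noteq> 0 \<and> (\<forall>n>0. v ^ n \<noteq> 1)"

lemma generic_nz: "generic v \<Longrightarrow> v \<noteq> 0"
  by (simp add: generic_def)

lemma generic_powi: "generic v \<Longrightarrow> z \<noteq> 0 \<Longrightarrow> v powi z \<noteq> 1"
  unfolding generic_def power_int_def
  by (auto simp: power_inverse)

lemma generic_powi_diff:
  assumes "generic v" "z \<noteq> y" shows "v powi z \<noteq> v powi y"
proof
  assume "v powi z = v powi y"
  then have "v powi (z - y) = 1" using generic_nz[OF assms(1)] by (simp add: power_int_diff)
  with generic_powi[OF assms(1), of "z - y"] assms(2) show False by simp
qed

lemma generic_d: assumes "generic v" shows "v - inverse v \<noteq> 0"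
proof -
  have "v powi 1 \<noteq> v powi (-1)" by (rule generic_powi_diff[OF assms]) simp
  then show ?thesis by (simp add: power_int_minus)
qed

lemma qi_nz: "generic v \<Longrightarrow> z \<noteq> 0 \<Longrightarrow> qi v z \<noteq> 0"
  using generic_powi_diff[of v z "- z"] generic_d[of v] by (simp add: qi_def)

lemma qint_qi: "qint v n = qi v (int n)"
  by (simp add: qint_def qi_def power_int_minus power_inverse)

lemma qi_0 [simp]: "qi v 0 = 0"
  by (simp add: qi_def)

lemma qi_1: "generic v \<Longrightarrow> qi v 1 = 1"
  using generic_d[of v] by (simp add: qi_def power_int_minus)

text \<open>The coefficient that arises in the induction step of \<open>fr_comm_f\<close> is the
  left side. With \<open>v powi a\<close> and \<open>v powi m\<close> replaced by free nonzero A and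
  M this is an identity of rational functions.\<close>

lemma qi_rec:
  assumes "generic v"
  shows "qi v (1 - a - m) * qi v m - qi v (a + 2 * m) = qi v (m + 1) * qi v (- a - m)"
proof -
  have v: "v \<noteq> 0" "v - inverse v \<noteq> 0" using assms generic_nz generic_d by auto
  then have w: "v * v - 1 \<noteq> 0" by (auto simp: field_simps)
  define A where "A = v powi a"
  define M where "M = v powi m"
  have nz: "A \<noteq> 0" "M \<noteq> 0" using v by (auto simp: A_def M_def)
  have e: "v powi (1 - a - m) = v / (A * M)" "v powi - (1 - a - m) = A * M / v"
    "v powi (a + 2 * m) = A * M ^ 2" "v powi - (a + 2 * m) = 1 / (A * M ^ 2)"
    "v powi (m + 1) = M * v" "v powi - (m + 1) = 1 / (M * v)" "v powi (- a - m) = 1 / (A * M)"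
    "v powi - (- a - m) = A * M" "v powi m = M" "v powi (- m) = 1 / M"
    using v by (simp_all add: A_def M_def power_int_add power_int_diff power_int_minus power_int_mult field_simps power2_eq_square)
  have d: "v - inverse v = (v * v - 1) / v" using v by (simp add: field_simps)
  show ?thesis unfolding qi_def e d using v nz w
    by (simp add: divide_simps power2_eq_square) (simp add: algebra_simps)
qed

lemma powi_merge:
  fixes v :: "'f::field"
  assumes "v \<noteq> 0"
  shows "v powi a * v powi b = v powi (a + b)" "v powi a * (v powi b * c) = v powi (a + b) * c"
  using assms by (simp_all add: power_int_add)

lemma qi_add:
  assumes "generic v"
  shows "qi v (s + r) = v powi r * qi v s + v powi (- s) * qi v r"
proof -
  have v: "v \<noteq> 0" "v - inverse v \<noteq> 0" using assms generic_nz generic_d by auto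
  show ?thesis unfolding qi_def using v powi_merge[OF v(1)]
    by (simp add: add_divide_distrib[symmetric] algebra_simps)
qed

section \<open>Iterated q-commutators\<close>

locale cq_algebra = vector_space sc for sc :: "Cq \<Rightarrow> 'a::ring_1 \<Rightarrow> 'a" (infixr "*s" 75) +
  assumes sc_left [simp]: "(c *s x) * y = c *s (x * y)"
    and sc_right [simp]: "x * (c *s y) = c *s (x * y)"
begin

text \<open>With divided powers, \<open>fr v a e x m\<close> equals
  \<open>\<Sum>r\<le>m. (-1)^r v^(r (a + m - 1)) e^(r) x e^(m - r)\<close>. For \<open>a = a\<^sub>i\<^sub>j\<close> the element with \<open>m = - a\<close> is
  \<open>T\<^sub>i (E\<^sub>j)\<close>, and the one with \<open>m = 1 - a\<close> is a multiple of the Serre element. \<open>fl\<close> is the mirror image.\<close>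

primrec fr :: "Cq \<Rightarrow> int \<Rightarrow> 'a \<Rightarrow> 'a \<Rightarrow> nat \<Rightarrow> 'a" where
  "fr v a e x 0 = x"
| "fr v a e x (Suc m) = inverse (qi v (int m + 1)) *s
     (fr v a e x m * e - v powi (a + 2 * int m) *s (e * fr v a e x m))"

primrec fl :: "Cq \<Rightarrow> int \<Rightarrow> 'a \<Rightarrow> 'a \<Rightarrow> nat \<Rightarrow> 'a" where
  "fl v a e x 0 = x"
| "fl v a e x (Suc m) = inverse (qi v (int m + 1)) *s
     (e * fl v a e x m - v powi (a + 2 * int m) *s (fl v a e x m * e))"

lemma fr_Suc:
  assumes "generic v"
  shows "qi v (int m + 1) *s fr v a e x (Suc m) = fr v a e x m * e - v powi (a + 2 * int m) *s (e * fr v a e x m)"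
  using qi_nz[OF assms, of "int m + 1"] by simp

lemma fl_Suc:
  assumes "generic v"
  shows "qi v (int m + 1) *s fl v a e x (Suc m) = e * fl v a e x m - v powi (a + 2 * int m) *s (fl v a e x m * e)"
  using qi_nz[OF assms, of "int m + 1"] by simp

lemma fr_conj:
  assumes "k * e = d *s (e * k)" "k * x = c *s (x * k)"
  shows "k * fr v a e x m = (d ^ m * c) *s (fr v a e x m * k)"
proof (induction m)
  case 0 then show ?case using assms by simp
next
  case (Suc m)
  let ?g = "fr v a e x m"
  have 1: "k * (?g * e) = (d ^ Suc m * c) *s (?g * e * k)"
    by (simp only: mult.assoc[symmetric] Suc.IH sc_left) (simp add: mult.assoc assms(1) mult_ac)
  have 2: "k * (e * ?g) = (d ^ Suc m * c) *s (e * ?g * k)"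
    by (simp only: mult.assoc[symmetric] assms(1) sc_left) (simp add: mult.assoc Suc.IH mult_ac)
  have "k * fr v a e x (Suc m) = inverse (qi v (int m + 1)) *s (k * (?g * e) - v powi (a + 2 * int m) *s (k * (e * ?g)))"
    by (simp add: right_diff_distrib)
  also have "\<dots> = (d ^ Suc m * c) *s (fr v a e x (Suc m) * k)"
    unfolding 1 2 by (simp add: scale_right_diff_distrib left_diff_distrib mult_ac add_ac)
  finally show ?case .
qed

lemma fr_weight:
  assumes "k * e = v powi b *s (e * k)" "k * x = c *s (x * k)"
  shows "k * fr v a e x m = (v powi (b * int m) * c) *s (fr v a e x m * k)"
  using fr_conj[OF assms] by (simp add: power_int_mult)

text \<open>Commuting with F_i undoes one q-commutator with E_i. The coefficient [-a-m] vanishes at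
  m = -a, so the next iterate, which is the Serre element up to a scalar, commutes with F_i.\<close>

lemma fr_comm_f:
  assumes g: "generic v" and kki: "k * ki = 1" "ki * k = 1"
    and ke: "k * e = v powi 2 *s (e * k)" and kx: "k * x = v powi a *s (x * k)"
    and ef: "e * f - f * e = inverse (v - inverse v) *s (k - ki)" and xf: "x * f = f * x"
  shows "fr v a e x (Suc m) * f - f * fr v a e x (Suc m) = qi v (- a - int m) *s (k * fr v a e x m)"
proof (induction m)
  case 0
  have v: "v \<noteq> 0" using g generic_nz by auto
  have kix: "ki * x = v powi (- a) *s (x * ki)"
  proof -
    have "x * ki = ki * (k * x) * ki" using kki by (simp add: mult.assoc[symmetric])
    also have "\<dots> = v powi a *s (ki * x)" using kki kx by (simp add: mult.assoc)
    finally show ?thesis using v by (simp add: power_int_minus)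
  qed
  have kx': "x * k = v powi (- a) *s (k * x)" using kx v by (simp add: power_int_minus)
  have kix': "x * ki = v powi a *s (ki * x)" using kix v by (simp add: power_int_minus)
  have "fr v a e x (Suc 0) * f - f * fr v a e x (Suc 0)
      = x * (e * f - f * e) - v powi a *s ((e * f - f * e) * x)"
    using qi_1[OF g] xf by (simp add: algebra_simps scale_right_diff_distrib)
       (metis (no_types, lifting) mult.assoc)
  also have "\<dots> = inverse (v - inverse v) *s (x * k - x * ki - v powi a *s (k * x) + v powi a *s (ki * x))"
    unfolding ef by (simp add: algebra_simps scale_right_diff_distrib scale_right_distrib mult.commute)
  also have "\<dots> = (inverse (v - inverse v) * (v powi (- a) - v powi a)) *s (k * x)"
    unfolding kx' kix' by (simp add: algebra_simps scale_right_diff_distrib scale_left_diff_distrib)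
  also have "\<dots> = qi v (- a) *s (k * x)" by (simp add: qi_def divide_inverse mult.commute)
  finally show ?case by simp
next
  case (Suc m)
  have v: "v \<noteq> 0" using g generic_nz by auto
  define g1 where "g1 = fr v a e x (Suc m)"
  define g0 where "g0 = fr v a e x m"
  define M where "M = int (Suc m)"
  have kg: "k * g1 = v powi (a + 2 * M) *s (g1 * k)" unfolding g1_def M_def
    using fr_weight[OF ke kx, of a "Suc m"] v by (simp add: power_int_add)
  have gk: "g1 * k = v powi - (a + 2 * M) *s (k * g1)" using kg v by (simp add: powi_merge)
  have gki: "g1 * ki = v powi (a + 2 * M) *s (ki * g1)"
  proof -
    have "g1 * ki = ki * (k * g1) * ki" using kki by (simp add: mult.assoc[symmetric])
    also have "\<dots> = v powi (a + 2 * M) *s (ki * g1)" using kki by (simp only: kg) (simp add: mult.assoc)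
    finally show ?thesis .
  qed
  have ek: "e * k = v powi (- 2) *s (k * e)" using ke v by (simp add: power_int_minus)
  have IH: "g1 * f = f * g1 + qi v (1 - a - M) *s (k * g0)" using Suc.IH by (simp add: g1_def g0_def M_def algebra_simps)
  have ef': "e * f = f * e + inverse (v - inverse v) *s (k - ki)" using ef by (simp add: algebra_simps)
  have rec1: "g0 * e - v powi (a + 2 * (M - 1)) *s (e * g0) = qi v M *s g1"
    unfolding g1_def g0_def M_def using fr_Suc[OF g, of m a e x] by (simp add: add.commute)
  have ekg: "e * (k * g0) = v powi (- 2) *s (k * (e * g0))" using ek by (metis mult.assoc sc_left)
  \<comment> \<open>Both terms of the q-commutator are expanded: moving f past e leaves k - ki,
    moving it past g1 leaves a multiple of k g0, and the g0 terms recombine to a multiple of k g1 by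
    \<open>rec1\<close>.\<close>
  have "qi v (M + 1) *s (fr v a e x (Suc (Suc m)) * f - f * fr v a e x (Suc (Suc m)))
     = (g1 * e - v powi (a + 2 * M) *s (e * g1)) * f - f * (g1 * e - v powi (a + 2 * M) *s (e * g1))"
  proof -
    have S: "qi v (M + 1) *s fr v a e x (Suc (Suc m)) = g1 * e - v powi (a + 2 * M) *s (e * g1)"
      unfolding M_def g1_def by (rule fr_Suc[OF g])
    show ?thesis
      by (simp only: S[symmetric] sc_left sc_right scale_right_diff_distrib)
  qed
  also have "\<dots> = g1 * (e * f) + (g1 * f) * e - f * g1 * e - g1 * f * e - v powi (a + 2 * M) *s (e * (g1 * f) - f * e * g1)"
    by (simp add: algebra_simps scale_right_diff_distrib)
  also have "\<dots> = inverse (v - inverse v) *s (g1 * k - g1 * ki) + qi v (1 - a - M) *s (k * g0 * e)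
       - v powi (a + 2 * M) *s (inverse (v - inverse v) *s ((k - ki) * g1) + qi v (1 - a - M) *s (e * (k * g0)))"
  proof -
    have a1: "g1 * (e * f) = g1 * f * e + inverse (v - inverse v) *s (g1 * k - g1 * ki)"
      unfolding ef' by (simp add: distrib_left right_diff_distrib mult.assoc)
    have a2: "g1 * f * e = f * g1 * e + qi v (1 - a - M) *s (k * g0 * e)"
      unfolding IH by (simp add: distrib_right)
    have "e * (f * g1) = f * e * g1 + inverse (v - inverse v) *s ((k - ki) * g1)"
      by (simp only: mult.assoc[symmetric] ef') (simp add: distrib_right mult.assoc)
    then have a3: "e * (g1 * f) = f * e * g1 + inverse (v - inverse v) *s ((k - ki) * g1) + qi v (1 - a - M) *s (e * (k * g0))"
      unfolding IH by (simp add: distrib_left)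
    show ?thesis unfolding a1 a3 by (simp only: a2) simp
  qed
  also have "\<dots> = (inverse (v - inverse v) * (v powi - (a + 2 * M) - v powi (a + 2 * M))) *s (k * g1)
       + qi v (1 - a - M) *s (k * (g0 * e - v powi (a + 2 * (M - 1)) *s (e * g0)))"
  proof -
    have p: "v powi (a + 2 * M) * v powi (- 2) = v powi (a + 2 * (M - 1))" using v by (simp add: power_int_add[symmetric] algebra_simps)
    show ?thesis unfolding gk gki ekg p[symmetric]
     by (simp add: algebra_simps scale_right_diff_distrib scale_right_distrib scale_left_diff_distrib)
  qed
  also have "\<dots> = (qi v (1 - a - M) * qi v M - qi v (a + 2 * M)) *s (k * g1)"
    unfolding rec1 by (simp add: qi_def divide_inverse algebra_simps scale_left_diff_distrib scale_left_distrib)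
  also have "\<dots> = qi v (M + 1) *s (qi v (- a - M) *s (k * g1))"
    unfolding qi_rec[OF g] by simp
  finally have eq: "qi v (M + 1) *s (fr v a e x (Suc (Suc m)) * f - f * fr v a e x (Suc (Suc m))) = qi v (M + 1) *s (qi v (- a - M) *s (k * g1))" .
  have "qi v (M + 1) \<noteq> 0" using qi_nz[OF g, of "M + 1"] unfolding M_def by simp
  from scale_left_imp_eq[OF this eq]
  have "fr v a e x (Suc (Suc m)) * f - f * fr v a e x (Suc (Suc m)) = qi v (- a - M) *s (k * g1)" .
  then show ?case unfolding g1_def M_def .
qed

text \<open>This is F_j against the chain starting at x = E_j. The commutator with x is a multiple
  of kj - ki; one q-commutation with e removes kj, and each further one only multiplies a power of e
  times ki by a scalar, until a scalar vanishes.\<close>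

lemma fr_comm_fj:
  assumes g: "generic v"
    and ke: "kj * e = v powi a *s (e * kj)" and kie: "ki * e = v powi (- a) *s (e * ki)"
    and ef: "e * f = f * e" and xf: "x * f - f * x = d *s (kj - ki)" and a: "a = - int n"
  shows "fr v a e x (Suc n) * f = f * fr v a e x (Suc n)"
proof -
  \<comment> \<open>\<open>\<beta> m\<close> is the accumulated scalar: it starts with what one
    q-commutation leaves of ki, and each step contributes v^(-a) - v^(a+2m+2) divided by the quantum
    integer in the recursion of \<open>fr\<close>.\<close>
  define \<beta> where "\<beta> = rec_nat (d * (v powi a - v powi (- a)))
      (\<lambda>m b. inverse (qi v (int m + 2)) * b * (v powi (- a) - v powi (a + 2 * (int m + 1))))"
  have \<beta>0: "\<beta> 0 = d * (v powi a - v powi (- a))"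
    and \<beta>S: "\<And>m. \<beta> (Suc m) = inverse (qi v (int m + 2)) * \<beta> m * (v powi (- a) - v powi (a + 2 * (int m + 1)))"
    by (simp_all add: \<beta>_def)
  have main: "fr v a e x (Suc m) * f - f * fr v a e x (Suc m) = \<beta> m *s (e ^ Suc m * ki)" for m
  proof (induction m)
    case 0
    have "fr v a e x (Suc 0) * f - f * fr v a e x (Suc 0)
      = (x * f - f * x) * e - v powi a *s (e * (x * f - f * x))"
      using qi_1[OF g] ef by (simp add: algebra_simps scale_right_diff_distrib)
       (metis (no_types, lifting) mult.assoc)
    also have "\<dots> = \<beta> 0 *s (e * ki)"
      unfolding xf \<beta>0 by (simp add: algebra_simps scale_right_diff_distrib ke kie scale_left_diff_distrib)
    finally show ?case by simp
  next
    case (Suc m)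
    define g1 where "g1 = fr v a e x (Suc m)"
    have IH: "g1 * f = f * g1 + \<beta> m *s (e ^ Suc m * ki)" using Suc.IH by (simp add: g1_def algebra_simps)
    have "fr v a e x (Suc (Suc m)) * f - f * fr v a e x (Suc (Suc m))
      = inverse (qi v (int m + 2)) *s ((g1 * f - f * g1) * e - v powi (a + 2 * (int m + 1)) *s (e * (g1 * f - f * g1)))"
    proof -
      have "fr v a e x (Suc (Suc m)) = inverse (qi v (int m + 2)) *s (g1 * e - v powi (a + 2 * (int m + 1)) *s (e * g1))"
        unfolding g1_def by (simp add: algebra_simps)
      moreover have "g1 * (e * f) = g1 * (f * e)" by (simp add: ef)
      moreover have "f * (e * g1) = e * (f * g1)" by (simp add: mult.assoc[symmetric] ef)
      ultimately show ?thesis by (simp add: left_diff_distrib right_diff_distrib scale_right_diff_distrib mult.assoc)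
    qed
    also have "\<dots> = \<beta> (Suc m) *s (e ^ Suc (Suc m) * ki)"
    proof -
      have "e ^ Suc m * ki * e = v powi (- a) *s (e * (e ^ Suc m * ki))"
        by (simp only: mult.assoc kie sc_right) (simp only: mult.assoc[symmetric] power_commutes)
      then show ?thesis unfolding \<beta>S
        by (simp add: IH scale_left_diff_distrib[symmetric] mult.assoc) (simp add: algebra_simps)
    qed
    finally show ?case by simp
  qed
  \<comment> \<open>For n = 0 the initial factor v^a - v^(-a) is zero; otherwise the last factor
    v^(-a) - v^(a+2n) is, because a = -n.\<close>
  have "\<beta> n = 0"
    using a by (cases n) (simp_all add: \<beta>0 \<beta>S)
  with main[of n] show ?thesis by simp
qed

end

lemma qfact_Suc: "qfact v (Suc n) = qfact v n * qi v (int n + 1)"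
  by (simp add: qfact_def qint_qi add.commute)

lemma qfact_0 [simp]: "qfact v 0 = 1"
  by (simp add: qfact_def)

lemma qfact_nz: "generic v \<Longrightarrow> qfact v n \<noteq> 0"
  by (induction n) (auto simp: qfact_Suc qi_nz)

context cq_algebra
begin

text \<open>This links the recursion to the sums in Lusztig's formulas. Multiplying by e on the
  right and on the left shifts the summands against each other, and the induction step is the
  q-Pascal rule v^r [m+1] = [m+1-r] + v^(m+1) [r].\<close>

lemma fr_closed:
  assumes g: "generic v"
  shows "fr v a e x m = (\<Sum>r\<le>m. ((-1) ^ r * v powi (int r * (a + int m - 1)) * inverse (qfact v r) * inverse (qfact v (m - r)))
     *s (e ^ r * x * e ^ (m - r)))"
proof (induction m)
  case 0 then show ?case by simp
next
  case (Suc m)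
  have v: "v \<noteq> 0" using g generic_nz by auto
  define c where "c = (\<lambda>m r. (-1) ^ r * v powi (int r * (a + int m - 1)) * inverse (qfact v r) * inverse (qfact v (m - r)))"
  define X where "X = (\<lambda>r. e ^ r * x * e ^ (Suc m - r))"
  define d where "d = (\<lambda>r. (-1) ^ r * v powi (int r * (a + int m - 1)) * inverse (qfact v r) * inverse (qfact v (Suc m - r)))"
  have 1: "fr v a e x m * e = (\<Sum>r\<le>Suc m. (qi v (int (Suc m) - int r) * d r) *s X r)"
  proof -
    have "fr v a e x m * e = (\<Sum>r\<le>m. c m r *s X r)"
      unfolding Suc.IH sum_distrib_right c_def X_def
      by (intro sum.cong refl) (simp add: Suc_diff_le mult.assoc power_commutes)
    also have "\<dots> = (\<Sum>r\<le>m. (qi v (int (Suc m) - int r) * d r) *s X r)"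
    proof (intro sum.cong refl)
      fix r assume "r \<in> {..m}"
      then have "qfact v (Suc m - r) = qfact v (m - r) * qi v (int (Suc m) - int r)"
        by (simp add: Suc_diff_le qfact_Suc of_nat_diff algebra_simps)
      moreover have "qi v (int (Suc m) - int r) \<noteq> 0" using qi_nz[OF g] \<open>r \<in> {..m}\<close> by simp
      ultimately show "c m r *s X r = (qi v (int (Suc m) - int r) * d r) *s X r"
        unfolding c_def d_def by (simp add: field_simps qfact_nz[OF g])
    qed
    finally show ?thesis by simp
  qed
  have 2: "e * fr v a e x m = (\<Sum>r\<le>Suc m. (- (v powi (- (a + int m - 1))) * qi v (int r) * d r) *s X r)"
  proof -
    have "e * fr v a e x m = (\<Sum>r\<le>m. c m r *s X (Suc r))"
      unfolding Suc.IH sum_distrib_left c_def X_def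
      by (intro sum.cong refl) (simp add: mult.assoc)
    also have "\<dots> = (\<Sum>r\<le>m. (- (v powi (- (a + int m - 1))) * qi v (int (Suc r)) * d (Suc r)) *s X (Suc r))"
    proof (intro sum.cong refl)
      fix r assume "r \<in> {..m}"
      have "qi v (int r + 1) \<noteq> 0" using qi_nz[OF g] by simp
      then have i: "qi v (int (Suc r)) * inverse (qfact v (Suc r)) = inverse (qfact v r)"
        by (simp add: qfact_Suc add.commute)
      have p: "v powi (- (a + int m - 1)) * v powi (int (Suc r) * (a + int m - 1)) = v powi (int r * (a + int m - 1))"
        unfolding powi_merge[OF v] by (simp add: algebra_simps)
      have "c m r = - (v powi (- (a + int m - 1))) * qi v (int (Suc r)) * d (Suc r)"
        unfolding c_def d_def i[symmetric] p[symmetric] by (simp add: mult_ac)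
      then show "c m r *s X (Suc r) = (- (v powi (- (a + int m - 1))) * qi v (int (Suc r)) * d (Suc r)) *s X (Suc r)"
        by simp
    qed
    finally show ?thesis by (simp add: sum.atMost_Suc_shift[of _ m] del: sum.atMost_Suc)
  qed
  have "fr v a e x (Suc m) = inverse (qi v (int m + 1)) *s (\<Sum>r\<le>Suc m. (qi v (int m + 1) * c (Suc m) r) *s X r)"
  proof -
    have "fr v a e x m * e - v powi (a + 2 * int m) *s (e * fr v a e x m) = (\<Sum>r\<le>Suc m. (qi v (int m + 1) * c (Suc m) r) *s X r)"
      unfolding 1 2 scale_sum_right sum_subtractf[symmetric]
    proof (intro sum.cong refl)
      fix r assume "r \<in> {..Suc m}"
      have p: "v powi (int r * (a + int (Suc m) - 1)) = v powi (int r * (a + int m - 1)) * v powi (int r)"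
        unfolding powi_merge[OF v] by (simp add: algebra_simps)
      have q: "v powi (a + 2 * int m) * v powi (- (a + int m - 1)) = v powi (int m + 1)"
        unfolding powi_merge[OF v] by (simp add: algebra_simps)
      have k: "v powi (int r) * qi v (int m + 1) = qi v (int (Suc m) - int r) + v powi (int m + 1) * qi v (int r)"
      proof -
        have "qi v (int r + (int m + 1 - int r)) = v powi (int m + 1 - int r) * qi v (int r) + v powi (- int r) * qi v (int m + 1 - int r)"
          by (rule qi_add[OF g])
        then have "v powi (int r) * qi v (int m + 1) =
          v powi (int r) * (v powi (int m + 1 - int r) * qi v (int r)) + v powi (int r) * (v powi (- int r) * qi v (int m + 1 - int r))"
          by (simp add: distrib_left)
        then show ?thesis unfolding powi_merge[OF v] by (simp add: algebra_simps)
      qed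
      have "qi v (int m + 1) * c (Suc m) r = d r * (v powi (int r) * qi v (int m + 1))"
        unfolding c_def d_def p by (simp add: mult_ac)
      also have "\<dots> = qi v (int (Suc m) - int r) * d r + (v powi (a + 2 * int m) * v powi (- (a + int m - 1))) * qi v (int r) * d r"
        unfolding k q by (simp add: algebra_simps)
      finally have "qi v (int m + 1) * c (Suc m) r = \<dots>" .
      then show "(qi v (int (Suc m) - int r) * d r) *s X r -
         v powi (a + 2 * int m) *s ((- (v powi (- (a + int m - 1))) * qi v (int r) * d r) *s X r) =
         (qi v (int m + 1) * c (Suc m) r) *s X r"
        by (simp add: scale_left_distrib mult.assoc)
    qed
    then show ?thesis by simp
  qed
  also have "\<dots> = (\<Sum>r\<le>Suc m. c (Suc m) r *s X r)"
    unfolding scale_sum_right scale_scale using qi_nz[OF g, of "int m + 1"] by (simp add: mult.assoc[symmetric])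
  finally show ?case unfolding c_def X_def .
qed

text \<open>At N = 1 - a the exponent a + N - 1 in \<open>fr_closed\<close> is zero, so the powers
  of v disappear and quantum binomials remain; reversing the summation index accounts for the sign
  (-1)^N.\<close>

lemma fr_serre:
  assumes g: "generic v" and N: "int N = 1 - a"
  shows "(\<Sum>k=0..N. ((- 1) ^ k * qbinom v N k) *s (e ^ (N - k) * x * e ^ k)) = ((-1) ^ N * qfact v N) *s fr v a e x N"
proof -
  have "((-1) ^ N * qfact v N) *s fr v a e x N = (\<Sum>r\<le>N. ((-1) ^ (N - r) * qbinom v N r) *s (e ^ r * x * e ^ (N - r)))"
    unfolding fr_closed[OF g] scale_sum_right scale_scale
  proof (intro sum.cong refl)
    fix r assume r: "r \<in> {..N}"
    have "(-1 :: Cq) ^ N = (-1) ^ (N - r) * (-1) ^ r" using r by (simp add: power_add[symmetric])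
    then have "(-1 :: Cq) ^ N * (-1) ^ r = (-1) ^ (N - r)" by simp
    moreover have "a + int N - 1 = 0" using N by simp
    ultimately show "((- 1) ^ N * qfact v N * ((- 1) ^ r * v powi (int r * (a + int N - 1)) * inverse (qfact v r) * inverse (qfact v (N - r))))
      *s (e ^ r * x * e ^ (N - r)) = ((-1) ^ (N - r) * qbinom v N r) *s (e ^ r * x * e ^ (N - r))"
      unfolding qbinom_def by (simp add: field_simps)
  qed
  also have "\<dots> = (\<Sum>k=0..N. ((- 1) ^ k * qbinom v N k) *s (e ^ (N - k) * x * e ^ k))"
    by (rule sum.reindex_bij_witness[of _ "\<lambda>k. N - k" "\<lambda>k. N - k"]) (auto simp: qbinom_def mult.commute)
  finally show ?thesis by simp
qed

end

section \<open>The relations of the quantized enveloping algebra without the Serre relations\<close>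

lemma q_var_power: "q_var ^ n = Fraction_Field.Fract (Polynomial.monom 1 n) 1"
  by (induction n) (auto simp: q_var_def One_fract_def monom_Suc mult.commute one_pCons[symmetric] monom_0)

lemma q_var_generic: "d > 0 \<Longrightarrow> generic (q_var ^ d)"
proof -
  assume d: "d > 0"
  have "q_var ^ n \<noteq> 1" if "n > 0" for n
  proof
    assume "q_var ^ n = 1"
    then have "Polynomial.monom (1::complex) n = 1" unfolding q_var_power One_fract_def by (simp add: eq_fract)
    then show False using that by (metis degree_1 degree_monom_eq less_irrefl zero_neq_one)
  qed
  moreover have "q_var \<noteq> 0" unfolding q_var_def by (simp add: Zero_fract_def eq_fract)
  ultimately show ?thesis using d unfolding generic_def by (simp add: power_mult[symmetric])
qed

text \<open>The operators on the free algebra from which the Verma module is made satisfy exactly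
  these relations, and the Serre elements have to be controlled on top of them. The same locale is
  instantiated by the image of the quantized enveloping algebra, and by both with E and F
  exchanged.\<close>

locale qrel = cq_algebra sc for sc :: "Cq \<Rightarrow> 'a::ring_1 \<Rightarrow> 'a" (infixr "*s" 75) +
  fixes G :: "'i cartan_datum" and E F K Ki :: "'i \<Rightarrow> 'a"
  assumes ft: "finite_type G"
    and KKi: "i \<in> idx G \<Longrightarrow> K i * Ki i = 1" and KiK: "i \<in> idx G \<Longrightarrow> Ki i * K i = 1"
    and KK: "i \<in> idx G \<Longrightarrow> j \<in> idx G \<Longrightarrow> K i * K j = K j * K i"
    and KE: "i \<in> idx G \<Longrightarrow> j \<in> idx G \<Longrightarrow> K i * E j = (q_at G i powi cm G i j) *s (E j * K i)"
    and KF: "i \<in> idx G \<Longrightarrow> j \<in> idx G \<Longrightarrow> K i * F j = (q_at G i powi - cm G i j) *s (F j * K i)"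
    and EF: "i \<in> idx G \<Longrightarrow> j \<in> idx G \<Longrightarrow> E i * F j - F j * E i =
       (if i = j then inverse (q_at G i - inverse (q_at G i)) *s (K i - Ki i) else 0)"
begin

lemma q_generic: "i \<in> idx G \<Longrightarrow> generic (q_at G i)"
  using ft unfolding finite_type_def q_at_def by (intro q_var_generic) auto

lemma q_nz: "i \<in> idx G \<Longrightarrow> q_at G i \<noteq> 0"
  using q_generic generic_nz by blast

lemma cm_diag: "i \<in> idx G \<Longrightarrow> cm G i i = 2"
  using ft unfolding finite_type_def by auto

lemma cm_nonpos: "i \<in> idx G \<Longrightarrow> j \<in> idx G \<Longrightarrow> i \<noteq> j \<Longrightarrow> cm G i j \<le> 0"
  using ft unfolding finite_type_def by auto

text \<open>Symmetrizability: it lets the power of q attached to (i, j) be used also when K_j moves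
  past E_i.\<close>

lemma q_sym: "i \<in> idx G \<Longrightarrow> j \<in> idx G \<Longrightarrow> q_at G i powi cm G i j = q_at G j powi cm G j i"
proof -
  assume ij: "i \<in> idx G" "j \<in> idx G"
  have "int (sym G i) * cm G i j = int (sym G j) * cm G j i" using ft ij unfolding finite_type_def by blast
  moreover have "q_at G k powi z = q_var powi (int (sym G k) * z)" for k z
    unfolding q_at_def by (metis power_int_mult power_int_of_nat)
  ultimately show ?thesis by simp
qed

lemma Ki_comm:
  assumes "i \<in> idx G" "K i * x = c *s (x * K i)" "c \<noteq> 0"
  shows "Ki i * x = inverse c *s (x * Ki i)"
proof -
  have "x * Ki i = Ki i * (K i * x) * Ki i" using KiK[OF assms(1)] by (simp add: mult.assoc[symmetric])
  also have "\<dots> = c *s (Ki i * x)" using KKi[OF assms(1)] by (simp only: assms(2)) (simp add: mult.assoc)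
  finally show ?thesis using assms(3) by simp
qed

lemma KiE: "i \<in> idx G \<Longrightarrow> j \<in> idx G \<Longrightarrow> Ki i * E j = (q_at G i powi - cm G i j) *s (E j * Ki i)"
  using Ki_comm[OF _ KE[of i j]] q_nz[of i] by (simp add: power_int_minus)

lemma KiF: "i \<in> idx G \<Longrightarrow> j \<in> idx G \<Longrightarrow> Ki i * F j = (q_at G i powi cm G i j) *s (F j * Ki i)"
  using Ki_comm[OF _ KF[of i j]] q_nz[of i] by (simp add: power_int_minus)

lemma KKi_comm: "i \<in> idx G \<Longrightarrow> j \<in> idx G \<Longrightarrow> Ki i * K j = K j * Ki i"
  using Ki_comm[of i "K j" 1] KK[of i j] by simp

lemma KiKi_comm: "i \<in> idx G \<Longrightarrow> j \<in> idx G \<Longrightarrow> Ki i * Ki j = Ki j * Ki i"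
  using Ki_comm[of i "Ki j" 1] KKi_comm[of j i] by simp

lemma swap: "qrel sc G F E Ki K"
proof (unfold_locales, goal_cases)
  case (7 i j)
  then show ?case using EF[of j i] by (auto simp: scale_right_diff_distrib algebra_simps)
qed (auto simp: ft KKi KiK KiKi_comm KiE KiF)

text \<open>This makes the ideal of Serre elements stable under the F_k. For k = i the coefficient
  [-a-n] is zero, for k = j the scalars in \<open>fr_comm_fj\<close> break off, and any other F_k
  commutes with both letters.\<close>

lemma serre_comm_F:
  assumes ij: "i \<in> idx G" "j \<in> idx G" "i \<noteq> j" and k: "k \<in> idx G" and n: "cm G i j = - int n"
  shows "fr (q_at G i) (cm G i j) (E i) (E j) (Suc n) * F k = F k * fr (q_at G i) (cm G i j) (E i) (E j) (Suc n)"
proof -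
  note g = q_generic[OF ij(1)]
  consider "k = i" | "k = j" | "k \<noteq> i" "k \<noteq> j" by blast
  then show ?thesis
  proof cases
    case 1
    have "fr (q_at G i) (cm G i j) (E i) (E j) (Suc n) * F i - F i * fr (q_at G i) (cm G i j) (E i) (E j) (Suc n)
       = qi (q_at G i) (- cm G i j - int n) *s (K i * fr (q_at G i) (cm G i j) (E i) (E j) n)"
      using ij KE[of i i] KE[of i j] EF[of i i] EF[of j i] cm_diag[of i]
      by (intro fr_comm_f[OF g KKi KiK]) auto
    then show ?thesis using n 1 by simp
  next
    case 2
    have "K j * E i = (q_at G i powi cm G i j) *s (E i * K j)" using KE[of j i] ij q_sym[of i j] by simp
    moreover have "Ki j * E i = (q_at G i powi - cm G i j) *s (E i * Ki j)"
      using KiE[of j i] ij q_sym[of i j] by (simp add: power_int_minus)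
    ultimately show ?thesis using 2 ij EF[of i j] EF[of j j] n
      by (intro fr_comm_fj[OF g, of "K j" _ _ "Ki j" _ _ "inverse (q_at G j - inverse (q_at G j))"]) auto
  next
    case 3
    then have c: "E i * F k = F k * E i" "E j * F k = F k * E j" using EF[of i k] EF[of j k] ij k by auto
    have "fr v a (E i) (E j) m * F k = F k * fr v a (E i) (E j) m" for v a m
    proof (induction m)
      case (Suc m)
      then show ?case using c
        by (simp add: left_diff_distrib right_diff_distrib mult.assoc) (simp add: mult.assoc[symmetric])
    qed (use c in auto)
    then show ?thesis .
  qed
qed

end

section \<open>Weyl group combinatorics\<close>

lemma finite_type_cox:
  assumes ft: "finite_type G" and ij: "i \<in> idx G" "j \<in> idx G" "i \<noteq> j"
  shows "(cm G i j, cm G j i) \<in> {(0, 0), (-1, -1), (-1, -2), (-2, -1), (-1, -3), (-3, -1)}"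
proof -
  define A where "A = - cm G i j"
  define B where "B = - cm G j i"
  have AB: "A \<ge> 0" "B \<ge> 0" "A = 0 \<longleftrightarrow> B = 0" using ft ij unfolding finite_type_def A_def B_def by force+
  have d: "int (sym G i) * A = int (sym G j) * B" "sym G i > 0" "sym G j > 0"
    using ft ij unfolding finite_type_def A_def B_def by auto
  have fin: "finite (idx G)" using ft unfolding finite_type_def by auto
  have cd: "cm G i i = 2" "cm G j j = 2" using ft ij unfolding finite_type_def by auto
  \<comment> \<open>For the vector A \<alpha>_i + 2 \<alpha>_j the two terms with first index i
    cancel; positivity of the form leaves 2 d_j (4 - AB) > 0.\<close>
  define x where "x = (\<lambda>k. if k = i then real_of_int A else if k = j then 2 else 0)"
  have "(\<Sum>k\<in>idx G. \<Sum>l\<in>idx G. real (sym G k) * real_of_int (cm G k l) * x k * x l) =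
     (\<Sum>k\<in>{i,j}. \<Sum>l\<in>{i,j}. real (sym G k) * real_of_int (cm G k l) * x k * x l)"
  proof -
    have "(\<Sum>l\<in>idx G. real (sym G k) * real_of_int (cm G k l) * x k * x l) =
      (\<Sum>l\<in>{i,j}. real (sym G k) * real_of_int (cm G k l) * x k * x l)" for k
      using fin ij by (intro sum.mono_neutral_right) (auto simp: x_def)
    moreover have "(\<Sum>k\<in>idx G. \<Sum>l\<in>{i,j}. real (sym G k) * real_of_int (cm G k l) * x k * x l) =
      (\<Sum>k\<in>{i,j}. \<Sum>l\<in>{i,j}. real (sym G k) * real_of_int (cm G k l) * x k * x l)"
      using fin ij by (intro sum.mono_neutral_right) (auto simp: x_def)
    ultimately show ?thesis by simp
  qed
  moreover have "0 < (\<Sum>k\<in>idx G. \<Sum>l\<in>idx G. real (sym G k) * real_of_int (cm G k l) * x k * x l)"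
  proof -
    have "\<exists>k\<in>idx G. x k \<noteq> 0" using ij by (intro bexI[of _ j]) (auto simp: x_def)
    then show ?thesis using ft unfolding finite_type_def by blast
  qed
  ultimately have "0 < real (sym G i) * 2 * A * A + real (sym G i) * (- A) * A * 2 + (real (sym G j) * (- B) * 2 * A + real (sym G j) * 2 * 2 * 2)"
    using ij cd by (simp add: x_def A_def B_def)
  then have "0 < real_of_int (int (sym G i) * 2 * A * A + int (sym G i) * (- A) * A * 2 + (int (sym G j) * (- B) * 2 * A + int (sym G j) * 2 * 2 * 2))"
    by simp
  then have "0 < int (sym G i) * 2 * A * A + int (sym G i) * (- A) * A * 2 + (int (sym G j) * (- B) * 2 * A + int (sym G j) * 2 * 2 * 2)"
    by (simp only: of_int_0_less_iff)
  then have "0 < int (sym G j) * (4 - A * B)" using d by (simp add: algebra_simps)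
  then have lt: "A * B < 4" using d by (simp add: zero_less_mult_iff)
  have "A = 0 \<and> B = 0 \<or> A \<ge> 1 \<and> B \<ge> 1" using AB by linarith
  then have "(A, B) \<in> {(0, 0), (1, 1), (1, 2), (2, 1), (1, 3), (3, 1)}"
  proof
    assume p: "A \<ge> 1 \<and> B \<ge> 1"
    then have "A * 1 \<le> A * B" "1 * B \<le> A * B" by (auto intro!: mult_left_mono mult_right_mono)
    then have "A \<le> 3" "B \<le> 3" using lt by simp_all
    then have "A = 1 \<or> A = 2 \<or> A = 3" "B = 1 \<or> B = 2 \<or> B = 3" using p by linarith+
    then show ?thesis using lt by auto
  qed auto
  then show ?thesis unfolding A_def B_def by auto
qed

locale cartan =
  fixes G :: "'i cartan_datum"
  assumes fin_type: "finite_type G"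
begin

abbreviation I where "I \<equiv> idx G"
abbreviation W where "W \<equiv> weyl_word G"

definition pair :: "'i \<Rightarrow> ('i \<Rightarrow> int) \<Rightarrow> int" where
  "pair i \<beta> = (\<Sum>j\<in>I. cm G i j * \<beta> j)"

definition comb :: "'i \<Rightarrow> 'i \<Rightarrow> int \<Rightarrow> int \<Rightarrow> 'i \<Rightarrow> int" where
  "comb i j a b = (\<lambda>k. a * simple_root i k + b * simple_root j k)"

lemma finI: "finite I"
  using fin_type unfolding finite_type_def by auto

lemma cm_refl: "i \<in> I \<Longrightarrow> cm G i i = 2"
  using fin_type unfolding finite_type_def by auto

lemma refl_pair: "reflection G i \<beta> = (\<lambda>k. \<beta> k - pair i \<beta> * simple_root i k)"
  by (simp add: reflection_def pair_def)

lemma pair_simple: "j \<in> I \<Longrightarrow> pair i (simple_root j) = cm G i j"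
  by (simp add: pair_def simple_root_def finI if_distrib[of "\<lambda>z. c * z" for c] cong: if_cong)

lemma pair_lin: "pair i (\<lambda>k. c * x k + d * y k) = c * pair i x + d * pair i y"
  by (simp add: pair_def distrib_left sum.distrib sum_distrib_left mult.left_commute)

lemma refl_lin: "reflection G i (\<lambda>k. c * x k + d * y k) = (\<lambda>k. c * reflection G i x k + d * reflection G i y k)"
  by (simp add: refl_pair pair_lin algebra_simps)

lemma W_Nil [simp]: "W [] = id"
  by (simp add: weyl_word_def fun_eq_iff)

lemma W_Cons: "W (i # ws) = reflection G i \<circ> W ws"
  by (simp add: weyl_word_def)

lemma W_app: "W (xs @ ys) = W xs \<circ> W ys"
  by (simp add: weyl_word_def fun_eq_iff)

lemma W_lin: "W ws (\<lambda>k. c * x k + d * y k) = (\<lambda>k. c * W ws x k + d * W ws y k)"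
  by (induction ws) (simp_all add: W_Cons refl_lin)

lemma W_comb: "W ws (comb i j a b) = (\<lambda>k. a * W ws (simple_root i) k + b * W ws (simple_root j) k)"
  unfolding comb_def by (rule W_lin)

lemma W_uminus: "W ws (\<lambda>k. - x k) = (\<lambda>k. - W ws x k)"
  using W_lin[of ws "-1" x 0 x] by simp

lemma pair_comb: "i \<in> I \<Longrightarrow> j \<in> I \<Longrightarrow> pair k (\<lambda>l. \<beta> l + comb i j a b l) = pair k \<beta> + a * cm G k i + b * cm G k j"
  using pair_lin[of k 1 \<beta> 1 "comb i j a b"] pair_lin[of k a "simple_root i" b "simple_root j"]
  by (simp add: comb_def pair_simple)

lemma refl_comb1:
  assumes "i \<in> I" "j \<in> I"
  shows "reflection G i (\<lambda>k. \<beta> k + comb i j a b k) = (\<lambda>k. \<beta> k + comb i j (- a - pair i \<beta> - b * cm G i j) b k)"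
  using assms unfolding refl_pair pair_comb[OF assms] by (simp add: comb_def algebra_simps cm_refl)

lemma refl_comb2:
  assumes "i \<in> I" "j \<in> I"
  shows "reflection G j (\<lambda>k. \<beta> k + comb i j a b k) = (\<lambda>k. \<beta> k + comb i j a (- b - pair j \<beta> - a * cm G j i) k)"
  using assms unfolding refl_pair pair_comb[OF assms] by (simp add: comb_def algebra_simps cm_refl)

lemma pair_zero [simp]: "pair i (\<lambda>k. 0) = 0"
  by (simp add: pair_def)

lemma refl_comb1':
  assumes "i \<in> I" "j \<in> I"
  shows "reflection G i (comb i j a b) = comb i j (- a - b * cm G i j) b"
  using refl_comb1[OF assms, of "\<lambda>k. 0" a b] by simp

lemma refl_comb2':
  assumes "i \<in> I" "j \<in> I"
  shows "reflection G j (comb i j a b) = comb i j a (- b - a * cm G j i)"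
  using refl_comb2[OF assms, of "\<lambda>k. 0" a b] by simp

lemma refl_invol: assumes "i \<in> I" shows "reflection G i \<circ> reflection G i = id"
proof
  fix \<beta>
  have "(\<lambda>k. \<beta> k + comb i i 0 0 k) = \<beta>" by (simp add: comb_def)
  then have "reflection G i (reflection G i \<beta>) = reflection G i (\<lambda>k. \<beta> k + comb i i (- pair i \<beta>) 0 k)"
    using refl_comb1[OF assms assms, of \<beta> 0 0] by simp
  also have "\<dots> = \<beta>" using refl_comb1[OF assms assms, of \<beta> "- pair i \<beta>" 0] by (simp add: comb_def)
  finally show "(reflection G i \<circ> reflection G i) \<beta> = id \<beta>" by simp
qed

lemma refl_refl: "i \<in> I \<Longrightarrow> reflection G i (reflection G i \<beta>) = \<beta>"
  using refl_invol[of i] by (metis comp_apply id_apply)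

lemma refl_simple: "i \<in> I \<Longrightarrow> reflection G i (simple_root i) = (\<lambda>k. - simple_root i k)"
  by (simp add: refl_pair pair_simple cm_refl)

lemma W_double: "x \<in> I \<Longrightarrow> W (xs @ [x, x] @ ys) = W (xs @ ys)"
  by (simp add: W_app W_Cons refl_refl fun_eq_iff)

lemma W_rev: "ws \<in> lists I \<Longrightarrow> W (rev ws) \<circ> W ws = id"
proof (induction ws)
  case (Cons i ws)
  then show ?case by (simp add: W_app W_Cons refl_refl fun_eq_iff)
qed simp

lemma W_rev': "ws \<in> lists I \<Longrightarrow> W ws \<circ> W (rev ws) = id"
  using W_rev[of "rev ws"] by (simp add: in_lists_conv_set)

lemma W_nonzero: "ws \<in> lists I \<Longrightarrow> W ws (simple_root i) \<noteq> (\<lambda>k. 0)"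
proof
  assume ws: "ws \<in> lists I" and z: "W ws (simple_root i) = (\<lambda>k. 0)"
  have "W (rev ws) (\<lambda>k. 0) = (\<lambda>k. 0)" using W_lin[of "rev ws" 0 "\<lambda>k. 0" 0 "\<lambda>k. 0"] by simp
  then have "simple_root i = (\<lambda>k. 0)" using W_rev[OF ws] z by (metis comp_apply id_apply)
  then show False by (metis simple_root_def zero_neq_one)
qed

section \<open>Rank two: positivity and braid relations for dihedral subgroups\<close>

lemma cox_cases:
  assumes ij: "i \<in> I" "j \<in> I" "i \<noteq> j"
  obtains "cm G i j = 0" "cm G j i = 0" "coxeter_number G i j = 2"
   | "cm G i j = -1" "cm G j i = -1" "coxeter_number G i j = 3"
   | "cm G i j = -1" "cm G j i = -2" "coxeter_number G i j = 4"
   | "cm G i j = -2" "cm G j i = -1" "coxeter_number G i j = 4"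
   | "cm G i j = -1" "cm G j i = -3" "coxeter_number G i j = 6"
   | "cm G i j = -3" "cm G j i = -1" "coxeter_number G i j = 6"
  using finite_type_cox[OF fin_type ij] unfolding coxeter_number_def Let_def by auto

lemma cox_sym: "coxeter_number G i j = coxeter_number G j i"
  by (simp add: coxeter_number_def mult.commute)

lemma W_rev_fold: "W (rev ws) = fold (reflection G) ws"
  by (simp add: weyl_word_def foldr_conv_fold)

lemma alternating_numeral: "alternating i j (numeral n) = i # alternating j i (pred_numeral n)"
  by (simp add: numeral_eq_Suc)

text \<open>The reversal makes the word end in j, so that i is an ascent of it. As the order is at
  most 6, the coordinates with respect to \<alpha>_i and \<alpha>_j can be computed for each of the
  six rank two Cartan matrices.\<close>

lemma dihedral_pos:
  assumes ij: "i \<in> I" "j \<in> I" "i \<noteq> j" and p: "p < coxeter_number G i j"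
  shows "\<exists>a\<ge>0. \<exists>b\<ge>0. W (rev (alternating j i p)) (simple_root i) = comb i j a b"
proof -
  have s: "simple_root i = comb i j 1 0" by (simp add: comb_def)
  have e: "(\<exists>a\<ge>0. \<exists>b\<ge>0. comb i j c d = comb i j a b)" if "c \<ge> 0" "d \<ge> 0" for c d
    using that by blast
  note [simp] = refl_comb1'[OF ij(1,2)] refl_comb2'[OF ij(1,2)] alternating_numeral
  show ?thesis
    unfolding W_rev_fold s
  proof (cases rule: cox_cases[OF ij])
    case 1
    with p have "p \<in> {0,1}" by auto
    with 1 show "\<exists>a\<ge>0. \<exists>b\<ge>0. fold (reflection G) (alternating j i p) (comb i j 1 0) = comb i j a b"
      by (auto intro!: e)
  next
    case 2
    with p have "p \<in> {0,1,2}" by auto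
    with 2 show "\<exists>a\<ge>0. \<exists>b\<ge>0. fold (reflection G) (alternating j i p) (comb i j 1 0) = comb i j a b"
      by (auto intro!: e)
  next
    case 3
    with p have "p \<in> {0,1,2,3}" by auto
    with 3 show "\<exists>a\<ge>0. \<exists>b\<ge>0. fold (reflection G) (alternating j i p) (comb i j 1 0) = comb i j a b"
      by (auto intro!: e)
  next
    case 4
    with p have "p \<in> {0,1,2,3}" by auto
    with 4 show "\<exists>a\<ge>0. \<exists>b\<ge>0. fold (reflection G) (alternating j i p) (comb i j 1 0) = comb i j a b"
      by (auto intro!: e)
  next
    case 5
    with p have "p \<in> {0,1,2,3,4,5}" by auto
    with 5 show "\<exists>a\<ge>0. \<exists>b\<ge>0. fold (reflection G) (alternating j i p) (comb i j 1 0) = comb i j a b"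
      by (auto intro!: e)
  next
    case 6
    with p have "p \<in> {0,1,2,3,4,5}" by auto
    with 6 show "\<exists>a\<ge>0. \<exists>b\<ge>0. fold (reflection G) (alternating j i p) (comb i j 1 0) = comb i j a b"
      by (auto intro!: e)
  qed
qed

text \<open>The reflections change a vector only by multiples of \<alpha>_i and \<alpha>_j. Tracking
  these two coefficients, with \<open>pair i \<beta>\<close> and \<open>pair j \<beta>\<close> as
  parameters, settles arbitrary \<beta> and not just the span of the two roots.\<close>

lemma W_braid:
  assumes ij: "i \<in> I" "j \<in> I" "i \<noteq> j"
  shows "W (rev (alternating i j (coxeter_number G i j))) = W (rev (alternating j i (coxeter_number G i j)))"
proof
  fix \<beta>
  have s: "(\<lambda>k. \<beta> k + comb i j 0 0 k) = \<beta>" by (simp add: comb_def)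
  let ?m = "coxeter_number G i j"
  note [simp] = refl_comb1[OF ij(1,2)] refl_comb2[OF ij(1,2)] alternating_numeral
  have "fold (reflection G) (alternating i j ?m) (\<lambda>k. \<beta> k + comb i j 0 0 k) =
    fold (reflection G) (alternating j i ?m) (\<lambda>k. \<beta> k + comb i j 0 0 k)"
    by (cases rule: cox_cases[OF ij]) (simp_all, simp_all add: comb_def algebra_simps)
  then show "W (rev (alternating i j ?m)) \<beta> = W (rev (alternating j i ?m)) \<beta>"
    unfolding W_rev_fold s .
qed

subsection \<open>Reduced words\<close>

definition red :: "'i list \<Rightarrow> bool" where
  "red ws \<longleftrightarrow> ws \<in> lists I \<and> (\<forall>us\<in>lists I. W us = W ws \<longrightarrow> length ws \<le> length us)"

text \<open>For reduced \<open>ws\<close> this says that w s_i is not shorter than w. Equality of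
  the lengths is left open, which avoids a parity argument; where it matters it is excluded by the
  sign of the root w \<alpha>_i.\<close>

definition asc :: "'i list \<Rightarrow> 'i \<Rightarrow> bool" where
  "asc ws i \<longleftrightarrow> (\<forall>us\<in>lists I. W us = W (ws @ [i]) \<longrightarrow> length ws \<le> length us)"

lemma red_lists: "red ws \<Longrightarrow> ws \<in> lists I"
  by (simp add: red_def)

lemma red_cong: "red ws \<Longrightarrow> us \<in> lists I \<Longrightarrow> W us = W ws \<Longrightarrow> length us = length ws \<Longrightarrow> red us"
  by (simp add: red_def)

lemma red_mid:
  assumes "red (xs @ ys @ zs)" "ys' \<in> lists I" "W ys' = W ys"
  shows "length ys \<le> length ys'"
proof -
  have "W (xs @ ys' @ zs) = W (xs @ ys @ zs)" "xs @ ys' @ zs \<in> lists I"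
    using assms by (auto simp: W_app red_def)
  then have "length (xs @ ys @ zs) \<le> length (xs @ ys' @ zs)" using assms(1) unfolding red_def by blast
  then show ?thesis by simp
qed

lemma red_mid_red: "red (xs @ ys @ zs) \<Longrightarrow> red ys"
  using red_mid[of xs ys zs] by (auto simp: red_def)

lemma red_app1: "red (xs @ ys) \<Longrightarrow> red xs"
  using red_mid_red[of "[]" xs ys] by simp

lemma red_app2: "red (xs @ ys) \<Longrightarrow> red ys"
  using red_mid_red[of xs ys "[]"] by simp

lemma red_nodup: "red us \<Longrightarrow> us \<noteq> xs @ [x, x] @ ys"
proof
  assume r: "red us" and u: "us = xs @ [x, x] @ ys"
  then have "W [] = W [x, x]" using W_double[of x "[]" "[]"] by (simp add: red_def)
  then have "length [x, x] \<le> length ([] :: 'i list)" using red_mid[of xs "[x,x]" ys "[]"] r u by simp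
  then show False by simp
qed

lemma asc_snoc: "red (ws @ [i]) \<Longrightarrow> asc ws i"
  unfolding red_def asc_def by fastforce

lemma desc_snoc: "red (ws @ [i]) \<Longrightarrow> \<not> asc (ws @ [i]) i"
proof
  assume r: "red (ws @ [i])" and a: "asc (ws @ [i]) i"
  have "W ws = W ((ws @ [i]) @ [i])" using W_double[of i ws "[]"] r by (simp add: red_def)
  then show False using a r unfolding asc_def red_def by force
qed

text \<open>Among the length-additive factorisations into v and a word u in i and j, one with
  shortest v is taken: a letter i or j that shortened v could be moved over to u. The factorisation
  into \<open>ws\<close> and \<open>[j]\<close> bounds the length of v, which drives the inductions
  below.\<close>

lemma parabolic:
  assumes r: "red (ws @ [j])" and i: "i \<in> I"
  obtains vs us where "vs \<in> lists I" "us \<in> lists {i, j}" "W (vs @ us) = W (ws @ [j])"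
    "length vs + length us = Suc (length ws)" "length vs \<le> length ws" "asc vs i" "asc vs j"
    "red (vs @ us)" "red vs" "red us"
proof -
  let ?P = "\<lambda>n. \<exists>vs us. vs \<in> lists I \<and> us \<in> lists {i, j} \<and> W (vs @ us) = W (ws @ [j]) \<and>
    length vs + length us = Suc (length ws) \<and> length vs = n"
  have j: "j \<in> I" and wI: "ws \<in> lists I" using r by (auto simp: red_def)
  have ex: "?P (length ws)" by (intro exI[of _ ws] exI[of _ "[j]"]) (use wI in auto)
  define n where "n = (LEAST n. ?P n)"
  have "?P n" unfolding n_def by (rule LeastI[of ?P, OF ex])
  then obtain vs us where vu: "vs \<in> lists I" "us \<in> lists {i, j}" "W (vs @ us) = W (ws @ [j])"
    "length vs + length us = Suc (length ws)" "length vs = n" by blast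
  have le: "n \<le> length ws" unfolding n_def by (rule Least_le[of ?P, OF ex])
  have usI: "us \<in> lists I" using vu(2) i j by auto
  have rvu: "red (vs @ us)" using red_cong[OF r _ vu(3)] vu usI by simp
  have asc: "asc vs k" if k: "k \<in> {i, j}" for k
    unfolding asc_def
  proof (intro ballI impI, rule ccontr)
    fix xs assume xs: "xs \<in> lists I" "W xs = W (vs @ [k])" "\<not> length vs \<le> length xs"
    have kI: "k \<in> I" using k i j by auto
    have w: "W (xs @ k # us) = W (ws @ [j])"
      using xs(2) W_double[OF kI, of vs us] vu(3) by (simp add: W_app W_Cons fun_eq_iff)
    moreover have "xs @ k # us \<in> lists I" using xs usI kI by auto
    ultimately have "Suc (length ws) \<le> length (xs @ k # us)" using r unfolding red_def by fastforce
    then have "length xs + length (k # us) = Suc (length ws)" using xs(3) vu(4) by simp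
    then have "?P (length xs)" using xs w vu(2) k by (intro exI[of _ xs] exI[of _ "k # us"]) auto
    then have "n \<le> length xs" unfolding n_def by (rule Least_le)
    then show False using xs(3) vu by simp
  qed
  show ?thesis
    by (rule that[OF vu(1-4)]) (use asc red_app1[OF rvu] red_app2[OF rvu] rvu vu le in auto)
qed

lemma alternating_list:
  "ts \<in> lists {i, j} \<Longrightarrow> \<forall>xs x ys. ts \<noteq> xs @ [x, x] @ ys \<Longrightarrow> (ts \<noteq> [] \<longrightarrow> hd ts = j) \<Longrightarrow> ts = alternating j i (length ts)"
proof (induction ts arbitrary: i j)
  case (Cons t ts)
  have t: "t = j" using Cons.prems by simp
  have nd: "\<forall>xs x ys. ts \<noteq> xs @ [x, x] @ ys"
  proof (intro allI notI)
    fix xs x ys assume "ts = xs @ [x, x] @ ys"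
    then have "t # ts = (t # xs) @ [x, x] @ ys" by simp
    then show False using Cons.prems(2) by blast
  qed
  have hd: "ts \<noteq> [] \<longrightarrow> hd ts = i"
  proof
    assume "ts \<noteq> []"
    then obtain u us where u: "ts = u # us" by (cases ts) auto
    have "t # ts \<noteq> [] @ [t, t] @ us" using Cons.prems(2) by blast
    then show "hd ts = i" using u Cons.prems(1) t by auto
  qed
  have "ts = alternating i j (length ts)" using Cons.IH[of j i] Cons.prems(1) nd hd by auto
  then show ?case using t by simp
qed simp

lemma red_alternating:
  assumes "red us" "us \<in> lists {i, j}" "us \<noteq> [] \<Longrightarrow> last us = j"
  shows "us = rev (alternating j i (length us))"
proof -
  have "\<forall>xs x ys. rev us \<noteq> xs @ [x, x] @ ys"
  proof (intro allI notI)
    fix xs x ys assume "rev us = xs @ [x, x] @ ys"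
    then have "us = rev ys @ [x, x] @ rev xs" by (metis append.assoc append_Cons append_Nil rev.simps(2) rev_append rev_rev_ident)
    then show False using red_nodup[OF assms(1)] by blast
  qed
  then have "rev us = alternating j i (length (rev us))"
    using assms by (intro alternating_list) (auto simp: hd_rev)
  then show ?thesis by (metis length_rev rev_rev_ident)
qed

lemma alternating_in: "set (alternating i j n) \<subseteq> {i, j}"
  by (induction n arbitrary: i j) auto

lemma length_alternating [simp]: "length (alternating i j n) = n"
  by (induction n arbitrary: i j) auto

lemma alternating_add: "\<exists>ys. alternating i j (m + n) = alternating i j m @ ys"
  by (induction m arbitrary: i j) auto

lemma alternating_long:
  assumes "coxeter_number G i j \<le> p"
  shows "\<exists>pre. rev (alternating j i p) = pre @ rev (alternating j i (coxeter_number G i j))"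
proof -
  obtain ys where "alternating j i p = alternating j i (coxeter_number G i j) @ ys"
    using alternating_add[of j i "coxeter_number G i j" "p - coxeter_number G i j"] assms by auto
  then show ?thesis by auto
qed

lemma cox_pos: "i \<in> I \<Longrightarrow> j \<in> I \<Longrightarrow> i \<noteq> j \<Longrightarrow> \<exists>n. coxeter_number G i j = Suc n"
  by (auto simp: coxeter_number_def Let_def)

text \<open>The word \<open>us\<close> cannot be longer than the longest element of the dihedral group, since the
  braid relation would produce a word ending in \<open>i\<close>.\<close>

lemma dihedral_short:
  assumes ij: "i \<in> I" "j \<in> I" "i \<noteq> j" and r: "red (vs @ us)" and us: "us = rev (alternating j i p)"
    and a: "asc (vs @ us) i"
  shows "p < coxeter_number G i j"
proof (rule ccontr)
  assume "\<not> ?thesis"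
  then obtain pre where pre: "us = pre @ rev (alternating j i (coxeter_number G i j))"
    using alternating_long[of i j p] us by auto
  obtain m where m: "coxeter_number G i j = Suc m" using cox_pos ij by blast
  have "W us = W (pre @ rev (alternating i j (Suc m)))"
    unfolding pre W_app using W_braid[OF ij] m by simp
  then have "W ((vs @ us) @ [i]) = W ((vs @ pre @ rev (alternating j i m)) @ [i, i] @ [])"
    by (simp add: W_app W_Cons comp_assoc)
  then have "W ((vs @ us) @ [i]) = W (vs @ pre @ rev (alternating j i m))"
    using W_double[OF ij(1), of "vs @ pre @ rev (alternating j i m)" "[]"] by simp
  moreover have "vs @ pre @ rev (alternating j i m) \<in> lists I"
    using r pre alternating_in[of j i m] ij by (auto simp: red_def)
  ultimately have "length (vs @ us) \<le> length (vs @ pre @ rev (alternating j i m))"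
    using a unfolding asc_def by (metis)
  then show False using pre m by simp
qed

lemma asc_last:
  assumes "red (vs @ us)" "asc (vs @ us) i" "us \<noteq> []"
  shows "last us \<noteq> i"
proof
  assume "last us = i"
  then have "vs @ us = (vs @ butlast us) @ [i]" using assms(3) by (metis append_assoc append_butlast_last_id)
  then show False using desc_snoc assms by metis
qed

lemma asc_cong: "W us = W ws \<Longrightarrow> length us = length ws \<Longrightarrow> asc us i = asc ws i"
  by (simp add: asc_def W_app)

text \<open>Humphreys, Reflection groups and Coxeter groups, Theorem 5.4: pass to the minimal
  representative of the coset of the dihedral subgroup generated by the last letter and \<open>i\<close>.\<close>

lemma dihedral_split:
  assumes r: "red (ws @ [j])" and a: "asc (ws @ [j]) i" and i: "i \<in> I"
  obtains vs p where "red (vs @ rev (alternating j i p))" "red vs" "asc vs i" "asc vs j" "length vs \<le> length ws"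
    "W (vs @ rev (alternating j i p)) = W (ws @ [j])" "p < coxeter_number G i j" "i \<noteq> j" "j \<in> I"
    "length (vs @ rev (alternating j i p)) = Suc (length ws)"
proof -
  have j: "j \<in> I" using r by (auto simp: red_def)
  have ij: "i \<noteq> j" using a desc_snoc[OF r] by auto
  obtain vs us where vu: "vs \<in> lists I" "us \<in> lists {i, j}" "W (vs @ us) = W (ws @ [j])"
    "length vs + length us = Suc (length ws)" "length vs \<le> length ws" "asc vs i" "asc vs j"
    "red (vs @ us)" "red vs" "red us" using parabolic[OF r i] by blast
  have a': "asc (vs @ us) i" using asc_cong[of "vs @ us" "ws @ [j]" i] a vu by simp
  have "us = rev (alternating j i (length us))"
    by (rule red_alternating[OF vu(10,2)]) (use asc_last[OF vu(8) a'] vu(2) in \<open>auto dest: last_in_set\<close>)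
  moreover from this have "length us < coxeter_number G i j"
    using dihedral_short[OF i j ij vu(8) _ a'] by blast
  ultimately show ?thesis using vu ij j by (intro that[of vs "length us"]) auto
qed

text \<open>After replacing the word by v u with u alternating, u \<alpha>_i is a nonnegative
  combination of \<alpha>_i and \<alpha>_j by rank two, and v is shorter with both i and j as
  ascents.\<close>

lemma root_pos:
  "red ws \<Longrightarrow> asc ws i \<Longrightarrow> i \<in> I \<Longrightarrow> W ws (simple_root i) k \<ge> 0"
proof (induction "length ws" arbitrary: ws i rule: less_induct)
  case less
  show ?case
  proof (cases ws rule: rev_cases)
    case Nil
    then show ?thesis by (simp add: simple_root_def)
  next
    case (snoc ws' j)
    obtain vs p where vp: "red (vs @ rev (alternating j i p))" "red vs" "asc vs i" "asc vs j" "length vs \<le> length ws'"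
      "W (vs @ rev (alternating j i p)) = W (ws' @ [j])" "p < coxeter_number G i j" "i \<noteq> j" "j \<in> I"
      using dihedral_split[of ws' j i] less.prems snoc by metis
    obtain a b where ab: "a \<ge> 0" "b \<ge> 0" "W (rev (alternating j i p)) (simple_root i) = comb i j a b"
      using dihedral_pos[OF less.prems(3) vp(9,8,7)] by blast
    have "W ws (simple_root i) = W vs (comb i j a b)"
      using vp(6) ab(3) snoc by (metis W_app comp_apply)
    moreover have "W vs (simple_root i) k \<ge> 0" "W vs (simple_root j) k \<ge> 0"
      using less.hyps[of vs] less.prems vp snoc by auto
    ultimately show ?thesis using ab by (simp add: W_comb)
  qed
qed

lemma root_neg:
  assumes "red (ws @ [i])"
  shows "W (ws @ [i]) (simple_root i) k \<le> 0"
proof -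
  have i: "i \<in> I" using assms by (auto simp: red_def)
  have "W ws (simple_root i) k \<ge> 0" using root_pos[OF red_app1[OF assms] asc_snoc[OF assms] i] .
  then show ?thesis using refl_simple[OF i] by (simp add: W_app W_Cons W_uminus)
qed

lemma not_both:
  assumes "us \<in> lists I" "\<And>k. W us (simple_root i) k \<ge> 0" "\<And>k. W us (simple_root i) k \<le> 0"
  shows False
  using W_nonzero[OF assms(1), of i] assms(2,3) by (metis antisym ext)

lemma foldr_mem: "(\<And>i x. i \<in> I \<Longrightarrow> x \<in> U \<Longrightarrow> T i x \<in> U) \<Longrightarrow> ws \<in> lists I \<Longrightarrow> x \<in> U \<Longrightarrow> foldr T ws x \<in> U"
  by (induction ws) auto

lemma rev_alternating: "rev (alternating i j n) = (if odd n then alternating i j n else alternating j i n)"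
proof (induction n arbitrary: i j)
  case (Suc n)
  have snoc: "alternating i j (Suc n) = alternating i j n @ [if even n then i else j]" for i j :: 'b
    by (induction n arbitrary: i j) auto
  show ?case using Suc.IH[of j i] Suc.IH[of i j] snoc[of i j] snoc[of j i] by (auto)
qed simp

text \<open>Equal last letters are stripped by induction. If the last letters i and j differ, both
  are descents, the dihedral part u of the element has full length m(i,j), and the two forms of its
  final segment give reduced words ending in i and in j which one braid relation connects. The set U
  is there because the operators act on a subset of a ring type.\<close>

lemma matsumoto:
  assumes Tm: "\<And>i x. i \<in> I \<Longrightarrow> x \<in> U \<Longrightarrow> T i x \<in> U"
    and br: "\<And>i j x. i \<in> I \<Longrightarrow> j \<in> I \<Longrightarrow> i \<noteq> j \<Longrightarrow> x \<in> U \<Longrightarrow>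
       foldr T (alternating i j (coxeter_number G i j)) x = foldr T (alternating j i (coxeter_number G i j)) x"
  shows "red ws \<Longrightarrow> red ws' \<Longrightarrow> W ws = W ws' \<Longrightarrow> x \<in> U \<Longrightarrow> foldr T ws x = foldr T ws' x"
proof (induction "length ws" arbitrary: ws ws' x)
  case 0
  then have "length ws' \<le> length ws" unfolding red_def by metis
  with 0 show ?case by simp
next
  case (Suc n)
  have same: "foldr T (as @ [i]) y = foldr T (bs @ [i]) y"
    if "red (as @ [i])" "red (bs @ [i])" "W (as @ [i]) = W (bs @ [i])" "length as = n" "y \<in> U" for as bs i y
  proof -
    have i: "i \<in> I" using that by (auto simp: red_def)
    have "W (as @ [i] @ [i]) = W (bs @ [i] @ [i])" using that(3) by (metis W_app append_assoc)
    then have "W as = W bs" using W_double[OF i, of as "[]"] W_double[OF i, of bs "[]"] by simp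
    then have "foldr T as (T i y) = foldr T bs (T i y)"
      using Suc.hyps(1)[of as bs "T i y"] red_app1 that Tm i by metis
    then show ?thesis by simp
  qed
  have len: "length ws' = Suc n" using Suc by (metis le_antisym red_def)
  obtain as i where as: "ws = as @ [i]" "length as = n" using Suc.hyps(2) by (cases ws rule: rev_cases) auto
  obtain bs j where bs: "ws' = bs @ [j]" "length bs = n" using len by (cases ws' rule: rev_cases) auto
  have iI: "i \<in> I" "j \<in> I" using as bs Suc.prems by (auto simp: red_def)
  show ?case
  proof (cases "i = j")
    case True
    then show ?thesis using same as bs Suc.prems by metis
  next
    case ij: False
    obtain vs us where vu: "vs \<in> lists I" "us \<in> lists {i, j}" "W (vs @ us) = W ws'"
      "length vs + length us = Suc n" "length vs \<le> n" "asc vs i" "asc vs j"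
      "red (vs @ us)" "red vs" "red us" using parabolic[of bs j i] iI bs Suc.prems by metis
    have neg: "W (vs @ us) (simple_root k) l \<le> 0" if "k \<in> {i, j}" for k l
      using that root_neg[of as i l] root_neg[of bs j l] as bs Suc.prems vu by auto
    have vI: "vs @ us \<in> lists I" using vu(8) by (simp add: red_def)
    have "us \<noteq> []"
    proof
      assume "us = []"
      then have "W (vs @ us) (simple_root i) k \<ge> 0" for k using root_pos[OF vu(9,6) iI(1)] by simp
      then show False using not_both[OF vI, of i] neg by auto
    qed
    define l where "l = last us"
    define l' where "l' = (if l = i then j else i)"
    have l: "l \<in> {i, j}" using vu(2) \<open>us \<noteq> []\<close> unfolding l_def by (auto dest: last_in_set)
    have ll: "{i, j} = {l', l}" "l' \<in> {i,j}" "l' \<noteq> l" "l \<in> I" "l' \<in> I" using l ij iI unfolding l'_def by auto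
    have us: "us = rev (alternating l l' (length us))"
      by (rule red_alternating[OF vu(10)]) (use vu(2) ll l_def in auto)
    \<comment> \<open>A shorter u would send \<alpha>_l' to a nonnegative combination of the two
      simple roots, and v would keep it nonnegative, although both letters are descents of v
      u.\<close>
    have "coxeter_number G l' l \<le> length us"
    proof (rule ccontr)
      assume "\<not> ?thesis"
      then obtain a b where ab: "a \<ge> 0" "b \<ge> 0" "W us (simple_root l') = comb l' l a b"
        using dihedral_pos[OF ll(5,4,3), of "length us"] us by auto
      have p: "W vs (simple_root l) k \<ge> 0" "W vs (simple_root l') k \<ge> 0" for k
        using root_pos[OF vu(9)] vu(6,7) iI ll(1) by (metis insertCI insertE singletonD)+
      have "W (vs @ us) (simple_root l') k \<ge> 0" for k
        using ab p[of k] by (simp add: W_app W_comb)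
      then show False using not_both[OF vI, of l'] neg ll by auto
    qed
    then obtain pre where pre: "us = pre @ rev (alternating l l' (coxeter_number G l' l))"
      using alternating_long[of l' l "length us"] us by auto
    let ?m = "coxeter_number G i j"
    have mm: "coxeter_number G l' l = ?m" using ll cox_sym by (metis doubleton_eq_iff)
    define R where "R = (\<lambda>i j. vs @ pre @ rev (alternating i j ?m))"
    have R: "W (R i j) = W ws'" "W (R j i) = W ws'"
      using vu(3) pre W_braid[OF iI ij] ll mm ij unfolding R_def by (auto simp: W_app l'_def split: if_splits)
    have Rl: "length (R i j) = Suc n" "length (R j i) = Suc n"
      using vu(4) pre mm unfolding R_def by auto
    have RI: "R i j \<in> lists I" "R j i \<in> lists I"
      using vI pre alternating_in[of i j ?m] alternating_in[of j i ?m] iI unfolding R_def by auto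
    have Rr: "red (R i j)" "red (R j i)" using red_cong[OF Suc.prems(2)] R Rl RI len by auto
    obtain m where m: "?m = Suc m" using cox_pos iI ij by blast
    \<comment> \<open>\<open>R i j\<close> ends in i and \<open>R j i\<close> in j, so each can be
      compared with the given word that has the same last letter.\<close>
    have Ri: "R i j = (vs @ pre @ rev (alternating j i m)) @ [i]" "R j i = (vs @ pre @ rev (alternating i j m)) @ [j]"
      unfolding R_def m by simp_all
    have 1: "foldr T ws x = foldr T (R i j) x"
      unfolding Ri as by (rule same) (use as Ri Rr R Suc.prems in auto)
    have 2: "foldr T ws' x = foldr T (R j i) x"
      unfolding Ri bs by (rule same) (use bs Ri Rr R Suc.prems in auto)
    have "foldr T (rev (alternating i j ?m)) x = foldr T (rev (alternating j i ?m)) x"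
      unfolding rev_alternating using br[OF iI ij Suc.prems(4)] by auto
    then have "foldr T (R i j) x = foldr T (R j i) x" unfolding R_def by simp
    then show ?thesis using 1 2 by simp
  qed
qed

end

context cartan
begin

subsection \<open>The longest element\<close>

definition longest :: "'i list \<Rightarrow> bool" where
  "longest ws \<longleftrightarrow> red ws \<and> (\<forall>us. red us \<longrightarrow> length us \<le> length ws)"

lemma ex_red:
  assumes "ws \<in> lists I"
  shows "\<exists>us. red us \<and> W us = W ws \<and> length us \<le> length ws"
proof -
  let ?P = "\<lambda>n. \<exists>us\<in>lists I. W us = W ws \<and> length us = n"
  have ex: "?P (length ws)" using assms by blast
  obtain us where us: "us \<in> lists I" "W us = W ws" "length us = (LEAST n. ?P n)" using LeastI[of ?P, OF ex] by blast
  have "length us \<le> n" if "?P n" for n using Least_le[of ?P, OF that] us by simp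
  then show ?thesis using us assms by (intro exI[of _ us]) (auto simp: red_def)
qed

lemma W_uncancel: "x \<in> I \<Longrightarrow> W us = W (ws @ [x]) \<Longrightarrow> W (us @ [x]) = W ws"
  using W_double[of x ws "[]"] by (simp add: W_app W_Cons comp_assoc)

text \<open>Maximality gives l(w s_i) at most l(w), and an ascent excludes a drop, so the lengths
  would agree. Then i would be an ascent of w s_i too, and both w \<alpha>_i and its negative would
  be nonnegative.\<close>

lemma longest_desc:
  assumes l: "longest ws" and i: "i \<in> I"
  shows "\<not> asc ws i"
proof
  assume a: "asc ws i"
  have r: "red ws" "ws \<in> lists I" using l by (auto simp: longest_def red_def)
  obtain us where us: "red us" "W us = W (ws @ [i])" using ex_red[of "ws @ [i]"] i r by auto
  have len: "length us = length ws" using l a us unfolding longest_def asc_def by (metis le_antisym red_lists)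
  have "asc us i" unfolding asc_def W_uncancel[OF i us(2)] len using r(1) by (auto simp: red_def)
  then have 1: "W us (simple_root i) k \<ge> 0" for k using root_pos[OF us(1) _ i] by auto
  have "W us (simple_root i) = (\<lambda>k. - W ws (simple_root i) k)"
    using us(2) refl_simple[OF i] by (simp add: W_app W_Cons W_uminus)
  then have "W ws (simple_root i) k \<le> 0" for k using 1[of k] by simp
  then show False using not_both[OF r(2)] root_pos[OF r(1) a i] by blast
qed

lemma longest_ends:
  assumes l: "longest ws" and i: "i \<in> I"
  obtains us where "red (us @ [i])" "W (us @ [i]) = W ws" "length (us @ [i]) = length ws"
proof -
  obtain us where us: "us \<in> lists I" "W us = W (ws @ [i])" "length us < length ws"
    using longest_desc[OF l i] unfolding asc_def by (auto simp: not_le)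
  have r: "red ws" using l by (auto simp: longest_def)
  have w: "W (us @ [i]) = W ws" by (rule W_uncancel[OF i us(2)])
  have "us @ [i] \<in> lists I" using us i by simp
  then have "length ws \<le> length (us @ [i])" using r w unfolding red_def by blast
  then have "length (us @ [i]) = length ws" using us by simp
  then show ?thesis using red_cong[OF r _ w] us i w by (intro that[of us]) auto
qed

lemma longest_neg:
  assumes l: "longest ws" and i: "i \<in> I"
  shows "W ws (simple_root i) k \<le> 0"
proof -
  obtain us where "red (us @ [i])" "W (us @ [i]) = W ws" using longest_ends[OF l i] by blast
  then show ?thesis using root_neg by metis
qed

lemma W_rev_eq: "xs \<in> lists I \<Longrightarrow> ys \<in> lists I \<Longrightarrow> W xs = W (rev ys) \<Longrightarrow> W (rev xs) = W ys"
proof -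
  assume a: "xs \<in> lists I" "ys \<in> lists I" "W xs = W (rev ys)"
  have "W (rev xs) = W (rev xs) \<circ> (W (rev ys) \<circ> W ys)" using W_rev[OF a(2)] by simp
  also have "\<dots> = (W (rev xs) \<circ> W xs) \<circ> W ys" using a by (simp add: comp_assoc)
  also have "\<dots> = W ys" using W_rev[OF a(1)] by simp
  finally show ?thesis .
qed

lemma lists_rev: "ws \<in> lists I \<Longrightarrow> rev ws \<in> lists I"
  by (auto simp: in_lists_conv_set)

lemma longest_rev: "longest ws \<Longrightarrow> longest (rev ws)"
  unfolding longest_def red_def
proof (intro conjI ballI allI impI; (elim conjE)?)
  show "rev ws \<in> lists I" if "ws \<in> lists I" using that by (rule lists_rev)
next
  fix us assume "ws \<in> lists I" "\<forall>us\<in>lists I. W us = W ws \<longrightarrow> length ws \<le> length us" "us \<in> lists I" "W us = W (rev ws)"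
  then show "length (rev ws) \<le> length us" using W_rev_eq lists_rev by (metis length_rev)
qed simp

lemma W_out: "ws \<in> lists I \<Longrightarrow> k \<notin> I \<Longrightarrow> W ws \<beta> k = \<beta> k"
  by (induction ws) (auto simp: W_Cons refl_pair simple_root_def)

lemma W_expand:
  assumes "\<And>k. k \<notin> I \<Longrightarrow> \<beta> k = 0"
  shows "W ws \<beta> = (\<lambda>k. \<Sum>l\<in>I. \<beta> l * W ws (simple_root l) k)"
proof -
  have "W ws (\<lambda>k. \<Sum>l\<in>A. \<beta> l * simple_root l k) = (\<lambda>k. \<Sum>l\<in>A. \<beta> l * W ws (simple_root l) k)" if "finite A" for A
    using that
  proof induction
    case empty
    show ?case using W_lin[of ws 0 "\<lambda>k. 0" 0 "\<lambda>k. 0"] by simp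
  next
    case (insert l A)
    show ?case using insert W_lin[of ws "\<beta> l" "simple_root l" 1 "\<lambda>k. \<Sum>l\<in>A. \<beta> l * simple_root l k"] by simp
  qed
  moreover have "(\<lambda>k. \<Sum>l\<in>I. \<beta> l * simple_root l k) = \<beta>"
    using assms finI by (auto simp: simple_root_def if_distrib[of "\<lambda>z. c * z" for c] cong: if_cong)
  ultimately show ?thesis using finI by metis
qed

text \<open>The root \<beta> = u \<alpha>_i = -w \<alpha>_i is nonnegative; choose k in its support
  and write \<beta> as \<alpha>_k plus a nonnegative rest. The negative of the inverse of w
  preserves nonnegativity and sends \<beta> to \<alpha>_i, so its value at \<alpha>_k is nonzero and
  bounded by \<alpha>_i, hence equal to it.\<close>

lemma longest_simple:
  assumes l: "longest ws" and r: "red (us @ [i])" and e: "W (us @ [i]) = W ws"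
  shows "\<exists>k\<in>I. W us (simple_root i) = simple_root k"
proof -
  have i: "i \<in> I" "us \<in> lists I" using r by (auto simp: red_def)
  have wI: "ws \<in> lists I" "rev ws \<in> lists I" using l lists_rev by (auto simp: longest_def red_def)
  define \<beta> where "\<beta> = W us (simple_root i)"
  have b: "W ws (simple_root i) = (\<lambda>k. - \<beta> k)"
    unfolding e[symmetric] \<beta>_def using refl_simple[OF i(1)] by (simp add: W_app W_Cons W_uminus)
  have pos: "\<beta> k \<ge> 0" for k using longest_neg[OF l i(1), of k] b by simp
  have out: "\<beta> k = 0" if "k \<notin> I" for k using W_out[OF i(2) that, of "simple_root i"] that i by (auto simp: \<beta>_def simple_root_def)
  have "\<exists>k. \<beta> k \<noteq> 0" using W_nonzero[OF i(2), of i] unfolding \<beta>_def by auto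
  then obtain k where k0: "\<beta> k \<noteq> 0" by blast
  then have k: "\<beta> k \<ge> 1" "k \<in> I" using pos[of k] out[of k] by auto
  define \<beta>' where "\<beta>' = (\<lambda>l. \<beta> l - simple_root k l)"
  define g where "g = (\<lambda>l m. - W (rev ws) (simple_root l) m)"
  have g: "g l m \<ge> 0" if "l \<in> I" for l m using longest_neg[OF longest_rev[OF l] that, of m] by (simp add: g_def)
  have inv: "W (rev ws) (W ws x) = x" for x using W_rev[OF wI(1)] by (metis comp_apply id_apply)
  have "W (rev ws) \<beta> = (\<lambda>m. - simple_root i m)" using inv[of "simple_root i"] W_uminus[of "rev ws" "\<lambda>m. - \<beta> m"] b by simp
  moreover have "W (rev ws) \<beta> = (\<lambda>m. W (rev ws) (simple_root k) m + W (rev ws) \<beta>' m)"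
    using W_lin[of "rev ws" 1 "simple_root k" 1 \<beta>'] by (simp add: \<beta>'_def)
  moreover have "W (rev ws) \<beta>' = (\<lambda>m. \<Sum>l\<in>I. \<beta>' l * W (rev ws) (simple_root l) m)"
    by (rule W_expand) (use out k in \<open>auto simp: \<beta>'_def simple_root_def\<close>)
  ultimately have eq: "(\<lambda>m. - simple_root i m) = (\<lambda>m. W (rev ws) (simple_root k) m + (\<Sum>l\<in>I. \<beta>' l * W (rev ws) (simple_root l) m))"
    by simp
  have sum: "simple_root i m = g k m + (\<Sum>l\<in>I. \<beta>' l * g l m)" for m
    using fun_cong[OF eq, of m] by (simp add: g_def sum_negf)
  have nn: "(\<Sum>l\<in>I. \<beta>' l * g l m) \<ge> 0" for m
    using g pos k by (intro sum_nonneg mult_nonneg_nonneg) (auto simp: \<beta>'_def simple_root_def)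
  have le: "g k m \<le> simple_root i m" for m using sum[of m] nn[of m] by linarith
  have "\<exists>m. g k m \<noteq> 0" using W_nonzero[OF wI(2), of k] unfolding g_def by auto
  then obtain m where m0: "g k m \<noteq> 0" by blast
  then have m: "g k m \<ge> 1" using g[OF k(2), of m] by simp
  have mi: "m = i" using m le[of m] by (auto simp: simple_root_def split: if_splits)
  have "g k l = simple_root i l" for l
    using le[of l] g[OF k(2), of l] m mi by (auto simp: simple_root_def split: if_splits)
  then have "W (rev ws) (simple_root k) = (\<lambda>l. - simple_root i l)" unfolding g_def by (simp add: fun_eq_iff minus_equation_iff)
  then have "W ws (W (rev ws) (simple_root k)) = \<beta>" using W_uminus[of ws "simple_root i"] b by simp
  then have "simple_root k = \<beta>" using W_rev'[OF wI(1)] by (metis comp_apply id_apply)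
  then show ?thesis using k \<beta>_def by metis
qed

end

section \<open>Positivity of root vectors\<close>

context cq_algebra
begin

lemma span_mult:
  assumes "\<And>a b. a \<in> A \<Longrightarrow> b \<in> B \<Longrightarrow> a * b \<in> span C" "x \<in> span A" "y \<in> span B"
  shows "x * y \<in> span C"
proof -
  have 1: "a * y \<in> span C" if "a \<in> A" for a
    using assms(3)
  proof (induction rule: span_induct_alt)
    case (step c b z)
    then show ?case using assms(1)[OF that step(1)] by (simp add: distrib_left span_add span_scale)
  qed (simp add: span_zero)
  show ?thesis using assms(2)
  proof (induction rule: span_induct_alt)
    case (step c a z)
    then show ?case using 1[OF step(1)] by (simp add: distrib_right span_add span_scale)
  qed (simp add: span_zero)
qed

end

definition word_wt :: "'i list \<Rightarrow> 'i \<Rightarrow> int" where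
  "word_wt w k = int (count_list w k)"

lemma word_wt_simps [simp]:
  "word_wt [] = (\<lambda>k. 0)" "word_wt (i # w) = (\<lambda>k. simple_root i k + word_wt w k)"
  "word_wt (v @ w) = (\<lambda>k. word_wt v k + word_wt w k)"
  by (auto simp: word_wt_def simple_root_def fun_eq_iff)

text \<open>Lusztig's formulas are the case \<open>t = 1\<close>, \<open>s = - 1\<close>. The free scalars make the assumptions
  stable, up to the values of \<open>t\<close> and \<open>s\<close>, under the exchange of \<open>E\<close> with \<open>F\<close> and of \<open>K\<close> with its inverse.\<close>

locale lusz = cartan G + qrel sc G E F K Ki for sc :: "Cq \<Rightarrow> 'a::ring_1 \<Rightarrow> 'a" (infixr "*s" 75)
    and G :: "'i cartan_datum" and E F K Ki :: "'i \<Rightarrow> 'a" +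
  fixes U :: "'a set" and T :: "'i \<Rightarrow> 'a \<Rightarrow> 'a" and t :: "'i \<Rightarrow> 'i \<Rightarrow> Cq" and s :: "'i \<Rightarrow> Cq"
  assumes U_one: "1 \<in> U" and U_add: "x \<in> U \<Longrightarrow> y \<in> U \<Longrightarrow> x + y \<in> U"
    and U_mult: "x \<in> U \<Longrightarrow> y \<in> U \<Longrightarrow> x * y \<in> U" and U_sc: "x \<in> U \<Longrightarrow> c *s x \<in> U"
    and U_E: "i \<in> idx G \<Longrightarrow> E i \<in> U" and U_F: "i \<in> idx G \<Longrightarrow> F i \<in> U"
    and U_K: "i \<in> idx G \<Longrightarrow> K i \<in> U" and U_Ki: "i \<in> idx G \<Longrightarrow> Ki i \<in> U"
    and T_mem: "i \<in> idx G \<Longrightarrow> x \<in> U \<Longrightarrow> T i x \<in> U"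
    and T_add: "i \<in> idx G \<Longrightarrow> x \<in> U \<Longrightarrow> y \<in> U \<Longrightarrow> T i (x + y) = T i x + T i y"
    and T_mult: "i \<in> idx G \<Longrightarrow> x \<in> U \<Longrightarrow> y \<in> U \<Longrightarrow> T i (x * y) = T i x * T i y"
    and T_sc: "i \<in> idx G \<Longrightarrow> x \<in> U \<Longrightarrow> T i (c *s x) = c *s T i x"
    and T_one: "i \<in> idx G \<Longrightarrow> T i 1 = 1"
    and T_braid: "i \<in> idx G \<Longrightarrow> j \<in> idx G \<Longrightarrow> i \<noteq> j \<Longrightarrow> x \<in> U \<Longrightarrow>
       foldr T (alternating i j (coxeter_number G i j)) x = foldr T (alternating j i (coxeter_number G i j)) x"
    and T_E: "i \<in> idx G \<Longrightarrow> j \<in> idx G \<Longrightarrow> i \<noteq> j \<Longrightarrow> T i (E j) = t i j *s fr (q_at G i) (cm G i j) (E i) (E j) (nat (- cm G i j))"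
    and T_Eii: "i \<in> idx G \<Longrightarrow> T i (E i) = s i *s (Ki i * F i)"
begin

abbreviation frr where "frr i j \<equiv> fr (q_at G i) (cm G i j) (E i) (E j)"
abbreviation fll where "fll i j \<equiv> fl (q_at G i) (cm G i j) (E i) (E j)"

text \<open>J = {i, j} serves the rank two steps and J = I the final statement. The weight \<beta>
  is carried along because it later identifies a root vector of simple weight as a multiple of a
  generator.\<close>

definition Upd :: "'i set \<Rightarrow> ('i \<Rightarrow> int) \<Rightarrow> 'a set" where
  "Upd J \<beta> = span {prod_list (map E w) | w. set w \<subseteq> J \<and> word_wt w = \<beta>}"

lemma U_0: "0 \<in> U"
  using U_sc[OF U_one, of 0] by simp

lemma U_uminus: "x \<in> U \<Longrightarrow> - x \<in> U"
  using U_sc[of x "-1"] by simp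

lemma U_diff: "x \<in> U \<Longrightarrow> y \<in> U \<Longrightarrow> x - y \<in> U"
  using U_add[of x "- y"] U_uminus[of y] by simp

lemma T_diff: "i \<in> I \<Longrightarrow> x \<in> U \<Longrightarrow> y \<in> U \<Longrightarrow> T i (x - y) = T i x - T i y"
  using T_add[of i x "(-1) *s y"] T_sc[of i y "-1"] U_sc[of y "-1"] by simp

lemma T_0: "i \<in> I \<Longrightarrow> T i 0 = 0"
  using T_sc[of i 1 0] U_one by simp

lemma T_uminus: "i \<in> I \<Longrightarrow> x \<in> U \<Longrightarrow> T i (- x) = - T i x"
  using T_diff[of i 0 x] T_0[of i] U_0 by simp

lemma U_subspace: "subspace U"
  by (simp add: subspace_def U_0 U_add U_sc)

lemma U_span: "A \<subseteq> U \<Longrightarrow> span A \<subseteq> U"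
  using span_minimal[OF _ U_subspace] .

lemma U_words: "set w \<subseteq> I \<Longrightarrow> prod_list (map E w) \<in> U"
  by (induction w) (auto simp: U_one U_mult U_E)

lemma Upd_U: "J \<subseteq> I \<Longrightarrow> x \<in> Upd J \<beta> \<Longrightarrow> x \<in> U"
  unfolding Upd_def using U_span[of "{prod_list (map E w) | w. set w \<subseteq> J \<and> word_wt w = \<beta>}"] U_words by blast

lemma Upd_add: "x \<in> Upd J \<beta> \<Longrightarrow> y \<in> Upd J \<beta> \<Longrightarrow> x + y \<in> Upd J \<beta>"
  by (simp add: Upd_def span_add)

lemma Upd_diff: "x \<in> Upd J \<beta> \<Longrightarrow> y \<in> Upd J \<beta> \<Longrightarrow> x - y \<in> Upd J \<beta>"
  by (simp add: Upd_def span_diff)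

lemma Upd_sc: "x \<in> Upd J \<beta> \<Longrightarrow> c *s x \<in> Upd J \<beta>"
  by (simp add: Upd_def span_scale)

lemma Upd_uminus: "x \<in> Upd J \<beta> \<Longrightarrow> - x \<in> Upd J \<beta>"
  by (simp add: Upd_def span_neg)

lemma Upd_word: "set w \<subseteq> J \<Longrightarrow> word_wt w = \<beta> \<Longrightarrow> prod_list (map E w) \<in> Upd J \<beta>"
  unfolding Upd_def by (rule span_base) blast

lemma Upd_one: "1 \<in> Upd J (\<lambda>k. 0)"
  using Upd_word[of "[]"] by simp

lemma Upd_E: "i \<in> J \<Longrightarrow> E i \<in> Upd J (simple_root i)"
  using Upd_word[of "[i]" J "simple_root i"] by simp

lemma Upd_mult: "x \<in> Upd J \<beta> \<Longrightarrow> y \<in> Upd J \<gamma> \<Longrightarrow> x * y \<in> Upd J (\<lambda>k. \<beta> k + \<gamma> k)"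
  unfolding Upd_def
proof (rule span_mult; (assumption)?)
  fix a b assume "a \<in> {prod_list (map E w) |w. set w \<subseteq> J \<and> word_wt w = \<beta>}" "b \<in> {prod_list (map E w) |w. set w \<subseteq> J \<and> word_wt w = \<gamma>}"
  then obtain v w where "a = prod_list (map E v)" "b = prod_list (map E w)"
    "set v \<subseteq> J" "word_wt v = \<beta>" "set w \<subseteq> J" "word_wt w = \<gamma>" by auto
  then show "a * b \<in> span {prod_list (map E w) |w. set w \<subseteq> J \<and> word_wt w = (\<lambda>k. \<beta> k + \<gamma> k)}"
    by (intro span_base CollectI exI[of _ "v @ w"]) auto
qed

lemma Upd_mult': "x \<in> Upd J \<beta> \<Longrightarrow> y \<in> Upd J \<gamma> \<Longrightarrow> (\<lambda>k. \<beta> k + \<gamma> k) = \<delta> \<Longrightarrow> x * y \<in> Upd J \<delta>"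
  using Upd_mult by blast

lemma Upd_E1: "E i \<in> Upd {i, j} (comb i j 1 0)"
  using Upd_E[of i "{i, j}"] by (simp add: comb_def)

lemma Upd_E2: "E j \<in> Upd {i, j} (comb i j 0 1)"
  using Upd_E[of j "{i, j}"] by (simp add: comb_def)

lemma frr_Upd: "frr i j m \<in> Upd {i, j} (comb i j (int m) 1)"
proof (induction m)
  case 0 show ?case using Upd_E2 by simp
next
  case (Suc m)
  show ?case unfolding fr.simps
    by (intro Upd_sc Upd_diff Upd_mult'[OF Suc Upd_E1] Upd_mult'[OF Upd_E1 Suc]) (auto simp: comb_def algebra_simps)
qed

lemma fll_Upd: "fll i j m \<in> Upd {i, j} (comb i j (int m) 1)"
proof (induction m)
  case 0 show ?case using Upd_E2 by simp
next
  case (Suc m)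
  show ?case unfolding fl.simps
    by (intro Upd_sc Upd_diff Upd_mult'[OF Suc Upd_E1] Upd_mult'[OF Upd_E1 Suc]) (auto simp: comb_def algebra_simps)
qed

lemma frr_U: "i \<in> I \<Longrightarrow> j \<in> I \<Longrightarrow> frr i j m \<in> U"
  by (rule Upd_U[OF _ frr_Upd]) auto

lemma fll_U: "i \<in> I \<Longrightarrow> j \<in> I \<Longrightarrow> fll i j m \<in> U"
  by (rule Upd_U[OF _ fll_Upd]) auto

declare fr.simps(2) [simp del] fl.simps(2) [simp del]

text \<open>T_i reverses the chain of q-commutators. The start is Lusztig's formula for E_j; since
  T_i E_i is a multiple of K_i^-1 F_i, each further q-commutator with E_i on the left becomes a
  commutator with F_i, which lowers the index by \<open>fr_comm_f\<close>.\<close>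

lemma T_fll:
  assumes ij: "i \<in> I" "j \<in> I" "i \<noteq> j" and n: "cm G i j = - int n"
  shows "m \<le> n \<Longrightarrow> T i (fll i j m) = (t i j * (- s i) ^ m) *s frr i j (n - m)"
proof (induction m)
  case 0
  then show ?case using T_E[OF ij] n by simp
next
  case (Suc m)
  let ?v = "q_at G i" and ?a = "cm G i j"
  let ?g = "frr i j (n - m)"
  have v: "generic ?v" "?v \<noteq> 0" using q_generic q_nz ij by auto
  define d where "d = n - Suc m"
  have d: "n - m = Suc d" "n = m + Suc d" using Suc.prems unfolding d_def by auto
  note U = U_E[OF ij(1)] fll_U[OF ij(1,2)] U_mult U_sc U_diff
  \<comment> \<open>The weight of \<open>?g\<close> matches the power of v in the recursion of
    \<open>fl\<close>, so that the q-commutator with K_i^-1 F_i turns into K_i^-1 times an ordinary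
    commutator with F_i.\<close>
  have "Ki i * ?g = (?v powi (- 2 * int (n - m)) * ?v powi (- ?a)) *s (?g * Ki i)"
    by (rule fr_weight) (use KiE[of i i] KiE[of i j] ij cm_refl in auto)
  then have kg: "?v powi (?a + 2 * int m) *s (?g * Ki i) = Ki i * ?g"
  proof -
    have "- 2 * int (n - m) + - ?a = ?a + 2 * int m" using Suc.prems n by (simp add: of_nat_diff)
    then have "?v powi (- 2 * int (n - m)) * ?v powi (- ?a) = ?v powi (?a + 2 * int m)"
      unfolding powi_merge[OF v(2)] by simp
    then show ?thesis using \<open>Ki i * ?g = _\<close> by simp
  qed
  have "T i (fll i j (Suc m)) = inverse (qi ?v (int m + 1)) *s (T i (E i) * T i (fll i j m) - ?v powi (?a + 2 * int m) *s (T i (fll i j m) * T i (E i)))"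
    by (simp add: fl.simps(2) T_sc T_diff T_mult U ij)
  also have "\<dots> = (inverse (qi ?v (int m + 1)) * s i * (t i j * (- s i) ^ m)) *s (Ki i * F i * ?g - (?v powi (?a + 2 * int m) *s (?g * Ki i)) * F i)"
    using Suc T_Eii[OF ij(1)] by (simp add: scale_right_diff_distrib mult_ac mult.assoc)
  also have "\<dots> = (inverse (qi ?v (int m + 1)) * s i * (t i j * (- s i) ^ m)) *s (- (Ki i * (?g * F i - F i * ?g)))"
    unfolding kg by (simp add: right_diff_distrib mult.assoc)
  also have "?g * F i - F i * ?g = qi ?v (- ?a - int d) *s (K i * frr i j d)"
    unfolding d(1) using ij KE[of i i] KE[of i j] EF[of i i] EF[of j i] cm_diag[of i]
    by (intro fr_comm_f[OF v(1) KKi KiK]) auto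
  also have "- ?a - int d = int m + 1" using n d by simp
  also have "Ki i * (qi ?v (int m + 1) *s (K i * frr i j d)) = qi ?v (int m + 1) *s frr i j d"
    using KiK[OF ij(1)] by (simp add: mult.assoc[symmetric])
  finally show ?case using qi_nz[OF v(1), of "int m + 1"] unfolding d_def by (simp add: mult_ac)
qed

section \<open>Chains of root vectors in rank two\<close>

lemma fll_1: "i \<in> I \<Longrightarrow> fll i j 1 = E i * E j - (q_at G i powi cm G i j) *s (E j * E i)"
  using qi_1[OF q_generic] by (simp add: fl.simps(2) fr.simps(2))

lemma frr_1: "i \<in> I \<Longrightarrow> frr i j 1 = E j * E i - (q_at G i powi cm G i j) *s (E i * E j)"
  using qi_1[OF q_generic] by (simp add: fl.simps(2) fr.simps(2))

lemma frr_fll: "i \<in> I \<Longrightarrow> j \<in> I \<Longrightarrow> frr j i 1 = fll i j 1"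
  using fll_1[of i j] frr_1[of j i] q_sym[of i j] by (simp del: One_nat_def)

text \<open>In finite type one of two nonzero off-diagonal Cartan integers is -1, so this setting
  covers all connected rank two types up to exchanging i and j.\<close>

context
  fixes i j n
  assumes ij: "i \<in> I" "j \<in> I" "i \<noteq> j" and cij: "cm G i j = - int n" and cji: "cm G j i = -1"
begin

lemma rank2_Tj_Ei: "T j (E i) = t j i *s fll i j 1"
  using T_E[of j i] ij cji frr_fll[OF ij(1,2)] by simp

lemma rank2_Tj_fr1: "T j (frr i j 1) = (t j i * (- s j)) *s E i"
  using T_fll[of j i 1 1] ij cji frr_fll[of j i] by simp

lemma rank2_Tj_fr2: "T j (frr i j 2) = (t j i * (- s j) * t j i) *s fll i j 2"
proof -
  note U = U_E[OF ij(1)] frr_U[OF ij(1,2)] U_mult U_sc U_diff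
  have "T j (frr i j (Suc 1)) = inverse (qi (q_at G i) (int 1 + 1)) *s (T j (frr i j 1) * T j (E i) -
      q_at G i powi (cm G i j + 2 * int 1) *s (T j (E i) * T j (frr i j 1)))"
    unfolding fr.simps(2)[of _ _ _ _ 1] by (simp only: T_sc T_diff T_mult U ij)
  then show ?thesis unfolding rank2_Tj_fr1 rank2_Tj_Ei numeral_2_eq_2 fl.simps(2)[of _ _ _ _ 1] One_nat_def[symmetric]
    by (simp only: sc_left sc_right scale_right_diff_distrib scale_scale mult_ac)
qed

text \<open>The two root vectors of type \<open>G\<^sub>2\<close> which are not of the form \<open>fr\<close> or \<open>fl\<close>.\<close>

definition quintic where "quintic = fll i j 2 * fll i j 1 - q_at G i powi (cm G i j + 4) *s (fll i j 1 * fll i j 2)"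
definition quintic' where "quintic' = frr i j 1 * frr i j 2 - q_at G i powi (cm G i j + 4) *s (frr i j 2 * frr i j 1)"

lemma rank2_Tj_fr3: "\<exists>c. T j (frr i j 3) = c *s quintic"
proof -
  note U = U_E[OF ij(1)] frr_U[OF ij(1,2)] U_mult U_sc U_diff
  have "T j (frr i j (Suc 2)) = inverse (qi (q_at G i) (int 2 + 1)) *s (T j (frr i j 2) * T j (E i) -
      q_at G i powi (cm G i j + 2 * int 2) *s (T j (E i) * T j (frr i j 2)))"
    unfolding fr.simps(2)[of _ _ _ _ 2] by (simp only: T_sc T_diff T_mult U ij)
  also have "\<dots> = (inverse (qi (q_at G i) (int 2 + 1)) * (t j i * (- s j) * t j i) * t j i) *s quintic"
    unfolding rank2_Tj_fr2 rank2_Tj_Ei quintic_def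
    by (simp only: sc_left sc_right scale_right_diff_distrib scale_scale mult_ac) simp
  finally have "T j (frr i j 3) = \<dots>" by (simp only: eval_nat_numeral)
  then show ?thesis by blast
qed

lemma rank2_Ti_quintic: "n = 3 \<Longrightarrow> \<exists>c. T i quintic = c *s quintic'"
proof -
  assume n: "n = 3"
  note U = U_E[OF ij(1)] fll_U[OF ij(1,2)] U_mult U_sc U_diff
  have "T i (fll i j 1) = (t i j * (- s i)) *s frr i j 2" "T i (fll i j 2) = (t i j * (- s i) ^ 2) *s frr i j 1"
    using T_fll[OF ij cij, of 1] T_fll[OF ij cij, of 2] n by simp_all
  moreover have "T i quintic = T i (fll i j 2) * T i (fll i j 1) - q_at G i powi (cm G i j + 4) *s (T i (fll i j 1) * T i (fll i j 2))"
    unfolding quintic_def by (simp only: T_sc T_diff T_mult U ij)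
  ultimately have "T i quintic = (t i j * (- s i) * (t i j * (- s i) ^ 2)) *s quintic'"
    unfolding quintic'_def by (simp only: sc_left sc_right scale_right_diff_distrib scale_scale mult_ac)
  then show ?thesis by blast
qed

lemma rank2_Tj_quintic': "n = 3 \<Longrightarrow> \<exists>c. T j quintic' = c *s fll i j 3"
proof -
  assume n: "n = 3"
  note U = U_E[OF ij(1)] frr_U[OF ij(1,2)] U_mult U_sc U_diff
  have "T j quintic' = T j (frr i j 1) * T j (frr i j 2) - q_at G i powi (cm G i j + 4) *s (T j (frr i j 2) * T j (frr i j 1))"
    unfolding quintic'_def by (simp only: T_sc T_diff T_mult U ij)
  also have "\<dots> = (t j i * (- s j) * (t j i * (- s j) * t j i)) *s (E i * fll i j 2 - q_at G i powi (cm G i j + 4) *s (fll i j 2 * E i))"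
    unfolding rank2_Tj_fr1 rank2_Tj_fr2 by (simp only: sc_left sc_right scale_right_diff_distrib scale_scale mult_ac)
  also have "E i * fll i j 2 - q_at G i powi (cm G i j + 4) *s (fll i j 2 * E i) = qi (q_at G i) (int 2 + 1) *s fll i j (Suc 2)"
    unfolding fl_Suc[OF q_generic[OF ij(1)]] by simp
  finally show ?thesis by (intro exI[of _ "t j i * (- s j) * (t j i * (- s j) * t j i) * qi (q_at G i) (int 2 + 1)"]) (simp add: eval_nat_numeral)
qed

lemma hh_Upd: "quintic \<in> Upd {i, j} (comb i j 3 2)" "quintic' \<in> Upd {i, j} (comb i j 3 2)"
  unfolding quintic_def quintic'_def
  by (intro Upd_sc Upd_diff Upd_mult'[OF frr_Upd frr_Upd] Upd_mult'[OF fll_Upd fll_Upd]; simp add: comb_def algebra_simps)+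

text \<open>Up to scalars and with \<open>fr\<close>, \<open>fl\<close> taken over (i, j), the
  chains are as follows. For n = 1: E_i, \<open>fl 1\<close>, E_j and E_j, \<open>fr 1\<close>, E_i.
  For n = 2: E_i, \<open>fl 1\<close>, \<open>fr 1\<close>, E_i and E_j, \<open>fr 2\<close>,
  \<open>fl 2\<close>, E_j. For n = 3: E_i, \<open>fl 1\<close>, \<open>fr 2\<close>,
  \<open>fl 2\<close>, \<open>fr 1\<close>, E_i and E_j, \<open>fr 3\<close>,
  \<open>quintic\<close>, \<open>quintic'\<close>, \<open>fl 3\<close>, E_j.\<close>

lemma rank2_chain:
  assumes n: "n \<in> {1, 2, 3}" and p: "p < coxeter_number G i j"
  shows "fold T (alternating j i p) (E i) \<in> Upd {i, j} (fold (reflection G) (alternating j i p) (simple_root i))"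
    and "fold T (alternating i j p) (E j) \<in> Upd {i, j} (fold (reflection G) (alternating i j p) (simple_root j))"
proof -
  have si: "simple_root i = comb i j 1 0" and sj: "simple_root j = comb i j 0 1" by (auto simp: comb_def)
  define f where "f = frr i j"
  define g where "g = fll i j"
  note fg = f_def[symmetric] g_def[symmetric]
  note U = U_E[OF ij(1)] U_E[OF ij(2)] frr_U[OF ij(1,2), unfolded fg] fll_U[OF ij(1,2), unfolded fg]
    Upd_U[OF _ hh_Upd(1)] Upd_U[OF _ hh_Upd(2)]
  have nx: "n = 1 \<or> n = 2 \<or> n = 3" using n by auto
  obtain c3 where c3: "T j (frr i j 3) = c3 *s quintic" using rank2_Tj_fr3 by blast
  note c3 = c3[unfolded fg]
  obtain d3 e3 where d3: "n = 3 \<Longrightarrow> T i quintic = d3 *s quintic'" "n = 3 \<Longrightarrow> T j quintic' = e3 *s g 3"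
    unfolding fg[symmetric] using rank2_Ti_quintic rank2_Tj_quintic' by meson
  have f0: "T i (E j) = t i j *s f n" unfolding f_def using T_fll[OF ij cij, of 0] by simp
  have fm: "m \<le> n \<Longrightarrow> T i (g m) = (t i j * (- s i) ^ m) *s f (n - m)" for m
    unfolding f_def g_def using T_fll[OF ij cij, of m] by simp
  have fr0: "f 0 = E j" by (simp add: f_def)
  note up = frr_Upd[of i j 1, unfolded fg] frr_Upd[of i j 2, unfolded fg] frr_Upd[of i j 3, unfolded fg]
     fll_Upd[of i j 1, unfolded fg] fll_Upd[of i j 2, unfolded fg] fll_Upd[of i j 3, unfolded fg] hh_Upd Upd_E1[of i j] Upd_E2[of j i]
  note [simp] = ij cij cji refl_comb1'[OF ij(1,2)] refl_comb2'[OF ij(1,2)] alternating_numeral T_sc T_uminus U U_sc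
     rank2_Tj_Ei[unfolded One_nat_def, unfolded fg] rank2_Tj_fr1[unfolded One_nat_def, unfolded fg] rank2_Tj_fr2[unfolded fg] c3 f0 fr0
  have fi: "fold T (alternating j i p) (E i) \<in> Upd {i, j} (fold (reflection G) (alternating j i p) (comb i j 1 0)) \<and>
    fold T (alternating i j p) (E j) \<in> Upd {i, j} (fold (reflection G) (alternating i j p) (comb i j 0 1))"
    using nx
  proof (elim disjE)
    assume n1: "n = 1"
    then have "coxeter_number G i j = 3" by (simp add: coxeter_number_def)
    then have p3: "p = 0 \<or> p = 1 \<or> p = 2" using p by auto
    note [simp] = n1 fm[of 1, simplified]
    show ?thesis using p3 up by (elim disjE) (simp_all add: Upd_sc Upd_uminus)
  next
    assume n1: "n = 2"
    then have "coxeter_number G i j = 4" by (simp add: coxeter_number_def)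
    then have p3: "p = 0 \<or> p = 1 \<or> p = 2 \<or> p = 3" using p by auto
    note [simp] = n1 fm[of 1, simplified] fm[of 2, simplified]
    show ?thesis using p3 up by (elim disjE) (simp_all add: Upd_sc Upd_uminus)
  next
    assume n1: "n = 3"
    then have "coxeter_number G i j = 6" by (simp add: coxeter_number_def)
    then have p3: "p = 0 \<or> p = 1 \<or> p = 2 \<or> p = 3 \<or> p = 4 \<or> p = 5" using p by auto
    note [simp] = n1 fm[of 1, simplified] fm[of 2, simplified] fm[of 3, simplified] d3
    show ?thesis using p3 up by (elim disjE) (simp_all add: Upd_sc Upd_uminus)
  qed
  then show "fold T (alternating j i p) (E i) \<in> Upd {i, j} (fold (reflection G) (alternating j i p) (simple_root i))"
    "fold T (alternating i j p) (E j) \<in> Upd {i, j} (fold (reflection G) (alternating i j p) (simple_root j))"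
    unfolding si sj by auto
qed

end

text \<open>\<open>rank2_chain\<close> wants a_ji = -1. If instead a_ij = -1 and a_ji is -2 or -3,
  the letters are exchanged and the second of its chains is the relevant one.\<close>

lemma rank2:
  assumes ij: "i \<in> I" "j \<in> I" "i \<noteq> j" and p: "p < coxeter_number G i j"
  shows "foldr T (rev (alternating j i p)) (E i) \<in> Upd {i, j} (W (rev (alternating j i p)) (simple_root i))"
proof -
  have "fold T (alternating j i p) (E i) \<in> Upd {i, j} (fold (reflection G) (alternating j i p) (simple_root i))"
  proof (cases rule: cox_cases[OF ij])
    case 1
    have "p = 0 \<or> p = 1" using p 1 by auto
    moreover have "simple_root i = comb i j 1 0" by (simp add: comb_def)
    ultimately show ?thesis using 1 T_E[of j i] ij Upd_E1[of i j]
      by (elim disjE) (simp_all add: Upd_sc refl_comb2'[OF ij(1,2)])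
  next
    case 2
    show ?thesis by (rule rank2_chain(1)[where n = 1]) (use ij 2 p in auto)
  next
    case 3
    have "fold T (alternating j i p) (E i) \<in> Upd {j, i} (fold (reflection G) (alternating j i p) (simple_root i))"
      by (rule rank2_chain(2)[where n = 2]) (use ij 3 p cox_sym[of i j] in auto)
    then show ?thesis by (simp add: insert_commute)
  next
    case 4
    show ?thesis by (rule rank2_chain(1)[where n = 2]) (use ij 4 p in auto)
  next
    case 5
    have "fold T (alternating j i p) (E i) \<in> Upd {j, i} (fold (reflection G) (alternating j i p) (simple_root i))"
      by (rule rank2_chain(2)[where n = 3]) (use ij 5 p cox_sym[of i j] in auto)
    then show ?thesis by (simp add: insert_commute)
  next
    case 6
    show ?thesis by (rule rank2_chain(1)[where n = 3]) (use ij 6 p in auto)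
  qed
  then show ?thesis by (simp add: W_rev_fold foldr_conv_fold)
qed

lemma Tw_mem: "ws \<in> lists I \<Longrightarrow> x \<in> U \<Longrightarrow> foldr T ws x \<in> U"
  using foldr_mem[of U T] T_mem by blast

lemma Tw_add: "ws \<in> lists I \<Longrightarrow> x \<in> U \<Longrightarrow> y \<in> U \<Longrightarrow> foldr T ws (x + y) = foldr T ws x + foldr T ws y"
  by (induction ws) (auto simp: T_add Tw_mem)

lemma Tw_mult: "ws \<in> lists I \<Longrightarrow> x \<in> U \<Longrightarrow> y \<in> U \<Longrightarrow> foldr T ws (x * y) = foldr T ws x * foldr T ws y"
  by (induction ws) (auto simp: T_mult Tw_mem)

lemma Tw_sc: "ws \<in> lists I \<Longrightarrow> x \<in> U \<Longrightarrow> foldr T ws (c *s x) = c *s foldr T ws x"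
  by (induction ws) (auto simp: T_sc Tw_mem)

lemma Tw_one: "ws \<in> lists I \<Longrightarrow> foldr T ws 1 = 1"
  by (induction ws) (auto simp: T_one)

lemma Tw_0: "ws \<in> lists I \<Longrightarrow> foldr T ws 0 = 0"
  by (induction ws) (auto simp: T_0)

lemma Tw_Upd:
  assumes v: "vs \<in> lists I" and J: "J \<subseteq> I" and p: "\<And>k. k \<in> J \<Longrightarrow> foldr T vs (E k) \<in> Upd I (W vs (simple_root k))"
    and x: "x \<in> Upd J \<beta>"
  shows "foldr T vs x \<in> Upd I (W vs \<beta>)"
proof -
  have w: "foldr T vs (prod_list (map E w)) \<in> Upd I (W vs (word_wt w))" if "set w \<subseteq> J" for w
    using that
  proof (induction w)
    case Nil
    have "W vs (\<lambda>k. 0) = (\<lambda>k. 0)" using W_lin[of vs 0 "\<lambda>k. 0" 0 "\<lambda>k. 0"] by simp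
    then show ?case using Upd_one by (simp add: Tw_one[OF v])
  next
    case (Cons k w)
    have U: "E k \<in> U" "prod_list (map E w) \<in> U" using Cons.prems J U_E U_words by auto
    have "W vs (\<lambda>l. simple_root k l + word_wt w l) = (\<lambda>l. W vs (simple_root k) l + W vs (word_wt w) l)"
      using W_lin[of vs 1 "simple_root k" 1 "word_wt w"] by simp
    then show ?case using Cons p by (simp add: Tw_mult[OF v U] Upd_mult)
  qed
  have "foldr T vs x \<in> Upd I (W vs \<beta>) \<and> x \<in> U" using x unfolding Upd_def[of J]
  proof (induction rule: span_induct_alt)
    case base
    then show ?case by (simp add: Tw_0[OF v] Upd_def span_zero U_0)
  next
    case (step c b y)
    then obtain w' where w': "b = prod_list (map E w')" "set w' \<subseteq> J" "word_wt w' = \<beta>" by auto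
    then have "b \<in> U" using U_words J by auto
    then show ?case using step w[of w'] w' by (simp add: Tw_add[OF v] Tw_sc[OF v] U_sc U_add Upd_add Upd_sc)
  qed
  then show ?thesis by simp
qed

lemma Tw_cong: "red ws \<Longrightarrow> red ws' \<Longrightarrow> W ws = W ws' \<Longrightarrow> x \<in> U \<Longrightarrow> foldr T ws x = foldr T ws' x"
  by (rule matsumoto[of U T, OF T_mem T_braid])

text \<open>The induction is that of \<open>root_pos\<close>: braid invariance allows the word to be
  replaced by v u, rank two puts T_u E_i into the algebra generated by E_i and E_j, and T_v maps
  both of these to positive elements by induction.\<close>

theorem positivity:
  "red ws \<Longrightarrow> asc ws i \<Longrightarrow> i \<in> I \<Longrightarrow> foldr T ws (E i) \<in> Upd I (W ws (simple_root i))"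
proof (induction "length ws" arbitrary: ws i rule: less_induct)
  case less
  show ?case
  proof (cases ws rule: rev_cases)
    case Nil
    then show ?thesis using Upd_E less.prems by simp
  next
    case (snoc ws' j)
    obtain vs p where vp: "red (vs @ rev (alternating j i p))" "red vs" "asc vs i" "asc vs j" "length vs \<le> length ws'"
      "W (vs @ rev (alternating j i p)) = W (ws' @ [j])" "p < coxeter_number G i j" "i \<noteq> j" "j \<in> I"
      using dihedral_split[of ws' j i] less.prems snoc by metis
    have "foldr T ws (E i) = foldr T vs (foldr T (rev (alternating j i p)) (E i))"
      using Tw_cong[OF less.prems(1) vp(1), of "E i"] vp(6) snoc U_E less.prems by simp
    also have "\<dots> \<in> Upd I (W vs (W (rev (alternating j i p)) (simple_root i)))"
    proof (rule Tw_Upd[of vs "{i, j}"])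
      show "vs \<in> lists I" using vp by (simp add: red_def)
      show "foldr T vs (E k) \<in> Upd I (W vs (simple_root k))" if "k \<in> {i, j}" for k
        using that less.hyps[of vs] less.prems vp snoc by auto
      show "foldr T (rev (alternating j i p)) (E i) \<in> Upd {i, j} (W (rev (alternating j i p)) (simple_root i))"
        by (rule rank2) (use vp less.prems in auto)
    qed (use vp less.prems in auto)
    also have "W vs (W (rev (alternating j i p)) (simple_root i)) = W ws (simple_root i)"
      using vp(6) snoc by (metis W_app comp_apply)
    finally show ?thesis .
  qed
qed

lemma word_wt_simple: "word_wt w = simple_root k \<Longrightarrow> w = [k]"
proof -
  assume a: "word_wt w = simple_root k"
  have c: "count_list w l = (if l = k then 1 else 0)" for l
    using fun_cong[OF a, of l] by (auto simp: word_wt_def simple_root_def split: if_splits)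
  obtain l w' where w: "w = l # w'" using c[of k] by (cases w) auto
  have lk: "l = k" using c[of l] w by (auto split: if_splits)
  have "count_list w' m = 0" for m using c[of m] w lk by (auto split: if_splits)
  then have "w' = []" by (cases w') (metis count_list.simps(2) add_is_0 one_neq_zero, metis count_list.simps(2) add_is_0 one_neq_zero)
  then show ?thesis using w lk by simp
qed

text \<open>The one-letter word is the only word whose weight is a simple root.\<close>

lemma Upd_simple: "x \<in> Upd J (simple_root k) \<Longrightarrow> \<exists>c. x = c *s E k"
proof -
  assume "x \<in> Upd J (simple_root k)"
  moreover have "{prod_list (map E w) | w. set w \<subseteq> J \<and> word_wt w = simple_root k} \<subseteq> {E k}"
    by (auto dest!: word_wt_simple)
  ultimately have "x \<in> span {E k}" unfolding Upd_def using span_mono by blast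
  then show ?thesis unfolding span_singleton by auto
qed

end

section \<open>The PBW theorem for an abstract braid group action\<close>

context lusz
begin

definition Up :: "'a set" where
  "Up = span {prod_list (map E w) | w. set w \<subseteq> I}"

text \<open>A filtration by word length, used in place of a grading. The bound is strict so that
  \<open>Uf 0\<close> is zero and can start an induction.\<close>

definition Uf :: "nat \<Rightarrow> 'a set" where
  "Uf h = span {prod_list (map E w) | w. set w \<subseteq> I \<and> length w < h}"

lemma Up_U: "x \<in> Up \<Longrightarrow> x \<in> U"
  unfolding Up_def using U_span[of "{prod_list (map E w) | w. set w \<subseteq> I}"] U_words by blast

lemma Up_add: "x \<in> Up \<Longrightarrow> y \<in> Up \<Longrightarrow> x + y \<in> Up"
  and Up_diff: "x \<in> Up \<Longrightarrow> y \<in> Up \<Longrightarrow> x - y \<in> Up"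
  and Up_sc: "x \<in> Up \<Longrightarrow> c *s x \<in> Up"
  and Up_0: "0 \<in> Up"
  by (simp_all add: Up_def span_add span_diff span_scale span_zero)

lemma Up_word: "set w \<subseteq> I \<Longrightarrow> prod_list (map E w) \<in> Up"
  unfolding Up_def by (rule span_base) blast

lemma Up_one: "1 \<in> Up"
  using Up_word[of "[]"] by simp

lemma Up_E: "i \<in> I \<Longrightarrow> E i \<in> Up"
  using Up_word[of "[i]"] by simp

lemma Up_mult: "x \<in> Up \<Longrightarrow> y \<in> Up \<Longrightarrow> x * y \<in> Up"
  unfolding Up_def
proof (rule span_mult; (assumption)?)
  fix a b assume "a \<in> {prod_list (map E w) |w. set w \<subseteq> I}" "b \<in> {prod_list (map E w) |w. set w \<subseteq> I}"
  then obtain v w where "a = prod_list (map E v)" "b = prod_list (map E w)"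
    "set v \<subseteq> I" "set w \<subseteq> I" by auto
  then show "a * b \<in> span {prod_list (map E w) |w. set w \<subseteq> I}"
    by (intro span_base CollectI exI[of _ "v @ w"]) auto
qed

lemma Up_power: "x \<in> Up \<Longrightarrow> x ^ n \<in> Up"
  by (induction n) (auto simp: Up_one Up_mult)

lemma U_power: "x \<in> U \<Longrightarrow> x ^ n \<in> U"
  by (induction n) (auto simp: U_one U_mult)

lemma Upd_Up: "J \<subseteq> I \<Longrightarrow> x \<in> Upd J \<beta> \<Longrightarrow> x \<in> Up"
  unfolding Upd_def Up_def by (erule rev_subsetD, rule span_mono) blast

lemma Tw_uminus: "ws \<in> lists I \<Longrightarrow> x \<in> U \<Longrightarrow> foldr T ws (- x) = - foldr T ws x"
  using Tw_sc[of ws x "-1"] by simp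

lemma Uf_mono: "h \<le> h' \<Longrightarrow> x \<in> Uf h \<Longrightarrow> x \<in> Uf h'"
  unfolding Uf_def by (erule rev_subsetD, rule span_mono) auto

lemma Uf_Up: "x \<in> Uf h \<Longrightarrow> x \<in> Up"
  unfolding Uf_def Up_def by (erule rev_subsetD, rule span_mono) auto

lemma Uf_word: "set w \<subseteq> I \<Longrightarrow> length w < h \<Longrightarrow> prod_list (map E w) \<in> Uf h"
  unfolding Uf_def by (rule span_base) blast

lemma Uf_add: "x \<in> Uf h \<Longrightarrow> y \<in> Uf h \<Longrightarrow> x + y \<in> Uf h"
  and Uf_sc: "x \<in> Uf h \<Longrightarrow> c *s x \<in> Uf h"
  and Uf_zero: "0 \<in> Uf h"
  by (simp_all add: Uf_def span_add span_scale span_zero)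

lemma Uf_0: "x \<in> Uf 0 \<Longrightarrow> x = 0"
  by (simp add: Uf_def)

lemma Uf_E: "k \<in> I \<Longrightarrow> x \<in> Uf h \<Longrightarrow> E k * x \<in> Uf (Suc h)"
proof -
  assume k: "k \<in> I" and x: "x \<in> Uf h"
  show ?thesis using x unfolding Uf_def[of h]
  proof (induction rule: span_induct_alt)
    case (step c b y)
    then obtain w where "b = prod_list (map E w)" "set w \<subseteq> I" "length w < h" by auto
    then have "E k * b \<in> Uf (Suc h)" using Uf_word[of "k # w" "Suc h"] k by simp
    then show ?case using step by (simp add: distrib_left Uf_add Uf_sc)
  qed (simp add: Uf_zero)
qed

lemma Up_Uf: assumes "x \<in> Up" shows "\<exists>h. x \<in> Uf h"
  using assms unfolding Up_def
proof (induction rule: span_induct_alt)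
  case base
  then show ?case using Uf_zero by blast
next
  case (step c b y)
  then obtain h w where h: "y \<in> Uf h" and w: "b = prod_list (map E w)" "set w \<subseteq> I" by auto
  have "b \<in> Uf (Suc (length w + h))" using w by (auto intro: Uf_word)
  moreover have "y \<in> Uf (Suc (length w + h))" using h by (rule Uf_mono[rotated]) simp
  ultimately show ?case using Uf_add Uf_sc by blast
qed

section \<open>Commutation of positive elements with F and K\<close>

lemma EK: "i \<in> I \<Longrightarrow> k \<in> I \<Longrightarrow> E k * K i = (q_at G i powi - cm G i k) *s (K i * E k)"
  using KE[of i k] q_nz[of i] by (simp add: powi_merge)

lemma EKi: "i \<in> I \<Longrightarrow> k \<in> I \<Longrightarrow> E k * Ki i = (q_at G i powi cm G i k) *s (Ki i * E k)"
  using KiE[of i k] q_nz[of i] by (simp add: powi_merge)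

text \<open>Up to normalisation r and r' are values of the two skew derivations of Lusztig and
  Kashiwara; their existence and the drop in word length are all that is recorded.\<close>

lemma comm_F_word:
  assumes i: "i \<in> I"
  shows "set w \<subseteq> I \<Longrightarrow> \<exists>r r'. r \<in> Uf (length w) \<and> r' \<in> Uf (length w) \<and>
     prod_list (map E w) * F i - F i * prod_list (map E w) = K i * r - Ki i * r'"
proof (induction w)
  case Nil
  then show ?case using Uf_zero by force
next
  case (Cons k w)
  let ?p = "prod_list (map E w)"
  define d where "d = (if k = i then inverse (q_at G k - inverse (q_at G k)) else 0)"
  have k: "k \<in> I" using Cons by simp
  obtain r r' where r: "r \<in> Uf (length w)" "r' \<in> Uf (length w)" and eq: "?p * F i - F i * ?p = K i * r - Ki i * r'"
    using Cons by auto
  have ef: "E k * F i - F i * E k = d *s (K i - Ki i)" using EF[OF k i] by (auto simp: d_def)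
  have "E k * ?p * F i - F i * (E k * ?p) = E k * (?p * F i - F i * ?p) + (E k * F i - F i * E k) * ?p"
    by (simp add: algebra_simps)
  also have "\<dots> = E k * K i * r - E k * Ki i * r' + d *s (K i * ?p - Ki i * ?p)"
    unfolding eq ef by (simp add: right_diff_distrib left_diff_distrib mult.assoc)
  also have "\<dots> = K i * ((q_at G i powi - cm G i k) *s (E k * r) + d *s ?p) - Ki i * ((q_at G i powi cm G i k) *s (E k * r') + d *s ?p)"
    unfolding EK[OF i k] EKi[OF i k] by (simp add: distrib_left scale_right_diff_distrib mult.assoc)
  finally have "prod_list (map E (k # w)) * F i - F i * prod_list (map E (k # w)) = \<dots>" by simp
  moreover have "?p \<in> Uf (length (k # w))" using Cons by (intro Uf_word) auto
  ultimately show ?case using Uf_E[OF k r(1)] Uf_E[OF k r(2)]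
    by (intro exI conjI) (auto intro!: Uf_add Uf_sc)
qed

lemma comm_F:
  assumes i: "i \<in> I" and x: "x \<in> Uf (Suc h)"
  shows "\<exists>r r'. r \<in> Uf h \<and> r' \<in> Uf h \<and> x * F i - F i * x = K i * r - Ki i * r'"
  using x unfolding Uf_def[of "Suc h"]
proof (induction rule: span_induct_alt)
  case base
  then show ?case using Uf_zero by force
next
  case (step c b y)
  then obtain w where w: "b = prod_list (map E w)" "set w \<subseteq> I" "length w < Suc h" by auto
  obtain r r' where r: "r \<in> Uf h" "r' \<in> Uf h" "b * F i - F i * b = K i * r - Ki i * r'"
    using comm_F_word[OF i w(2)] w Uf_mono[of "length w" h] by auto
  obtain z z' where z: "z \<in> Uf h" "z' \<in> Uf h" "y * F i - F i * y = K i * z - Ki i * z'" using step by auto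
  have "(c *s b + y) * F i - F i * (c *s b + y) = c *s (b * F i - F i * b) + (y * F i - F i * y)"
    by (simp add: algebra_simps scale_right_diff_distrib)
  also have "\<dots> = K i * (c *s r + z) - Ki i * (c *s r' + z')"
    unfolding r z by (simp add: algebra_simps scale_right_diff_distrib)
  finally show ?case using r z by (intro exI conjI) (auto intro!: Uf_add Uf_sc)
qed

lemma conj_K:
  assumes i: "i \<in> I" and r: "r \<in> Up"
  shows "K i * r * Ki i \<in> Up" "Ki i * r * K i \<in> Up"
proof -
  have "K i * r * Ki i \<in> Up \<and> Ki i * r * K i \<in> Up"
    using r unfolding Up_def
  proof (induction rule: span_induct_alt)
    case (step c b y)
    then obtain w where w: "b = prod_list (map E w)" "set w \<subseteq> I" by auto
    have "K i * prod_list (map E w) * Ki i \<in> Up \<and> Ki i * prod_list (map E w) * K i \<in> Up"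
      using w(2)
    proof (induction w)
      case Nil
      then show ?case using KKi[OF i] KiK[OF i] Up_one by simp
    next
      case (Cons k w)
      have k: "k \<in> I" using Cons by simp
      have "K i * (E k * x) * Ki i = (q_at G i powi cm G i k) *s (E k * (K i * x * Ki i))" for x
        using KE[OF i k] by (metis mult.assoc sc_left)
      moreover have "Ki i * (E k * x) * K i = (q_at G i powi - cm G i k) *s (E k * (Ki i * x * K i))" for x
        using KiE[OF i k] by (metis mult.assoc sc_left)
      ultimately show ?case using Cons Up_E[OF k] by (simp add: Up_sc Up_mult)
    qed
    then show ?case using step unfolding w Up_def[symmetric] by (simp add: distrib_left distrib_right Up_add Up_sc)
  qed (simp add: span_zero)
  then show "K i * r * Ki i \<in> Up" "Ki i * r * K i \<in> Up" by auto
qed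

text \<open>Nonvanishing is claimed for A alone, because later only the K_i component is
  compared.\<close>

lemma comm_E_power:
  assumes i: "i \<in> I"
  defines "c \<equiv> inverse (q_at G i - inverse (q_at G i))"
  shows "\<exists>A B. A \<noteq> 0 \<and> E i ^ Suc m * F i - F i * E i ^ Suc m = K i * (A *s E i ^ m) - Ki i * (B *s E i ^ m)"
proof -
  let ?v = "q_at G i"
  have g: "generic ?v" "?v \<noteq> 0" using q_generic q_nz i by auto
  have c: "c \<noteq> 0" using generic_d[OF g(1)] by (simp add: c_def)
  have ef: "E i * F i - F i * E i = c *s (K i - Ki i)" using EF[OF i i] by (simp add: c_def)
  \<comment> \<open>A geometric sum: the solution of A(m+1) = v^-2 A(m) + c with A(0) = c.\<close>
  define A where "A = (\<lambda>m. c * (1 - ?v powi (- 2 * (int m + 1))) / (1 - ?v powi (- 2)))"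
  have n1: "1 - ?v powi (- 2) \<noteq> 0" using generic_powi[OF g(1), of "-2"] by auto
  have AS: "A (Suc m) = ?v powi (- 2) * A m + c" for m
  proof -
    have "?v powi (- 2 * (int (Suc m) + 1)) = ?v powi (- 2) * ?v powi (- 2 * (int m + 1))"
      unfolding powi_merge[OF g(2)] by (simp add: algebra_simps)
    then show ?thesis unfolding A_def using n1 by (simp add: field_simps)
  qed
  have "\<exists>B. E i ^ Suc m * F i - F i * E i ^ Suc m = K i * (A m *s E i ^ m) - Ki i * (B *s E i ^ m)"
  proof (induction m)
    case 0
    have "A 0 = c" using n1 by (simp add: A_def)
    then show ?case using ef by (intro exI[of _ c]) (simp add: scale_right_diff_distrib)
  next
    case (Suc m)
    then obtain B where B: "E i ^ Suc m * F i - F i * E i ^ Suc m = K i * (A m *s E i ^ m) - Ki i * (B *s E i ^ m)" by blast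
    have "E i ^ Suc (Suc m) * F i - F i * E i ^ Suc (Suc m)
       = E i * (E i ^ Suc m * F i - F i * E i ^ Suc m) + (E i * F i - F i * E i) * E i ^ Suc m"
      by (simp add: algebra_simps)
    also have "\<dots> = A m *s (E i * K i * E i ^ m) - B *s (E i * Ki i * E i ^ m) + c *s (K i * E i ^ Suc m - Ki i * E i ^ Suc m)"
      unfolding B ef by (simp add: right_diff_distrib left_diff_distrib mult.assoc)
    also have "\<dots> = K i * (A (Suc m) *s E i ^ Suc m) - Ki i * ((?v powi 2 * B + c) *s E i ^ Suc m)"
      unfolding EK[OF i i] EKi[OF i i] cm_diag[OF i] AS
      by (simp add: scale_right_diff_distrib scale_left_distrib distrib_left mult.assoc mult.commute)
    finally show ?case by blast
  qed
  moreover have "A m \<noteq> 0" using c n1 generic_powi[OF g(1), of "- 2 * (int m + 1)"] by (auto simp: A_def)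
  ultimately show ?thesis by blast
qed

lemma E_power_K:
  assumes i: "i \<in> I"
  shows "\<exists>c. c \<noteq> 0 \<and> E i ^ m * K i = c *s (K i * E i ^ m)" "\<exists>c. E i ^ m * Ki i = c *s (Ki i * E i ^ m)"
proof -
  show "\<exists>c. c \<noteq> 0 \<and> E i ^ m * K i = c *s (K i * E i ^ m)"
  proof (induction m)
    case (Suc m)
    then obtain c where c: "c \<noteq> 0" "E i ^ m * K i = c *s (K i * E i ^ m)" by blast
    have "E i ^ Suc m * K i = E i * (E i ^ m * K i)" by (simp add: mult.assoc)
    also have "\<dots> = c *s ((E i * K i) * E i ^ m)" unfolding c(2) by (simp add: mult.assoc)
    also have "\<dots> = (c * q_at G i powi - cm G i i) *s (K i * E i ^ Suc m)"
      unfolding EK[OF i i] by (simp add: mult.assoc)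
    finally have "E i ^ Suc m * K i = \<dots>" .
    then show ?case using c(1) q_nz[OF i] by (intro exI[of _ "c * q_at G i powi - cm G i i"]) simp
  qed (auto intro: exI[of _ 1])
  show "\<exists>c. E i ^ m * Ki i = c *s (Ki i * E i ^ m)"
  proof (induction m)
    case (Suc m)
    then obtain c where c: "E i ^ m * Ki i = c *s (Ki i * E i ^ m)" by blast
    have "E i ^ Suc m * Ki i = E i * (E i ^ m * Ki i)" by (simp add: mult.assoc)
    also have "\<dots> = c *s ((E i * Ki i) * E i ^ m)" unfolding c by (simp add: mult.assoc)
    also have "\<dots> = (c * q_at G i powi cm G i i) *s (Ki i * E i ^ Suc m)"
      unfolding EKi[OF i i] by (simp add: mult.assoc)
    finally have "E i ^ Suc m * Ki i = \<dots>" .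
    then show ?case by blast
  qed (auto intro: exI[of _ 1])
qed

end

text \<open>\<open>L \<kappa>\<close> is modelled on the annihilator of the generating vector of a Verma module on which all
  \<open>F i\<close> act by zero and all \<open>K i\<close> by \<open>\<kappa>\<close>, and \<open>R\<close> on the image of \<open>L 1\<close> under the anti-automorphism fixing
  the \<open>E i\<close> and \<open>F i\<close> and inverting the \<open>K i\<close>. That they meet the positive part only in zero
  replaces the triangular decomposition.\<close>

locale pbw = lusz sc G E F K Ki U T "\<lambda>_ _. 1" "\<lambda>_. - 1"
  for sc :: "Cq \<Rightarrow> 'a::ring_1 \<Rightarrow> 'a" (infixr "*s" 75) and G :: "'i cartan_datum" and E F K Ki U T +
  fixes L :: "Cq \<Rightarrow> 'a set" and R :: "'a set" and t' s'
  assumes swapped: "lusz sc G F E Ki K U T t' s'"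
    and serre0: "i \<in> idx G \<Longrightarrow> j \<in> idx G \<Longrightarrow> i \<noteq> j \<Longrightarrow> fr (q_at G i) (cm G i j) (E i) (E j) (nat (1 - cm G i j)) = 0"
    and T_FK: "i \<in> idx G \<Longrightarrow> T i (F i * K i) = - E i"
    and T_inj: "i \<in> idx G \<Longrightarrow> inj_on (T i) U"
    and L_subspace: "\<kappa> \<noteq> 0 \<Longrightarrow> subspace (L \<kappa>)"
    and L_left: "\<kappa> \<noteq> 0 \<Longrightarrow> u \<in> U \<Longrightarrow> x \<in> L \<kappa> \<Longrightarrow> u * x \<in> L \<kappa>"
    and L_F: "\<kappa> \<noteq> 0 \<Longrightarrow> i \<in> idx G \<Longrightarrow> F i \<in> L \<kappa>"
    and L_K: "\<kappa> \<noteq> 0 \<Longrightarrow> i \<in> idx G \<Longrightarrow> K i - \<kappa> *s 1 \<in> L \<kappa>"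
    and L_Up: "\<kappa> \<noteq> 0 \<Longrightarrow> x \<in> L \<kappa> \<Longrightarrow> x \<in> Up \<Longrightarrow> x = 0"
    and R_right: "u \<in> U \<Longrightarrow> x \<in> R \<Longrightarrow> x * u \<in> R"
    and R_F: "i \<in> idx G \<Longrightarrow> F i \<in> R"
    and R_Up: "x \<in> R \<Longrightarrow> x \<in> Up \<Longrightarrow> x = 0"
begin

section \<open>Cancelling E and independence of PBW monomials\<close>

lemma L_Ki: assumes "\<kappa> \<noteq> 0" "i \<in> I" shows "Ki i - inverse \<kappa> *s 1 \<in> L \<kappa>"
proof -
  have "(- inverse \<kappa>) *s (Ki i * (K i - \<kappa> *s 1)) \<in> L \<kappa>"
    using assms by (intro subspace_scale[OF L_subspace] L_left L_K U_Ki)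
  moreover have "(- inverse \<kappa>) *s (Ki i * (K i - \<kappa> *s 1)) = Ki i - inverse \<kappa> *s 1"
    using assms KiK[OF assms(2)] by (simp add: right_diff_distrib scale_right_diff_distrib)
  ultimately show ?thesis by simp
qed

text \<open>Modulo \<open>L \<kappa>\<close> a right factor K_i is the scalar \<kappa>. Written as a
  K_i = b K_i^-1 with positive a and b, the equation gives \<kappa> a = \<kappa>^-1 b for every
  nonzero \<kappa>; comparing \<kappa> = 1 with \<kappa> = q forces a = 0.\<close>

lemma K_component:
  assumes i: "i \<in> I" and r: "r \<in> Up" "r' \<in> Up" and eq: "K i * r = Ki i * r'"
  shows "r = 0"
proof -
  let ?a = "K i * r * Ki i" and ?b = "Ki i * r' * K i"
  have U: "?a \<in> Up" "?b \<in> Up" using conj_K[OF i] r by auto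
  have e: "\<kappa> *s ?a - inverse \<kappa> *s ?b = 0" if l: "\<kappa> \<noteq> 0" for \<kappa>
  proof (rule L_Up[OF l])
    have 1: "?a * K i = K i * r" "?b * Ki i = Ki i * r'" using KKi[OF i] KiK[OF i] by (simp_all add: mult.assoc)
    have "?b * (Ki i - inverse \<kappa> *s 1) - ?a * (K i - \<kappa> *s 1) \<in> L \<kappa>"
      using l i U Up_U by (intro subspace_diff[OF L_subspace] L_left L_K L_Ki) auto
    also have "?b * (Ki i - inverse \<kappa> *s 1) - ?a * (K i - \<kappa> *s 1) = \<kappa> *s ?a - inverse \<kappa> *s ?b"
    proof -
      have 2: "?b * Ki i = ?a * K i" using 1 eq by simp
      show ?thesis by (simp only: right_diff_distrib 2) simp
    qed
    finally show "\<kappa> *s ?a - inverse \<kappa> *s ?b \<in> L \<kappa>" .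
    show "\<kappa> *s ?a - inverse \<kappa> *s ?b \<in> Up" using U by (intro Up_diff Up_sc)
  qed
  have "?a = ?b" using e[of 1] by simp
  have q: "generic q_var" using q_var_generic[of 1] by simp
  have "(q_var - inverse q_var) *s ?a = 0"
    using e[OF generic_nz[OF q]] \<open>?a = ?b\<close> by (simp add: scale_left_diff_distrib del: scale_eq_0_iff)
  moreover have "q_var - inverse q_var \<noteq> 0" using generic_d[OF q] .
  ultimately have "?a = 0" by simp
  then have "Ki i * ?a * K i = 0" by simp
  then show ?thesis using KiK[OF i] by (metis mult.assoc mult_1_left mult_1_right)
qed

text \<open>The power n makes the induction work. Commuting E_i^(n+1) x = 0 with F_i, the K_i
  component reads A E_i^n x + c E_i^(n+1) r = 0 with r of smaller length than x. One more E_i on the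
  left removes the first term, so r = 0 by induction on the length, and then E_i^n x = 0.\<close>

lemma E_cancel_aux:
  assumes i: "i \<in> I"
  shows "x \<in> Uf h \<Longrightarrow> E i ^ n * x = 0 \<Longrightarrow> x = 0"
proof (induction h arbitrary: x n)
  case 0
  then show ?case using Uf_0 by blast
next
  case (Suc h)
  note IHh = Suc.IH
  show ?case using Suc.prems
  proof (induction n)
    case (Suc n)
    obtain A B where A: "A \<noteq> 0" "E i ^ Suc n * F i - F i * E i ^ Suc n = K i * (A *s E i ^ n) - Ki i * (B *s E i ^ n)"
      using comm_E_power[OF i] by blast
    obtain r r' where r: "r \<in> Uf h" "r' \<in> Uf h" "x * F i - F i * x = K i * r - Ki i * r'"
      using comm_F[OF i Suc.prems(1)] by blast
    obtain c where c: "c \<noteq> 0" "E i ^ Suc n * K i = c *s (K i * E i ^ Suc n)" using E_power_K(1)[OF i] by blast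
    obtain d where d: "E i ^ Suc n * Ki i = d *s (Ki i * E i ^ Suc n)" using E_power_K(2)[OF i] by blast
    let ?r = "A *s (E i ^ n * x) + c *s (E i ^ Suc n * r)"
    let ?r' = "B *s (E i ^ n * x) + d *s (E i ^ Suc n * r')"
    have "0 = E i ^ Suc n * x * F i - F i * (E i ^ Suc n * x)" using Suc.prems by simp
    also have "\<dots> = (E i ^ Suc n * F i - F i * E i ^ Suc n) * x + E i ^ Suc n * (x * F i - F i * x)"
      by (simp add: left_diff_distrib right_diff_distrib mult.assoc)
    also have "\<dots> = (K i * (A *s E i ^ n) - Ki i * (B *s E i ^ n)) * x + (E i ^ Suc n * K i * r - E i ^ Suc n * Ki i * r')"
      unfolding A r right_diff_distrib by (simp only: mult.assoc)
    also have "\<dots> = K i * ?r - Ki i * ?r'"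
      unfolding c(2) d by (simp add: left_diff_distrib distrib_left mult.assoc del: power_Suc)
    finally have eq: "K i * ?r = Ki i * ?r'" by simp
    have "x \<in> Up" "r \<in> Up" "r' \<in> Up" using Suc.prems r Uf_Up by blast+
    then have "?r \<in> Up" "?r' \<in> Up" using i by (auto intro!: Up_add Up_sc Up_mult Up_power Up_E simp del: power_Suc)
    then have z: "?r = 0" using K_component[OF i _ _ eq] by blast
    then have "E i * ?r = 0" by simp
    then have "A *s (E i ^ Suc n * x) + c *s (E i ^ Suc (Suc n) * r) = 0"
      by (simp add: distrib_left mult.assoc)
    then have "E i ^ Suc (Suc n) * r = 0" using Suc.prems c(1) by simp
    then have "r = 0" using IHh[OF r(1)] by blast
    then have "E i ^ n * x = 0" using z A(1) by simp
    then show ?case using Suc.IH Suc.prems by blast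
  qed simp
qed

lemma E_cancel: "i \<in> I \<Longrightarrow> x \<in> Up \<Longrightarrow> E i * x = 0 \<Longrightarrow> x = 0"
  using E_cancel_aux[of i x _ 1] Up_Uf[of x] by auto

lemma T_sum: "i \<in> I \<Longrightarrow> (\<And>a. a \<in> A \<Longrightarrow> f a \<in> U) \<Longrightarrow> T i (sum f A) = (\<Sum>a\<in>A. T i (f a)) \<and> sum f A \<in> U"
  by (induction A rule: infinite_finite_induct) (auto simp: T_0 U_0 T_add U_add)

lemma T_power: "i \<in> I \<Longrightarrow> x \<in> U \<Longrightarrow> T i (x ^ n) = T i x ^ n"
  by (induction n) (auto simp: T_one T_mult U_power)

text \<open>Positivity of the y_a is what turns membership in \<open>R\<close> into vanishing;
  positivity of the T_i y_a allows E_i to be cancelled from the remaining sum.\<close>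

lemma E_T_indep:
  assumes i: "i \<in> I"
  shows "(\<And>a. y a \<in> Up) \<Longrightarrow> (\<And>a. T i (y a) \<in> Up) \<Longrightarrow> (\<Sum>a<N. E i ^ a * T i (y a)) = 0 \<Longrightarrow> a < N \<Longrightarrow> y a = 0"
proof (induction N arbitrary: y a)
  case (Suc N)
  \<comment> \<open>The preimage of E_i under T_i.\<close>
  define g where "g = - (F i * K i)"
  have g: "g \<in> U" "T i g = E i"
    using T_FK[OF i] T_uminus[OF i, of "F i * K i"] U_F U_K U_mult U_uminus i by (auto simp: g_def)
  let ?Z = "\<Sum>a<N. E i ^ a * T i (y (Suc a))"
  let ?X = "\<Sum>a<N. g ^ a * y (Suc a)"
  have yU: "y a \<in> U" for a using Suc.prems(1) Up_U by blast
  have X: "T i ?X = ?Z" "?X \<in> U" using T_sum[OF i, of "{..<N}" "\<lambda>a. g ^ a * y (Suc a)"] yU g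
    by (simp_all add: T_mult[OF i] T_power[OF i] U_power U_mult)
  have "(\<Sum>a<Suc N. E i ^ a * T i (y a)) = T i (y 0) + E i * ?Z"
    unfolding sum.lessThan_Suc_shift by (simp add: sum_distrib_left mult.assoc)
  then have z: "T i (y 0) + E i * ?Z = 0" using Suc.prems(3) by simp
  then have "T i (y 0 + g * ?X) = T i 0" using i X g yU by (simp add: T_add T_mult U_mult T_0)
  then have "y 0 + g * ?X = 0" using T_inj[OF i] U_add U_mult g X yU U_0 by (meson inj_onD)
  then have "y 0 = F i * (K i * ?X)" by (simp add: g_def mult.assoc)
  moreover have "F i * (K i * ?X) \<in> R" using R_right[OF _ R_F[OF i]] U_mult U_K i X by blast
  ultimately have y0: "y 0 = 0" using R_Up Suc.prems(1) by metis
  then have "E i * ?Z = 0" using z T_0[OF i] by simp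
  moreover have "?Z \<in> Up" using Suc.prems(2) Up_E[OF i] unfolding Up_def
    by (intro span_sum) (auto simp: Up_def[symmetric] Up_mult Up_power)
  ultimately have "?Z = 0" using E_cancel[OF i] by blast
  then have "y (Suc a) = 0" if "a < N" for a using Suc.IH[of "\<lambda>a. y (Suc a)"] Suc.prems that by blast
  then show ?case using y0 Suc.prems(4) by (cases a) auto
qed simp

text \<open>PBW monomials without the normalising constants, nested so that the first letter can be
  split off in the form E_i^a T_i(y) which \<open>E_T_indep\<close> and \<open>Up_decomp\<close>
  deal with.\<close>

primrec mono :: "'i list \<Rightarrow> nat list \<Rightarrow> 'a" where
  "mono [] as = 1"
| "mono (i # ws) as = E i ^ hd as * T i (mono ws (tl as))"

lemma mono_U: "ws \<in> lists I \<Longrightarrow> mono ws as \<in> U"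
  by (induction ws arbitrary: as) (auto simp: U_one U_mult U_power U_E T_mem)

lemma Tw_power: "ws \<in> lists I \<Longrightarrow> x \<in> U \<Longrightarrow> foldr T ws (x ^ n) = foldr T ws x ^ n"
  by (induction n) (auto simp: Tw_one Tw_mult U_power)

text \<open>The prefix is what the induction needs: every factor becomes a power of some T_pre E_i
  with \<open>pre @ [i]\<close> reduced, to which \<open>positivity\<close> applies.\<close>

lemma Tw_mono_Up: "red (pre @ ws) \<Longrightarrow> foldr T pre (mono ws as) \<in> Up"
proof (induction ws arbitrary: pre as)
  case Nil
  then show ?case by (simp add: Tw_one red_def Up_one)
next
  case (Cons i ws)
  have r: "red (pre @ [i])" using red_app1[of "pre @ [i]" ws] Cons.prems by simp
  then have i: "i \<in> I" "pre \<in> lists I" "ws \<in> lists I" using Cons.prems by (auto simp: red_def)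
  have "foldr T pre (E i) \<in> Up" using positivity[OF red_app1[OF r] asc_snoc[OF r] i(1)] Upd_Up by blast
  moreover have "foldr T (pre @ [i]) (mono ws (tl as)) \<in> Up" using Cons.IH[of "pre @ [i]"] Cons.prems by simp
  ultimately show ?case using i
    by (simp add: Tw_mult Tw_power U_power U_E T_mem mono_U Up_mult Up_power)
qed

lemma mono_Up: "red ws \<Longrightarrow> mono ws as \<in> Up"
  using Tw_mono_Up[of "[]"] by simp

text \<open>Grouping the exponents by their first entry a turns the relation into a sum of terms
  E_i^a T_i(y_a). Here y_a is positive because \<open>ws\<close> is reduced, and T_i y_a because
  \<open>i # ws\<close> is.\<close>

theorem mono_indep:
  "red ws \<Longrightarrow> finite A \<Longrightarrow> (\<And>as. as \<in> A \<Longrightarrow> length as = length ws) \<Longrightarrow> (\<Sum>as\<in>A. c as *s mono ws as) = 0 \<Longrightarrow> as \<in> A \<Longrightarrow> c as = 0"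
proof (induction ws arbitrary: A c as)
  case Nil
  then have "A = {[]}" by fastforce
  then show ?case using Nil by simp
next
  case (Cons i ws)
  have r: "red ws" "red ([i] @ ws)" and i: "i \<in> I" "ws \<in> lists I" using Cons.prems red_app2[of "[i]" ws] by (auto simp: red_def)
  define B where "B = (\<lambda>a. {bs. a # bs \<in> A})"
  have fB: "finite (B a)" for a
    using finite_imageD[of "(#) a" "B a"] finite_subset[OF _ Cons.prems(2), of "(#) a ` B a"] by (auto simp: B_def)
  define y where "y = (\<lambda>a. \<Sum>bs\<in>B a. c (a # bs) *s mono ws bs)"
  define N where "N = Suc (Max (insert 0 (hd ` A)))"
  have hN: "hd as < N" if "as \<in> A" for as unfolding N_def using Cons.prems(2) that by (simp add: less_Suc_eq_le)
  have ne: "as \<noteq> []" if "as \<in> A" for as using Cons.prems(3)[OF that] by auto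
  have "A = (\<Union>a<N. (#) a ` B a)"
  proof
    show "A \<subseteq> (\<Union>a<N. (#) a ` B a)"
    proof
      fix as assume "as \<in> A"
      then show "as \<in> (\<Union>a<N. (#) a ` B a)" using hN[of as] ne[of as] by (cases as) (auto simp: B_def)
    qed
  qed (auto simp: B_def)
  then have "(\<Sum>as\<in>A. c as *s mono (i # ws) as) = (\<Sum>as\<in>(\<Union>a<N. (#) a ` B a). c as *s mono (i # ws) as)" by simp
  also have "\<dots> = (\<Sum>a<N. \<Sum>as\<in>(#) a ` B a. c as *s mono (i # ws) as)"
    by (rule sum.UNION_disjoint) (auto simp: fB)
  also have "\<dots> = (\<Sum>a<N. \<Sum>bs\<in>B a. c (a # bs) *s mono (i # ws) (a # bs))"
    by (rule sum.cong[OF refl]) (simp add: sum.reindex inj_on_def del: mono.simps)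
  also have "\<dots> = (\<Sum>a<N. E i ^ a * T i (y a))"
  proof (intro sum.cong refl)
    fix a
    have "T i (y a) = (\<Sum>bs\<in>B a. T i (c (a # bs) *s mono ws bs))"
      unfolding y_def using T_sum[OF i(1), of "B a" "\<lambda>bs. c (a # bs) *s mono ws bs"] mono_U[OF i(2)] U_sc by blast
    then show "(\<Sum>bs\<in>B a. c (a # bs) *s mono (i # ws) (a # bs)) = E i ^ a * T i (y a)"
      using i by (simp add: sum_distrib_left T_sc mono_U)
  qed
  finally have z: "(\<Sum>a<N. E i ^ a * T i (y a)) = 0" using Cons.prems(4) by simp
  have yUp: "y a \<in> Up" for a unfolding y_def Up_def
    by (intro span_sum) (auto simp: Up_def[symmetric] Up_sc mono_Up r)
  have TyUp: "T i (y a) \<in> Up" for a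
  proof -
    have "T i (y a) = (\<Sum>bs\<in>B a. c (a # bs) *s T i (mono ws bs))"
      unfolding y_def using T_sum[OF i(1), of "B a" "\<lambda>bs. c (a # bs) *s mono ws bs"] mono_U[OF i(2)] U_sc T_sc[OF i(1)] by simp
    moreover have "T i (mono ws bs) \<in> Up" for bs using Tw_mono_Up[OF r(2)] by simp
    ultimately show ?thesis unfolding Up_def by (simp add: span_sum span_scale)
  qed
  obtain a bs where as: "as = a # bs" using ne[OF Cons.prems(5)] by (cases as) auto
  have "y a = 0" by (rule E_T_indep[OF i(1) yUp TyUp z]) (use hN[OF Cons.prems(5)] as in auto)
  then show ?case unfolding as y_def
    using Cons.IH[OF r(1) fB[of a], of "\<lambda>bs. c (a # bs)" bs] Cons.prems(3,5) as by (force simp: B_def)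
qed

subsection \<open>Spanning\<close>

text \<open>With t = 1 and s = -1 the scalar in \<open>T_fll\<close> is 1.\<close>

lemma T_fll':
  assumes "i \<in> I" "j \<in> I" "i \<noteq> j" "m \<le> nat (- cm G i j)"
  shows "frr i j m = T i (fll i j (nat (- cm G i j) - m))"
proof -
  have "cm G i j = - int (nat (- cm G i j))" using cm_nonpos[OF assms(1-3)] by simp
  from T_fll[OF assms(1-3) this, of "nat (- cm G i j) - m"] assms(4) show ?thesis by simp
qed

lemma span_left_mult: "(\<And>a. a \<in> A \<Longrightarrow> z * a \<in> span C) \<Longrightarrow> x \<in> span A \<Longrightarrow> z * x \<in> span C"
  using span_mult[of "{z}" A C z x] span_base[of z "{z}"] by auto

text \<open>M is the monoid generated by the chain elements over all j other than i. The span D of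
  the E_i^a M contains 1 and is stable under left multiplication by every generator, so it is
  everything; and each element of M is T_i of a positive element by \<open>T_fll'\<close>.\<close>

lemma Up_decomp:
  assumes i: "i \<in> I" and x: "x \<in> Up"
  shows "x \<in> span {E i ^ a * T i y | a y. y \<in> Up}"
proof -
  define \<Gamma> where "\<Gamma> = {frr i j m | j m. j \<in> I \<and> j \<noteq> i \<and> m \<le> nat (- cm G i j)}"
  define M where "M = {prod_list bs | bs. set bs \<subseteq> \<Gamma>}"
  define D where "D = span {E i ^ a * b | a b. b \<in> M}"
  have DE: "E i * d \<in> D" if "d \<in> D" for d
    using that unfolding D_def
  proof (rule span_left_mult[rotated], goal_cases)
    case (1 z)
    then obtain a b where "z = E i ^ a * b" "b \<in> M" by auto
    then have "E i * z = E i ^ Suc a * b" "b \<in> M" by (auto simp: mult.assoc)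
    then show ?case by (intro span_base CollectI exI[of _ "Suc a"] exI[of _ b]) simp
  qed
  have Da: "d + d' \<in> D" if "d \<in> D" "d' \<in> D" for d d'
    using that by (auto simp: D_def span_add)
  have Ds: "c *s d \<in> D" if "d \<in> D" for d c
    using that by (auto simp: D_def span_scale)
  have Mg: "g * b \<in> M" if "g \<in> \<Gamma>" "b \<in> M" for g b
  proof -
    obtain bs where "b = prod_list bs" "set bs \<subseteq> \<Gamma>" using \<open>b \<in> M\<close> M_def by auto
    then show ?thesis unfolding M_def using that(1) by (intro CollectI exI[of _ "g # bs"]) auto
  qed
  have DM: "b \<in> D" if "b \<in> M" for b
    unfolding D_def using that by (intro span_base CollectI exI[of _ 0] exI[of _ b]) simp
  \<comment> \<open>Moving a chain element to the right past one E_i yields E_i times the same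
    element and a multiple of the next one in the chain; the induction on a is general in g to
    absorb the latter.\<close>
  have gE: "g * (E i ^ a * b) \<in> D" if "g \<in> \<Gamma>" "b \<in> M" for g a b
    using that
  proof (induction a arbitrary: g)
    case 0
    then show ?case using Mg DM by simp
  next
    case (Suc a)
    obtain j m where j: "g = frr i j m" "j \<in> I" "j \<noteq> i" "m \<le> nat (- cm G i j)" using Suc.prems(1) \<Gamma>_def by auto
    have g: "generic (q_at G i)" using q_generic[OF i] .
    let ?x = "E i ^ a * b"
    let ?g' = "frr i j (Suc m)"
    have gei: "g * E i = (q_at G i powi (cm G i j + 2 * int m)) *s (E i * g) + qi (q_at G i) (int m + 1) *s ?g'"
      unfolding fr_Suc[OF g] j(1) by simp
    have "g * (E i ^ Suc a * b) = (g * E i) * ?x" by (simp add: mult.assoc)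
    also have "\<dots> = (q_at G i powi (cm G i j + 2 * int m)) *s (E i * (g * ?x)) + qi (q_at G i) (int m + 1) *s (?g' * ?x)"
      unfolding gei by (simp add: distrib_right mult.assoc)
    also have "\<dots> \<in> D"
    proof (intro Da Ds DE, goal_cases)
      case 1
      show ?case using Suc by blast
    next
      case 2
      show ?case
      proof (cases "m = nat (- cm G i j)")
        \<comment> \<open>At the end of the chain the next element is a multiple of the Serre
          element, hence zero.\<close>
        case True
        then have "Suc m = nat (1 - cm G i j)" using cm_nonpos[of i j] i j by simp
        then have "?g' = 0" using serre0[of i j] i j by simp
        then show ?thesis by (simp add: D_def span_zero)
      next
        case False
        then have "?g' \<in> \<Gamma>" using j unfolding \<Gamma>_def by (intro CollectI exI[of _ j] exI[of _ "Suc m"]) auto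
        then show ?thesis using Suc.IH Suc.prems by blast
      qed
    qed
    finally show ?case .
  qed
  have Ej: "E j * d \<in> D" if "d \<in> D" "j \<in> I" for j d
  proof (cases "j = i")
    case True then show ?thesis using DE that by simp
  next
    case False
    have "E j \<in> \<Gamma>" unfolding \<Gamma>_def using False that by (intro CollectI exI[of _ j] exI[of _ 0]) simp
    then have 1: "E j * z \<in> D" if "z \<in> {E i ^ a * b | a b. b \<in> M}" for z using that gE[of "E j"] by auto
    show ?thesis using span_left_mult[of "{E i ^ a * b | a b. b \<in> M}" "E j" "{E i ^ a * b | a b. b \<in> M}" d] 1 that(1)
      unfolding D_def by blast
  qed
  have "1 \<in> M" unfolding M_def by (intro CollectI exI[of _ "[]"]) simp
  then have "prod_list (map E w) \<in> D" if "set w \<subseteq> I" for w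
    using that by (induction w) (auto intro: DM Ej)
  then have "{prod_list (map E w) | w. set w \<subseteq> I} \<subseteq> D" by auto
  moreover have "subspace D" by (simp add: D_def)
  ultimately have "x \<in> D" using x span_minimal unfolding Up_def by blast
  moreover have "\<exists>y\<in>Up. b = T i y" if b: "b \<in> M" for b
  proof -
    obtain bs where bs: "b = prod_list bs" "set bs \<subseteq> \<Gamma>" using b M_def by auto
    have "\<exists>y\<in>Up. prod_list bs = T i y" using bs(2)
    proof (induction bs)
      case Nil
      then show ?case using T_one[OF i] Up_one by auto
    next
      case (Cons g bs)
      then obtain y where y: "y \<in> Up" "prod_list bs = T i y" by auto
      obtain j m where j: "g = frr i j m" "j \<in> I" "j \<noteq> i" "m \<le> nat (- cm G i j)" using Cons.prems \<Gamma>_def by auto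
      define f where "f = fll i j (nat (- cm G i j) - m)"
      have f: "g = T i f" unfolding j(1) f_def using T_fll'[of i j m] i j by simp
      have "f \<in> Up" unfolding f_def using Upd_Up[OF _ fll_Upd[of i j]] i j by simp
      then show ?case using y f i Up_U by (intro bexI[of _ "f * y"]) (auto simp: T_mult Up_mult)
    qed
    then show ?thesis using bs by simp
  qed
  then have "{E i ^ a * b | a b. b \<in> M} \<subseteq> {E i ^ a * T i y | a y. y \<in> Up}" by fast
  then have "D \<subseteq> span {E i ^ a * T i y | a y. y \<in> Up}" unfolding D_def by (rule span_mono)
  ultimately show ?thesis by blast
qed

lemma T_span:
  assumes i: "i \<in> I" and A: "A \<subseteq> U" and x: "x \<in> span A"
  shows "T i x \<in> span (T i ` A)"
proof -
  have "T i x \<in> span (T i ` A) \<and> x \<in> U" using x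
  proof (induction rule: span_induct_alt)
    case base
    then show ?case using T_0[OF i] U_0 by (simp add: span_zero)
  next
    case (step c b y)
    then have "b \<in> U" using A by auto
    then show ?case using step i by (simp add: T_add T_sc U_add U_sc span_add span_scale span_base)
  qed
  then show ?thesis by simp
qed

lemma Up_iterate:
  "ws \<in> lists I \<Longrightarrow> x \<in> Up \<Longrightarrow> x \<in> span {mono ws as * foldr T ws z | as z. length as = length ws \<and> z \<in> Up}"
proof (induction ws arbitrary: x)
  case Nil
  then show ?case by (intro span_base) auto
next
  case (Cons i ws)
  have i: "i \<in> I" "ws \<in> lists I" using Cons.prems by auto
  let ?A = "{mono ws as * foldr T ws z | as z. length as = length ws \<and> z \<in> Up}"
  let ?C = "{mono (i # ws) as * foldr T (i # ws) z | as z. length as = length (i # ws) \<and> z \<in> Up}"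
  have AU: "?A \<subseteq> U" by (auto simp: U_mult mono_U[OF i(2)] Tw_mem[OF i(2)] Up_U)
  have 1: "E i ^ a * T i y \<in> span ?C" if y: "y \<in> Up" for a y
  proof (rule span_left_mult)
    show "T i y \<in> span (T i ` ?A)" by (rule T_span[OF i(1) AU Cons.IH[OF i(2) y]])
    fix b assume "b \<in> T i ` ?A"
    then obtain as z where b: "b = T i (mono ws as * foldr T ws z)" "length as = length ws" "z \<in> Up" by auto
    have "E i ^ a * b = mono (i # ws) (a # as) * foldr T (i # ws) z"
      unfolding b using T_mult[OF i(1) mono_U[OF i(2)] Tw_mem[OF i(2) Up_U[OF b(3)]]] by (simp add: mult.assoc)
    then show "E i ^ a * b \<in> span ?C" using b by (intro span_base CollectI exI[of _ "a # as"] exI[of _ z]) simp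
  qed
  have "span {E i ^ a * T i y | a y. y \<in> Up} \<subseteq> span ?C"
    by (rule span_minimal) (use 1 in auto)
  then show ?case using Up_decomp[OF i(1) Cons.prems(2)] by blast
qed

text \<open>A word of the longest element may be chosen to end in i, say as u followed by i. Then
  T_u F_i is positive for the algebra with E and F exchanged and has simple weight, so it is a
  multiple of some F_k; hence T_u T_i E_i lies in the left ideal \<open>L \<kappa>\<close>.\<close>

lemma Tw_longest_E:
  assumes l: "longest ws" and i: "i \<in> I" and k: "\<kappa> \<noteq> 0"
  shows "foldr T ws (E i) \<in> L \<kappa>"
proof -
  interpret sw: lusz sc G F E Ki K U T t' s' by (rule swapped)
  obtain us where us: "red (us @ [i])" "W (us @ [i]) = W ws" using longest_ends[OF l i] by blast
  obtain k' where k': "k' \<in> I" "W us (simple_root i) = simple_root k'" using longest_simple[OF l us] by blast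
  have r: "red us" "asc us i" "us \<in> lists I" using red_app1[OF us(1)] asc_snoc[OF us(1)] red_lists by auto
  have "foldr T us (F i) \<in> sw.Upd I (simple_root k')" using sw.positivity[OF r(1,2) i] k' by simp
  then obtain c where c: "foldr T us (F i) = c *s F k'" using sw.Upd_simple by blast
  have "foldr T ws (E i) = foldr T (us @ [i]) (E i)"
    using Tw_cong[OF _ us(1), of ws "E i"] l us U_E i by (simp add: longest_def)
  also have "\<dots> = (- c) *s (foldr T us (Ki i) * F k')"
    using T_Eii[OF i] i r by (simp add: Tw_uminus Tw_mult U_mult U_Ki U_F c)
  also have "\<dots> \<in> L \<kappa>" using k i k' r
    by (intro subspace_scale[OF L_subspace] L_left L_F Tw_mem U_Ki) auto
  finally show ?thesis .
qed

lemma Tw_longest_Up: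
  assumes l: "longest ws" and k: "\<kappa> \<noteq> 0" and z: "z \<in> Up"
  shows "\<exists>c. foldr T ws z - c *s 1 \<in> L \<kappa>"
proof -
  have ws: "ws \<in> lists I" using l by (simp add: longest_def red_def)
  have w: "\<exists>c. foldr T ws (prod_list (map E w)) - c *s 1 \<in> L \<kappa>" if w: "set w \<subseteq> I" for w
  proof (cases w rule: rev_cases)
    case Nil
    then show ?thesis using Tw_one[OF ws] subspace_0[OF L_subspace[OF k]] by (intro exI[of _ 1]) simp
  next
    case (snoc w' i)
    then have "foldr T ws (prod_list (map E w)) = foldr T ws (prod_list (map E w')) * foldr T ws (E i)"
      using w ws U_words[of w'] U_E by (simp add: Tw_mult)
    also have "\<dots> \<in> L \<kappa>" using k snoc w ws U_words[of w'] by (intro L_left Tw_mem Tw_longest_E[OF l]) auto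
    finally show ?thesis by (intro exI[of _ 0]) simp
  qed
  have "(\<exists>c. foldr T ws z - c *s 1 \<in> L \<kappa>) \<and> z \<in> U" using z unfolding Up_def
  proof (induction rule: span_induct_alt)
    case base
    then show ?case using Tw_0[OF ws] subspace_0[OF L_subspace[OF k]] U_0 by (auto intro: exI[of _ 0])
  next
    case (step a b y)
    then obtain w' where w': "b = prod_list (map E w')" "set w' \<subseteq> I" by auto
    obtain c d where c: "foldr T ws b - c *s 1 \<in> L \<kappa>" and d: "foldr T ws y - d *s 1 \<in> L \<kappa>" using w w' step by blast
    have bU: "b \<in> U" "y \<in> U" using w' U_words step by auto
    have "a *s (foldr T ws b - c *s 1) + (foldr T ws y - d *s 1) \<in> L \<kappa>"
      using subspace_add subspace_scale L_subspace[OF k] c d by blast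
    also have "a *s (foldr T ws b - c *s 1) + (foldr T ws y - d *s 1) = foldr T ws (a *s b + y) - (a * c + d) *s 1"
      using bU ws by (simp add: Tw_add Tw_sc U_sc scale_right_diff_distrib scale_left_distrib algebra_simps)
    finally show ?case using bU U_add U_sc by blast
  qed
  then show ?thesis by simp
qed

text \<open>Modulo \<open>L 1\<close> the element agrees with a combination of monomials; the
  difference is positive as well, hence zero.\<close>

theorem mono_span:
  assumes l: "longest ws" and x: "x \<in> Up"
  shows "x \<in> span {mono ws as | as. length as = length ws}"
proof -
  let ?M = "{mono ws as | as. length as = length ws}"
  have r: "red ws" "ws \<in> lists I" using l by (auto simp: longest_def red_def)
  have MUp: "span ?M \<subseteq> Up" unfolding Up_def by (rule span_minimal) (use mono_Up[OF r(1)] Up_def in auto)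
  have "\<exists>y\<in>span ?M. x - y \<in> L 1" using Up_iterate[OF r(2) x]
  proof (induction rule: span_induct_alt)
    case base
    then show ?case using subspace_0[OF L_subspace] by (intro bexI[of _ 0]) (auto simp: span_zero)
  next
    case (step a b y)
    then obtain as z where b: "b = mono ws as * foldr T ws z" "length as = length ws" "z \<in> Up" by auto
    obtain c where c: "foldr T ws z - c *s 1 \<in> L 1" using Tw_longest_Up[OF l _ b(3), of 1] by auto
    obtain y' where y': "y' \<in> span ?M" "y - y' \<in> L 1" using step by blast
    have "mono ws as * (foldr T ws z - c *s 1) \<in> L 1" using c mono_U[OF r(2)] by (intro L_left) auto
    then have "a *s (mono ws as * (foldr T ws z - c *s 1)) + (y - y') \<in> L 1"
      using y' subspace_add subspace_scale L_subspace[of 1] by simp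
    also have "a *s (mono ws as * (foldr T ws z - c *s 1)) + (y - y') = (a *s b + y) - ((a * c) *s mono ws as + y')"
      unfolding b by (simp add: right_diff_distrib scale_right_diff_distrib algebra_simps)
    finally have "(a *s b + y) - ((a * c) *s mono ws as + y') \<in> L 1" .
    moreover have "(a * c) *s mono ws as + y' \<in> span ?M" using b by (intro span_add[OF span_scale[OF span_base] y'(1)]) auto
    ultimately show ?case by blast
  qed
  then obtain y where y: "y \<in> span ?M" "x - y \<in> L 1" by blast
  have "x - y \<in> Up" using x y MUp Up_diff by blast
  then have "x = y" using L_Up[of 1 "x - y"] y by simp
  then show ?thesis using y by simp
qed

end

section \<open>Free algebras and their linear operators\<close>

definition psc :: "Cq \<Rightarrow> ('w::monoid_add \<Rightarrow>\<^sub>0 Cq) \<Rightarrow> ('w \<Rightarrow>\<^sub>0 Cq)" where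
  "psc c x = Poly_Mapping.single 0 c * x"

lemma pm_expand: "(x :: 'w \<Rightarrow>\<^sub>0 'b::comm_monoid_add) = (\<Sum>k\<in>Poly_Mapping.keys x. Poly_Mapping.single k (Poly_Mapping.lookup x k))"
proof (rule poly_mapping_eqI)
  fix l
  have "(\<Sum>k\<in>Poly_Mapping.keys x. Poly_Mapping.lookup x k when k = l) = Poly_Mapping.lookup x l"
    by (simp add: when_def in_keys_iff)
  then show "Poly_Mapping.lookup x l = Poly_Mapping.lookup (\<Sum>k\<in>Poly_Mapping.keys x. Poly_Mapping.single k (Poly_Mapping.lookup x k)) l"
    by (simp add: lookup_sum lookup_single)
qed

lemma psc_expand: "psc c x = (\<Sum>k\<in>Poly_Mapping.keys x. Poly_Mapping.single k (c * Poly_Mapping.lookup x k))"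
  unfolding psc_def by (subst pm_expand[of x]) (simp add: sum_distrib_left mult_single)

lemma psc_central: "x * Poly_Mapping.single 0 c = psc c x"
  unfolding psc_expand by (subst pm_expand[of x]) (simp add: sum_distrib_right mult_single mult.commute)

lemma psc_single: "psc c (Poly_Mapping.single k d) = Poly_Mapping.single k (c * d)"
  by (simp add: psc_def mult_single)

interpretation pm: cq_algebra "psc :: Cq \<Rightarrow> ('w::monoid_add \<Rightarrow>\<^sub>0 Cq) \<Rightarrow> ('w \<Rightarrow>\<^sub>0 Cq)"
proof
  fix c d :: Cq and x y :: "'w \<Rightarrow>\<^sub>0 Cq"
  show "psc c (x + y) = psc c x + psc c y" by (simp add: psc_def distrib_left)
  show "psc (c + d) x = psc c x + psc d x" by (simp add: psc_def single_add distrib_right)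
  show "psc c (psc d x) = psc (c * d) x" by (simp add: psc_def mult.assoc[symmetric] mult_single)
  show "psc 1 x = x" by (simp add: psc_def)
  show "psc c x * y = psc c (x * y)" by (simp add: psc_def mult.assoc)
  show "x * psc c y = psc c (x * y)"
  proof -
    have "x * psc c y = (x * Poly_Mapping.single 0 c) * y" by (simp add: psc_def mult.assoc)
    also have "\<dots> = psc c (x * y)" unfolding psc_central by (simp add: psc_def mult.assoc)
    finally show ?thesis .
  qed
qed

context cq_algebra
begin

definition lext :: "('w \<Rightarrow> 'a) \<Rightarrow> ('w \<Rightarrow>\<^sub>0 Cq) \<Rightarrow> 'a" where
  "lext f x = (\<Sum>k\<in>Poly_Mapping.keys x. Poly_Mapping.lookup x k *s f k)"

lemma lext_superset: "finite A \<Longrightarrow> Poly_Mapping.keys x \<subseteq> A \<Longrightarrow> lext f x = (\<Sum>k\<in>A. Poly_Mapping.lookup x k *s f k)"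
  unfolding lext_def by (rule sum.mono_neutral_left) (auto simp: in_keys_iff)

lemma lext_add: "lext f (x + y) = lext f x + lext f y"
proof -
  let ?A = "Poly_Mapping.keys x \<union> Poly_Mapping.keys y"
  have "lext f (x + y) = (\<Sum>k\<in>?A. Poly_Mapping.lookup (x + y) k *s f k)"
    by (rule lext_superset) (auto dest: subsetD[OF keys_add])
  moreover have "lext f x = (\<Sum>k\<in>?A. Poly_Mapping.lookup x k *s f k)" "lext f y = (\<Sum>k\<in>?A. Poly_Mapping.lookup y k *s f k)"
    by (rule lext_superset; auto)+
  ultimately show ?thesis by (simp add: lookup_add scale_left_distrib sum.distrib)
qed

lemma lext_single: "lext f (Poly_Mapping.single k c) = c *s f k"
  by (subst lext_superset[of "{k}"]) (auto)

lemma lext_0 [simp]: "lext f 0 = 0"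
  by (simp add: lext_def)

lemma lext_sum: "lext f (sum g A) = (\<Sum>a\<in>A. lext f (g a))"
  by (induction A rule: infinite_finite_induct) (auto simp: lext_add)

lemma lext_psc: "lext f (psc c x) = c *s lext f x"
  unfolding psc_expand lext_sum lext_single by (simp add: lext_def scale_sum_right)

lemma lext_mult:
  assumes "\<And>v w. f (v + w) = f v * f w"
  shows "lext f (x * y) = lext f x * lext f y"
proof -
  have "x * y = (\<Sum>k\<in>Poly_Mapping.keys x. \<Sum>l\<in>Poly_Mapping.keys y. Poly_Mapping.single (k + l) (Poly_Mapping.lookup x k * Poly_Mapping.lookup y l))"
    by (subst pm_expand[of x], subst pm_expand[of y]) (simp add: sum_product mult_single)
  then have "lext f (x * y) = (\<Sum>k\<in>Poly_Mapping.keys x. \<Sum>l\<in>Poly_Mapping.keys y. (Poly_Mapping.lookup x k * Poly_Mapping.lookup y l) *s (f k * f l))"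
    by (simp add: lext_sum lext_single assms)
  also have "\<dots> = lext f x * lext f y"
    by (simp add: lext_def sum_product mult.commute)
  finally show ?thesis .
qed

definition ev :: "('g \<Rightarrow> 'a) \<Rightarrow> ('g free_word \<Rightarrow>\<^sub>0 Cq) \<Rightarrow> 'a" where
  "ev h = lext (\<lambda>w. prod_list (map h (letters w)))"

lemma ev_add: "ev h (x + y) = ev h x + ev h y"
  and ev_psc: "ev h (psc c x) = c *s ev h x"
  and ev_0 [simp]: "ev h 0 = 0"
  and ev_sum: "ev h (sum g A) = (\<Sum>a\<in>A. ev h (g a))"
  and ev_mult: "ev h (x * y) = ev h x * ev h y"
  by (simp_all add: ev_def lext_add lext_psc lext_sum) (rule lext_mult, simp add: plus_free_word_def)

lemma ev_diff: "ev h (x - y) = ev h x - ev h y"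
  using ev_add[of h "x - y" y] by simp

lemma ev_one: "ev h 1 = 1"
proof -
  have "ev h (Poly_Mapping.single 0 1) = 1" unfolding ev_def lext_single by (simp add: zero_free_word_def)
  then show ?thesis by simp
qed

lemma ev_fr: "ev h (pm.fr v a e x m) = fr v a (ev h e) (ev h x) m"
  by (induction m) (auto simp: ev_psc ev_diff ev_mult fr.simps pm.fr.simps)

lemma ev_fgen [simp]: "ev h (fgen g) = h g"
  by (simp add: ev_def lext_single fgen_def)

end

definition fwd :: "'g list \<Rightarrow> 'g free_word \<Rightarrow>\<^sub>0 Cq" where
  "fwd w = Poly_Mapping.single (FW w) 1"

lemma fwd_app: "fwd (v @ w) = fwd v * fwd w"
  by (simp add: fwd_def mult_single plus_free_word_def)

lemma fwd_Nil: "fwd [] = 1"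
proof -
  have "fwd [] = Poly_Mapping.single 0 1" by (simp add: fwd_def zero_free_word_def)
  then show ?thesis by simp
qed

lemma fwd_Cons: "fwd (i # w) = fwd [i] * fwd w"
  using fwd_app[of "[i]" w] by simp

lemma fwd_prod: "prod_list (map (\<lambda>i. fwd [i]) w) = fwd w"
  by (induction w) (auto simp: fwd_Nil fwd_Cons[of _ "_ # _"] fwd_Cons[symmetric])

lemma (in cq_algebra) ev_fwd: "ev h (fwd w) = prod_list (map h w)"
  by (simp add: ev_def lext_single fwd_def)

lemma fgen_fwd: "fgen g = fwd [g]"
  by (simp add: fgen_def fwd_def)

lemma fconst_mult: "fconst c * x = psc c x"
  by (simp add: fconst_def psc_def)

lemma fconst_psc: "fconst c = psc c 1"
  by (simp add: fconst_def psc_def)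

lemma pm_expand_fwd: "(x :: 'g free_word \<Rightarrow>\<^sub>0 Cq) = (\<Sum>w\<in>Poly_Mapping.keys x. psc (Poly_Mapping.lookup x w) (fwd (letters w)))"
  by (subst pm_expand) (simp add: fwd_def psc_single)

definition plin :: "(('w::monoid_add \<Rightarrow>\<^sub>0 Cq) \<Rightarrow> ('w \<Rightarrow>\<^sub>0 Cq)) \<Rightarrow> bool" where
  "plin f \<longleftrightarrow> (\<forall>x y. f (x + y) = f x + f y) \<and> (\<forall>c x. f (psc c x) = psc c (f x))"

lemma plin_add: "plin f \<Longrightarrow> f (x + y) = f x + f y"
  and plin_psc: "plin f \<Longrightarrow> f (psc c x) = psc c (f x)"
  by (auto simp: plin_def)

lemma plin_0: "plin f \<Longrightarrow> f 0 = 0"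
  using plin_psc[of f 0 0] by simp

lemma plin_sum: "plin f \<Longrightarrow> f (sum g A) = (\<Sum>a\<in>A. f (g a))"
  by (induction A rule: infinite_finite_induct) (auto simp: plin_add plin_0)

lemma plin_lext: "plin (pm.lext f)"
  by (simp add: plin_def pm.lext_add pm.lext_psc)

lemma plin_eqI:
  fixes f g :: "('g free_word \<Rightarrow>\<^sub>0 Cq) \<Rightarrow> ('g free_word \<Rightarrow>\<^sub>0 Cq)"
  assumes "plin f" "plin g" "\<And>w. f (fwd w) = g (fwd w)"
  shows "f = g"
proof
  fix x
  show "f x = g x"
    by (subst (1 2) pm_expand_fwd) (simp add: plin_sum plin_psc assms)
qed

text \<open>A type, so that operators form an instance of \<open>ring_1\<close> under composition
  and \<open>cq_algebra\<close> applies to them. It carries both the Verma module and the embedded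
  algebra.\<close>

typedef (overloaded) 'w lop = "{f :: ('w::monoid_add \<Rightarrow>\<^sub>0 Cq) \<Rightarrow> ('w \<Rightarrow>\<^sub>0 Cq). plin f}"
  morphisms app Abs_lop
  by (rule exI[of _ id]) (simp add: plin_def)

setup_lifting type_definition_lop

instantiation lop :: (monoid_add) ring_1
begin

lift_definition zero_lop :: "'a lop" is "\<lambda>_. 0" by (simp add: plin_def)
lift_definition one_lop :: "'a lop" is "\<lambda>x. x" by (simp add: plin_def)
lift_definition plus_lop :: "'a lop \<Rightarrow> 'a lop \<Rightarrow> 'a lop" is "\<lambda>f g x. f x + g x"
  by (simp add: plin_def pm.scale_right_distrib)
lift_definition minus_lop :: "'a lop \<Rightarrow> 'a lop \<Rightarrow> 'a lop" is "\<lambda>f g x. f x - g x"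
  by (simp add: plin_def pm.scale_right_diff_distrib)
lift_definition uminus_lop :: "'a lop \<Rightarrow> 'a lop" is "\<lambda>f x. - f x"
  by (simp add: plin_def)
lift_definition times_lop :: "'a lop \<Rightarrow> 'a lop \<Rightarrow> 'a lop" is "\<lambda>f g x. f (g x)"
  by (simp add: plin_def)

instance
proof
  fix a b c :: "'a lop"
  show "0 \<noteq> (1 :: 'a lop)" by transfer (metis zero_neq_one)
qed (transfer, simp add: fun_eq_iff plin_add plin_0 algebra_simps)+

end

lemma app_plin: "plin (app f)"
  using app[of f] by simp

lemma app_Abs: "plin f \<Longrightarrow> app (Abs_lop f) = f"
  by (simp add: Abs_lop_inverse)

definition lsc :: "Cq \<Rightarrow> 'a::monoid_add lop \<Rightarrow> 'a lop" where
  "lsc c f = Abs_lop (\<lambda>x. psc c (app f x))"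

definition lmul :: "('a::monoid_add \<Rightarrow>\<^sub>0 Cq) \<Rightarrow> 'a lop" where
  "lmul y = Abs_lop (\<lambda>x. y * x)"

definition llext :: "('a::monoid_add \<Rightarrow> ('a \<Rightarrow>\<^sub>0 Cq)) \<Rightarrow> 'a lop" where
  "llext h = Abs_lop (pm.lext h)"

lemma app_lin: "app f (x + y) = app f x + app f y" "app f (psc c x) = psc c (app f x)" "app f 0 = 0"
  "app f (sum g A) = (\<Sum>a\<in>A. app f (g a))"
  using app_plin[of f] by (simp_all add: plin_add plin_psc plin_0 plin_sum)

lemma app_diff: "app f (x - y) = app f x - app f y"
  using app_lin(1)[of f "x - y" y] by simp

lemma app_lsc [simp]: "app (lsc c f) x = psc c (app f x)"
  unfolding lsc_def by (subst app_Abs) (simp_all add: plin_def app_lin pm.scale_right_distrib mult.commute)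

lemma app_lmul [simp]: "app (lmul y) x = y * x"
  unfolding lmul_def by (subst app_Abs) (simp_all add: plin_def distrib_left)

lemma app_simps [simp]:
  "app 0 x = 0" "app 1 x = x" "app (f + g) x = app f x + app g x" "app (f - g) x = app f x - app g x"
  "app (- f) x = - app f x" "app (f * g) x = app f (app g x)"
  by (transfer; simp)+

lemma lop_ext: "(\<And>x. app f x = app g x) \<Longrightarrow> f = g"
  using app_inject[of f g] by (simp add: fun_eq_iff)

interpretation lo: cq_algebra "lsc :: Cq \<Rightarrow> 'w::monoid_add lop \<Rightarrow> 'w lop"
  by standard (rule lop_ext, simp add: pm.scale_right_distrib pm.scale_left_distrib app_lin)+

lemma app_llext: "app (llext h) (fwd w) = h (FW w)"
  by (simp add: llext_def app_Abs plin_lext) (simp add: fwd_def pm.lext_single)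

lemma lop_eqI: "(\<And>w. app f (fwd w) = app g (fwd w)) \<Longrightarrow> f = g"
  using plin_eqI[OF app_plin app_plin, of f g] by (simp add: app_inject)

section \<open>The Verma module of lowest weight type\<close>

text \<open>The Verma module is first built, without Serre relations, on the free algebra in the letters \<open>E\<close>:
  \<open>E i\<close> acts by left multiplication, the empty word is killed by the \<open>F i\<close> and has weight \<open>\<kappa>\<close>.\<close>

locale verma = cartan G for G :: "'i cartan_datum" +
  fixes \<kappa> :: Cq
  assumes kappa: "\<kappa> \<noteq> 0"
begin

definition wp :: "'i \<Rightarrow> 'i list \<Rightarrow> int" where
  "wp i w = (\<Sum>j\<leftarrow>w. cm G i j)"

definition vK :: "'i \<Rightarrow> 'i free_word lop" where
  "vK i = llext (\<lambda>w. psc (\<kappa> * q_at G i powi wp i (letters w)) (fwd (letters w)))"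

definition vKi :: "'i \<Rightarrow> 'i free_word lop" where
  "vKi i = llext (\<lambda>w. psc (inverse \<kappa> * q_at G i powi - wp i (letters w)) (fwd (letters w)))"

definition vE :: "'i \<Rightarrow> 'i free_word lop" where
  "vE i = lmul (fwd [i])"

text \<open>The eigenvalue of (K_i - K_i^-1) / (q_i - q_i^-1) on the word w, the empty word having
  weight \<kappa>.\<close>

definition cK :: "'i \<Rightarrow> 'i list \<Rightarrow> Cq" where
  "cK i w = inverse (q_at G i - inverse (q_at G i)) * (\<kappa> * q_at G i powi wp i w - inverse \<kappa> * q_at G i powi - wp i w)"

text \<open>Forced by the relation for [E_j, F_i] and by F_i killing the empty word: F_i is moved to
  the right through the letters.\<close>

primrec fF :: "'i \<Rightarrow> 'i list \<Rightarrow> ('i free_word \<Rightarrow>\<^sub>0 Cq)" where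
  "fF i [] = 0"
| "fF i (j # w) = fwd [j] * fF i w - (if i = j then psc (cK i w) (fwd w) else 0)"

definition vF :: "'i \<Rightarrow> 'i free_word lop" where
  "vF i = llext (\<lambda>w. fF i (letters w))"

lemma vK_fwd: "app (vK i) (fwd w) = psc (\<kappa> * q_at G i powi wp i w) (fwd w)"
  by (simp add: vK_def app_llext)

lemma vKi_fwd: "app (vKi i) (fwd w) = psc (inverse \<kappa> * q_at G i powi - wp i w) (fwd w)"
  by (simp add: vKi_def app_llext)

lemma vF_fwd: "app (vF i) (fwd w) = fF i w"
  by (simp add: vF_def app_llext)

lemma q_at_nz: "i \<in> I \<Longrightarrow> q_at G i \<noteq> 0"
  using q_var_generic[of 1] generic_nz by (auto simp: q_at_def)

lemma wp_Cons: "wp i (j # w) = cm G i j + wp i w"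
  by (simp add: wp_def)

lemma vKE:
  assumes "i \<in> I"
  shows "vK i * vE j = lsc (q_at G i powi cm G i j) (vE j * vK i)"
proof (rule lop_eqI)
  fix w
  have "\<kappa> * q_at G i powi wp i (j # w) = q_at G i powi cm G i j * (\<kappa> * q_at G i powi wp i w)"
    unfolding wp_Cons using q_at_nz[OF assms] by (simp add: power_int_add)
  then show "app (vK i * vE j) (fwd w) = app (lsc (q_at G i powi cm G i j) (vE j * vK i)) (fwd w)"
    by (simp only: vE_def app_simps app_lmul app_lsc vK_fwd fwd_Cons[symmetric] pm.sc_right pm.scale_scale)
qed

lemma vK_letter:
  assumes "i \<in> I"
  shows "app (vK i) (fwd [j] * x) = psc (q_at G i powi cm G i j) (fwd [j] * app (vK i) x)"
  using arg_cong[OF vKE[OF assms, of j], of "\<lambda>f. app f x"] by (simp add: vE_def)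

lemma vKF_word:
  assumes "i \<in> I"
  shows "app (vK i) (fF j w) = psc (\<kappa> * q_at G i powi (wp i w - cm G i j)) (fF j w)"
proof (induction w)
  case Nil
  then show ?case by (simp add: app_lin)
next
  case (Cons k w)
  have q: "q_at G i \<noteq> 0" using q_at_nz[OF assms] .
  have c: "q_at G i powi cm G i k * (\<kappa> * q_at G i powi (wp i w - cm G i j)) = \<kappa> * q_at G i powi (wp i (k # w) - cm G i j)"
    unfolding wp_Cons by (simp only: mult.left_commute[of _ \<kappa>] powi_merge[OF q]) (simp add: algebra_simps)
  have "app (vK i) (fwd [k] * fF j w) = psc (\<kappa> * q_at G i powi (wp i (k # w) - cm G i j)) (fwd [k] * fF j w)"
    unfolding vK_letter[OF assms] Cons pm.sc_right pm.scale_scale c ..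
  moreover have "wp i (k # w) - cm G i k = wp i w" by (simp add: wp_Cons)
  ultimately show ?case
    by (simp add: app_diff app_lin vK_fwd pm.scale_right_diff_distrib mult.commute)
qed

text \<open>The relation between E and F holds by the recursion that defines F, and the relations
  with K hold by the weights of words.\<close>

lemma verma_qrel: "qrel lsc G vE vF vK vKi"
proof (intro qrel.intro lo.cq_algebra_axioms qrel_axioms.intro fin_type)
  fix i j assume ij: "i \<in> I" "j \<in> I"
  have q: "q_at G i \<noteq> 0" using q_at_nz[OF ij(1)] .
  show "vK i * vK j = vK j * vK i"
    by (rule lop_eqI) (simp add: vK_fwd app_lin mult.commute)
  show "vK i * vE j = lsc (q_at G i powi cm G i j) (vE j * vK i)" by (rule vKE[OF ij(1)])
  show "vK i * vF j = lsc (q_at G i powi - cm G i j) (vF j * vK i)"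
  proof (rule lop_eqI)
    fix w
    have "\<kappa> * q_at G i powi (wp i w - cm G i j) = q_at G i powi - cm G i j * (\<kappa> * q_at G i powi wp i w)"
      by (simp only: mult.left_commute[of _ \<kappa>] powi_merge[OF q]) simp
    then show "app (vK i * vF j) (fwd w) = app (lsc (q_at G i powi - cm G i j) (vF j * vK i)) (fwd w)"
      by (simp only: app_simps app_lsc vF_fwd vK_fwd app_lin vKF_word[OF ij(1)] pm.scale_scale)
  qed
  show "vE i * vF j - vF j * vE i = (if i = j then lsc (inverse (q_at G i - inverse (q_at G i))) (vK i - vKi i) else 0)"
  proof (rule lop_eqI)
    fix w
    show "app (vE i * vF j - vF j * vE i) (fwd w) = app (if i = j then lsc (inverse (q_at G i - inverse (q_at G i))) (vK i - vKi i) else 0) (fwd w)"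
      by (simp add: vE_def fwd_Cons[of i w, symmetric] vF_fwd vK_fwd vKi_fwd cK_def pm.scale_left_diff_distrib[symmetric])
  qed
next
  fix i assume i: "i \<in> I"
  have c: "\<kappa> * q_at G i powi wp i w * (inverse \<kappa> * q_at G i powi - wp i w) = 1" for w
    using kappa q_at_nz[OF i] by (simp add: power_int_minus field_simps)
  show "vK i * vKi i = 1"
    by (rule lop_eqI) (simp only: app_simps vK_fwd vKi_fwd app_lin pm.scale_scale mult.commute c pm.scale_one)
  show "vKi i * vK i = 1"
    by (rule lop_eqI) (simp only: app_simps vK_fwd vKi_fwd app_lin pm.scale_scale c pm.scale_one)
qed

end

section \<open>The ideal of the quantized enveloping algebra\<close>

abbreviation frc :: "'i set \<Rightarrow> 'i free_alg set" where
  "frc I \<equiv> carrier (free_ring I)"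

definition gword :: "'i set \<Rightarrow> 'i gen list \<Rightarrow> bool" where
  "gword I w \<longleftrightarrow> (\<forall>g\<in>set w. set_gen g \<subseteq> I)"

lemma frc_span: "frc I = pm.span {fwd w | w. gword I w}"
proof
  show "frc I \<subseteq> pm.span {fwd w | w. gword I w}"
  proof
    fix x assume x: "x \<in> frc I"
    have "(\<Sum>w\<in>Poly_Mapping.keys x. psc (Poly_Mapping.lookup x w) (fwd (letters w))) \<in> pm.span {fwd w | w. gword I w}"
      using x by (intro pm.span_sum pm.span_scale pm.span_base) (auto simp: free_ring_def gword_def)
    then show "x \<in> pm.span {fwd w | w. gword I w}" by (subst pm_expand_fwd)
  qed
  show "pm.span {fwd w | w. gword I w} \<subseteq> frc I"
  proof
    fix x assume "x \<in> pm.span {fwd w | w. gword I w}"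
    then show "x \<in> frc I"
    proof (induction rule: pm.span_induct_alt)
      case (step c b y)
      then obtain w where w: "b = fwd w" "gword I w" by auto
      have "psc c b = Poly_Mapping.single (FW w) c" unfolding w fwd_def psc_single by simp
      then have "Poly_Mapping.keys (psc c b) \<subseteq> {FW w}" by simp
      then have "Poly_Mapping.keys (psc c b + y) \<subseteq> insert (FW w) (Poly_Mapping.keys y)"
        using keys_add[of "psc c b" y] by auto
      then show ?case using step(2) w(2) unfolding free_ring_def gword_def by (auto dest!: subsetD)
    qed (simp add: free_ring_def)
  qed
qed

lemma frc_add: "x \<in> frc I \<Longrightarrow> y \<in> frc I \<Longrightarrow> x + y \<in> frc I"
  and frc_diff: "x \<in> frc I \<Longrightarrow> y \<in> frc I \<Longrightarrow> x - y \<in> frc I"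
  and frc_uminus: "x \<in> frc I \<Longrightarrow> - x \<in> frc I"
  and frc_psc: "x \<in> frc I \<Longrightarrow> psc c x \<in> frc I"
  and frc_0: "0 \<in> frc I"
  by (simp_all add: frc_span pm.span_add pm.span_diff pm.span_scale pm.span_zero pm.span_neg)

lemma frc_fwd: "gword I w \<Longrightarrow> fwd w \<in> frc I"
  unfolding frc_span by (rule pm.span_base) blast

lemma frc_1: "1 \<in> frc I"
  using frc_fwd[of I "[]"] by (simp add: fwd_Nil gword_def)

lemma frc_mult: "x \<in> frc I \<Longrightarrow> y \<in> frc I \<Longrightarrow> x * y \<in> frc I"
  unfolding frc_span
proof (rule pm.span_mult; (assumption)?)
  fix a b :: "'a free_alg" assume "a \<in> {fwd w |w. gword I w}" "b \<in> {fwd w |w. gword I w}"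
  then obtain v w where "a = fwd v" "b = fwd w" "gword I v" "gword I w" by auto
  then show "a * b \<in> pm.span {fwd w |w. gword I w}"
    by (intro pm.span_base CollectI exI[of _ "v @ w"]) (auto simp: fwd_app gword_def)
qed

lemma frc_power: "x \<in> frc I \<Longrightarrow> x ^ n \<in> frc I"
  by (induction n) (auto simp: frc_1 frc_mult)

lemma frc_fgen: "set_gen g \<subseteq> I \<Longrightarrow> fgen g \<in> frc I"
  using frc_fwd[of I "[g]"] by (simp add: fgen_fwd gword_def)

lemma frc_fconst: "fconst c \<in> frc I"
  by (simp add: fconst_psc frc_psc frc_1)

lemma free_ring_simps [simp]:
  "mult (free_ring I) = (*)" "one (free_ring I) = 1" "zero (free_ring I) = 0" "add (free_ring I) = (+)"
  by (simp_all add: free_ring_def)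

lemma free_ring_ring: "ring (free_ring I)"
proof (rule ringI)
  show "abelian_group (free_ring I)"
    by (rule abelian_groupI) (auto simp: frc_add frc_0 algebra_simps intro: bexI[of _ "- x" for x] frc_uminus)
  show "monoid (free_ring I)"
    by (rule monoidI) (auto simp: frc_mult frc_1 mult.assoc)
qed (auto simp: algebra_simps)

lemma uq_relations_frc: "uq_relations G \<subseteq> frc (idx G)"
proof -
  have s: "serre G X i j \<in> frc (idx G)" if "set_gen (X i) \<subseteq> idx G" "set_gen (X j) \<subseteq> idx G" for X i j
    unfolding serre_def Let_def frc_span
    by (rule pm.span_sum) (use that in \<open>auto simp: frc_span[symmetric] intro!: frc_mult frc_fconst frc_fgen frc_power\<close>)
  show ?thesis unfolding uq_relations_def
    by (auto intro!: frc_diff frc_mult frc_fgen frc_1 frc_fconst frc_0 s)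
qed

lemma uq_ideal_ideal: "ideal (uq_ideal G) (free_ring (idx G))"
  unfolding uq_ideal_def by (rule ring.genideal_ideal[OF free_ring_ring uq_relations_frc])

lemma uq_ideal_frc: "x \<in> uq_ideal G \<Longrightarrow> x \<in> frc (idx G)"
  using ideal.Icarr[OF uq_ideal_ideal] .

lemma uq_ideal_add: "x \<in> uq_ideal G \<Longrightarrow> y \<in> uq_ideal G \<Longrightarrow> x + y \<in> uq_ideal G"
  using additive_subgroup.a_closed[OF ideal.axioms(1)[OF uq_ideal_ideal[of G]]] by simp

lemma uq_ideal_0: "0 \<in> uq_ideal G"
  using additive_subgroup.zero_closed[OF ideal.axioms(1)[OF uq_ideal_ideal[of G]]] by simp

lemma uq_ideal_l: "x \<in> frc (idx G) \<Longrightarrow> y \<in> uq_ideal G \<Longrightarrow> x * y \<in> uq_ideal G"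
  using ideal.I_l_closed[OF uq_ideal_ideal[of G]] by simp

lemma uq_ideal_r: "x \<in> frc (idx G) \<Longrightarrow> y \<in> uq_ideal G \<Longrightarrow> y * x \<in> uq_ideal G"
  using ideal.I_r_closed[OF uq_ideal_ideal[of G]] by simp

lemma uq_ideal_psc: "y \<in> uq_ideal G \<Longrightarrow> psc c y \<in> uq_ideal G"
  using uq_ideal_l[OF frc_fconst] by (metis fconst_mult)

lemma uq_ideal_subspace: "pm.subspace (uq_ideal G)"
  by (simp add: pm.subspace_def uq_ideal_0 uq_ideal_add uq_ideal_psc)

lemma uq_ideal_rel: "x \<in> uq_relations G \<Longrightarrow> x \<in> uq_ideal G"
  unfolding uq_ideal_def using ring.genideal_self[OF free_ring_ring uq_relations_frc] by blast

lemma uq_ideal_min: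
  assumes "uq_relations G \<subseteq> J" "pm.subspace J" "J \<subseteq> frc (idx G)"
    "\<And>x y. x \<in> frc (idx G) \<Longrightarrow> y \<in> J \<Longrightarrow> x * y \<in> J" "\<And>x y. x \<in> frc (idx G) \<Longrightarrow> y \<in> J \<Longrightarrow> y * x \<in> J"
  shows "uq_ideal G \<subseteq> J"
proof -
  interpret R: ring "free_ring (idx G)" by (rule free_ring_ring)
  have inv: "a_inv (free_ring (idx G)) x = - x" if "x \<in> frc (idx G)" for x
    by (rule R.minus_equality) (use that frc_uminus in auto)
  have "ideal J (free_ring (idx G))"
  proof (rule idealI[OF free_ring_ring])
    show "subgroup J (add_monoid (free_ring (idx G)))"
    proof (rule group.subgroupI[OF R.a_group])
      show "inv\<^bsub>add_monoid (free_ring (idx G))\<^esub> a \<in> J" if "a \<in> J" for a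
      proof -
        have "a \<in> frc (idx G)" using that assms(3) by blast
        then show ?thesis using inv[of a] pm.subspace_neg[OF assms(2) that] by (simp add: a_inv_def)
      qed
    qed (use assms(2,3) pm.subspace_0 pm.subspace_add in auto)
  qed (use assms(4,5) in auto)
  then show ?thesis unfolding uq_ideal_def using R.genideal_minimal assms(1) by blast
qed

lemma serre_fr:
  assumes g: "generic (q_at G i)" and c: "cm G i j \<le> 0"
  shows "serre G X i j = psc ((-1) ^ nat (1 - cm G i j) * qfact (q_at G i) (nat (1 - cm G i j)))
     (pm.fr (q_at G i) (cm G i j) (fgen (X i)) (fgen (X j)) (nat (1 - cm G i j)))"
proof -
  have "int (nat (1 - cm G i j)) = 1 - cm G i j" using c by simp
  from pm.fr_serre[OF g this, of "fgen (X i)" "fgen (X j)", symmetric]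
  show ?thesis unfolding serre_def Let_def by (simp add: fconst_mult mult.assoc)
qed

section \<open>The action on the Verma module\<close>

lemma lmul_hom: "lmul (x * y) = lmul x * lmul y" "lmul (x - y) = lmul x - lmul y" "lmul (psc c x) = lsc c (lmul x)"
  by (rule lop_ext, simp add: mult.assoc left_diff_distrib)+

lemma lmul_fr: "lmul (pm.fr v a e x m) = lo.fr v a (lmul e) (lmul x) m"
  by (induction m) (simp_all add: lmul_hom pm.fr.simps lo.fr.simps)

context cartan
begin

text \<open>The type of letters may be larger than the index set, hence the restriction to words
  over I.\<close>

definition PI :: "('i free_word \<Rightarrow>\<^sub>0 Cq) set" where
  "PI = pm.span {fwd w | w. set w \<subseteq> I}"

definition srr :: "'i \<Rightarrow> 'i \<Rightarrow> ('i free_word \<Rightarrow>\<^sub>0 Cq)" where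
  "srr i j = pm.fr (q_at G i) (cm G i j) (fwd [i]) (fwd [j]) (nat (1 - cm G i j))"

text \<open>The two-sided ideal of \<open>PI\<close> generated by the Serre elements.
  \<open>PI\<close> modulo \<open>SI\<close> is the Verma module, but the quotient is never formed;
  the facts below say that operators preserve both spaces.\<close>

definition SI :: "('i free_word \<Rightarrow>\<^sub>0 Cq) set" where
  "SI = pm.span {fwd v * srr i j * fwd w | v w i j. set v \<subseteq> I \<and> set w \<subseteq> I \<and> i \<in> I \<and> j \<in> I \<and> i \<noteq> j}"

lemma PI_fwd: "set w \<subseteq> I \<Longrightarrow> fwd w \<in> PI"
  unfolding PI_def by (rule pm.span_base) blast

lemma PI_add: "x \<in> PI \<Longrightarrow> y \<in> PI \<Longrightarrow> x + y \<in> PI"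
  and PI_diff: "x \<in> PI \<Longrightarrow> y \<in> PI \<Longrightarrow> x - y \<in> PI"
  and PI_psc: "x \<in> PI \<Longrightarrow> psc c x \<in> PI"
  and PI_0: "0 \<in> PI"
  by (simp_all add: PI_def pm.span_add pm.span_diff pm.span_scale pm.span_zero)

lemma SI_add: "x \<in> SI \<Longrightarrow> y \<in> SI \<Longrightarrow> x + y \<in> SI"
  and SI_diff: "x \<in> SI \<Longrightarrow> y \<in> SI \<Longrightarrow> x - y \<in> SI"
  and SI_psc: "x \<in> SI \<Longrightarrow> psc c x \<in> SI"
  and SI_0: "0 \<in> SI"
  by (simp_all add: SI_def pm.span_add pm.span_diff pm.span_scale pm.span_zero)

lemma SI_gen: "set v \<subseteq> I \<Longrightarrow> set w \<subseteq> I \<Longrightarrow> i \<in> I \<Longrightarrow> j \<in> I \<Longrightarrow> i \<noteq> j \<Longrightarrow> fwd v * srr i j * fwd w \<in> SI"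
  unfolding SI_def by (rule pm.span_base) blast

lemma SI_op:
  assumes g: "\<And>v w i j. set v \<subseteq> I \<Longrightarrow> set w \<subseteq> I \<Longrightarrow> i \<in> I \<Longrightarrow> j \<in> I \<Longrightarrow> i \<noteq> j \<Longrightarrow> app f (fwd v * srr i j * fwd w) \<in> SI"
    and x: "x \<in> SI"
  shows "app f x \<in> SI"
  using x unfolding SI_def
proof (induction rule: pm.span_induct_alt)
  case (step c b y)
  then have "app f b \<in> SI" using g by auto
  then show ?case using step unfolding SI_def[symmetric] by (simp add: app_lin SI_add SI_psc)
qed (simp add: app_lin pm.span_zero)

lemma PI_op:
  assumes g: "\<And>w. set w \<subseteq> I \<Longrightarrow> app f (fwd w) \<in> M" and M: "pm.subspace M"
    and x: "x \<in> PI"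
  shows "app f x \<in> M"
  using x unfolding PI_def
proof (induction rule: pm.span_induct_alt)
  case (step c b y)
  then have "app f b \<in> M" using g by auto
  then show ?case using step M by (simp add: app_lin pm.subspace_add pm.subspace_scale)
qed (simp add: app_lin M pm.subspace_0)

lemma PI_subspace: "pm.subspace PI" and SI_subspace: "pm.subspace SI"
  by (simp_all add: PI_def SI_def)

lemma srr_PI: "i \<in> I \<Longrightarrow> j \<in> I \<Longrightarrow> i \<noteq> j \<Longrightarrow> y \<in> PI \<Longrightarrow> srr i j * y \<in> SI"
  using PI_op[of "lmul (srr i j)" SI y] SI_gen[of "[]" _ i j] SI_subspace by (simp add: fwd_Nil)

lemma SI_letter: assumes "k \<in> I" "x \<in> SI" shows "fwd [k] * x \<in> SI"
proof -
  have "app (lmul (fwd [k])) x \<in> SI"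
  proof (rule SI_op[OF _ assms(2)])
    fix v w i j assume "set v \<subseteq> I" "set w \<subseteq> I" "i \<in> I" "j \<in> I" "i \<noteq> j"
    then show "app (lmul (fwd [k])) (fwd v * srr i j * fwd w) \<in> SI"
      using SI_gen[of "k # v" w i j] assms(1) by (simp add: fwd_Cons[of k v] mult.assoc)
  qed
  then show ?thesis by simp
qed

lemma PI_letter: assumes "k \<in> I" "x \<in> PI" shows "fwd [k] * x \<in> PI"
proof -
  have "app (lmul (fwd [k])) x \<in> PI"
  proof (rule PI_op[OF _ PI_subspace assms(2)])
    fix w assume "set w \<subseteq> I"
    then show "app (lmul (fwd [k])) (fwd w) \<in> PI"
      using PI_fwd[of "k # w"] assms(1) by (simp add: fwd_Cons[of k w])
  qed
  then show ?thesis by simp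
qed

end

context verma
begin

sublocale vq: qrel lsc G vE vF vK vKi by (rule verma_qrel)

lemma lmul_srr: "lmul (srr i j) = lo.fr (q_at G i) (cm G i j) (vE i) (vE j) (nat (1 - cm G i j))"
  by (simp add: srr_def lmul_fr vE_def)

lemma nat_cm: "i \<in> I \<Longrightarrow> j \<in> I \<Longrightarrow> i \<noteq> j \<Longrightarrow> nat (1 - cm G i j) = Suc (nat (- cm G i j)) \<and> cm G i j = - int (nat (- cm G i j))"
  using vq.cm_nonpos[of i j] by auto

lemma PI_K: assumes "k \<in> I" "x \<in> PI" shows "app (vK k) x \<in> PI" "app (vKi k) x \<in> PI"
  by (rule PI_op[OF _ PI_subspace assms(2)], simp add: vK_fwd vKi_fwd PI_psc PI_fwd)+

lemma fF_PI: "set w \<subseteq> I \<Longrightarrow> fF k w \<in> PI"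
  by (induction w) (auto simp: PI_0 PI_diff PI_psc PI_fwd PI_letter)

lemma PI_F: assumes "k \<in> I" "x \<in> PI" shows "app (vF k) x \<in> PI"
  by (rule PI_op[OF _ PI_subspace assms(2)]) (simp add: vF_fwd fF_PI)

text \<open>An operator that commutes with every letter up to a scalar does so with every Serre
  element, since the latter is homogeneous (\<open>fr_conj\<close>).\<close>

lemma SI_K_aux:
  assumes x: "x \<in> SI" and f: "\<And>i. i \<in> I \<Longrightarrow> \<exists>c. f * vE i = lsc c (vE i * f)" "\<And>w. set w \<subseteq> I \<Longrightarrow> app f (fwd w) \<in> PI"
  shows "app f x \<in> SI"
proof (rule SI_op[OF _ x])
  fix v w i j assume vw: "set v \<subseteq> I" "set w \<subseteq> I" and ij: "i \<in> I" "j \<in> I" "i \<noteq> j"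
  obtain c d where "f * vE i = lsc c (vE i * f)" "f * vE j = lsc d (vE j * f)" using f ij by metis
  then have "\<exists>c. f * lmul (srr i j) = lsc c (lmul (srr i j) * f)"
    unfolding lmul_srr using lo.fr_conj by blast
  then obtain c where "f * lmul (srr i j) = lsc c (lmul (srr i j) * f)" by blast
  then have "app (f * lmul (srr i j)) (fwd w) = app (lsc c (lmul (srr i j) * f)) (fwd w)" by simp
  then have "app f (srr i j * fwd w) = psc c (srr i j * app f (fwd w))" by simp
  then have base: "app f (srr i j * fwd w) \<in> SI" using f(2)[OF vw(2)] ij by (simp add: SI_psc srr_PI)
  show "app f (fwd v * srr i j * fwd w) \<in> SI" using vw(1)
  proof (induction v)
    case Nil
    then show ?case using base by (simp add: fwd_Nil)
  next
    case (Cons l v)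
    then obtain d where "f * vE l = lsc d (vE l * f)" using f(1)[of l] by auto
    then have "app (f * vE l) y = app (lsc d (vE l * f)) y" for y by simp
    then have "app f (fwd [l] * y) = psc d (fwd [l] * app f y)" for y by (simp add: vE_def)
    then show ?case using Cons by (simp add: fwd_Cons[of l v] mult.assoc SI_psc SI_letter)
  qed
qed

lemma SI_K: assumes k: "k \<in> I" and x: "x \<in> SI" shows "app (vK k) x \<in> SI" "app (vKi k) x \<in> SI"
  by (rule SI_K_aux[OF x]; use k in \<open>auto intro: vq.KE vq.KiE PI_K PI_fwd\<close>)+

lemma vF_letter:
  assumes "k \<in> I" "l \<in> I"
  shows "app (vF k) (fwd [l] * y) = fwd [l] * app (vF k) y -
    (if l = k then psc (inverse (q_at G l - inverse (q_at G l))) (app (vK l) y - app (vKi l) y) else 0)"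
proof -
  have "app (vE l * vF k - vF k * vE l) y = app (if l = k then lsc (inverse (q_at G l - inverse (q_at G l))) (vK l - vKi l) else 0) y"
    using vq.EF[OF assms(2,1)] by simp
  then show ?thesis by (auto simp: vE_def algebra_simps split: if_splits)
qed

text \<open>As left multiplication a Serre element commutes with F_k by \<open>serre_comm_F\<close>,
  so F_k passes it and acts on the word behind it. The letters in front are passed at the cost of
  terms in K and its inverse, under which the ideal is stable.\<close>

lemma SI_F: assumes k: "k \<in> I" and x: "x \<in> SI" shows "app (vF k) x \<in> SI"
proof (rule SI_op[OF _ x])
  fix v w i j assume vw: "set v \<subseteq> I" "set w \<subseteq> I" and ij: "i \<in> I" "j \<in> I" "i \<noteq> j"
  have "lmul (srr i j) * vF k = vF k * lmul (srr i j)"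
    unfolding lmul_srr using vq.serre_comm_F[OF ij k] nat_cm[OF ij] by metis
  then have "app (lmul (srr i j) * vF k) (fwd w) = app (vF k * lmul (srr i j)) (fwd w)" by simp
  then have base: "app (vF k) (srr i j * fwd w) \<in> SI"
    using srr_PI[OF ij PI_F[OF k PI_fwd[OF vw(2)]]] by simp
  show "app (vF k) (fwd v * srr i j * fwd w) \<in> SI" using vw(1)
  proof (induction v)
    case Nil
    then show ?case using base by (simp add: fwd_Nil)
  next
    case (Cons l v)
    have "fwd v * srr i j * fwd w \<in> SI" using SI_gen vw ij Cons by simp
    then show ?case using Cons k vF_letter[OF k, of l "fwd v * srr i j * fwd w"]
      by (simp add: fwd_Cons[of l v] mult.assoc SI_psc SI_letter SI_diff SI_K)
  qed
qed

section \<open>The representation of the free algebra and the annihilator of the empty word\<close>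

fun gop :: "'i gen \<Rightarrow> 'i free_word lop" where
  "gop (GenE i) = vE i"
| "gop (GenF i) = vF i"
| "gop (GenK i) = vK i"
| "gop (GenKinv i) = vKi i"

abbreviation vrep where "vrep \<equiv> lo.ev gop"

lemma gop_pres: "set_gen g \<subseteq> I \<Longrightarrow> x \<in> SI \<Longrightarrow> app (gop g) x \<in> SI" "set_gen g \<subseteq> I \<Longrightarrow> x \<in> PI \<Longrightarrow> app (gop g) x \<in> PI"
  by (cases g; auto simp: SI_K SI_F PI_K PI_F SI_letter PI_letter vE_def)+

lemma vrep_pres:
  assumes M: "pm.subspace M" and g: "\<And>g x. set_gen g \<subseteq> I \<Longrightarrow> x \<in> M \<Longrightarrow> app (gop g) x \<in> M"
    and y: "y \<in> frc I" and x: "x \<in> M"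
  shows "app (vrep y) x \<in> M"
  using y unfolding frc_span
proof (induction rule: pm.span_induct_alt)
  case base
  then show ?case using pm.subspace_0[OF M] by simp
next
  case (step c b y)
  then obtain w where w: "b = fwd w" "gword I w" by auto
  have "app (prod_list (map gop w)) x \<in> M" using w(2)
    by (induction w) (auto simp: x g gword_def)
  then show ?case using step M by (simp add: w lo.ev_add lo.ev_psc lo.ev_fwd pm.subspace_add pm.subspace_scale)
qed

lemmas vrep_SI = vrep_pres[OF SI_subspace gop_pres(1)]
lemmas vrep_PI = vrep_pres[OF PI_subspace gop_pres(2)]

text \<open>The Serre element in the F kills the empty word because F_i and F_j do, and it commutes
  with all E_k by the exchanged form of \<open>serre_comm_F\<close>.\<close>

lemma fr_vF_kill:
  assumes ij: "i \<in> I" "j \<in> I" "i \<noteq> j" and p: "p \<in> PI"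
  shows "app (lo.fr (q_at G i) (cm G i j) (vF i) (vF j) (nat (1 - cm G i j))) p = 0"
proof -
  interpret vs: qrel lsc G vF vE vKi vK by (rule vq.swap)
  let ?f = "lo.fr (q_at G i) (cm G i j) (vF i) (vF j) (nat (1 - cm G i j))"
  have z: "app (lo.fr v a (vF i) (vF j) m) (fwd []) = 0" for v a m
    by (induction m) (simp_all add: vF_fwd lo.fr.simps app_lin)
  have "app ?f (fwd w) = 0" if "set w \<subseteq> I" for w
    using that
  proof (induction w)
    case Nil
    then show ?case using z by simp
  next
    case (Cons k w)
    then have k: "k \<in> I" by simp
    have "?f * vE k = vE k * ?f" using vs.serre_comm_F[OF ij k] nat_cm[OF ij] by metis
    then have "app (?f * vE k) (fwd w) = app (vE k * ?f) (fwd w)" by simp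
    then show ?case using Cons by (simp add: vE_def fwd_Cons[of k w])
  qed
  then have "app ?f p \<in> {0}" by (intro PI_op[OF _ _ p]) (auto simp: pm.subspace_def)
  then show ?thesis by simp
qed

text \<open>The Serre elements in the E map \<open>PI\<close> into \<open>SI\<close> by construction
  of \<open>SI\<close>; all other relations act as zero on \<open>PI\<close>.\<close>

lemma vrep_rel:
  assumes r: "r \<in> uq_relations G" and p: "p \<in> PI"
  shows "app (vrep r) p \<in> SI"
proof -
  note hom = lo.ev_add lo.ev_diff lo.ev_mult lo.ev_psc lo.ev_one fconst_mult
  have sE: "app (vrep (serre G GenE i j)) p \<in> SI" if ij: "i \<in> I" "j \<in> I" "i \<noteq> j" for i j
    using srr_PI[OF ij p] vq.cm_nonpos[OF ij]
    by (simp add: serre_fr[OF vq.q_generic[OF ij(1)]] lo.ev_psc lo.ev_fr lmul_srr[symmetric] SI_psc)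
  have sF: "app (vrep (serre G GenF i j)) p \<in> SI" if ij: "i \<in> I" "j \<in> I" "i \<noteq> j" for i j
    using fr_vF_kill[OF ij p] vq.cm_nonpos[OF ij]
    by (simp add: serre_fr[OF vq.q_generic[OF ij(1)]] lo.ev_psc lo.ev_fr SI_0)
  have eq: "vK i * vE j * vKi i = lsc (q_at G i powi cm G i j) (vE j)"
    "vK i * vF j * vKi i = lsc (q_at G i powi - cm G i j) (vF j)" if "i \<in> I" "j \<in> I" for i j
    unfolding vq.KE[OF that] vq.KF[OF that] using vq.KKi[OF that(1)] by (simp_all add: mult.assoc)
  show ?thesis
    using r unfolding uq_relations_def
    by (auto simp: hom vq.KKi vq.KiK vq.KK vq.EF eq SI_0 sE sF simp del: app_simps) (auto simp: SI_0)
qed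

lemma uq_ideal_vrep:
  assumes x: "x \<in> uq_ideal G" and p: "p \<in> PI"
  shows "app (vrep x) p \<in> SI"
proof -
  have "uq_ideal G \<subseteq> {x \<in> frc I. \<forall>p\<in>PI. app (vrep x) p \<in> SI}"
  proof (rule uq_ideal_min)
    show "uq_relations G \<subseteq> {x \<in> frc I. \<forall>p\<in>PI. app (vrep x) p \<in> SI}"
      using vrep_rel uq_relations_frc[of G] by auto
    show "pm.subspace {x \<in> frc I. \<forall>p\<in>PI. app (vrep x) p \<in> SI}"
      by (auto simp: pm.subspace_def frc_0 frc_add frc_psc lo.ev_add lo.ev_psc SI_0 SI_add SI_psc)
  qed (auto simp: frc_mult lo.ev_mult vrep_SI vrep_PI)
  then show ?thesis using x p by auto
qed

text \<open>The annihilator of the generating vector of the Verma module modulo the Serre relations.\<close>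

definition LF :: "'i free_alg set" where
  "LF = {x \<in> frc I. app (vrep x) 1 \<in> SI}"

lemma one_PI: "1 \<in> PI"
  using PI_fwd[of "[]"] by (simp add: fwd_Nil)

lemma LF_ideal: "x \<in> uq_ideal G \<Longrightarrow> x \<in> LF"
  using uq_ideal_vrep one_PI uq_ideal_frc by (auto simp: LF_def)

lemma LF_subspace: "pm.subspace LF"
  by (auto simp: LF_def pm.subspace_def frc_0 frc_add frc_psc lo.ev_add lo.ev_psc SI_0 SI_add SI_psc)

lemma LF_left: "u \<in> frc I \<Longrightarrow> x \<in> LF \<Longrightarrow> u * x \<in> LF"
  by (auto simp: LF_def frc_mult lo.ev_mult vrep_SI)

lemma LF_F: "i \<in> I \<Longrightarrow> fgen (GenF i) \<in> LF"
  using vF_fwd[of i "[]"] by (simp add: LF_def frc_fgen fwd_Nil SI_0)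

lemma LF_K: "i \<in> I \<Longrightarrow> fgen (GenK i) - psc \<kappa> 1 \<in> LF"
  using vK_fwd[of i "[]"] by (simp add: LF_def frc_fgen frc_diff frc_psc frc_1 fwd_Nil lo.ev_diff lo.ev_psc lo.ev_one wp_def SI_0)

text \<open>Applied to the empty word, a positive element reproduces the polynomial p it comes from,
  so membership in the annihilator puts p into \<open>SI\<close>. The image of \<open>SI\<close>
  lies in the ideal of relations because the quantum factorial relating \<open>serre\<close> to
  \<open>srr\<close> is invertible.\<close>

lemma LF_positive:
  assumes x: "x \<in> LF" and p: "x = pm.ev (\<lambda>i. fgen (GenE i)) p" "p \<in> PI"
  shows "x \<in> uq_ideal G"
proof -
  let ?e = "pm.ev (\<lambda>i. fgen (GenE i))"
  have words: "app (vrep (?e (fwd w))) 1 = fwd w" for w :: "'i list"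
  proof (induction w)
    case (Cons i w)
    have "?e (fwd (i # w)) = fgen (GenE i) * ?e (fwd w)" by (simp add: pm.ev_fwd)
    then show ?case using Cons by (simp add: fwd_Cons[of i w] lo.ev_mult vE_def)
  qed (simp add: fwd_Nil pm.ev_one lo.ev_one)
  have "(\<lambda>p. app (vrep (?e p)) 1) = (\<lambda>p. p)"
    by (rule plin_eqI) (simp_all only: plin_def pm.ev_add pm.ev_psc lo.ev_add lo.ev_psc app_simps app_lsc words simp_thms)
  then have "app (vrep (?e p)) 1 = p" by (rule fun_cong)
  then have "p \<in> SI" using x p by (simp add: LF_def)
  then have "?e p \<in> uq_ideal G" unfolding SI_def
  proof (induction rule: pm.span_induct_alt)
    case base
    then show ?case by (simp add: uq_ideal_0)
  next
    case (step c b y)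
    then obtain v w i j where b: "b = fwd v * srr i j * fwd w" "set v \<subseteq> I" "set w \<subseteq> I" and ij: "i \<in> I" "j \<in> I" "i \<noteq> j" by auto
    have E: "?e (fwd w) \<in> frc I" if "set w \<subseteq> I" for w
      unfolding pm.ev_fwd using that by (induction w) (simp_all add: frc_1 frc_mult frc_fgen)
    have "serre G GenE i j \<in> uq_ideal G" using ij by (intro uq_ideal_rel) (auto simp: uq_relations_def)
    moreover have "serre G GenE i j = psc ((-1) ^ nat (1 - cm G i j) * qfact (q_at G i) (nat (1 - cm G i j))) (?e (srr i j))"
      using serre_fr[OF vq.q_generic[OF ij(1)] vq.cm_nonpos[OF ij], of GenE] by (simp add: srr_def pm.ev_fr pm.ev_fwd)
    moreover have "(-1) ^ nat (1 - cm G i j) * qfact (q_at G i) (nat (1 - cm G i j)) \<noteq> 0"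
      using qfact_nz[OF vq.q_generic[OF ij(1)]] by simp
    ultimately have "\<exists>c. c \<noteq> 0 \<and> psc c (?e (srr i j)) \<in> uq_ideal G" by metis
    then obtain c' where c': "c' \<noteq> 0" "psc c' (?e (srr i j)) \<in> uq_ideal G" by blast
    have "psc (inverse c') (psc c' (?e (srr i j))) \<in> uq_ideal G" by (rule uq_ideal_psc[OF c'(2)])
    then have "?e (srr i j) \<in> uq_ideal G" using c'(1) by simp
    then have "?e b \<in> uq_ideal G" unfolding b(1) pm.ev_mult by (intro uq_ideal_r uq_ideal_l E b)
    then show ?case unfolding pm.ev_add pm.ev_psc by (intro uq_ideal_add uq_ideal_psc step)
  qed
  then show ?thesis using p by simp
qed

end

section \<open>A faithful unital representation in a ring type\<close>

context cq_algebra
begin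

lemma lext_antimult:
  assumes "\<And>v w. f (v + w) = f w * f v"
  shows "lext f (x * y) = lext f y * lext f x"
proof -
  have "x * y = (\<Sum>k\<in>Poly_Mapping.keys x. \<Sum>l\<in>Poly_Mapping.keys y. Poly_Mapping.single (k + l) (Poly_Mapping.lookup x k * Poly_Mapping.lookup y l))"
    by (subst pm_expand[of x], subst pm_expand[of y]) (simp add: sum_product mult_single)
  then have "lext f (x * y) = (\<Sum>k\<in>Poly_Mapping.keys x. \<Sum>l\<in>Poly_Mapping.keys y. (Poly_Mapping.lookup x k * Poly_Mapping.lookup y l) *s (f l * f k))"
    by (simp add: lext_sum lext_single assms)
  also have "\<dots> = (\<Sum>l\<in>Poly_Mapping.keys y. \<Sum>k\<in>Poly_Mapping.keys x. (Poly_Mapping.lookup x k * Poly_Mapping.lookup y l) *s (f l * f k))"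
    by (rule sum.swap)
  also have "\<dots> = lext f y * lext f x"
    by (simp add: lext_def sum_product mult.commute)
  finally show ?thesis .
qed

end

text \<open>K is inverted because reversing products changes the sign of [E_i, F_i], and the sign of
  K_i - K_i^-1 has to follow.\<close>

fun ginv :: "'i gen \<Rightarrow> 'i gen" where
  "ginv (GenE i) = GenE i"
| "ginv (GenF i) = GenF i"
| "ginv (GenK i) = GenKinv i"
| "ginv (GenKinv i) = GenK i"

lemma ginv_ginv [simp]: "ginv (ginv g) = g" and set_gen_ginv [simp]: "set_gen (ginv g) = set_gen g"
  by (cases g; simp)+

definition frev :: "'i free_alg \<Rightarrow> 'i free_alg" where
  "frev = pm.lext (\<lambda>w. fwd (rev (map ginv (letters w))))"

lemma frev_add: "frev (x + y) = frev x + frev y"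
  and frev_psc: "frev (psc c x) = psc c (frev x)"
  and frev_0 [simp]: "frev 0 = 0"
  and frev_mult: "frev (x * y) = frev y * frev x"
  and frev_sum: "frev (sum g A) = (\<Sum>a\<in>A. frev (g a))"
  unfolding frev_def by (simp_all add: pm.lext_add pm.lext_psc pm.lext_sum)
    (rule pm.lext_antimult, simp add: plus_free_word_def fwd_app)

lemma frev_diff: "frev (x - y) = frev x - frev y"
  using frev_add[of "x - y" y] by simp

lemma frev_fwd: "frev (fwd w) = fwd (rev (map ginv w))"
  by (simp add: frev_def fwd_def pm.lext_single)

lemma frev_1: "frev 1 = 1"
  using frev_fwd[of "[]"] by (simp add: fwd_Nil)

lemma frev_power: "frev (x ^ n) = frev x ^ n"
  by (induction n) (simp_all add: frev_1 frev_mult power_commutes)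

lemma frev_fgen: "frev (fgen g) = fgen (ginv g)"
  by (simp add: fgen_fwd frev_fwd)

lemma frev_frev: "frev (frev x) = x"
proof -
  have words: "frev (frev (fwd w)) = fwd w" for w :: "'a gen list" by (simp add: frev_fwd rev_map comp_def)
  have "(\<lambda>x :: 'a free_alg. frev (frev x)) = (\<lambda>x. x)"
    by (rule plin_eqI) (simp_all only: plin_def frev_add frev_psc words simp_thms)
  then show ?thesis by (rule fun_cong)
qed

lemma frev_frc: "x \<in> frc I \<Longrightarrow> frev x \<in> frc I"
  unfolding frc_span[of I]
proof (induction rule: pm.span_induct_alt)
  case (step c b y)
  then obtain w where "b = fwd w" "gword I w" by auto
  then have "frev b \<in> frc I" by (auto intro!: frc_fwd simp: gword_def frev_fwd)
  then show ?case using step unfolding frc_span[symmetric] by (simp add: frev_add frev_psc frc_add frc_psc)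
qed (simp add: pm.span_zero)

lemma frev_serre:
  assumes "ginv (X i) = X i" "ginv (X j) = X j"
  shows "frev (serre G X i j) = psc ((-1) ^ nat (1 - cm G i j)) (serre G X i j)"
proof -
  let ?N = "nat (1 - cm G i j)"
  let ?c = "\<lambda>k. qbinom (q_at G i) ?N k"
  have "frev (serre G X i j) = (\<Sum>k=0..?N. psc ((- 1) ^ k * ?c k) (fgen (X i) ^ k * fgen (X j) * fgen (X i) ^ (?N - k)))"
    by (simp add: serre_def Let_def frev_sum frev_psc frev_mult fconst_mult mult.assoc frev_power frev_fgen assms)
  also have "\<dots> = (\<Sum>k=0..?N. psc ((-1) ^ ?N) (psc ((- 1) ^ k * ?c k) (fgen (X i) ^ (?N - k) * fgen (X j) * fgen (X i) ^ k)))"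
  proof (rule sum.reindex_bij_witness[of _ "\<lambda>k. ?N - k" "\<lambda>k. ?N - k"])
    fix k assume k: "k \<in> {0..?N}"
    have "(-1 :: Cq) ^ ?N = (-1) ^ (?N - k) * (-1) ^ k" using k by (simp add: power_add[symmetric])
    then have "(-1 :: Cq) ^ ?N * (-1) ^ (?N - k) = (-1) ^ k" by simp
    moreover have "?c (?N - k) = ?c k" using k by (simp add: qbinom_def mult.commute)
    ultimately show "psc ((- 1) ^ ?N) (psc ((- 1) ^ (?N - k) * ?c (?N - k)) (fgen (X i) ^ (?N - (?N - k)) * fgen (X j) * fgen (X i) ^ (?N - k))) =
        psc ((- 1) ^ k * ?c k) (fgen (X i) ^ k * fgen (X j) * fgen (X i) ^ (?N - k))"
      using k by (simp add: mult.assoc[symmetric])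
  qed auto
  also have "\<dots> = psc ((-1) ^ ?N) (serre G X i j)"
    by (simp add: serre_def Let_def fconst_mult mult.assoc pm.scale_sum_right)
  finally show ?thesis .
qed

text \<open>Most relations go to themselves up to sign. The exception is the commutation of the K,
  which becomes commutation of their inverses; this is not among the relations and has to be derived
  inside the ideal.\<close>

lemma frev_uq_ideal:
  assumes "x \<in> uq_ideal G"
  shows "frev x \<in> uq_ideal G"
proof -
  let ?I = "idx G"
  let ?J = "{x \<in> frc ?I. frev x \<in> uq_ideal G}"
  have n: "x \<in> uq_ideal G \<Longrightarrow> - x \<in> uq_ideal G" for x
    by (rule pm.subspace_neg[OF uq_ideal_subspace])
  have "uq_ideal G \<subseteq> ?J"
  proof (rule uq_ideal_min)
    have 1: "frev (fgen (GenK i) * fgen (GenKinv i) - 1) = fgen (GenK i) * fgen (GenKinv i) - 1"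
     "frev (fgen (GenKinv i) * fgen (GenK i) - 1) = fgen (GenKinv i) * fgen (GenK i) - 1"
     "frev (fgen (GenK i) * fgen (GenE j) * fgen (GenKinv i) - fconst c * fgen (GenE j)) = fgen (GenK i) * fgen (GenE j) * fgen (GenKinv i) - fconst c * fgen (GenE j)"
     "frev (fgen (GenK i) * fgen (GenF j) * fgen (GenKinv i) - fconst c * fgen (GenF j)) = fgen (GenK i) * fgen (GenF j) * fgen (GenKinv i) - fconst c * fgen (GenF j)"
     for i j :: 'a and c
      by (simp_all add: frev_diff frev_mult frev_fgen frev_1 fconst_mult frev_psc mult.assoc)
    have 2: "frev (fgen (GenE i) * fgen (GenF j) - fgen (GenF j) * fgen (GenE i)
        - (if i = j then fconst c * (fgen (GenK i) - fgen (GenKinv i)) else 0)) =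
        - (fgen (GenE i) * fgen (GenF j) - fgen (GenF j) * fgen (GenE i)
        - (if i = j then fconst c * (fgen (GenK i) - fgen (GenKinv i)) else 0))" for i j :: 'a and c
      by (simp add: frev_diff frev_mult frev_fgen fconst_mult frev_psc pm.scale_right_diff_distrib)
    have 3: "frev (fgen (GenK i) * fgen (GenK j) - fgen (GenK j) * fgen (GenK i)) \<in> uq_ideal G"
      if ij: "i \<in> ?I" "j \<in> ?I" for i j
    proof -
      let ?K = "\<lambda>i. fgen (GenK i)" and ?L = "\<lambda>i. fgen (GenKinv i) :: 'a free_alg"
      have f: "?K k \<in> frc ?I" "?L k \<in> frc ?I" if "k \<in> ?I" for k using that by (auto intro: frc_fgen)
      have r0: "?L k * ?K k - 1 \<in> uq_ideal G" "?K k * ?L k - 1 \<in> uq_ideal G" "?K k * ?K l - ?K l * ?K k \<in> uq_ideal G"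
        if "k \<in> ?I" "l \<in> ?I" for k l
        by (rule uq_ideal_rel, unfold uq_relations_def, use that in blast)+
      have r: "1 - ?L k * ?K k \<in> uq_ideal G" "1 - ?K k * ?L k \<in> uq_ideal G" "?K k * ?K l - ?K l * ?K k \<in> uq_ideal G"
        if "k \<in> ?I" "l \<in> ?I" for k l
        using n[OF r0(1)[OF that]] n[OF r0(2)[OF that]] r0(3)[OF that] by simp_all
      text \<open>The inverses commute: insert \<open>K K\<inverse>\<close> on both sides.\<close>
      have "?L j * ?L i - ?L i * ?L j \<in> uq_ideal G"
      proof -
        define J where "J = uq_ideal G"
        have J: "x + y \<in> J" "x - y \<in> J" if "x \<in> J" "y \<in> J" for x y
          using that unfolding J_def by (auto intro: uq_ideal_add pm.subspace_diff[OF uq_ideal_subspace])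
        have l: "x * y \<in> J" "y * x \<in> J" if "x \<in> frc ?I" "y \<in> J" for x y
          using that unfolding J_def by (auto intro: uq_ideal_l uq_ideal_r)
        note fr = f[OF ij(1)] f[OF ij(2)] frc_mult
        have a: "?L j * ?L i * (?K i * ?K j - ?K j * ?K i) * (?L i * ?L j) \<in> J"
          by (intro l) (use r(3)[OF ij] fr in \<open>auto simp: J_def\<close>)
        have b: "?L j * (1 - ?L i * ?K i) * (?K j * ?L i * ?L j) \<in> J"
          by (rule l(2)[OF _ l(1)]) (use r(1)[OF ij(1,1)] fr in \<open>auto simp: J_def intro!: frc_mult\<close>)
        have c: "(1 - ?L j * ?K j) * (?L i * ?L j) \<in> J"
          by (intro l) (use r(1)[OF ij(2,2)] fr in \<open>auto simp: J_def\<close>)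
        have d: "?L j * ?L i * (?K j * ((1 - ?K i * ?L i) * ?L j)) \<in> J"
          by (intro l) (use r(2)[OF ij(1,1)] fr in \<open>auto simp: J_def\<close>)
        have e: "?L j * ?L i * (1 - ?K j * ?L j) \<in> J"
          by (intro l) (use r(2)[OF ij(2,2)] fr in \<open>auto simp: J_def\<close>)
        have "?L j * ?L i - ?L i * ?L j =
           ?L j * ?L i * (1 - ?K j * ?L j) + ?L j * ?L i * (?K j * ((1 - ?K i * ?L i) * ?L j))
           - ?L j * ?L i * (?K i * ?K j - ?K j * ?K i) * (?L i * ?L j)
           - ?L j * (1 - ?L i * ?K i) * (?K j * ?L i * ?L j) - (1 - ?L j * ?K j) * (?L i * ?L j)"
          by (simp add: left_diff_distrib right_diff_distrib mult.assoc)
        then show ?thesis using J a b c d e unfolding J_def by metis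
      qed
      then show ?thesis by (simp add: frev_diff frev_mult frev_fgen)
    qed
    have s: "frev (serre G X i j) \<in> uq_ideal G" if "serre G X i j \<in> uq_ideal G" "ginv (X i) = X i" "ginv (X j) = X j" for X i j
      using frev_serre[OF that(2,3)] uq_ideal_psc that(1) by metis
    show "uq_relations G \<subseteq> ?J"
    proof
      fix r assume r: "r \<in> uq_relations G"
      then have i: "r \<in> uq_ideal G" "- r \<in> uq_ideal G" using uq_ideal_rel n by blast+
      have "frev r \<in> uq_ideal G"
        using r unfolding uq_relations_def
      proof (elim UnE CollectE exE conjE, goal_cases)
        case (6 i j)
        show ?case using i(2) unfolding 6 2 by simp
      qed (use i 1 3 s in auto)
      then show "r \<in> ?J" using r uq_relations_frc by blast
    qed
  qed (auto simp: pm.subspace_def frc_0 frc_add frc_psc frc_mult frev_add frev_psc frev_mult uq_ideal_0 uq_ideal_add uq_ideal_psc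
      intro: uq_ideal_l uq_ideal_r frev_frc)
  then show ?thesis using assms by auto
qed

text \<open>A basis of J is extended to one of A; P kills the former and fixes the added vectors.
  Its range, a complement of J in A, is a copy of A/J inside the given space.\<close>

lemma exists_projection:
  fixes J A :: "('w::monoid_add \<Rightarrow>\<^sub>0 Cq) set"
  assumes J: "pm.subspace J" and A: "pm.subspace A" and JA: "J \<subseteq> A"
  shows "\<exists>P :: 'w lop. (\<forall>v. app P v \<in> A) \<and> (\<forall>v\<in>J. app P v = 0) \<and> (\<forall>v\<in>A. app P v - v \<in> J) \<and> P * P = P"
proof -
  interpret vp: vector_space_pair "psc :: Cq \<Rightarrow> ('w \<Rightarrow>\<^sub>0 Cq) \<Rightarrow> _" "psc :: Cq \<Rightarrow> ('w \<Rightarrow>\<^sub>0 Cq) \<Rightarrow> _" ..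
  obtain B where B: "B \<subseteq> J" "pm.independent B" "J \<subseteq> pm.span B" using pm.maximal_independent_subset[of J] by metis
  obtain C where C: "B \<subseteq> C" "C \<subseteq> A" "pm.independent C" "A \<subseteq> pm.span C"
    using pm.maximal_independent_subset_extend[of B A] B JA by blast
  define h where "h = (\<lambda>b. if b \<in> B then 0 else b)"
  define f where "f = vp.construct C h"
  have lin: "Vector_Spaces.linear psc psc f" unfolding f_def by (rule vp.linear_construct[OF C(3)])
  then have pl: "plin f" by (simp add: plin_def Vector_Spaces.linear_iff)
  have fb: "f b = h b" if "b \<in> C" for b unfolding f_def by (rule vp.construct_basis[OF C(3) that])
  have hA: "h ` C \<subseteq> insert 0 (C - B)" by (auto simp: h_def)
  have rng: "f v \<in> pm.span (C - B)" for v
  proof -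
    have "f v \<in> pm.span (h ` C)" unfolding f_def by (rule vp.construct_in_span[OF C(3)])
    then show ?thesis using pm.span_mono[OF hA] by auto
  qed
  have z: "f v = 0" if "v \<in> pm.span B" for v
    using that by (induction rule: pm.span_induct_alt) (use fb C pl in \<open>auto simp: plin_0 plin_add plin_psc h_def\<close>)
  have idt: "f v = v" if "v \<in> pm.span (C - B)" for v
    using that by (induction rule: pm.span_induct_alt) (use fb C pl in \<open>auto simp: plin_0 plin_add plin_psc h_def\<close>)
  have cong: "f v - v \<in> J" if "v \<in> pm.span C" for v
    using that
  proof (induction rule: pm.span_induct_alt)
    case base
    then show ?case using pl J by (simp add: plin_0 pm.subspace_0)
  next
    case (step c b y)
    have "f b - b \<in> J" using fb[OF step(1)] B J by (auto simp: h_def pm.subspace_0 intro: pm.subspace_neg)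
    then have "psc c (f b - b) + (f y - y) \<in> J" using step J pm.subspace_add pm.subspace_scale by blast
    also have "psc c (f b - b) + (f y - y) = f (psc c b + y) - (psc c b + y)"
      using pl by (simp add: plin_add plin_psc pm.scale_right_diff_distrib)
    finally show ?case .
  qed
  have app: "app (Abs_lop f) = f" by (rule app_Abs[OF pl])
  have "pm.span (C - B) \<subseteq> A" using C A by (meson Diff_subset order_trans pm.span_minimal)
  then have "\<forall>v. f v \<in> A" using rng by blast
  moreover have "Abs_lop f * Abs_lop f = Abs_lop f" by (rule lop_ext) (simp add: app idt rng)
  ultimately show ?thesis using z B(3) cong C(4) by (intro exI[of _ "Abs_lop f"]) (auto simp: app)
qed

text \<open>The trivial representation, with values in operators rather than scalars so that it can
  be combined with the main part of \<open>rho\<close>.\<close>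

fun eop :: "'i gen \<Rightarrow> 'i gen free_word lop" where
  "eop (GenE i) = 0"
| "eop (GenF i) = 0"
| "eop (GenK i) = 1"
| "eop (GenKinv i) = 1"

abbreviation counit where "counit \<equiv> lo.ev eop"

lemma counit_scalar: "\<exists>c. counit x = lsc c 1"
proof -
  have w: "\<exists>c. counit (fwd w) = lsc c 1" for w :: "'a gen list"
  proof (induction w)
    case Nil
    then show ?case by (intro exI[of _ 1]) (simp add: lo.ev_fwd)
  next
    case (Cons g w)
    then obtain c where "counit (fwd w) = lsc c 1" by blast
    then have "counit (fwd (g # w)) = lsc (if eop g = 1 then c else 0) 1"
      by (cases g) (simp_all add: lo.ev_fwd)
    then show ?case by blast
  qed
  have "\<forall>w :: 'a gen list. \<exists>c. counit (fwd w) = lsc c 1" using w by blast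
  from choice[OF this] obtain c where c: "\<And>w :: 'a gen list. counit (fwd w) = lsc (c w) 1" by blast
  have "counit x = (\<Sum>w\<in>Poly_Mapping.keys x. lsc (Poly_Mapping.lookup x w) (counit (fwd (letters w))))"
    by (subst pm_expand_fwd) (simp add: lo.ev_sum lo.ev_psc)
  also have "(\<Sum>w\<in>Poly_Mapping.keys x. lsc (Poly_Mapping.lookup x w) (counit (fwd (letters w)))) =
     lsc (\<Sum>w\<in>Poly_Mapping.keys x. Poly_Mapping.lookup x w * c (letters w)) 1"
    by (simp add: lo.scale_sum_left c)
  finally show ?thesis by blast
qed

lemma counit_ideal:
  assumes "x \<in> uq_ideal G"
  shows "counit x = 0"
proof -
  have z: "counit (serre G X i j) = 0" if "eop (X j) = 0" for X :: "'a \<Rightarrow> 'a gen" and i j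
    using that by (simp add: serre_def Let_def lo.ev_sum lo.ev_mult)
  have "uq_ideal G \<subseteq> {x \<in> frc (idx G). counit x = 0}"
  proof (rule uq_ideal_min)
    show "uq_relations G \<subseteq> {x \<in> frc (idx G). counit x = 0}"
    proof
      fix r assume r: "r \<in> uq_relations G"
      have "counit r = 0" using r unfolding uq_relations_def
        by (auto simp: lo.ev_diff lo.ev_mult lo.ev_one z)
      then show "r \<in> {x \<in> frc (idx G). counit x = 0}" using r uq_relations_frc by blast
    qed
  qed (auto simp: pm.subspace_def frc_0 frc_add frc_psc frc_mult lo.ev_add lo.ev_psc lo.ev_mult)
  then show ?thesis using assms by auto
qed

locale embed = cartan G for G :: "'i cartan_datum" +
  fixes P :: "'i gen free_word lop"
  assumes P_frc: "app P v \<in> frc (idx G)" and P_ideal: "v \<in> uq_ideal G \<Longrightarrow> app P v = 0"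
    and P_cong: "v \<in> frc (idx G) \<Longrightarrow> app P v - v \<in> uq_ideal G" and PP: "P * P = P"
begin

text \<open>The counit acts on the complement of the quotient, so that the representation is unital.\<close>

definition rho :: "'i free_alg \<Rightarrow> 'i gen free_word lop" where
  "rho x = P * lmul x * P + counit x * (1 - P)"

lemma rho_add: "rho (x + y) = rho x + rho y"
proof -
  have "lmul (x + y) = lmul x + lmul y" by (rule lop_ext) (simp add: distrib_right)
  then show ?thesis by (simp add: rho_def lo.ev_add algebra_simps)
qed

lemma rho_psc: "rho (psc c x) = lsc c (rho x)"
  by (simp add: rho_def lmul_hom lo.ev_psc lo.scale_right_distrib)

lemma rho_0: "rho 0 = 0"
  using rho_psc[of 0 0] by simp

lemma rho_diff: "rho (x - y) = rho x - rho y"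
  using rho_add[of "x - y" y] by simp

lemma rho_one: "rho 1 = 1"
proof -
  have "lmul 1 = (1 :: 'i gen free_word lop)" by (rule lop_ext) simp
  then show ?thesis by (simp add: rho_def PP lo.ev_one)
qed

text \<open>P is not multiplicative, but P u - u lies in the ideal for u in the free ring, hence so
  does x times it, and P kills the result. The complementary idempotents P and 1 - P keep the two
  summands of \<open>rho\<close> apart.\<close>

lemma rho_mult: assumes "x \<in> frc I" "y \<in> frc I" shows "rho (x * y) = rho x * rho y"
proof -
  obtain c where c: "counit x = lsc c 1" using counit_scalar by blast
  obtain d where d: "counit y = lsc d 1" using counit_scalar by blast
  have "P * lmul x * P * lmul y * P = P * lmul (x * y) * P"
  proof (rule lop_ext)
    fix v
    let ?u = "y * app P v"
    have "?u \<in> frc I" using assms P_frc frc_mult by blast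
    then have "x * (app P ?u - ?u) \<in> uq_ideal G" using P_cong uq_ideal_l assms by blast
    then have "app P (x * app P ?u - x * ?u) = 0" using P_ideal by (simp add: right_diff_distrib)
    then show "app (P * lmul x * P * lmul y * P) v = app (P * lmul (x * y) * P) v"
      by (simp add: app_diff mult.assoc)
  qed
  moreover have "P * (1 - P) = 0" "(1 - P) * P = 0" "(1 - P) * (1 - P) = 1 - P" by (simp_all add: algebra_simps PP)
  moreover have "rho x * rho y = P * lmul x * (P * P) * lmul y * P + lsc d (P * lmul x * (P * (1 - P))) +
     lsc c (((1 - P) * P) * lmul y * P) + lsc (c * d) ((1 - P) * (1 - P))"
    unfolding rho_def c d by (simp add: distrib_left distrib_right lo.scale_right_distrib mult.assoc mult.commute)
  ultimately show ?thesis unfolding rho_def lo.ev_mult c d by (simp add: PP)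
qed

lemma rho_ideal: "x \<in> uq_ideal G \<Longrightarrow> rho x = 0"
proof -
  assume x: "x \<in> uq_ideal G"
  have "P * lmul x * P = 0" by (rule lop_ext) (use P_ideal uq_ideal_r[OF P_frc x] in simp)
  then show ?thesis by (simp add: rho_def counit_ideal[OF x])
qed

text \<open>Evaluated at 1, the main part of the operator is x P(1) modulo the ideal, and P(1) is
  congruent to 1.\<close>

lemma rho_kernel:
  assumes x: "x \<in> frc I" and z: "rho x = 0"
  shows "x \<in> uq_ideal G"
proof -
  obtain c where c: "counit x = lsc c 1" using counit_scalar by blast
  have "P * rho x = (P * P) * lmul x * P + lsc c (P * (1 - P))"
    unfolding rho_def c by (simp add: distrib_left mult.assoc)
  then have "P * lmul x * P = 0" using z by (simp add: PP algebra_simps)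
  then have "app (P * lmul x * P) 1 = 0" by simp
  then have "app P (x * app P 1) = 0" by simp
  moreover have "x * app P 1 \<in> frc I" using x P_frc frc_mult by blast
  ultimately have "- (x * app P 1) \<in> uq_ideal G" using P_cong[of "x * app P 1"] by simp
  then have "x * app P 1 \<in> uq_ideal G" using pm.subspace_neg[OF uq_ideal_subspace, of "- (x * app P 1)"] by simp
  moreover have "x * (app P 1 - 1) \<in> uq_ideal G" using P_cong[OF frc_1] x uq_ideal_l by blast
  ultimately have "x * app P 1 - x * (app P 1 - 1) \<in> uq_ideal G" by (rule pm.subspace_diff[OF uq_ideal_subspace])
  then show ?thesis by (simp add: right_diff_distrib)
qed

lemma rho_eq_iff: "x \<in> frc I \<Longrightarrow> y \<in> frc I \<Longrightarrow> rho x = rho y \<longleftrightarrow> x - y \<in> uq_ideal G"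
  using rho_kernel[of "x - y"] rho_ideal[of "x - y"] by (auto simp: frc_diff rho_diff)

lemma frc_fr: "e \<in> frc I \<Longrightarrow> x \<in> frc I \<Longrightarrow> pm.fr v a e x m \<in> frc I"
  by (induction m) (auto simp: pm.fr.simps frc_psc frc_diff frc_mult)

lemma rho_fr: "e \<in> frc I \<Longrightarrow> x \<in> frc I \<Longrightarrow> rho (pm.fr v a e x m) = lo.fr v a (rho e) (rho x) m"
  by (induction m) (auto simp: pm.fr.simps lo.fr.simps rho_psc rho_diff rho_mult frc_fr)

definition eU :: "'i gen free_word lop set" where "eU = rho ` frc I"
definition eE where "eE i = rho (fgen (GenE i))"
definition eF where "eF i = rho (fgen (GenF i))"
definition eK where "eK i = rho (fgen (GenK i))"
definition eKi where "eKi i = rho (fgen (GenKinv i))"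

lemmas egen_defs = eE_def eF_def eK_def eKi_def

lemma rho_rel: "x - y \<in> uq_relations G \<Longrightarrow> rho x = rho y"
  using rho_ideal[OF uq_ideal_rel, of "x - y"] by (simp add: rho_diff)

lemma embed_qrel: "qrel lsc G eE eF eK eKi"
proof (intro qrel.intro lo.cq_algebra_axioms qrel_axioms.intro fin_type)
  fix i assume i: "i \<in> I"
  note f = frc_fgen[of "GenE i" I] frc_fgen[of "GenF i" I] frc_fgen[of "GenK i" I] frc_fgen[of "GenKinv i" I]
  show k1: "eK i * eKi i = 1"
  proof -
    have "fgen (GenK i) * fgen (GenKinv i) - 1 \<in> uq_relations G" unfolding uq_relations_def using i by blast
    from rho_rel[OF this] show ?thesis using f i by (simp add: egen_defs rho_mult rho_one)
  qed
  show k2: "eKi i * eK i = 1"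
  proof -
    have "fgen (GenKinv i) * fgen (GenK i) - 1 \<in> uq_relations G" unfolding uq_relations_def using i by blast
    from rho_rel[OF this] show ?thesis using f i by (simp add: egen_defs rho_mult rho_one)
  qed
  fix j assume j: "j \<in> I"
  note f = f frc_fgen[of "GenE j" I] frc_fgen[of "GenF j" I] frc_fgen[of "GenK j" I] frc_fgen[of "GenKinv j" I]
  have "fgen (GenK i) * fgen (GenK j) - fgen (GenK j) * fgen (GenK i) \<in> uq_relations G"
    unfolding uq_relations_def using i j by blast
  from rho_rel[OF this] show "eK i * eK j = eK j * eK i" using f i j by (simp add: egen_defs rho_mult)
  have "fgen (GenK i) * fgen (GenE j) * fgen (GenKinv i) - fconst (q_at G i powi cm G i j) * fgen (GenE j) \<in> uq_relations G"
    unfolding uq_relations_def using i j by blast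
  from rho_rel[OF this] have "eK i * eE j * eKi i = lsc (q_at G i powi cm G i j) (eE j)"
    using f i j by (simp add: egen_defs rho_mult frc_mult fconst_mult rho_psc)
  then have "eK i * eE j * eKi i * eK i = lsc (q_at G i powi cm G i j) (eE j * eK i)" by simp
  then show "eK i * eE j = lsc (q_at G i powi cm G i j) (eE j * eK i)" using k2 by (simp add: mult.assoc)
  have "fgen (GenK i) * fgen (GenF j) * fgen (GenKinv i) - fconst (q_at G i powi (- cm G i j)) * fgen (GenF j) \<in> uq_relations G"
    unfolding uq_relations_def using i j by blast
  from rho_rel[OF this] have "eK i * eF j * eKi i = lsc (q_at G i powi - cm G i j) (eF j)"
    using f i j by (simp add: egen_defs rho_mult frc_mult fconst_mult rho_psc)
  then have "eK i * eF j * eKi i * eK i = lsc (q_at G i powi - cm G i j) (eF j * eK i)" by simp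
  then show "eK i * eF j = lsc (q_at G i powi - cm G i j) (eF j * eK i)" using k2 by (simp add: mult.assoc)
  have "fgen (GenE i) * fgen (GenF j) - fgen (GenF j) * fgen (GenE i)
        - (if i = j then fconst (inverse (q_at G i - inverse (q_at G i))) * (fgen (GenK i) - fgen (GenKinv i)) else 0) \<in> uq_relations G"
    unfolding uq_relations_def using i j by blast
  from rho_rel[OF this] show "eE i * eF j - eF j * eE i = (if i = j then lsc (inverse (q_at G i - inverse (q_at G i))) (eK i - eKi i) else 0)"
    using f i j by (auto simp: egen_defs rho_mult rho_diff frc_mult fconst_mult rho_psc rho_0)
qed

sublocale eq: qrel lsc G eE eF eK eKi by (rule embed_qrel)

lemma embed_serre0:
  assumes ij: "i \<in> I" "j \<in> I" "i \<noteq> j"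
  shows "lo.fr (q_at G i) (cm G i j) (eE i) (eE j) (nat (1 - cm G i j)) = 0"
proof -
  have "rho (serre G GenE i j) = 0"
    by (rule rho_ideal, rule uq_ideal_rel) (unfold uq_relations_def, use ij in blast)
  then show ?thesis unfolding serre_fr[OF eq.q_generic[OF ij(1)] eq.cm_nonpos[OF ij]]
    using ij qfact_nz[OF eq.q_generic[OF ij(1)]] by (simp add: rho_psc rho_fr frc_fgen eE_def)
qed

end

lemma (in cartan) ex_embed: "\<exists>P. embed G P"
proof -
  obtain P :: "'i gen free_word lop" where "\<forall>v. app P v \<in> frc I" "\<forall>v\<in>uq_ideal G. app P v = 0" "\<forall>v\<in>frc I. app P v - v \<in> uq_ideal G" "P * P = P"
  proof -
    have "pm.subspace (frc I)" unfolding frc_span by (rule pm.subspace_span)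
    from exists_projection[OF uq_ideal_subspace this, of G] show ?thesis using uq_ideal_frc that by blast
  qed
  then show ?thesis by (intro exI[of _ P] embed.intro embed_axioms.intro cartan_axioms) auto
qed

section \<open>The quotient ring and its image\<close>

lemma uq_class_eq: "uq_class G x = {j + x | j. j \<in> uq_ideal G}"
  by (auto simp: uq_class_def a_r_coset_def r_coset_def)

lemma uq_class_self: "x \<in> uq_class G x"
  unfolding uq_class_eq using uq_ideal_0 by force

lemma uq_class_cong: "uq_class G x = uq_class G y \<longleftrightarrow> x - y \<in> uq_ideal G"
proof
  assume "uq_class G x = uq_class G y"
  then have "x \<in> uq_class G y" using uq_class_self[of x G] by simp
  then show "x - y \<in> uq_ideal G" by (auto simp: uq_class_eq)
next
  assume d: "x - y \<in> uq_ideal G"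
  have m: "- (x - y) \<in> uq_ideal G" using pm.subspace_neg[OF uq_ideal_subspace d] .
  show "uq_class G x = uq_class G y"
  proof (intro Set.set_eqI iffI)
    fix z assume "z \<in> uq_class G x"
    then obtain j where "z = j + x" "j \<in> uq_ideal G" by (auto simp: uq_class_eq)
    then have "z = (j + (x - y)) + y" "j + (x - y) \<in> uq_ideal G" using uq_ideal_add d by auto
    then show "z \<in> uq_class G y" unfolding uq_class_eq by blast
  next
    fix z assume "z \<in> uq_class G y"
    then obtain j where "z = j + y" "j \<in> uq_ideal G" by (auto simp: uq_class_eq)
    then have "z = (j + - (x - y)) + x" "j + - (x - y) \<in> uq_ideal G" using uq_ideal_add m by auto
    then show "z \<in> uq_class G x" unfolding uq_class_eq by blast
  qed
qed

lemma Uq_carrier: "carrier (Uq G) = uq_class G ` frc (idx G)"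
  by (auto simp: Uq_def Let_def FactRing_def A_RCOSETS_def RCOSETS_def uq_class_def a_r_coset_def)

lemma Uq_mult: "x \<in> frc (idx G) \<Longrightarrow> y \<in> frc (idx G) \<Longrightarrow> uq_class G x \<otimes>\<^bsub>Uq G\<^esub> uq_class G y = uq_class G (x * y)"
  using ideal.rcoset_mult_add[OF uq_ideal_ideal, of x G y] by (simp add: Uq_def Let_def FactRing_def uq_class_def)

lemma Uq_add: "x \<in> frc (idx G) \<Longrightarrow> y \<in> frc (idx G) \<Longrightarrow> uq_class G x \<oplus>\<^bsub>Uq G\<^esub> uq_class G y = uq_class G (x + y)"
proof -
  assume a: "x \<in> frc (idx G)" "y \<in> frc (idx G)"
  interpret J: ideal "uq_ideal G" "free_ring (idx G)" by (rule uq_ideal_ideal)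
  show ?thesis using J.a_rcos_sum[OF a] by (simp add: Uq_def Let_def FactRing_def uq_class_def)
qed

lemma Uq_one: "\<one>\<^bsub>Uq G\<^esub> = uq_class G 1"
  by (simp add: Uq_def Let_def FactRing_def uq_class_def)

lemma Uq_zero: "\<zero>\<^bsub>Uq G\<^esub> = uq_class G 0"
  by (auto simp: Uq_def Let_def FactRing_def uq_class_eq)

lemma Uq_smult: "x \<in> frc (idx G) \<Longrightarrow> c \<odot>\<^bsub>Uq G\<^esub> uq_class G x = uq_class G (psc c x)"
  using Uq_mult[OF frc_fconst, of x G c] by (simp add: Uq_def Let_def fconst_mult)

lemma Uq_ring: "ring (Uq G)"
proof (rule ringI)
  show "abelian_group (Uq G)"
  proof (rule abelian_groupI)
    show "\<exists>y\<in>carrier (Uq G). y \<oplus>\<^bsub>Uq G\<^esub> x = \<zero>\<^bsub>Uq G\<^esub>" if x: "x \<in> carrier (Uq G)" for x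
    proof -
      obtain z where z: "x = uq_class G z" "z \<in> frc (idx G)" using x unfolding Uq_carrier by auto
      then show ?thesis by (intro bexI[of _ "uq_class G (- z)"]) (auto simp: Uq_add frc_uminus Uq_zero Uq_carrier)
    qed
  qed (auto simp: Uq_carrier Uq_add Uq_zero frc_add frc_0 algebra_simps)
  show "monoid (Uq G)"
    by (rule monoidI) (auto simp: Uq_carrier Uq_mult Uq_one frc_mult frc_1 mult.assoc)
qed (auto simp: Uq_carrier Uq_mult Uq_add frc_mult frc_add algebra_simps)

context embed
begin

definition Phi :: "'i free_alg set \<Rightarrow> 'i gen free_word lop" where
  "Phi u = the_elem (rho ` u)"

lemma Phi_class: "Phi (uq_class G x) = rho x"
proof -
  have "rho ` uq_class G x = {rho x}"
    unfolding uq_class_eq using uq_ideal_0[of G] by (auto simp: rho_add rho_ideal image_iff intro!: exI[of _ 0])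
  then show ?thesis by (simp add: Phi_def)
qed

lemma Phi_inj: "inj_on Phi (carrier (Uq G))"
proof (rule inj_onI)
  fix u v assume uv: "u \<in> carrier (Uq G)" "v \<in> carrier (Uq G)" "Phi u = Phi v"
  obtain x y where xy: "u = uq_class G x" "x \<in> frc I" "v = uq_class G y" "y \<in> frc I"
    using uv unfolding Uq_carrier by auto
  then have "x - y \<in> uq_ideal G" using uv(3) Phi_class rho_eq_iff by metis
  then show "u = v" unfolding xy(1,3) uq_class_cong .
qed

lemma Phi_image: "Phi ` carrier (Uq G) = eU"
  by (auto simp: Uq_carrier Phi_class eU_def image_image)

lemma Phi_U: "u \<in> carrier (Uq G) \<Longrightarrow> Phi u \<in> eU"
  using Phi_image by blast

lemma Phi_mult: "u \<in> carrier (Uq G) \<Longrightarrow> v \<in> carrier (Uq G) \<Longrightarrow> Phi (u \<otimes>\<^bsub>Uq G\<^esub> v) = Phi u * Phi v"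
  and Phi_add: "u \<in> carrier (Uq G) \<Longrightarrow> v \<in> carrier (Uq G) \<Longrightarrow> Phi (u \<oplus>\<^bsub>Uq G\<^esub> v) = Phi u + Phi v"
  and Phi_smult: "u \<in> carrier (Uq G) \<Longrightarrow> Phi (c \<odot>\<^bsub>Uq G\<^esub> u) = lsc c (Phi u)"
  and Phi_one: "Phi \<one>\<^bsub>Uq G\<^esub> = 1"
  and Phi_zero: "Phi \<zero>\<^bsub>Uq G\<^esub> = 0"
  by (auto simp: Uq_carrier Uq_mult Uq_add Uq_smult Uq_one Uq_zero Phi_class rho_mult rho_add rho_psc rho_one rho_0)

lemma Uq_smult_closed: "u \<in> carrier (Uq G) \<Longrightarrow> c \<odot>\<^bsub>Uq G\<^esub> u \<in> carrier (Uq G)"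
  by (auto simp: Uq_carrier Uq_smult frc_psc)

sublocale Q: ring "Uq G" by (rule Uq_ring)

lemma Phi_minus: "u \<in> carrier (Uq G) \<Longrightarrow> Phi (\<ominus>\<^bsub>Uq G\<^esub> u) = - Phi u"
proof -
  assume u: "u \<in> carrier (Uq G)"
  have "Phi (\<ominus>\<^bsub>Uq G\<^esub> u \<oplus>\<^bsub>Uq G\<^esub> u) = 0" using u Q.l_neg Phi_zero by simp
  then have "Phi (\<ominus>\<^bsub>Uq G\<^esub> u) + Phi u = 0" using u Phi_add by simp
  then show ?thesis by (simp add: eq_neg_iff_add_eq_0)
qed

lemma Phi_pow: "u \<in> carrier (Uq G) \<Longrightarrow> Phi (u [^]\<^bsub>Uq G\<^esub> (n::nat)) = Phi u ^ n"
  by (induction n) (simp_all add: Phi_one Phi_mult power_commutes)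

lemma Phi_finsum:
  "finite A \<Longrightarrow> (\<And>a. a \<in> A \<Longrightarrow> f a \<in> carrier (Uq G)) \<Longrightarrow> Phi (\<Oplus>\<^bsub>Uq G\<^esub>a\<in>A. f a) = (\<Sum>a\<in>A. Phi (f a))"
proof (induction A rule: finite_induct)
  case (insert a A)
  have f: "f \<in> A \<rightarrow> carrier (Uq G)" "f a \<in> carrier (Uq G)" using insert by auto
  then show ?case using insert by (simp add: Q.finsum_insert Phi_add)
qed (simp add: Phi_zero)

lemma gens_carrier:
  "i \<in> I \<Longrightarrow> uE G i \<in> carrier (Uq G)" "i \<in> I \<Longrightarrow> uF G i \<in> carrier (Uq G)"
  "i \<in> I \<Longrightarrow> uK G i \<in> carrier (Uq G)" "i \<in> I \<Longrightarrow> uKinv G i \<in> carrier (Uq G)"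
  unfolding Uq_carrier uE_def uF_def uK_def uKinv_def by (auto intro!: imageI frc_fgen)

lemma Phi_gens: "Phi (uE G i) = eE i" "Phi (uF G i) = eF i" "Phi (uK G i) = eK i" "Phi (uKinv G i) = eKi i"
  by (simp_all add: uE_def uF_def uK_def uKinv_def Phi_class egen_defs)

definition Psi :: "'i gen free_word lop \<Rightarrow> 'i free_alg set" where
  "Psi = inv_into (carrier (Uq G)) Phi"

lemma Psi_Phi: "u \<in> carrier (Uq G) \<Longrightarrow> Psi (Phi u) = u"
  unfolding Psi_def by (rule inv_into_f_f[OF Phi_inj])

definition tr :: "('i free_alg set \<Rightarrow> 'i free_alg set) \<Rightarrow> 'i gen free_word lop \<Rightarrow> 'i gen free_word lop" where
  "tr f a = Phi (f (Psi a))"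

lemma tr_Phi: "u \<in> carrier (Uq G) \<Longrightarrow> tr f (Phi u) = Phi (f u)"
  by (simp add: tr_def Psi_Phi)

lemma tr_rho: "x \<in> frc I \<Longrightarrow> tr f (rho x) = Phi (f (uq_class G x))"
  using tr_Phi[of "uq_class G x" f] by (simp add: Phi_class Uq_carrier)

lemma eU_cases: "a \<in> eU \<Longrightarrow> \<exists>u\<in>carrier (Uq G). a = Phi u"
  using Phi_image by blast

section \<open>Positive elements and annihilators inside the operator algebra\<close>

abbreviation psiE where "psiE \<equiv> pm.ev (\<lambda>i. fgen (GenE i))"

lemma psiE_fwd: "psiE (fwd w) = fwd (map GenE w)"
  using fwd_prod[of "map GenE w"] by (simp add: pm.ev_fwd fgen_fwd comp_def)

lemma psiE_frc: "p \<in> PI \<Longrightarrow> psiE p \<in> frc I"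
  unfolding PI_def
proof (induction rule: pm.span_induct_alt)
  case (step c b y)
  then obtain w where "b = fwd w" "set w \<subseteq> I" by auto
  then have "psiE b \<in> frc I" unfolding \<open>b = fwd w\<close> psiE_fwd by (intro frc_fwd) (auto simp: gword_def)
  then show ?case using step by (simp add: pm.ev_add pm.ev_psc frc_add frc_psc)
qed (simp add: frc_0)

lemma rho_word: "set w \<subseteq> I \<Longrightarrow> rho (psiE (fwd w)) = prod_list (map eE w)"
  unfolding pm.ev_fwd
proof (induction w)
  case (Cons i w)
  have "prod_list (map (\<lambda>i. fgen (GenE i)) w) \<in> frc I" using Cons.prems psiE_frc[OF PI_fwd, of w] by (simp add: pm.ev_fwd)
  then show ?case using Cons by (simp add: rho_mult frc_fgen eE_def)
qed (simp add: rho_one)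

lemma positive_rep:
  assumes "u \<in> lo.span {prod_list (map eE w) | w. set w \<subseteq> I}"
  obtains p where "p \<in> PI" "u = rho (psiE p)"
proof -
  have "\<exists>p\<in>PI. u = rho (psiE p)" using assms
  proof (induction rule: lo.span_induct_alt)
    case base
    then show ?case by (intro bexI[of _ 0]) (auto simp: rho_0 PI_0)
  next
    case (step c b y)
    then obtain w p where w: "b = prod_list (map eE w)" "set w \<subseteq> I" and p: "p \<in> PI" "y = rho (psiE p)" by auto
    have "b = rho (psiE (fwd w))" using rho_word w by simp
    then have "lsc c b + y = rho (psiE (psc c (fwd w) + p))" using p by (simp add: pm.ev_add pm.ev_psc rho_add rho_psc)
    then show ?case using w p PI_fwd by (intro bexI[of _ "psc c (fwd w) + p"]) (auto simp: PI_add PI_psc)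
  qed
  then show ?thesis using that by blast
qed

lemma frev_psiE: "p \<in> PI \<Longrightarrow> \<exists>p'\<in>PI. frev (psiE p) = psiE p'"
  unfolding PI_def[unfolded]
proof (induction rule: pm.span_induct_alt)
  case base
  then show ?case by (intro bexI[of _ 0]) (auto simp: pm.span_zero)
next
  case (step c b y)
  then obtain w p' where w: "b = fwd w" "set w \<subseteq> I" and p': "p' \<in> PI" "frev (psiE y) = psiE p'" unfolding PI_def by auto
  have "frev (psiE b) = psiE (fwd (rev w))" unfolding w psiE_fwd frev_fwd by (simp add: rev_map comp_def)
  then have "frev (psiE (psc c b + y)) = psiE (psc c (fwd (rev w)) + p')"
    using p' by (simp add: pm.ev_add pm.ev_psc frev_add frev_psc)
  moreover have "psc c (fwd (rev w)) + p' \<in> PI" using w p' by (intro PI_add PI_psc PI_fwd) auto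
  ultimately show ?case unfolding PI_def by blast
qed

definition eL :: "Cq \<Rightarrow> 'i gen free_word lop set" where
  "eL \<kappa> = rho ` verma.LF G \<kappa>"

definition eR :: "'i gen free_word lop set" where
  "eR = rho ` {x \<in> frc I. frev x \<in> verma.LF G 1}"

lemma verma: "\<kappa> \<noteq> 0 \<Longrightarrow> verma G \<kappa>"
  by (simp add: verma_def verma_axioms_def cartan_axioms)

lemma LF_frc: "\<kappa> \<noteq> 0 \<Longrightarrow> x \<in> verma.LF G \<kappa> \<Longrightarrow> x \<in> frc I"
  using verma.LF_def[OF verma] by auto

text \<open>The ideal of relations is contained in the annihilator, so a representative can be
  exchanged for a polynomial in the E, to which \<open>LF_positive\<close> applies.\<close>

lemma eL_positive:
  assumes k: "\<kappa> \<noteq> 0" and u: "u \<in> eL \<kappa>" and p: "u \<in> lo.span {prod_list (map eE w) | w. set w \<subseteq> I}"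
  shows "u = 0"
proof -
  interpret V: verma G \<kappa> by (rule verma[OF k])
  obtain x where x: "u = rho x" "x \<in> V.LF" using u eL_def by auto
  obtain p where p: "p \<in> PI" "u = rho (psiE p)" using positive_rep[OF p] by blast
  have "x - psiE p \<in> uq_ideal G" using x p rho_eq_iff LF_frc[OF k] psiE_frc by metis
  then have "x - (x - psiE p) \<in> V.LF" using x V.LF_ideal pm.subspace_diff[OF V.LF_subspace] by blast
  then have "psiE p \<in> uq_ideal G" using V.LF_positive[of "psiE p" p] p by simp
  then show ?thesis using p rho_ideal by simp
qed

text \<open>The argument of \<open>eL_positive\<close> after the anti-automorphism, which reverses
  words in the E and preserves the ideal.\<close>

lemma eR_positive:
  assumes u: "u \<in> eR" and p: "u \<in> lo.span {prod_list (map eE w) | w. set w \<subseteq> I}"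
  shows "u = 0"
proof -
  interpret V: verma G 1 by (rule verma) simp
  obtain x where x: "u = rho x" "x \<in> frc I" "frev x \<in> V.LF" using u eR_def by auto
  obtain p where p: "p \<in> PI" "u = rho (psiE p)" using positive_rep[OF p] by blast
  have "x - psiE p \<in> uq_ideal G" using x p rho_eq_iff psiE_frc by metis
  then have "frev (x - psiE p) \<in> V.LF" using V.LF_ideal frev_uq_ideal by blast
  then have "frev x - frev (x - psiE p) \<in> V.LF" using x pm.subspace_diff[OF V.LF_subspace] by blast
  then have f: "frev (psiE p) \<in> V.LF" by (simp add: frev_diff)
  obtain p' where p': "p' \<in> PI" "frev (psiE p) = psiE p'" using frev_psiE[OF p(1)] by blast
  have "frev (psiE p) \<in> uq_ideal G" using V.LF_positive[OF f p'(2,1)] .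
  then have "psiE p \<in> uq_ideal G" using frev_uq_ideal frev_frev by metis
  then show ?thesis using p rho_ideal by simp
qed

lemma eL_subspace: assumes k: "\<kappa> \<noteq> 0" shows "lo.subspace (eL \<kappa>)"
proof -
  interpret V: verma G \<kappa> by (rule verma[OF k])
  show ?thesis unfolding lo.subspace_def eL_def
    using pm.subspace_0[OF V.LF_subspace] pm.subspace_add[OF V.LF_subspace] pm.subspace_scale[OF V.LF_subspace]
    by (auto simp: rho_0[symmetric] rho_add[symmetric] rho_psc[symmetric])
qed

lemma eL_left: assumes k: "\<kappa> \<noteq> 0" and u: "u \<in> eU" and x: "x \<in> eL \<kappa>" shows "u * x \<in> eL \<kappa>"
proof -
  interpret V: verma G \<kappa> by (rule verma[OF k])
  obtain a where a: "u = rho a" "a \<in> frc I" using u eU_def by auto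
  obtain b where b: "x = rho b" "b \<in> V.LF" using x eL_def by auto
  have "u * x = rho (a * b)" using a b LF_frc[OF k] rho_mult by metis
  then show ?thesis using V.LF_left a b eL_def by auto
qed

lemma eL_F: assumes k: "\<kappa> \<noteq> 0" and i: "i \<in> I" shows "eF i \<in> eL \<kappa>" "eK i - lsc \<kappa> 1 \<in> eL \<kappa>"
proof -
  interpret V: verma G \<kappa> by (rule verma[OF k])
  show "eF i \<in> eL \<kappa>" using V.LF_F[OF i] by (auto simp: eL_def eF_def)
  have "rho (fgen (GenK i) - psc \<kappa> 1) \<in> eL \<kappa>" using V.LF_K[OF i] by (auto simp: eL_def)
  then show "eK i - lsc \<kappa> 1 \<in> eL \<kappa>" by (simp add: rho_diff rho_psc rho_one eK_def)
qed

lemma eR_right: assumes u: "u \<in> eU" and x: "x \<in> eR" shows "x * u \<in> eR"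
proof -
  interpret V: verma G 1 by (rule verma) simp
  obtain a where a: "u = rho a" "a \<in> frc I" using u eU_def by auto
  obtain b where b: "x = rho b" "b \<in> frc I" "frev b \<in> V.LF" using x eR_def by auto
  have "x * u = rho (b * a)" "b * a \<in> frc I" using a b rho_mult frc_mult by auto
  moreover have "frev (b * a) \<in> V.LF" unfolding frev_mult using V.LF_left b frev_frc[OF a(2)] by blast
  ultimately show ?thesis using eR_def by auto
qed

lemma eR_F: assumes i: "i \<in> I" shows "eF i \<in> eR"
proof -
  interpret V: verma G 1 by (rule verma) simp
  show ?thesis using V.LF_F[OF i] frc_fgen[of "GenF i" I] i by (auto simp: eR_def eF_def frev_fgen)
qed

lemma eU_closed: "1 \<in> eU" "x \<in> eU \<Longrightarrow> y \<in> eU \<Longrightarrow> x + y \<in> eU" "x \<in> eU \<Longrightarrow> y \<in> eU \<Longrightarrow> x * y \<in> eU" "x \<in> eU \<Longrightarrow> lsc c x \<in> eU"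
proof -
  show "1 \<in> eU" using frc_1 rho_one unfolding eU_def by (metis imageI)
  show "x + y \<in> eU" "x * y \<in> eU" if xy: "x \<in> eU" "y \<in> eU"
  proof -
    obtain a b where ab: "x = rho a" "a \<in> frc I" "y = rho b" "b \<in> frc I" using xy unfolding eU_def by auto
    show "x + y \<in> eU" using ab rho_add[of a b] frc_add[of a I b] unfolding eU_def by (metis imageI)
    show "x * y \<in> eU" using ab rho_mult[of a b] frc_mult[of a I b] unfolding eU_def by (metis imageI)
  qed
  show "lsc c x \<in> eU" if "x \<in> eU" using that rho_psc frc_psc unfolding eU_def by (metis (no_types, lifting) imageE imageI)
qed

lemma egen_U: "i \<in> I \<Longrightarrow> eE i \<in> eU" "i \<in> I \<Longrightarrow> eF i \<in> eU" "i \<in> I \<Longrightarrow> eK i \<in> eU" "i \<in> I \<Longrightarrow> eKi i \<in> eU"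
  unfolding eU_def egen_defs by (auto intro!: imageI frc_fgen)

end

locale uq_action = embed G P for G :: "'i cartan_datum" and P +
  fixes T :: "'i \<Rightarrow> 'i free_alg set \<Rightarrow> 'i free_alg set"
  assumes action: "lusztig_action G T"
begin

abbreviation C where "C \<equiv> carrier (Uq G)"

abbreviation Tt :: "'i \<Rightarrow> 'i gen free_word lop \<Rightarrow> 'i gen free_word lop" where
  "Tt i \<equiv> tr (T i)"

lemmas action_conj = action[unfolded lusztig_action_def]
lemmas action_aut = conjunct1[OF action_conj]
lemmas action_braid = conjunct1[OF conjunct2[OF action_conj]]
lemmas action_K = conjunct1[OF conjunct2[OF conjunct2[OF action_conj]]]
lemmas action_self = conjunct1[OF conjunct2[OF conjunct2[OF conjunct2[OF action_conj]]]]
lemmas action_other = conjunct2[OF conjunct2[OF conjunct2[OF conjunct2[OF action_conj]]]]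

lemma T_aut: "i \<in> I \<Longrightarrow> algebra_automorphism (Uq G) (T i)"
  using action_aut by blast

lemma T_closed: "i \<in> I \<Longrightarrow> u \<in> C \<Longrightarrow> T i u \<in> C"
  and T_hom_mult: "i \<in> I \<Longrightarrow> u \<in> C \<Longrightarrow> v \<in> C \<Longrightarrow> T i (u \<otimes>\<^bsub>Uq G\<^esub> v) = T i u \<otimes>\<^bsub>Uq G\<^esub> T i v"
  and T_hom_add: "i \<in> I \<Longrightarrow> u \<in> C \<Longrightarrow> v \<in> C \<Longrightarrow> T i (u \<oplus>\<^bsub>Uq G\<^esub> v) = T i u \<oplus>\<^bsub>Uq G\<^esub> T i v"
  and T_hom_one: "i \<in> I \<Longrightarrow> T i \<one>\<^bsub>Uq G\<^esub> = \<one>\<^bsub>Uq G\<^esub>"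
  and T_hom_smult: "i \<in> I \<Longrightarrow> u \<in> C \<Longrightarrow> T i (c \<odot>\<^bsub>Uq G\<^esub> u) = c \<odot>\<^bsub>Uq G\<^esub> T i u"
  and T_hom_inj: "i \<in> I \<Longrightarrow> inj_on (T i) C"
  using T_aut[of i] unfolding algebra_automorphism_def ring_iso_def ring_hom_def bij_betw_def by auto

lemma foldr_T_closed: "ws \<in> lists I \<Longrightarrow> u \<in> C \<Longrightarrow> foldr T ws u \<in> C"
  by (induction ws) (auto simp: T_closed)

lemma foldr_Tt: "ws \<in> lists I \<Longrightarrow> u \<in> C \<Longrightarrow> foldr Tt ws (Phi u) = Phi (foldr T ws u)"
  by (induction ws) (auto simp: tr_Phi foldr_T_closed)

lemma divided_power_closed: "i \<in> I \<Longrightarrow> y \<in> C \<Longrightarrow> divided_power G i y k \<in> C"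
  by (simp add: divided_power_def Uq_smult_closed)

lemma Phi_divided_power: "i \<in> I \<Longrightarrow> y \<in> C \<Longrightarrow> Phi (divided_power G i y k) = lsc (inverse (qfact (q_at G i) k)) (Phi y ^ k)"
  by (simp add: divided_power_def Phi_smult Phi_pow)

lemma Tt_E:
  assumes ij: "i \<in> I" "j \<in> I" "i \<noteq> j"
  shows "Tt i (eE j) = lsc 1 (lo.fr (q_at G i) (cm G i j) (eE i) (eE j) (nat (- cm G i j)))"
proof -
  let ?n = "nat (- cm G i j)" and ?v = "q_at G i"
  have v: "generic ?v" "?v \<noteq> 0" using eq.q_generic eq.q_nz ij by auto
  have n: "cm G i j + int ?n - 1 = -1" using eq.cm_nonpos[OF ij] by simp
  have "T i (uE G j) = (\<Oplus>\<^bsub>Uq G\<^esub>r\<in>{0..?n}. ((- 1) ^ r * inverse ?v ^ r) \<odot>\<^bsub>Uq G\<^esub>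
              (divided_power G i (uE G i) r \<otimes>\<^bsub>Uq G\<^esub> uE G j \<otimes>\<^bsub>Uq G\<^esub> divided_power G i (uE G i) (?n - r)))"
    using bspec[OF bspec[OF action_other ij(1)] ij(2)] ij(3) unfolding Let_def by simp
  then have "Tt i (eE j) = (\<Sum>r\<in>{0..?n}. lsc ((- 1) ^ r * inverse ?v ^ r) (lsc (inverse (qfact ?v r)) (eE i ^ r) * eE j * lsc (inverse (qfact ?v (?n - r))) (eE i ^ (?n - r))))"
    using ij tr_Phi[OF gens_carrier(1)[OF ij(2)], of "T i"]
    by (simp add: Phi_gens Phi_finsum Uq_smult_closed divided_power_closed gens_carrier Phi_smult Phi_mult Phi_divided_power)
  also have "\<dots> = lo.fr ?v (cm G i j) (eE i) (eE j) ?n"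
    unfolding lo.fr_closed[OF v(1)] n atLeast0AtMost
    by (intro sum.cong refl) (simp add: mult.assoc power_int_minus power_inverse)
  finally show ?thesis by simp
qed

text \<open>Lusztig's sum for F_j has the divided powers in the opposite order and the inverse
  powers of q_i. Reversing the summation index turns it into the chain element built from F_i and
  F_j, at the cost of the factor (-q_i)^n; this is the parameter t' of the exchanged
  algebra.\<close>

lemma Tt_F:
  assumes ij: "i \<in> I" "j \<in> I" "i \<noteq> j"
  shows "Tt i (eF j) = lsc ((- q_at G i) ^ nat (- cm G i j)) (lo.fr (q_at G i) (cm G i j) (eF i) (eF j) (nat (- cm G i j)))"
proof -
  let ?n = "nat (- cm G i j)" and ?v = "q_at G i"
  have v: "generic ?v" "?v \<noteq> 0" using eq.q_generic eq.q_nz ij by auto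
  have n: "cm G i j + int ?n - 1 = -1" using eq.cm_nonpos[OF ij] by simp
  have "T i (uF G j) = (\<Oplus>\<^bsub>Uq G\<^esub>r\<in>{0..?n}. ((- 1) ^ r * ?v ^ r) \<odot>\<^bsub>Uq G\<^esub>
              (divided_power G i (uF G i) (?n - r) \<otimes>\<^bsub>Uq G\<^esub> uF G j \<otimes>\<^bsub>Uq G\<^esub> divided_power G i (uF G i) r))"
    using bspec[OF bspec[OF action_other ij(1)] ij(2)] ij(3) unfolding Let_def by simp
  then have "Tt i (eF j) = (\<Sum>r\<in>{0..?n}. lsc ((- 1) ^ r * ?v ^ r) (lsc (inverse (qfact ?v (?n - r))) (eF i ^ (?n - r)) * eF j * lsc (inverse (qfact ?v r)) (eF i ^ r)))"
    using ij tr_Phi[OF gens_carrier(2)[OF ij(2)], of "T i"]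
    by (simp add: Phi_gens Phi_finsum Uq_smult_closed divided_power_closed gens_carrier Phi_smult Phi_mult Phi_divided_power)
  also have "\<dots> = (\<Sum>r\<in>{..?n}. lsc ((- ?v) ^ ?n) (lsc ((- 1) ^ r * ?v powi (int r * - 1) * inverse (qfact ?v r) * inverse (qfact ?v (?n - r)))
     (eF i ^ r * eF j * eF i ^ (?n - r))))"
  proof (rule sum.reindex_bij_witness[of _ "\<lambda>k. ?n - k" "\<lambda>k. ?n - k"])
    fix r assume r: "r \<in> {0..?n}"
    have "(- ?v) ^ ?n = (- ?v) ^ r * (- ?v) ^ (?n - r)" using r by (simp add: power_add[symmetric])
    also have "\<dots> = ((-1) ^ r * ?v ^ r) * ((-1) ^ (?n - r) * ?v ^ (?n - r))"
      unfolding power_minus[of ?v] ..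
    finally have "(- ?v) ^ ?n * ((-1) ^ (?n - r) * ?v powi (int (?n - r) * - 1)) =
       ((-1) ^ r * ?v ^ r) * (((-1) ^ (?n - r) * (-1) ^ (?n - r)) * (?v ^ (?n - r) * inverse (?v ^ (?n - r))))"
      by (simp add: power_int_minus mult_ac)
    then have 1: "(- ?v) ^ ?n * ((-1) ^ (?n - r) * ?v powi (int (?n - r) * - 1)) = (-1) ^ r * ?v ^ r"
      using v(2) by (simp add: power_mult_distrib[symmetric])
    have "lsc ((- ?v) ^ ?n) (lsc ((- 1) ^ (?n - r) * ?v powi (int (?n - r) * - 1) * inverse (qfact ?v (?n - r)) * inverse (qfact ?v (?n - (?n - r))))
     (eF i ^ (?n - r) * eF j * eF i ^ (?n - (?n - r)))) = lsc ((- ?v) ^ ?n * ((-1) ^ (?n - r) * ?v powi (int (?n - r) * - 1)))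
      (lsc (inverse (qfact ?v (?n - r)) * inverse (qfact ?v r)) (eF i ^ (?n - r) * eF j * eF i ^ r))"
      using r by (simp add: mult.assoc)
    also have "\<dots> = lsc ((- 1) ^ r * ?v ^ r) (lsc (inverse (qfact ?v (?n - r))) (eF i ^ (?n - r)) * eF j * lsc (inverse (qfact ?v r)) (eF i ^ r))"
      unfolding 1 by (simp add: mult.assoc mult_ac)
    finally show "lsc ((- ?v) ^ ?n) (lsc ((- 1) ^ (?n - r) * ?v powi (int (?n - r) * - 1) * inverse (qfact ?v (?n - r)) * inverse (qfact ?v (?n - (?n - r))))
     (eF i ^ (?n - r) * eF j * eF i ^ (?n - (?n - r)))) = \<dots>" .
  qed auto
  also have "\<dots> = lsc ((- ?v) ^ ?n) (lo.fr ?v (cm G i j) (eF i) (eF j) ?n)"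
    unfolding lo.fr_closed[OF v(1)] n lo.scale_sum_right ..
  finally show ?thesis .
qed

text \<open>Rewriting E_i K_i as q_i^-2 K_i E_i gives the value at F_i the shape required after
  exchanging E with F and K with its inverse, with s' = -q_i^-2.\<close>

lemma Tt_self:
  assumes i: "i \<in> I"
  shows "Tt i (eE i) = lsc (- 1) (eKi i * eF i)" "Tt i (eF i) = lsc (- (q_at G i powi - 2)) (eK i * eE i)" "Tt i (eK i) = eKi i"
proof -
  have "T i (uE G i) = \<ominus>\<^bsub>Uq G\<^esub> (uKinv G i \<otimes>\<^bsub>Uq G\<^esub> uF G i)" "T i (uF G i) = \<ominus>\<^bsub>Uq G\<^esub> (uE G i \<otimes>\<^bsub>Uq G\<^esub> uK G i)"
    "T i (uK G i) = uK G i \<otimes>\<^bsub>Uq G\<^esub> uKpow G i (- cm G i i)"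
    using bspec[OF action_self i] bspec[OF bspec[OF action_K i] i] by simp_all
  then have "Tt i (eE i) = - (eKi i * eF i)" "Tt i (eF i) = - (eE i * eK i)" "Tt i (eK i) = eK i * (eKi i * eKi i)"
    using i tr_Phi[OF gens_carrier(1)[OF i], of "T i"] tr_Phi[OF gens_carrier(2)[OF i], of "T i"] tr_Phi[OF gens_carrier(3)[OF i], of "T i"]
    by (simp_all add: Phi_gens Phi_minus Phi_mult gens_carrier uKpow_def cm_refl Phi_pow power2_eq_square)
  moreover have "eE i * eK i = lsc (q_at G i powi - 2) (eK i * eE i)"
    using eq.KE[OF i i] eq.q_nz[OF i] cm_refl[OF i] by (simp add: power_int_minus)
  moreover have "eK i * (eKi i * eKi i) = eKi i" using eq.KKi[OF i] by (simp add: mult.assoc[symmetric])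
  ultimately show "Tt i (eE i) = lsc (- 1) (eKi i * eF i)" "Tt i (eF i) = lsc (- (q_at G i powi - 2)) (eK i * eE i)" "Tt i (eK i) = eKi i"
    by simp_all
qed

lemma Tt_props:
  assumes i: "i \<in> I"
  shows "x \<in> eU \<Longrightarrow> Tt i x \<in> eU" "x \<in> eU \<Longrightarrow> y \<in> eU \<Longrightarrow> Tt i (x + y) = Tt i x + Tt i y"
    "x \<in> eU \<Longrightarrow> y \<in> eU \<Longrightarrow> Tt i (x * y) = Tt i x * Tt i y" "x \<in> eU \<Longrightarrow> Tt i (lsc c x) = lsc c (Tt i x)" "Tt i 1 = 1"
    "inj_on (Tt i) eU"
proof -
  show "Tt i x \<in> eU" if "x \<in> eU" using eU_cases[OF that] tr_Phi T_closed[OF i] Phi_U by metis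
  show "Tt i (x + y) = Tt i x + Tt i y" "Tt i (x * y) = Tt i x * Tt i y" if xy: "x \<in> eU" "y \<in> eU"
  proof -
    obtain u v where uv: "u \<in> C" "x = Phi u" "v \<in> C" "y = Phi v" using eU_cases xy by metis
    show "Tt i (x + y) = Tt i x + Tt i y"
      using uv i tr_Phi[of "u \<oplus>\<^bsub>Uq G\<^esub> v" "T i"] by (simp add: Phi_add tr_Phi T_hom_add T_closed)
    show "Tt i (x * y) = Tt i x * Tt i y"
      using uv i tr_Phi[of "u \<otimes>\<^bsub>Uq G\<^esub> v" "T i"] by (simp add: Phi_mult tr_Phi T_hom_mult T_closed)
  qed
  show "Tt i (lsc c x) = lsc c (Tt i x)" if x: "x \<in> eU"
  proof -
    obtain u where u: "u \<in> C" "x = Phi u" using eU_cases x by metis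
    show ?thesis using u i tr_Phi[of "c \<odot>\<^bsub>Uq G\<^esub> u" "T i"] by (simp add: Phi_smult tr_Phi T_hom_smult T_closed Uq_smult_closed)
  qed
  show "Tt i 1 = 1" using tr_Phi[of "\<one>\<^bsub>Uq G\<^esub>" "T i"] by (simp add: Phi_one T_hom_one[OF i])
  show "inj_on (Tt i) eU"
  proof (rule inj_onI)
    fix x y assume xy: "x \<in> eU" "y \<in> eU" and eq: "Tt i x = Tt i y"
    obtain u v where uv: "u \<in> C" "x = Phi u" "v \<in> C" "y = Phi v" using eU_cases xy by metis
    then have "Phi (T i u) = Phi (T i v)" using eq tr_Phi by simp
    then have "T i u = T i v" using Phi_inj T_closed[OF i] uv by (meson inj_onD)
    then have "u = v" using inj_onD[OF T_hom_inj[OF i]] uv by blast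
    then show "x = y" using uv by simp
  qed
qed

lemma Tt_braid:
  assumes ij: "i \<in> I" "j \<in> I" "i \<noteq> j" and x: "x \<in> eU"
  shows "foldr Tt (alternating i j (coxeter_number G i j)) x = foldr Tt (alternating j i (coxeter_number G i j)) x"
proof -
  obtain u where u: "u \<in> C" "x = Phi u" using eU_cases x by metis
  have l: "alternating i j n \<in> lists I" "alternating j i n \<in> lists I" for n
    using alternating_in[of i j n] alternating_in[of j i n] ij by auto
  have "foldr T (alternating i j (coxeter_number G i j)) u = foldr T (alternating j i (coxeter_number G i j)) u"
    using bspec[OF bspec[OF action_braid ij(1)] ij(2)] ij(3) u by blast
  then show ?thesis using u l by (simp add: foldr_Tt)
qed

lemma Tt_lusz: "lusz lsc G eE eF eK eKi eU Tt (\<lambda>_ _. 1) (\<lambda>_. - 1)"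
  by (intro lusz.intro lusz_axioms.intro cartan_axioms embed_qrel)
    (auto simp: eU_closed egen_U Tt_props Tt_E Tt_self intro: Tt_braid)

sublocale pbw lsc G eE eF eK eKi eU Tt eL eR "\<lambda>i j. (- q_at G i) ^ nat (- cm G i j)" "\<lambda>i. - (q_at G i powi - 2)"
proof (intro pbw.intro pbw_axioms.intro)
  show "lusz lsc G eE eF eK eKi eU Tt (\<lambda>_ _. 1) (\<lambda>_. - 1)"
    by (rule Tt_lusz)
  show "lusz lsc G eF eE eKi eK eU Tt (\<lambda>i j. (- q_at G i) ^ nat (- cm G i j)) (\<lambda>i. - (q_at G i powi - 2))"
    by (intro lusz.intro lusz_axioms.intro cartan_axioms eq.swap)
      (auto simp: eU_closed egen_U Tt_props Tt_F Tt_self intro: Tt_braid)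
  fix i assume i: "i \<in> idx G"
  show "Tt i (eF i * eK i) = - eE i"
  proof -
    have "Tt i (eF i * eK i) = - (eE i * eK i * eKi i)"
      using i Tt_self[OF i] egen_U eq.KE[OF i i] eq.q_nz[OF i] cm_refl[OF i] by (simp add: Tt_props power_int_minus)
    then show ?thesis using eq.KKi[OF i] by (simp add: mult.assoc)
  qed
  show "inj_on (Tt i) eU" using Tt_props(6)[OF i] .
next
  fix \<kappa> x assume "\<kappa> \<noteq> 0" "x \<in> eL \<kappa>" "x \<in> lusz.Up lsc G eE"
  then show "x = 0" unfolding lusz.Up_def[OF Tt_lusz] by (rule eL_positive)
next
  fix x assume "x \<in> eR" "x \<in> lusz.Up lsc G eE"
  then show "x = 0" unfolding lusz.Up_def[OF Tt_lusz] by (rule eR_positive)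
qed (simp_all add: embed_serre0 eL_subspace eL_left eL_F eR_right eR_F)

end

section \<open>The PBW basis of the positive part\<close>

definition omon :: "'a::monoid_mult list \<Rightarrow> nat list \<Rightarrow> 'a" where
  "omon xs as = prod_list (map2 (\<lambda>x a. x ^ a) xs as)"

lemma omon_simps [simp]: "omon [] as = 1" "omon (x # xs) (a # as) = x ^ a * omon xs as"
  by (simp_all add: omon_def)

lemma omon_app: "length xs = length as \<Longrightarrow> omon (xs @ ys) (as @ bs) = omon xs as * omon ys bs"
  by (simp add: omon_def)

context cq_algebra
begin

text \<open>The coefficients are indexed by D and not by the values of m; this yields injectivity as
  well, since equal values at two indices would satisfy the relation with coefficients 1 and
  -1.\<close>

lemma family_independent:
  assumes f: "\<And>A c a. finite A \<Longrightarrow> A \<subseteq> D \<Longrightarrow> (\<Sum>a\<in>A. c a *s m a) = 0 \<Longrightarrow> a \<in> A \<Longrightarrow> c a = 0"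
  shows "inj_on m D" "independent (m ` D)"
proof -
  show inj: "inj_on m D"
  proof (rule inj_onI, rule ccontr)
    fix a b assume ab: "a \<in> D" "b \<in> D" "m a = m b" "a \<noteq> b"
    have "(\<Sum>x\<in>{a, b}. (if x = a then 1 else - 1) *s m x) = 0" using ab by simp
    from f[OF _ _ this, of a] ab show False by simp
  qed
  show "independent (m ` D)"
    unfolding independent_explicit_finite_subsets
  proof (intro allI impI ballI)
    fix S u v assume S: "S \<subseteq> m ` D" "finite S" and z: "(\<Sum>v\<in>S. u v *s v) = 0" and v: "v \<in> S"
    obtain A where A: "A \<subseteq> D" "finite A" "S = m ` A" using finite_subset_image[OF S(2,1)] by blast
    have "(\<Sum>a\<in>A. u (m a) *s m a) = 0" using z A inj_on_subset[OF inj A(1)] by (simp add: sum.reindex)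
    then show "u v = 0" using f[OF A(2,1), of "\<lambda>a. u (m a)"] v A(3) by blast
  qed
qed

lemma sc_power: "(c *s x) ^ n = c ^ n *s x ^ n"
  by (induction n) (simp_all add: mult.commute)

lemma prod_list_sc: "prod_list (map (\<lambda>i. c i *s x i) is) = prod_list (map c is) *s prod_list (map x is)"
  by (induction "is") (simp_all add: mult.commute)

end

context uq_action
begin

lemma gamma_nz: "gamma G \<beta> \<noteq> 0"
  unfolding gamma_def using finI eq.q_generic generic_d by simp

definition rootvec :: "'i list \<Rightarrow> 'i \<Rightarrow> 'i gen free_word lop" where
  "rootvec pre i = lsc (inverse (gamma G (\<lambda>j. W pre (simple_root i) j - simple_root i j))) (foldr Tt pre (eE i))"

primrec rootvecs :: "'i list \<Rightarrow> 'i list \<Rightarrow> 'i gen free_word lop list" where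
  "rootvecs pre [] = []"
| "rootvecs pre (i # ws) = rootvec pre i # rootvecs (pre @ [i]) ws"

lemma rootvecs_length [simp]: "length (rootvecs pre ws) = length ws"
  by (induction ws arbitrary: pre) auto

lemma rootvecs_app: "rootvecs pre (vs @ ws) = rootvecs pre vs @ rootvecs (pre @ vs) ws"
  by (induction vs arbitrary: pre) auto

lemma rootvecs_map: "rootvecs pre ws = map (\<lambda>k. rootvec (pre @ take k ws) (ws ! k)) [0..<length ws]"
proof (induction ws arbitrary: pre)
  case (Cons i ws)
  have "[0..<length (i # ws)] = 0 # map Suc [0..<length ws]"
    by (simp add: upt_conv_Cons map_Suc_upt del: upt_Suc)
  then show ?case using Cons[of "pre @ [i]"] by simp
qed simp

lemma pbw_gens_closed: "ws \<in> lists I \<Longrightarrow> set (pbw_gens G T ws) \<subseteq> C"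
proof -
  assume ws: "ws \<in> lists I"
  have "inverse (pbw_coeff G ws k) \<odot>\<^bsub>Uq G\<^esub> foldr T (take k ws) (uE G (ws ! k)) \<in> C" if "k < length ws" for k
    using that ws by (intro Uq_smult_closed foldr_T_closed gens_carrier) (auto simp: in_lists_conv_set dest: in_set_takeD)
  then show ?thesis by (auto simp: pbw_gens_def)
qed

lemma Phi_pbw_gens: "ws \<in> lists I \<Longrightarrow> map Phi (pbw_gens G T ws) = rootvecs [] ws"
proof -
  assume ws: "ws \<in> lists I"
  have "Phi (inverse (pbw_coeff G ws k) \<odot>\<^bsub>Uq G\<^esub> foldr T (take k ws) (uE G (ws ! k))) = rootvec (take k ws) (ws ! k)" if k: "k < length ws" for k
  proof -
    have t: "take k ws \<in> lists I" "ws ! k \<in> I" using k ws by (auto simp: in_lists_conv_set dest: in_set_takeD)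
    have "foldr T (take k ws) (uE G (ws ! k)) \<in> C" using t by (intro foldr_T_closed gens_carrier)
    moreover have "Phi (foldr T (take k ws) (uE G (ws ! k))) = foldr Tt (take k ws) (eE (ws ! k))"
      using foldr_Tt[OF t(1) gens_carrier(1)[OF t(2)]] by (simp add: Phi_gens)
    ultimately show ?thesis by (simp add: Phi_smult rootvec_def pbw_coeff_def)
  qed
  then show ?thesis unfolding rootvecs_map pbw_gens_def by simp
qed

lemma Phi_ordered_monomial:
  "set xs \<subseteq> C \<Longrightarrow> length as = length xs \<Longrightarrow> ordered_monomial (Uq G) xs as \<in> C \<and> Phi (ordered_monomial (Uq G) xs as) = omon (map Phi xs) as"
proof (induction xs arbitrary: as)
  case Nil
  then show ?case by (simp add: ordered_monomial_def Phi_one)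
next
  case (Cons x xs)
  then obtain a bs where as: "as = a # bs" "length bs = length xs" by (cases as) auto
  have "ordered_monomial (Uq G) (x # xs) as = x [^]\<^bsub>Uq G\<^esub> a \<otimes>\<^bsub>Uq G\<^esub> ordered_monomial (Uq G) xs bs"
    by (simp add: ordered_monomial_def as)
  then show ?case using Cons as by (simp add: Phi_mult Phi_pow)
qed

lemma rootvec_scale: "foldr Tt pre (eE i) = lsc (gamma G (\<lambda>j. W pre (simple_root i) j - simple_root i j)) (rootvec pre i)"
  by (simp add: rootvec_def gamma_nz)

text \<open>The scalar collects powers of the constants \<gamma>, which do not vanish because q is
  generic. Independence and spanning therefore pass from the nested monomials to the normalised
  ones.\<close>

lemma mono_omon:
  "pre \<in> lists I \<Longrightarrow> ws \<in> lists I \<Longrightarrow> length as = length ws \<Longrightarrow> \<exists>d. d \<noteq> 0 \<and> foldr Tt pre (mono ws as) = lsc d (omon (rootvecs pre ws) as)"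
proof (induction ws arbitrary: pre as)
  case Nil
  then show ?case by (intro exI[of _ 1]) (simp add: Tw_one)
next
  case (Cons i ws)
  then obtain a bs where as: "as = a # bs" "length bs = length ws" by (cases as) auto
  have i: "i \<in> I" "ws \<in> lists I" "pre @ [i] \<in> lists I" using Cons.prems by auto
  obtain d where d: "d \<noteq> 0" "foldr Tt (pre @ [i]) (mono ws bs) = lsc d (omon (rootvecs (pre @ [i]) ws) bs)"
    using Cons.IH[OF i(3,2) as(2)] by blast
  have "foldr Tt pre (mono (i # ws) as) = foldr Tt pre (eE i) ^ a * foldr Tt (pre @ [i]) (mono ws bs)"
    using Cons.prems i as by (simp add: Tw_mult Tw_power U_power U_E T_mem mono_U)
  also have "\<dots> = lsc (gamma G (\<lambda>j. W pre (simple_root i) j - simple_root i j) ^ a * d) (omon (rootvecs pre (i # ws)) as)"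
    unfolding d(2) by (subst rootvec_scale) (simp add: as lo.sc_power)
  finally show ?case using d(1) gamma_nz by (metis mult_eq_0_iff power_eq_0_iff)
qed

lemma rootvecs_family:
  assumes r: "red ws" and A: "finite A" "A \<subseteq> {as. length as = length ws}"
    and z: "(\<Sum>as\<in>A. lsc (c as) (omon (rootvecs [] ws) as)) = 0" and as: "as \<in> A"
  shows "c as = 0"
proof -
  have ws: "ws \<in> lists I" using r by (simp add: red_def)
  have "\<forall>as. \<exists>d. length as = length ws \<longrightarrow> d \<noteq> 0 \<and> mono ws as = lsc d (omon (rootvecs [] ws) as)"
    using mono_omon[of "[]" ws] ws by auto
  then obtain d where d: "\<And>as. length as = length ws \<Longrightarrow> d as \<noteq> 0 \<and> mono ws as = lsc (d as) (omon (rootvecs [] ws) as)"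
    by metis
  have "(\<Sum>as\<in>A. lsc (c as / d as) (mono ws as)) = (\<Sum>as\<in>A. lsc (c as) (omon (rootvecs [] ws) as))"
  proof (intro sum.cong refl)
    fix as assume "as \<in> A"
    then have "d as \<noteq> 0" "mono ws as = lsc (d as) (omon (rootvecs [] ws) as)" using d[of as] A by auto
    then show "lsc (c as / d as) (mono ws as) = lsc (c as) (omon (rootvecs [] ws) as)" by simp
  qed
  then have "c as / d as = 0" using mono_indep[OF r A(1), of "\<lambda>as. c as / d as" as] z A as by auto
  then show ?thesis using d[of as] as A by auto
qed

lemma rootvecs_basis:
  assumes r: "red ws"
  shows "inj_on (omon (rootvecs [] ws)) {as. length as = length ws}"
    "lo.independent (omon (rootvecs [] ws) ` {as. length as = length ws})"
proof -
  have f: "c a = 0" if "finite A" "A \<subseteq> {as. length as = length ws}" "(\<Sum>a\<in>A. lsc (c a) (omon (rootvecs [] ws) a)) = 0" "a \<in> A" for A c a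
    by (rule rootvecs_family[OF r that])
  show "inj_on (omon (rootvecs [] ws)) {as. length as = length ws}"
    by (rule lo.family_independent(1)) (rule f)
  show "lo.independent (omon (rootvecs [] ws) ` {as. length as = length ws})"
    by (rule lo.family_independent(2)) (rule f)
qed

lemma rootvecs_Up: "red ws \<Longrightarrow> length as = length ws \<Longrightarrow> omon (rootvecs [] ws) as \<in> Up"
proof -
  assume r: "red ws" and l: "length as = length ws"
  obtain d where d: "d \<noteq> 0" "mono ws as = lsc d (omon (rootvecs [] ws) as)"
    using mono_omon[of "[]" ws as] r l by (auto simp: red_def)
  then have "omon (rootvecs [] ws) as = lsc (inverse d) (mono ws as)" by simp
  then show ?thesis using Up_sc mono_Up[OF r] by metis
qed

lemma rootvecs_span:
  assumes l: "longest ws"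
  shows "Up = lo.span (omon (rootvecs [] ws) ` {as. length as = length ws})"
proof
  have r: "red ws" "ws \<in> lists I" using l by (auto simp: longest_def red_def)
  show "lo.span (omon (rootvecs [] ws) ` {as. length as = length ws}) \<subseteq> Up"
    by (rule lo.span_minimal) (auto simp: rootvecs_Up[OF r(1)], simp add: Up_def)
  have "mono ws as \<in> lo.span (omon (rootvecs [] ws) ` {as. length as = length ws})" if len: "length as = length ws" for as
  proof -
    obtain d where "mono ws as = lsc d (omon (rootvecs [] ws) as)"
      using mono_omon[of "[]" ws as] r len by auto
    moreover have "omon (rootvecs [] ws) as \<in> lo.span (omon (rootvecs [] ws) ` {as. length as = length ws})"
      using len by (intro lo.span_base) blast
    ultimately show ?thesis by (simp only: lo.span_scale)
  qed
  then have "lo.span {mono ws as |as. length as = length ws} \<subseteq> lo.span (omon (rootvecs [] ws) ` {as. length as = length ws})"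
    by (intro lo.span_minimal) auto
  then show "Up \<subseteq> lo.span (omon (rootvecs [] ws) ` {as. length as = length ws})"
    using mono_span[OF l] by blast
qed

lemma Uq_plus_props: "u \<in> Uq_plus G \<Longrightarrow> u \<in> C \<and> Phi u \<in> Up"
  unfolding Uq_plus_def
proof (induction rule: generate_ring.induct)
  case (incl h)
  then show ?case using gens_carrier(1) Up_E Up_sc[OF Up_one]
    by (auto simp: Phi_gens Phi_smult Phi_one Uq_smult_closed)
next
  case (a_inv h)
  then show ?case using Up_sc[of "Phi h" "-1"] by (simp add: Phi_minus)
qed (auto simp: Phi_one Up_one Phi_add Up_add Phi_mult Up_mult)

lemma Uq_plus_sub: "Uq_plus G \<subseteq> C"
  using Uq_plus_props by blast

lemma Uq_plus_one: "\<one>\<^bsub>Uq G\<^esub> \<in> Uq_plus G"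
  and Uq_plus_add: "u \<in> Uq_plus G \<Longrightarrow> v \<in> Uq_plus G \<Longrightarrow> u \<oplus>\<^bsub>Uq G\<^esub> v \<in> Uq_plus G"
  and Uq_plus_mult: "u \<in> Uq_plus G \<Longrightarrow> v \<in> Uq_plus G \<Longrightarrow> u \<otimes>\<^bsub>Uq G\<^esub> v \<in> Uq_plus G"
  and Uq_plus_E: "i \<in> I \<Longrightarrow> uE G i \<in> Uq_plus G"
  by (auto simp: Uq_plus_def intro: generate_ring.intros)

lemma Uq_plus_smult: "u \<in> Uq_plus G \<Longrightarrow> c \<odot>\<^bsub>Uq G\<^esub> u \<in> Uq_plus G"
proof -
  assume u: "u \<in> Uq_plus G"
  then have uC: "u \<in> C" using Uq_plus_sub by blast
  have "c \<odot>\<^bsub>Uq G\<^esub> \<one>\<^bsub>Uq G\<^esub> \<in> Uq_plus G" unfolding Uq_plus_def by (auto intro: generate_ring.incl)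
  then have "(c \<odot>\<^bsub>Uq G\<^esub> \<one>\<^bsub>Uq G\<^esub>) \<otimes>\<^bsub>Uq G\<^esub> u \<in> Uq_plus G" using u by (rule Uq_plus_mult)
  moreover have "(c \<odot>\<^bsub>Uq G\<^esub> \<one>\<^bsub>Uq G\<^esub>) \<otimes>\<^bsub>Uq G\<^esub> u = c \<odot>\<^bsub>Uq G\<^esub> u"
    by (rule inj_onD[OF Phi_inj]) (simp_all add: uC Phi_mult Phi_smult Phi_one Uq_smult_closed)
  ultimately show ?thesis by simp
qed

lemma Phi_Uq_plus: "Phi ` Uq_plus G = Up"
proof
  show "Phi ` Uq_plus G \<subseteq> Up" using Uq_plus_props by blast
  show "Up \<subseteq> Phi ` Uq_plus G"
  proof
    fix x assume "x \<in> Up"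
    then show "x \<in> Phi ` Uq_plus G" unfolding Up_def
    proof (induction rule: lo.span_induct_alt)
      case base
      have "Phi (0 \<odot>\<^bsub>Uq G\<^esub> \<one>\<^bsub>Uq G\<^esub>) = 0" by (simp add: Phi_smult)
      then show ?case using Uq_plus_smult[OF Uq_plus_one] by (metis imageI)
    next
      case (step c b x)
      then obtain w u where w: "b = prod_list (map eE w)" "set w \<subseteq> I" and u: "u \<in> Uq_plus G" "x = Phi u" by auto
      have "\<exists>v\<in>Uq_plus G. prod_list (map eE w) = Phi v" using w(2)
      proof (induction w)
        case Nil
        then show ?case using Uq_plus_one Phi_one by force
      next
        case (Cons i w)
        then obtain v where v: "v \<in> Uq_plus G" "prod_list (map eE w) = Phi v" by auto
        then show ?case using Cons.prems Uq_plus_mult Uq_plus_E Uq_plus_sub gens_carrier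
          by (intro bexI[of _ "uE G i \<otimes>\<^bsub>Uq G\<^esub> v"]) (auto simp: Phi_mult Phi_gens)
      qed
      then obtain v where v: "v \<in> Uq_plus G" "b = Phi v" using w by auto
      have "lsc c b + x = Phi (c \<odot>\<^bsub>Uq G\<^esub> v \<oplus>\<^bsub>Uq G\<^esub> u)"
        using u v Uq_plus_sub by (auto simp: Phi_add Phi_smult Uq_smult_closed subsetD)
      then show ?case using u v Uq_plus_smult Uq_plus_add by blast
    qed
  qed
qed

lemma Psi_Up: "x \<in> Up \<Longrightarrow> Psi x \<in> Uq_plus G \<and> Phi (Psi x) = x"
proof -
  assume "x \<in> Up"
  then obtain u where u: "u \<in> Uq_plus G" "x = Phi u" using Phi_Uq_plus by blast
  then show ?thesis using Psi_Phi Uq_plus_sub by auto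
qed

section \<open>Reduced words in the sense of the statement\<close>

lemma weyl_length_le: "ws \<in> lists I \<Longrightarrow> weyl_length G (W ws) \<le> length ws"
  unfolding weyl_length_def by (rule Least_le) blast

lemma red_weyl_length: "red ws \<Longrightarrow> weyl_length G (W ws) = length ws"
proof -
  assume r: "red ws"
  have "\<exists>us\<in>lists I. length us = weyl_length G (W ws) \<and> W us = W ws"
    unfolding weyl_length_def by (rule LeastI[of _ "length ws"]) (use r in \<open>auto simp: red_def\<close>)
  then show ?thesis using r weyl_length_le[of ws] unfolding red_def by (metis le_antisym)
qed

lemma reduced_words_red: "ws \<in> reduced_words G w \<Longrightarrow> red ws"
proof -
  assume a: "ws \<in> reduced_words G w"
  have "length ws \<le> length us" if "us \<in> lists I" "W us = W ws" for us
    using weyl_length_le[OF that(1)] that(2) a by (simp add: reduced_words_def)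
  then show "red ws" using a by (auto simp: reduced_words_def red_def)
qed

lemma reduced_words_longest:
  assumes "longest_element G w" "ws \<in> reduced_words G w"
  shows "longest ws"
  unfolding longest_def
proof (intro conjI allI impI)
  show "red ws" using reduced_words_red assms by blast
  fix us assume us: "red us"
  then have "W us \<in> weyl_group G" unfolding weyl_group_def red_def by blast
  then have "weyl_length G (W us) \<le> weyl_length G w" using assms(1) unfolding longest_element_def by blast
  then show "length us \<le> length ws" using red_weyl_length[OF us] assms(2) unfolding reduced_words_def by auto
qed

end

section \<open>Folding\<close>

text \<open>Kept apart from \<open>folding\<close> so that it can be instantiated with the inverse
  of \<sigma> as well.\<close>

locale diagram = cartan G for G :: "'i cartan_datum" +
  fixes \<sigma> :: "'i \<Rightarrow> 'i"
  assumes sl: "simply_laced G" and da: "diagram_automorphism G \<sigma>"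
begin

lemma sigma_I: "i \<in> I \<Longrightarrow> \<sigma> i \<in> I"
  using da unfolding diagram_automorphism_def bij_betw_def by auto

lemma sigma_inj: "inj_on \<sigma> I"
  using da unfolding diagram_automorphism_def bij_betw_def by auto

lemma sigma_cm: "i \<in> I \<Longrightarrow> j \<in> I \<Longrightarrow> cm G (\<sigma> i) (\<sigma> j) = cm G i j"
  using da unfolding diagram_automorphism_def by auto

lemma sym1: "i \<in> I \<Longrightarrow> cartan_datum.sym G i = 1"
  using sl unfolding simply_laced_def by auto

lemma cm_sym: "i \<in> I \<Longrightarrow> j \<in> I \<Longrightarrow> cm G i j = cm G j i"
proof -
  assume ij: "i \<in> I" "j \<in> I"
  have "int (cartan_datum.sym G i) * cm G i j = int (cartan_datum.sym G j) * cm G j i"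
    using fin_type ij unfolding finite_type_def by blast
  then show ?thesis using sym1 ij by simp
qed

lemma inverse_diagram: "diagram G (inv_into I \<sigma>)"
proof (intro diagram.intro diagram_axioms.intro cartan_axioms sl)
  have b: "bij_betw \<sigma> I I" using da unfolding diagram_automorphism_def by blast
  have "cm G (inv_into I \<sigma> i) (inv_into I \<sigma> j) = cm G i j" if ij: "i \<in> I" "j \<in> I" for i j
  proof -
    have "inv_into I \<sigma> i \<in> I" "inv_into I \<sigma> j \<in> I" "\<sigma> (inv_into I \<sigma> i) = i" "\<sigma> (inv_into I \<sigma> j) = j"
      using ij bij_betw_inv_into_right[OF b] bij_betwE[OF bij_betw_inv_into[OF b]] by auto
    then show ?thesis using sigma_cm by metis
  qed
  then show "diagram_automorphism G (inv_into I \<sigma>)"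
    using bij_betw_inv_into[OF b] unfolding diagram_automorphism_def by blast
qed

end

locale folding = diagram G \<sigma> for G :: "'i cartan_datum" and \<sigma> +
  assumes ad: "admissible G \<sigma>"
begin

abbreviation Orb where "Orb \<equiv> orbit \<sigma> ` I"

text \<open>Extending by the identity outside I gives a permutation of the whole type. An orbit is
  generated from the image of i onwards, so it takes the periodicity of a permutation to see that i
  lies in its own orbit.\<close>

definition \<tau> where "\<tau> x = (if x \<in> I then \<sigma> x else x)"

lemma tau_perm: "permutation \<tau>"
proof -
  have "bij_betw \<tau> I I" using da unfolding diagram_automorphism_def by (simp add: \<tau>_def cong: bij_betw_cong)
  then have "\<tau> permutes I" by (rule bij_imp_permutes) (simp add: \<tau>_def)
  then show ?thesis using finI permutation_permutes by blast
qed

lemma orb_tau: "i \<in> I \<Longrightarrow> orbit \<sigma> i = orbit \<tau> i"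
  by (rule orbit_cong0[of _ I]) (auto simp: sigma_I \<tau>_def)

lemma orb_self: "i \<in> I \<Longrightarrow> i \<in> orbit \<sigma> i"
  using permutation_self_in_orbit[OF tau_perm, of i] orb_tau by simp

lemma orb_sub: "i \<in> I \<Longrightarrow> orbit \<sigma> i \<subseteq> I"
proof
  fix j assume i: "i \<in> I" and "j \<in> orbit \<sigma> i"
  from this(2) show "j \<in> I" by induction (use i sigma_I in auto)
qed

lemma orb_eq: "i \<in> I \<Longrightarrow> j \<in> orbit \<sigma> i \<Longrightarrow> orbit \<sigma> j = orbit \<sigma> i"
  using orbit_swap[OF orb_self, of i j] orbit_trans[of _ \<sigma> j i] orbit_trans[of _ \<sigma> i j] by blast

lemma orb_sub': "r \<in> Orb \<Longrightarrow> r \<subseteq> I"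
  using orb_sub by blast

lemma orb_fin: "r \<in> Orb \<Longrightarrow> finite r"
  using orb_sub' finI finite_subset by blast

lemma orb_ne: "r \<in> Orb \<Longrightarrow> r \<noteq> {}"
  using orb_self by blast

lemma orb_card: "r \<in> Orb \<Longrightarrow> card r > 0"
  using orb_fin orb_ne card_gt_0_iff by blast

lemma orb_of: "r \<in> Orb \<Longrightarrow> i \<in> r \<Longrightarrow> r = orbit \<sigma> i"
  using orb_eq by auto

lemma orb_sigma: "r \<in> Orb \<Longrightarrow> i \<in> r \<Longrightarrow> \<sigma> i \<in> r"
  using orbit.step by fastforce

lemma orb_image: "r \<in> Orb \<Longrightarrow> \<sigma> ` r = r"
proof -
  assume r: "r \<in> Orb"
  have inj: "inj_on \<sigma> r" using sigma_inj orb_sub'[OF r] inj_on_subset by blast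
  have "\<sigma> ` r \<subseteq> r" using orb_sigma[OF r] by blast
  then show ?thesis using card_image[OF inj] orb_fin[OF r] card_subset_eq by blast
qed

lemma orb_bij: "r \<in> Orb \<Longrightarrow> bij_betw \<sigma> r r"
  by (simp add: bij_betw_def orb_image inj_on_subset[OF sigma_inj orb_sub'])

lemma orb_orth:
  assumes r: "r \<in> Orb" and ij: "i \<in> r" "j \<in> r" "i \<noteq> j"
  shows "cm G i j = 0"
proof -
  have "j \<in> orbit \<sigma> i" using orb_of[OF r ij(1)] ij by simp
  then obtain n where n: "j = (\<sigma> ^^ n) i" unfolding orbit_altdef by blast
  have "i \<in> I" using ij(1) orb_sub'[OF r] by blast
  then have "(\<sigma> ^^ n) i \<noteq> i \<longrightarrow> cm G i ((\<sigma> ^^ n) i) = 0" using ad unfolding admissible_def by blast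
  then show ?thesis using ij(3) n by simp
qed

lemma orb_const:
  assumes r: "r \<in> Orb" and i: "i \<in> r" and f: "\<And>k. k \<in> r \<Longrightarrow> f (\<sigma> k) = f k" and j: "j \<in> r"
  shows "f j = f i"
proof -
  have "j \<in> orbit \<sigma> i" using orb_of[OF r i] j by simp
  then have "f j = f i \<and> j \<in> r"
    by (induction rule: orbit.induct) (use i f orb_sigma[OF r] in auto)
  then show ?thesis by simp
qed

text \<open>Reindexing s by \<sigma> shows that row sums are \<sigma>-invariant, hence constant on
  the orbit r. This makes the integer division in the folded Cartan matrix exact.\<close>

lemma row_const:
  assumes "r \<in> Orb" "s \<in> Orb" "i \<in> r" "j \<in> r"
  shows "(\<Sum>k\<in>s. cm G j k) = (\<Sum>k\<in>s. cm G i k)"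
proof (rule orb_const[OF assms(1,3) _ assms(4)])
  fix l assume l: "l \<in> r"
  have "(\<Sum>k\<in>s. cm G (\<sigma> l) k) = (\<Sum>k\<in>s. cm G (\<sigma> l) (\<sigma> k))"
    using sum.reindex_bij_betw[OF orb_bij[OF assms(2)], of "\<lambda>k. cm G (\<sigma> l) k"] by simp
  also have "\<dots> = (\<Sum>k\<in>s. cm G l k)"
    by (rule sum.cong[OF refl]) (use sigma_cm orb_sub'[OF assms(1)] orb_sub'[OF assms(2)] l in blast)
  finally show "(\<Sum>k\<in>s. cm G (\<sigma> l) k) = (\<Sum>k\<in>s. cm G l k)" .
qed

lemma folded_idx [simp]: "idx (folded G \<sigma>) = Orb"
  and folded_sym [simp]: "cartan_datum.sym (folded G \<sigma>) r = card r"
  by (simp_all add: folded_def)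

lemma folded_mult:
  assumes "r \<in> Orb" "s \<in> Orb"
  shows "int (card r) * cm (folded G \<sigma>) r s = (\<Sum>i\<in>r. \<Sum>j\<in>s. cm G i j)"
proof -
  obtain i where i: "i \<in> r" using orb_ne[OF assms(1)] by blast
  have "(\<Sum>j\<in>r. \<Sum>k\<in>s. cm G j k) = (\<Sum>j\<in>r. \<Sum>k\<in>s. cm G i k)"
    by (rule sum.cong[OF refl]) (rule row_const[OF assms i])
  then have "(\<Sum>j\<in>r. \<Sum>k\<in>s. cm G j k) = int (card r) * (\<Sum>k\<in>s. cm G i k)" by simp
  then show ?thesis by (simp add: folded_def)
qed

lemma folded_cm:
  assumes "r \<in> Orb" "s \<in> Orb" "i \<in> r"
  shows "cm (folded G \<sigma>) r s = (\<Sum>j\<in>s. cm G i j)"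
proof -
  have "(\<Sum>j\<in>r. \<Sum>k\<in>s. cm G j k) = (\<Sum>j\<in>r. \<Sum>k\<in>s. cm G i k)"
    by (rule sum.cong[OF refl]) (rule row_const[OF assms])
  then show ?thesis using orb_card[OF assms(1)] by (simp add: folded_def)
qed

lemma orb_disj:
  assumes "r \<in> Orb" "s \<in> Orb" "r \<noteq> s" "i \<in> r" "j \<in> s"
  shows "i \<noteq> j"
  using orb_of assms by metis

lemma cm_le: "i \<in> I \<Longrightarrow> j \<in> I \<Longrightarrow> i \<noteq> j \<Longrightarrow> cm G i j \<le> 0"
  using fin_type unfolding finite_type_def by auto

lemma sum_orbits:
  fixes f :: "'i \<Rightarrow> 'b::comm_monoid_add"
  shows "(\<Sum>i\<in>I. f i) = (\<Sum>r\<in>Orb. \<Sum>i\<in>r. f i)"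
proof -
  have "I = (\<Union>r\<in>Orb. r)" using orb_self orb_sub' by blast
  then have "(\<Sum>i\<in>I. f i) = (\<Sum>i\<in>(\<Union>r\<in>Orb. r). f i)" by simp
  also have "\<dots> = (\<Sum>r\<in>Orb. \<Sum>i\<in>r. f i)"
    by (rule sum.UNION_disjoint) (use finI orb_fin orb_disj in blast)+
  finally show ?thesis .
qed

text \<open>A vector on the orbits is pulled back to a vector on I that is constant on orbits, and
  the two quadratic forms agree because all d_i are 1. The diagonal entries are 2 since distinct
  members of an orbit are orthogonal.\<close>

lemma folded_finite_type: "finite_type (folded G \<sigma>)"
  unfolding finite_type_def folded_idx folded_sym
proof (intro conjI ballI allI impI)
  show "finite Orb" using finI by simp
  fix r assume r: "r \<in> Orb"
  obtain i where i: "i \<in> r" using orb_ne[OF r] by blast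
  have "(\<Sum>j\<in>r. cm G i j) = (\<Sum>j\<in>{i}. cm G i j)"
    using orb_orth[OF r i] i orb_fin[OF r] by (intro sum.mono_neutral_right) auto
  then show "cm (folded G \<sigma>) r r = 2" using folded_cm[OF r r i] cm_refl i orb_sub'[OF r] by auto
  show "card r > 0" using orb_card[OF r] .
  fix s assume s: "s \<in> Orb"
  obtain j where j: "j \<in> s" using orb_ne[OF s] by blast
  have sw: "(\<Sum>i\<in>r. \<Sum>j\<in>s. cm G i j) = (\<Sum>j\<in>s. \<Sum>i\<in>r. cm G j i)"
  proof -
    have "(\<Sum>j\<in>s. \<Sum>i\<in>r. cm G j i) = (\<Sum>j\<in>s. \<Sum>i\<in>r. cm G i j)"
      by (rule sum.cong[OF refl], rule sum.cong[OF refl], rule cm_sym) (use orb_sub'[OF r] orb_sub'[OF s] in blast)+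
    then show ?thesis using sum.swap[of "\<lambda>i j. cm G i j" s r] by simp
  qed
  show sm: "int (card r) * cm (folded G \<sigma>) r s = int (card s) * cm (folded G \<sigma>) s r"
    unfolding folded_mult[OF r s] folded_mult[OF s r] by (rule sw)
  assume rs: "r \<noteq> s"
  have le: "cm G i k \<le> 0" if "k \<in> s" for k
    using orb_disj[OF r s rs i that] cm_le i that orb_sub'[OF r] orb_sub'[OF s] by blast
  show "cm (folded G \<sigma>) r s \<le> 0"
    unfolding folded_cm[OF r s i] using le by (rule sum_nonpos)
  show "cm (folded G \<sigma>) r s = 0 \<longleftrightarrow> cm (folded G \<sigma>) s r = 0"
    using sm orb_card[OF r] orb_card[OF s] by auto
next
  fix x :: "'i set \<Rightarrow> real" assume x: "\<exists>r\<in>Orb. x r \<noteq> 0"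
  define z where "z i = x (orbit \<sigma> i)" for i
  have zr: "z i = x r" if "r \<in> Orb" "i \<in> r" for r i using orb_of[OF that] by (simp add: z_def)
  have "\<exists>i\<in>I. z i \<noteq> 0" using x by (auto simp: z_def)
  then have pos: "0 < (\<Sum>i\<in>I. \<Sum>j\<in>I. real (cartan_datum.sym G i) * real_of_int (cm G i j) * z i * z j)"
    using fin_type unfolding finite_type_def by blast
  have "(\<Sum>i\<in>I. \<Sum>j\<in>I. real (cartan_datum.sym G i) * real_of_int (cm G i j) * z i * z j) = (\<Sum>i\<in>I. \<Sum>j\<in>I. real_of_int (cm G i j) * z i * z j)"
    using sym1 by (simp cong: sum.cong)
  also have "\<dots> = (\<Sum>r\<in>Orb. \<Sum>i\<in>r. \<Sum>s\<in>Orb. \<Sum>j\<in>s. real_of_int (cm G i j) * z i * z j)"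
    by (simp only: sum_orbits)
  also have "\<dots> = (\<Sum>r\<in>Orb. \<Sum>s\<in>Orb. \<Sum>i\<in>r. \<Sum>j\<in>s. real_of_int (cm G i j) * z i * z j)"
    by (intro sum.cong refl sum.swap)
  also have "\<dots> = (\<Sum>r\<in>Orb. \<Sum>s\<in>Orb. real (card r) * real_of_int (cm (folded G \<sigma>) r s) * x r * x s)"
  proof (intro sum.cong refl)
    fix r s assume rs: "r \<in> Orb" "s \<in> Orb"
    have "(\<Sum>i\<in>r. \<Sum>j\<in>s. real_of_int (cm G i j) * z i * z j) = (\<Sum>i\<in>r. \<Sum>j\<in>s. real_of_int (cm G i j) * (x r * x s))"
      using zr[OF rs(1)] zr[OF rs(2)] by (intro sum.cong refl) (simp add: mult.assoc)
    also have "\<dots> = real_of_int (\<Sum>i\<in>r. \<Sum>j\<in>s. cm G i j) * (x r * x s)"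
      by (simp add: sum_distrib_right)
    also have "\<dots> = real (card r) * real_of_int (cm (folded G \<sigma>) r s) * x r * x s"
      unfolding folded_mult[OF rs, symmetric] by simp
    finally show "(\<Sum>i\<in>r. \<Sum>j\<in>s. real_of_int (cm G i j) * z i * z j) = \<dots>" .
  qed
  finally show "0 < (\<Sum>r\<in>Orb. \<Sum>s\<in>Orb. real (card r) * real_of_int (cm (folded G \<sigma>) r s) * x r * x s)"
    using pos by simp
qed

end

section \<open>The diagram automorphism on the quantized enveloping algebra\<close>

lemma frelabel_lext: "frelabel \<sigma> x = pm.lext (\<lambda>w. fwd (map (map_gen \<sigma>) (letters w))) x"
proof -
  have "map_free_word (map_gen \<sigma>) w = FW (map (map_gen \<sigma>) (letters w))" for w by (cases w) simp
  then show ?thesis by (simp add: frelabel_def pm.lext_def fwd_def psc_single)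
qed

lemma frelabel_add: "frelabel \<sigma> (x + y) = frelabel \<sigma> x + frelabel \<sigma> y"
  and frelabel_psc: "frelabel \<sigma> (psc c x) = psc c (frelabel \<sigma> x)"
  and frelabel_0 [simp]: "frelabel \<sigma> 0 = 0"
  and frelabel_sum: "frelabel \<sigma> (sum g A) = (\<Sum>a\<in>A. frelabel \<sigma> (g a))"
  and frelabel_mult: "frelabel \<sigma> (x * y) = frelabel \<sigma> x * frelabel \<sigma> y"
  unfolding frelabel_lext by (simp_all add: pm.lext_add pm.lext_psc pm.lext_sum)
    (rule pm.lext_mult, simp add: plus_free_word_def fwd_app)

lemma frelabel_diff: "frelabel \<sigma> (x - y) = frelabel \<sigma> x - frelabel \<sigma> y"
  using frelabel_add[of \<sigma> "x - y" y] by simp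

lemma frelabel_fwd: "frelabel \<sigma> (fwd w) = fwd (map (map_gen \<sigma>) w)"
  by (simp add: frelabel_lext fwd_def pm.lext_single)

lemma frelabel_1: "frelabel \<sigma> 1 = 1"
  using frelabel_fwd[of \<sigma> "[]"] by (simp add: fwd_Nil)

lemma frelabel_power: "frelabel \<sigma> (x ^ n) = frelabel \<sigma> x ^ n"
  by (induction n) (simp_all add: frelabel_1 frelabel_mult)

lemma frelabel_fgen: "frelabel \<sigma> (fgen g) = fgen (map_gen \<sigma> g)"
  by (simp add: fgen_fwd frelabel_fwd)

context diagram
begin

lemma q_at_sigma: "i \<in> I \<Longrightarrow> q_at G (\<sigma> i) = q_at G i"
  using sym1 sigma_I by (simp add: q_at_def)

lemma frelabel_frc: "x \<in> frc I \<Longrightarrow> frelabel \<sigma> x \<in> frc I"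
  unfolding frc_span[of I]
proof (induction rule: pm.span_induct_alt)
  case (step c b y)
  then obtain w where w: "b = fwd w" "gword I w" by auto
  then have "gword I (map (map_gen \<sigma>) w)" using sigma_I by (auto simp: gword_def gen.set_map)
  then have "frelabel \<sigma> b \<in> frc I" unfolding w frelabel_fwd by (rule frc_fwd)
  then show ?case using step unfolding frc_span[symmetric] by (simp add: frelabel_add frelabel_psc frc_add frc_psc)
qed (simp add: pm.span_zero)

lemma frelabel_rel:
  assumes r: "r \<in> uq_relations G"
  shows "frelabel \<sigma> r \<in> uq_relations G"
proof -
  note [simp] = frelabel_diff frelabel_mult frelabel_fgen frelabel_1 fconst_mult frelabel_psc q_at_sigma sigma_cm sigma_I
  have s: "frelabel \<sigma> (serre G X i j) = serre G X (\<sigma> i) (\<sigma> j)"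
    if "i \<in> I" "j \<in> I" "map_gen \<sigma> (X i) = X (\<sigma> i)" "map_gen \<sigma> (X j) = X (\<sigma> j)" for X i j
    using that by (simp add: serre_def Let_def frelabel_sum frelabel_power mult.assoc)
  have inj: "\<sigma> i = \<sigma> j \<longleftrightarrow> i = j" if "i \<in> I" "j \<in> I" for i j using sigma_inj that by (meson inj_onD)
  show ?thesis using r unfolding uq_relations_def
  proof (elim UnE CollectE exE conjE, goal_cases)
    case (1 i) then show ?case by (intro UnI1 CollectI exI[of _ "\<sigma> i"]) simp
  next
    case (2 i)
    have "frelabel \<sigma> r = fgen (GenKinv (\<sigma> i)) * fgen (GenK (\<sigma> i)) - 1 \<and> \<sigma> i \<in> I" using 2 by simp
    then show ?case by blast
  next
    case (3 i j)
    have "frelabel \<sigma> r = fgen (GenK (\<sigma> i)) * fgen (GenK (\<sigma> j)) - fgen (GenK (\<sigma> j)) * fgen (GenK (\<sigma> i)) \<and> \<sigma> i \<in> I \<and> \<sigma> j \<in> I" using 3 by simp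
    then show ?case by blast
  next
    case (4 i j)
    have "frelabel \<sigma> r = fgen (GenK (\<sigma> i)) * fgen (GenE (\<sigma> j)) * fgen (GenKinv (\<sigma> i))
        - fconst (q_at G (\<sigma> i) powi cm G (\<sigma> i) (\<sigma> j)) * fgen (GenE (\<sigma> j)) \<and> \<sigma> i \<in> I \<and> \<sigma> j \<in> I" using 4 by simp
    then show ?case by blast
  next
    case (5 i j)
    have "frelabel \<sigma> r = fgen (GenK (\<sigma> i)) * fgen (GenF (\<sigma> j)) * fgen (GenKinv (\<sigma> i))
        - fconst (q_at G (\<sigma> i) powi (- cm G (\<sigma> i) (\<sigma> j))) * fgen (GenF (\<sigma> j)) \<and> \<sigma> i \<in> I \<and> \<sigma> j \<in> I" using 5 by simp
    then show ?case by blast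
  next
    case (6 i j)
    have "frelabel \<sigma> r = fgen (GenE (\<sigma> i)) * fgen (GenF (\<sigma> j)) - fgen (GenF (\<sigma> j)) * fgen (GenE (\<sigma> i))
        - (if \<sigma> i = \<sigma> j then fconst (inverse (q_at G (\<sigma> i) - inverse (q_at G (\<sigma> i)))) * (fgen (GenK (\<sigma> i)) - fgen (GenKinv (\<sigma> i)))
           else 0) \<and> \<sigma> i \<in> I \<and> \<sigma> j \<in> I" using 6 inj[of i j] by simp
    then show ?case by blast
  next
    case (7 i j)
    have "frelabel \<sigma> r = serre G GenE (\<sigma> i) (\<sigma> j) \<and> \<sigma> i \<in> I \<and> \<sigma> j \<in> I \<and> \<sigma> i \<noteq> \<sigma> j" using 7 inj[of i j] s by simp
    then show ?case by blast
  next
    case (8 i j)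
    have "frelabel \<sigma> r = serre G GenF (\<sigma> i) (\<sigma> j) \<and> \<sigma> i \<in> I \<and> \<sigma> j \<in> I \<and> \<sigma> i \<noteq> \<sigma> j" using 8 inj[of i j] s by simp
    then show ?case by blast
  qed
qed

lemma frelabel_ideal: assumes "x \<in> uq_ideal G" shows "frelabel \<sigma> x \<in> uq_ideal G"
proof -
  have "uq_ideal G \<subseteq> {x \<in> frc I. frelabel \<sigma> x \<in> uq_ideal G}"
    by (rule uq_ideal_min)
      (auto simp: pm.subspace_def frc_0 frc_add frc_psc frc_mult frelabel_add frelabel_psc frelabel_mult uq_ideal_0 uq_ideal_add uq_ideal_psc
      intro: uq_ideal_l uq_ideal_r frelabel_frc frelabel_rel uq_ideal_rel subsetD[OF uq_relations_frc])
  then show ?thesis using assms by auto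
qed

lemma frelabel_inverse: "x \<in> frc I \<Longrightarrow> frelabel \<sigma> (frelabel (inv_into I \<sigma>) x) = x"
  unfolding frc_span[of I]
proof (induction rule: pm.span_induct_alt)
  case (step c b y)
  then obtain w where w: "b = fwd w" "gword I w" by auto
  have im: "\<sigma> ` I = I" using da unfolding diagram_automorphism_def bij_betw_def by blast
  have "map_gen \<sigma> (map_gen (inv_into I \<sigma>) g) = g" if "set_gen g \<subseteq> I" for g
    using that by (cases g) (auto simp: f_inv_into_f im)
  then have "map (map_gen \<sigma>) (map (map_gen (inv_into I \<sigma>)) w) = w" using w(2)
    by (auto simp: gword_def map_idI)
  then show ?case using step w by (simp add: frelabel_add frelabel_psc frelabel_fwd)
qed simp

text \<open>That the image of a coset is a full coset, and not just part of one, uses that the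
  inverse of \<sigma> preserves the ideal too.\<close>

lemma uq_aut_class:
  assumes x: "x \<in> frc I"
  shows "uq_aut \<sigma> (uq_class G x) = uq_class G (frelabel \<sigma> x)"
proof (intro Set.set_eqI iffI)
  fix z assume "z \<in> uq_aut \<sigma> (uq_class G x)"
  then obtain j where "z = frelabel \<sigma> j + frelabel \<sigma> x" "j \<in> uq_ideal G"
    by (auto simp: uq_aut_def uq_class_eq frelabel_add)
  then show "z \<in> uq_class G (frelabel \<sigma> x)" using frelabel_ideal by (auto simp: uq_class_eq)
next
  fix z assume "z \<in> uq_class G (frelabel \<sigma> x)"
  then obtain j where j: "z = j + frelabel \<sigma> x" "j \<in> uq_ideal G" by (auto simp: uq_class_eq)
  let ?j = "frelabel (inv_into I \<sigma>) j"
  have "?j \<in> uq_ideal G" using diagram.frelabel_ideal[OF inverse_diagram j(2)] .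
  then have "?j + x \<in> uq_class G x" by (auto simp: uq_class_eq)
  moreover have "frelabel \<sigma> (?j + x) = z" using j frelabel_inverse[OF uq_ideal_frc[OF j(2)]] by (simp add: frelabel_add)
  ultimately show "z \<in> uq_aut \<sigma> (uq_class G x)" unfolding uq_aut_def by blast
qed

end

section \<open>Reordering commuting factors\<close>

lemma foldr_perm:
  assumes "mset xs = mset ys" "\<And>a x. a \<in> set xs \<Longrightarrow> x \<in> U \<Longrightarrow> f a x \<in> U"
    "\<And>a b x. a \<in> set xs \<Longrightarrow> b \<in> set xs \<Longrightarrow> x \<in> U \<Longrightarrow> f a (f b x) = f b (f a x)"
  shows "x \<in> U \<Longrightarrow> foldr f xs x = foldr f ys x"
  using assms
proof (induction xs arbitrary: ys)
  case (Cons a xs)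
  have "a \<in> set ys" using Cons.prems(2) by (metis list.set_intros(1) set_mset_mset)
  then obtain us vs where ys: "ys = us @ a # vs" by (meson split_list)
  have m: "mset xs = mset (us @ vs)" using Cons.prems(2) ys by simp
  have s: "set (us @ vs) = set xs" using m by (metis set_mset_mset)
  have fU: "foldr f zs x \<in> U" if "set zs \<subseteq> set xs" for zs
    using that Cons.prems(1,3) by (induction zs) auto
  have mv: "foldr f us (f a z) = f a (foldr f us z) \<and> foldr f us z \<in> U" if "set us \<subseteq> set xs" "z \<in> U" for us z
    using that Cons.prems(3,4) by (induction us) (auto)
  have "foldr f ys x = foldr f us (f a (foldr f vs x))" by (simp add: ys)
  also have "\<dots> = f a (foldr f (us @ vs) x)" using mv[of us "foldr f vs x"] fU[of vs] s by auto
  also have "\<dots> = f a (foldr f xs x)" using Cons.IH[OF Cons.prems(1) m] Cons.prems(3,4) by auto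
  finally show ?case by simp
qed simp

lemma prod_list_perm:
  fixes f :: "'b \<Rightarrow> 'a::monoid_mult"
  assumes "mset xs = mset ys" "\<And>a b. a \<in> set xs \<Longrightarrow> b \<in> set xs \<Longrightarrow> f a * f b = f b * f a"
  shows "prod_list (map f xs) = prod_list (map f ys)"
proof -
  have e: "prod_list (map f zs) = foldr (\<lambda>a z. f a * z) zs 1" for zs by (induction zs) auto
  show ?thesis unfolding e
    by (rule foldr_perm[OF assms(1), of UNIV]) (auto simp: mult.assoc[symmetric] assms(2))
qed

lemma power_mult_commuting:
  fixes x y :: "'a::monoid_mult"
  assumes "x * y = y * x"
  shows "(x * y) ^ n = x ^ n * y ^ n"
proof (induction n)
  case (Suc n)
  have "(x * y) ^ Suc n = x * (y * x ^ n) * y ^ n" by (simp add: Suc mult.assoc)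
  also have "y * x ^ n = x ^ n * y" using power_commuting_commutes[OF assms, of n] by simp
  finally show ?case by (simp add: mult.assoc)
qed simp

lemma prod_list_power_commute:
  fixes f :: "'b \<Rightarrow> 'a::monoid_mult"
  assumes "\<And>a b. a \<in> set xs \<Longrightarrow> b \<in> set xs \<Longrightarrow> f a * f b = f b * f a"
  shows "prod_list (map (\<lambda>i. f i ^ n) xs) = prod_list (map f xs) ^ n"
  using assms
proof (induction xs)
  case (Cons a xs)
  have c: "f a * prod_list (map f ys) = prod_list (map f ys) * f a" if "set ys \<subseteq> set (a # xs)" for ys
    using that
  proof (induction ys)
    case (Cons b ys)
    have "f a * f b = f b * f a" using Cons.prems \<open>\<And>aa b. aa \<in> set (a # xs) \<Longrightarrow> b \<in> set (a # xs) \<Longrightarrow> f aa * f b = f b * f aa\<close> by simp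
    then show ?case using Cons by (simp add: mult.assoc[symmetric]) (simp add: mult.assoc)
  qed simp
  have "f a * prod_list (map f xs) = prod_list (map f xs) * f a" by (rule c) auto
  from power_mult_commuting[OF this, of n] show ?case using Cons by simp
qed simp

locale folded_action = uq_action G P T + folding G \<sigma>
  for G :: "'i cartan_datum" and P T and \<sigma> :: "'i \<Rightarrow> 'i"
begin

definition sg :: "'i gen free_word lop \<Rightarrow> 'i gen free_word lop" where
  "sg = tr (uq_aut \<sigma>)"

lemma sg_rho: "x \<in> frc I \<Longrightarrow> sg (rho x) = rho (frelabel \<sigma> x)"
  by (simp add: sg_def tr_rho uq_aut_class Phi_class)

lemma sg_Phi: "u \<in> C \<Longrightarrow> sg (Phi u) = Phi (uq_aut \<sigma> u) \<and> uq_aut \<sigma> u \<in> C"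
  unfolding Uq_carrier sg_def using tr_Phi[of u "uq_aut \<sigma>"]
  by (auto simp: Uq_carrier tr_rho uq_aut_class Phi_class intro!: imageI frelabel_frc)

section \<open>Algebra endomorphisms compared on generators\<close>

definition ahom :: "('i gen free_word lop \<Rightarrow> 'i gen free_word lop) \<Rightarrow> bool" where
  "ahom f \<longleftrightarrow> (\<forall>a\<in>eU. f a \<in> eU) \<and> (\<forall>a\<in>eU. \<forall>b\<in>eU. f (a + b) = f a + f b) \<and>
     (\<forall>a\<in>eU. \<forall>b\<in>eU. f (a * b) = f a * f b) \<and> (\<forall>c. \<forall>a\<in>eU. f (lsc c a) = lsc c (f a)) \<and> f 1 = 1"

lemma ahom_mem: "ahom f \<Longrightarrow> a \<in> eU \<Longrightarrow> f a \<in> eU"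
  and ahom_add: "ahom f \<Longrightarrow> a \<in> eU \<Longrightarrow> b \<in> eU \<Longrightarrow> f (a + b) = f a + f b"
  and ahom_mult: "ahom f \<Longrightarrow> a \<in> eU \<Longrightarrow> b \<in> eU \<Longrightarrow> f (a * b) = f a * f b"
  and ahom_sc: "ahom f \<Longrightarrow> a \<in> eU \<Longrightarrow> f (lsc c a) = lsc c (f a)"
  and ahom_1: "ahom f \<Longrightarrow> f 1 = 1"
  by (simp_all add: ahom_def)

lemma ahom_diff: "ahom f \<Longrightarrow> a \<in> eU \<Longrightarrow> b \<in> eU \<Longrightarrow> f (a - b) = f a - f b"
  using ahom_add[of f a "lsc (-1) b"] ahom_sc[of f b "-1"] U_sc[of b "-1"] by simp

lemma ahom_uminus: "ahom f \<Longrightarrow> a \<in> eU \<Longrightarrow> f (- a) = - f a"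
  using ahom_sc[of f a "-1"] by simp

lemma ahom_0: "ahom f \<Longrightarrow> f 0 = 0"
  using ahom_sc[of f 1 0] U_one by simp

lemma ahom_power: "ahom f \<Longrightarrow> a \<in> eU \<Longrightarrow> f (a ^ n) = f a ^ n"
  by (induction n) (simp_all add: ahom_1 ahom_mult U_power)

lemma fr_eU: "e \<in> eU \<Longrightarrow> x \<in> eU \<Longrightarrow> lo.fr v a e x m \<in> eU"
  by (induction m) (simp_all add: lo.fr.simps U_sc U_diff U_mult)

lemma ahom_fr: "ahom f \<Longrightarrow> e \<in> eU \<Longrightarrow> x \<in> eU \<Longrightarrow> f (lo.fr v a e x m) = lo.fr v a (f e) (f x) m"
  by (induction m) (simp_all add: lo.fr.simps ahom_sc ahom_diff ahom_mult U_sc U_diff U_mult fr_eU)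

lemma ahom_comp: "ahom f \<Longrightarrow> ahom g \<Longrightarrow> ahom (\<lambda>a. f (g a))"
  by (simp add: ahom_def)

lemma ahom_Tt: "i \<in> I \<Longrightarrow> ahom (Tt i)"
  by (simp add: ahom_def T_mem T_add T_mult T_sc T_one)

lemma ahom_sg: "ahom sg"
proof -
  have "sg (a + b) = sg a + sg b \<and> sg (a * b) = sg a * sg b \<and> sg (lsc c a) = lsc c (sg a) \<and> sg a \<in> eU" if ab: "a \<in> eU" "b \<in> eU" for a b c
  proof -
    obtain x y where xy: "a = rho x" "x \<in> frc I" "b = rho y" "y \<in> frc I" using ab unfolding eU_def by auto
    note fx = frelabel_frc[OF xy(2)] frelabel_frc[OF xy(4)]
    have "sg (rho (x + y)) = sg a + sg b"
      unfolding xy(1,3) sg_rho[OF xy(2)] sg_rho[OF xy(4)] sg_rho[OF frc_add[OF xy(2,4)]] unfolding frelabel_add rho_add ..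
    moreover have "sg (rho (x * y)) = sg a * sg b"
      unfolding xy(1,3) sg_rho[OF xy(2)] sg_rho[OF xy(4)] sg_rho[OF frc_mult[OF xy(2,4)]] unfolding frelabel_mult rho_mult[OF fx] ..
    moreover have "sg (rho (psc c x)) = lsc c (sg a)"
      unfolding xy(1) sg_rho[OF xy(2)] sg_rho[OF frc_psc[OF xy(2)]] unfolding frelabel_psc rho_psc ..
    moreover have "sg a \<in> eU" using xy frelabel_frc[of x] unfolding eU_def by (simp add: sg_rho)
    ultimately show ?thesis using xy by (simp add: rho_add rho_mult rho_psc)
  qed
  moreover have "sg 1 = 1" using sg_rho[OF frc_1] by (simp add: rho_one frelabel_1)
  ultimately show ?thesis unfolding ahom_def by blast
qed

lemma sg_gens:
  assumes i: "i \<in> I"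
  shows "sg (eE i) = eE (\<sigma> i)" "sg (eF i) = eF (\<sigma> i)" "sg (eK i) = eK (\<sigma> i)" "sg (eKi i) = eKi (\<sigma> i)"
  unfolding egen_defs using i by (simp_all add: sg_rho frc_fgen frelabel_fgen)

lemma ahom_ext:
  assumes f: "ahom f" and g: "ahom g"
    and gens: "\<And>k. k \<in> I \<Longrightarrow> f (eE k) = g (eE k) \<and> f (eF k) = g (eF k) \<and> f (eK k) = g (eK k) \<and> f (eKi k) = g (eKi k)"
    and a: "a \<in> eU"
  shows "f a = g a"
proof -
  obtain x where x: "a = rho x" "x \<in> frc I" using a unfolding eU_def by auto
  have gen: "f (rho (fgen h)) = g (rho (fgen h))" if "set_gen h \<subseteq> I" for h
    using that gens by (cases h) (auto simp: egen_defs)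
  have mem: "rho z \<in> eU" if "z \<in> frc I" for z using that by (auto simp: eU_def)
  have word: "f (rho (fwd w)) = g (rho (fwd w))" if "gword I w" for w
    using that
  proof (induction w)
    case Nil
    then show ?case using f g by (simp add: fwd_Nil rho_one ahom_1)
  next
    case (Cons h w)
    then have h: "fgen h \<in> frc I" "fwd w \<in> frc I" "set_gen h \<subseteq> I" "gword I w"
      by (auto simp: gword_def intro: frc_fgen frc_fwd)
    have "rho (fwd (h # w)) = rho (fgen h) * rho (fwd w)"
      using rho_mult[OF h(1,2)] fwd_Cons[of h w] by (simp add: fgen_fwd)
    then show ?case using f g h mem gen[OF h(3)] Cons.IH[OF h(4)] by (simp add: ahom_mult)
  qed
  have "x \<in> pm.span {fwd w | w. gword I w}" using x(2) by (simp only: frc_span)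
  then have "f (rho x) = g (rho x) \<and> x \<in> frc I"
  proof (induction rule: pm.span_induct_alt)
    case base
    then show ?case using f g by (simp add: rho_0 ahom_0 frc_0)
  next
    case (step c b z)
    then obtain w where w: "b = fwd w" "gword I w" by auto
    have b: "b \<in> frc I" unfolding w(1) by (rule frc_fwd[OF w(2)])
    have z: "f (rho z) = g (rho z)" "z \<in> frc I" using step(2) by auto
    have "f (rho (psc c b + z)) = g (rho (psc c b + z))"
      unfolding rho_add rho_psc w(1)
      using ahom_add[OF f U_sc[OF mem[OF b]] mem[OF z(2)], of c] ahom_add[OF g U_sc[OF mem[OF b]] mem[OF z(2)], of c]
        ahom_sc[OF f mem[OF b], of c] ahom_sc[OF g mem[OF b], of c] word[OF w(2)] z(1) w(1) by simp
    moreover have "psc c b + z \<in> frc I" using b z frc_add frc_psc by blast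
    ultimately show ?case by blast
  qed
  then show ?thesis using x by simp
qed

definition eKpow :: "'i \<Rightarrow> int \<Rightarrow> 'i gen free_word lop" where
  "eKpow i n = (if n \<ge> 0 then eK i ^ nat n else eKi i ^ nat (- n))"

lemma Tt_K:
  assumes ij: "i \<in> I" "j \<in> I"
  shows "Tt i (eK j) = eK j * eKpow i (- cm G i j)" "Tt i (eKi j) = eKi j * eKpow i (cm G i j)"
proof -
  have kp: "Phi (uKpow G i n) = eKpow i n \<and> uKpow G i n \<in> C" for n
  proof -
    have "Phi (uK G i [^]\<^bsub>Uq G\<^esub> m) = eK i ^ m" "uK G i [^]\<^bsub>Uq G\<^esub> m \<in> C"
      "Phi (uKinv G i [^]\<^bsub>Uq G\<^esub> m) = eKi i ^ m" "uKinv G i [^]\<^bsub>Uq G\<^esub> m \<in> C" for m :: nat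
      using Phi_pow[OF gens_carrier(3)[OF ij(1)], of m] Phi_pow[OF gens_carrier(4)[OF ij(1)], of m]
        Q.nat_pow_closed[OF gens_carrier(3)[OF ij(1)], of m] Q.nat_pow_closed[OF gens_carrier(4)[OF ij(1)], of m]
      by (simp_all only: Phi_gens)
    then show ?thesis unfolding uKpow_def eKpow_def by (cases "0 \<le> n") (simp_all only: if_True if_False)
  qed
  have "T i (uK G j) = uK G j \<otimes>\<^bsub>Uq G\<^esub> uKpow G i (- cm G i j)" "T i (uKinv G j) = uKinv G j \<otimes>\<^bsub>Uq G\<^esub> uKpow G i (cm G i j)"
    using bspec[OF bspec[OF action_K ij(1)] ij(2)] by simp_all
  then show "Tt i (eK j) = eK j * eKpow i (- cm G i j)" "Tt i (eKi j) = eKi j * eKpow i (cm G i j)"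
    using tr_Phi[OF gens_carrier(3)[OF ij(2)], of "T i"] tr_Phi[OF gens_carrier(4)[OF ij(2)], of "T i"] kp ij
    by (simp_all add: Phi_mult Phi_gens gens_carrier)
qed

lemma sg_eKpow: "i \<in> I \<Longrightarrow> sg (eKpow i n) = eKpow (\<sigma> i) n \<and> eKpow i n \<in> eU"
  by (simp add: eKpow_def ahom_power[OF ahom_sg] sg_gens U_K U_Ki U_power)

text \<open>Both sides are algebra homomorphisms, so generators suffice; on them Lusztig's formulas
  depend only on Cartan integers and on q_i, which are \<sigma>-invariant.\<close>

lemma sg_T:
  assumes i: "i \<in> I" and a: "a \<in> eU"
  shows "sg (Tt i a) = Tt (\<sigma> i) (sg a)"
proof (rule ahom_ext[OF _ _ _ a])
  show "ahom (\<lambda>a. sg (Tt i a))" by (rule ahom_comp[OF ahom_sg ahom_Tt[OF i]])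
  show "ahom (\<lambda>a. Tt (\<sigma> i) (sg a))" by (rule ahom_comp[OF ahom_Tt[OF sigma_I[OF i]] ahom_sg])
  fix k assume k: "k \<in> I"
  note s = ahom_sc[OF ahom_sg] ahom_mult[OF ahom_sg] ahom_fr[OF ahom_sg]
  note u = U_E U_F U_K U_Ki U_mult fr_eU
  have K: "sg (Tt i (eK k)) = Tt (\<sigma> i) (sg (eK k))" "sg (Tt i (eKi k)) = Tt (\<sigma> i) (sg (eKi k))"
    using i k sigma_I sg_eKpow[OF i] by (simp_all add: sg_gens s u Tt_K sigma_cm)
  have EF: "sg (Tt i (eE k)) = Tt (\<sigma> i) (sg (eE k)) \<and> sg (Tt i (eF k)) = Tt (\<sigma> i) (sg (eF k))"
  proof (cases "k = i")
    case True
    then show ?thesis using i sigma_I by (simp add: Tt_self sg_gens s u q_at_sigma ahom_uminus[OF ahom_sg] U_sc)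
  next
    case False
    then have "\<sigma> i \<noteq> \<sigma> k" using inj_onD[OF sigma_inj _ i k] by blast
    then show ?thesis using False i k sigma_I by (simp add: Tt_E Tt_F sg_gens s u q_at_sigma sigma_cm)
  qed
  show "sg (Tt i (eE k)) = Tt (\<sigma> i) (sg (eE k)) \<and> sg (Tt i (eF k)) = Tt (\<sigma> i) (sg (eF k)) \<and>
    sg (Tt i (eK k)) = Tt (\<sigma> i) (sg (eK k)) \<and> sg (Tt i (eKi k)) = Tt (\<sigma> i) (sg (eKi k))"
    using K EF by simp
qed

subsection \<open>Orthogonal blocks\<close>

definition block :: "'i list \<Rightarrow> bool" where
  "block os \<longleftrightarrow> distinct os \<and> set os \<in> Orb"

lemma block_I: "block os \<Longrightarrow> os \<in> lists I"
  using orb_sub' by (auto simp: block_def in_lists_conv_set)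

lemma block_orth: "block os \<Longrightarrow> i \<in> set os \<Longrightarrow> j \<in> set os \<Longrightarrow> i \<noteq> j \<Longrightarrow> cm G i j = 0"
  using orb_orth unfolding block_def by blast

lemma blocks_I: "(\<And>os. os \<in> set oss \<Longrightarrow> block os) \<Longrightarrow> concat oss \<in> lists I"
  using block_I by (fastforce simp: in_lists_conv_set)

lemma cox2: "i \<in> I \<Longrightarrow> j \<in> I \<Longrightarrow> cm G i j = 0 \<Longrightarrow> coxeter_number G i j = 2"
  by (simp add: coxeter_number_def)

lemma Tt_comm:
  assumes "i \<in> I" "j \<in> I" "i \<noteq> j \<Longrightarrow> cm G i j = 0" "a \<in> eU"
  shows "Tt i (Tt j a) = Tt j (Tt i a)"
proof (cases "i = j")
  case False
  then show ?thesis using T_braid[OF assms(1,2) False assms(4)] cox2[OF assms(1,2)] assms(3)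
    by (simp add: alternating_numeral)
qed simp

lemma reflection_comm:
  assumes "i \<in> I" "j \<in> I" "i \<noteq> j \<Longrightarrow> cm G i j = 0"
  shows "reflection G i (reflection G j b) = reflection G j (reflection G i b)"
proof (cases "i = j")
  case False
  then show ?thesis using W_braid[OF assms(1,2) False] cox2[OF assms(1,2)] assms(3)
    by (simp add: alternating_numeral W_app W_Cons fun_eq_iff)
qed simp

lemma Tt_orth: "i \<in> I \<Longrightarrow> j \<in> I \<Longrightarrow> i \<noteq> j \<Longrightarrow> cm G i j = 0 \<Longrightarrow> Tt i (eE j) = eE j"
  by (simp add: Tt_E)

lemma E_comm:
  assumes "i \<in> I" "j \<in> I" "i \<noteq> j \<Longrightarrow> cm G i j = 0"
  shows "eE i * eE j = eE j * eE i"
proof (cases "i = j")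
  case False
  then show ?thesis using embed_serre0[OF assms(1,2) False] assms(3) eq.q_generic[OF assms(1)]
    by (simp add: lo.fr.simps qi_1)
qed simp

lemma reflection_orth: "j \<in> I \<Longrightarrow> cm G i j = 0 \<Longrightarrow> reflection G i (simple_root j) = simple_root j"
  by (simp add: refl_pair pair_simple)

lemma block_fold_T:
  assumes "block os" "mset os = mset os'" "a \<in> eU"
  shows "foldr Tt os a = foldr Tt os' a"
  by (rule foldr_perm[OF assms(2), of eU]) (use assms block_I[OF assms(1)] block_orth[OF assms(1)] T_mem Tt_comm in auto)

lemma block_W:
  assumes "block os" "mset os = mset os'"
  shows "W os = W os'"
proof
  fix b
  have "foldr (reflection G) os b = foldr (reflection G) os' b"
    by (rule foldr_perm[OF assms(2), of UNIV]) (use assms block_I[OF assms(1)] block_orth[OF assms(1)] reflection_comm in auto)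
  then show "W os b = W os' b" by (simp add: weyl_word_def)
qed

lemma block_mset: "block os \<Longrightarrow> block os' \<Longrightarrow> set os = set os' \<Longrightarrow> mset os = mset os'"
  unfolding block_def using set_eq_iff_mset_eq_distinct by blast

lemma block_sigma: "block os \<Longrightarrow> block (map \<sigma> os) \<and> mset (map \<sigma> os) = mset os"
proof -
  assume b: "block os"
  then have "set (map \<sigma> os) = set os" using orb_image by (simp add: block_def)
  moreover have "distinct (map \<sigma> os)" using b inj_on_subset[OF sigma_inj orb_sub'[of "set os"]] by (simp add: distinct_map block_def)
  ultimately have "block (map \<sigma> os)" using b by (simp add: block_def)
  then show ?thesis using block_mset[OF _ b] \<open>set (map \<sigma> os) = set os\<close> by blast
qed

lemma blocks_fold:
  assumes "list_all2 (\<lambda>os os'. block os \<and> mset os = mset os') oss oss'"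
  shows "a \<in> eU \<Longrightarrow> foldr Tt (concat oss) a = foldr Tt (concat oss') a" "W (concat oss) = W (concat oss')"
proof -
  have "(\<forall>a\<in>eU. foldr Tt (concat oss) a = foldr Tt (concat oss') a) \<and> W (concat oss) = W (concat oss') \<and> concat oss \<in> lists I \<and> concat oss' \<in> lists I"
    using assms
  proof (induction rule: list_all2_induct)
    case (Cons os oss os' oss')
    have I: "os \<in> lists I" "os' \<in> lists I" using Cons block_I by (auto simp: in_lists_conv_set dest: mset_eq_setD)
    show ?case using Cons I block_W[of os os'] block_fold_T[of os os'] Tw_mem by (auto simp: W_app)
  qed simp
  then show "a \<in> eU \<Longrightarrow> foldr Tt (concat oss) a = foldr Tt (concat oss') a" "W (concat oss) = W (concat oss')" by auto
qed

text \<open>Within a block \<sigma> only permutes the letters, and the operators and reflections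
  belonging to one block commute.\<close>

lemma blocks_sigma:
  assumes "\<And>os. os \<in> set oss \<Longrightarrow> block os"
  shows "a \<in> eU \<Longrightarrow> foldr Tt (map \<sigma> (concat oss)) a = foldr Tt (concat oss) a" "W (map \<sigma> (concat oss)) = W (concat oss)"
proof -
  have l: "list_all2 (\<lambda>os os'. block os \<and> mset os = mset os') (map (map \<sigma>) oss) oss"
    using assms block_sigma by (induction oss) auto
  show "a \<in> eU \<Longrightarrow> foldr Tt (map \<sigma> (concat oss)) a = foldr Tt (concat oss) a" "W (map \<sigma> (concat oss)) = W (concat oss)"
    using blocks_fold[OF l] by (simp_all add: map_concat)
qed

lemma sg_Tw: "ws \<in> lists I \<Longrightarrow> a \<in> eU \<Longrightarrow> sg (foldr Tt ws a) = foldr Tt (map \<sigma> ws) (sg a)"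
  by (induction ws) (auto simp: sg_T Tw_mem)

lemma reflection_sigma:
  assumes i: "i \<in> I" and b: "\<And>k. k \<in> I \<Longrightarrow> b' (\<sigma> k) = b k" and k: "k \<in> I"
  shows "reflection G (\<sigma> i) b' (\<sigma> k) = reflection G i b k"
proof -
  have "bij_betw \<sigma> I I" using da unfolding diagram_automorphism_def by blast
  from sum.reindex_bij_betw[OF this, of "\<lambda>j. cm G (\<sigma> i) j * b' j"]
  have "pair (\<sigma> i) b' = (\<Sum>j\<in>I. cm G (\<sigma> i) (\<sigma> j) * b' (\<sigma> j))" by (simp add: pair_def)
  also have "\<dots> = pair i b" unfolding pair_def using i b sigma_cm by (intro sum.cong) auto
  finally have "pair (\<sigma> i) b' = pair i b" .
  moreover have "simple_root (\<sigma> i) (\<sigma> k) = simple_root i k"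
    using sigma_inj i k by (auto simp: simple_root_def dest: inj_onD)
  ultimately show ?thesis using b[OF k] by (simp add: refl_pair)
qed

lemma W_sigma:
  assumes "ws \<in> lists I" and b: "\<And>k. k \<in> I \<Longrightarrow> b' (\<sigma> k) = b k" and k: "k \<in> I"
  shows "W (map \<sigma> ws) b' (\<sigma> k) = W ws b k"
  using assms(1) k
proof (induction ws arbitrary: k)
  case (Cons i ws)
  then show ?case using reflection_sigma[of i "W (map \<sigma> ws) b'" "W ws b" k] by (simp add: W_Cons)
qed (simp add: b)

lemma gamma_sigma:
  assumes b: "\<And>k. k \<in> I \<Longrightarrow> b' (\<sigma> k) = b k"
  shows "gamma G b' = gamma G b"
proof -
  have "bij_betw \<sigma> I I" using da unfolding diagram_automorphism_def by blast
  from prod.reindex_bij_betw[OF this, of "\<lambda>i. (q_at G i - inverse (q_at G i)) powi b' i"]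
  show ?thesis unfolding gamma_def using b q_at_sigma by simp
qed

lemma rootvec_eU: "pre \<in> lists I \<Longrightarrow> i \<in> I \<Longrightarrow> rootvec pre i \<in> eU"
  by (simp add: rootvec_def U_sc Tw_mem U_E)

text \<open>The braid operator and the Weyl group element of a prefix made of whole blocks are
  unchanged by \<sigma>, so only the last letter moves; the normalising constant stays the same
  because \<gamma> is \<sigma>-invariant.\<close>

lemma sg_rootvec:
  assumes o: "\<And>os. os \<in> set oss \<Longrightarrow> block os" and i: "i \<in> I"
  shows "sg (rootvec (concat oss) i) = rootvec (concat oss) (\<sigma> i)"
proof -
  let ?p = "concat oss"
  have p: "?p \<in> lists I" by (rule blocks_I[OF o])
  have "W ?p (simple_root (\<sigma> i)) (\<sigma> k) - simple_root (\<sigma> i) (\<sigma> k) = W ?p (simple_root i) k - simple_root i k" if k: "k \<in> I" for k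
  proof -
    have s: "simple_root (\<sigma> i) (\<sigma> k) = simple_root i k" if "k \<in> I" for k
      using sigma_inj i that by (auto simp: simple_root_def dest: inj_onD)
    show ?thesis using W_sigma[of ?p "simple_root (\<sigma> i)" "simple_root i" k, OF p s k] blocks_sigma(2)[OF o] s[OF k] by simp
  qed
  then have g: "gamma G (\<lambda>j. W ?p (simple_root (\<sigma> i)) j - simple_root (\<sigma> i) j) = gamma G (\<lambda>j. W ?p (simple_root i) j - simple_root i j)"
    by (rule gamma_sigma)
  have "sg (foldr Tt ?p (eE i)) = foldr Tt ?p (eE (\<sigma> i))"
    using sg_Tw[OF p U_E[OF i]] blocks_sigma(1)[OF o U_E[OF sigma_I[OF i]]] sg_gens(1)[OF i] by simp
  then show ?thesis unfolding rootvec_def g using p i by (simp add: ahom_sc[OF ahom_sg] Tw_mem U_E)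
qed

lemma rootvec_comm:
  assumes "pre \<in> lists I" "block os" "i \<in> set os" "j \<in> set os"
  shows "rootvec pre i * rootvec pre j = rootvec pre j * rootvec pre i"
proof -
  have ij: "i \<in> I" "j \<in> I" using block_I[OF assms(2)] assms(3,4) by (auto simp: in_lists_conv_set)
  have "eE i * eE j = eE j * eE i" using E_comm[OF ij] block_orth[OF assms(2-4)] by blast
  then have "foldr Tt pre (eE i) * foldr Tt pre (eE j) = foldr Tt pre (eE j) * foldr Tt pre (eE i)"
    using Tw_mult[OF assms(1) U_E[OF ij(1)] U_E[OF ij(2)]] Tw_mult[OF assms(1) U_E[OF ij(2)] U_E[OF ij(1)]] by simp
  then show ?thesis by (simp add: rootvec_def mult.commute)
qed

text \<open>Earlier letters of the same block fix both E_i and \<alpha>_i, so all root vectors of a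
  block can be computed from the prefix in front of it.\<close>

lemma rootvec_orth:
  assumes pre: "pre \<in> lists I" and us: "us \<in> lists I" and i: "i \<in> I" and o: "\<And>j. j \<in> set us \<Longrightarrow> j \<noteq> i \<and> cm G j i = 0"
  shows "rootvec (pre @ us) i = rootvec pre i"
proof -
  have "foldr Tt us (eE i) = eE i \<and> W us (simple_root i) = simple_root i"
    using us o by (induction us) (auto simp: Tt_orth i W_Cons reflection_orth)
  then show ?thesis by (simp add: rootvec_def W_app)
qed

lemma rootvecs_block:
  assumes pre: "pre \<in> lists I" and b: "block os"
  shows "rootvecs pre os = map (rootvec pre) os"
proof -
  have "rootvecs (pre @ us) vs = map (rootvec pre) vs" if "os = us @ vs" for us vs
    using that
  proof (induction vs arbitrary: us)
    case (Cons i vs)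
    have "os = (us @ [i]) @ vs" using Cons.prems by simp
    from Cons.IH[OF this] have "rootvecs (pre @ us @ [i]) vs = map (rootvec pre) vs" by simp
    moreover have "rootvec (pre @ us) i = rootvec pre i"
      by (rule rootvec_orth[OF pre]) (use b block_I[OF b] block_orth[OF b] Cons.prems in \<open>auto simp: block_def\<close>)
    ultimately show ?case by simp
  qed simp
  from this[of "[]" os] show ?thesis by simp
qed

text \<open>The exponents form a function on I instead of a list, so that \<sigma> acts on them by
  composition.\<close>

definition block_prod :: "'i list \<Rightarrow> 'i list \<Rightarrow> ('i \<Rightarrow> nat) \<Rightarrow> 'i gen free_word lop" where
  "block_prod pre os e = prod_list (map (\<lambda>i. rootvec pre i ^ e i) os)"

primrec blocks_prod :: "'i list \<Rightarrow> 'i list list \<Rightarrow> ('i \<Rightarrow> nat) list \<Rightarrow> 'i gen free_word lop" where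
  "blocks_prod pre [] es = 1"
| "blocks_prod pre (os # oss) es = block_prod pre os (hd es) * blocks_prod (pre @ os) oss (tl es)"

definition flat :: "'i list list \<Rightarrow> ('i \<Rightarrow> nat) list \<Rightarrow> nat list" where
  "flat oss es = concat (map2 (\<lambda>os e. map e os) oss es)"

lemma flat_simps [simp]: "flat [] es = []" "flat (os # oss) (e # es) = map e os @ flat oss es"
  by (simp_all add: flat_def)

lemma flat_length: "length es = length oss \<Longrightarrow> length (flat oss es) = length (concat oss)"
proof (induction oss arbitrary: es)
  case (Cons os oss)
  then show ?case by (cases es) auto
qed simp

lemma omon_block: "omon (map f os) (map e os) = prod_list (map (\<lambda>i. f i ^ e i) os)"
  by (induction os) auto

lemma blocks_prod_omon:
  "pre \<in> lists I \<Longrightarrow> (\<And>os. os \<in> set oss \<Longrightarrow> block os) \<Longrightarrow> length es = length oss \<Longrightarrow> omon (rootvecs pre (concat oss)) (flat oss es) = blocks_prod pre oss es"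
proof (induction oss arbitrary: pre es)
  case (Cons os oss)
  obtain e es' where es: "es = e # es'" "length es' = length oss" using Cons.prems(3) by (cases es) auto
  have b: "block os" using Cons.prems by simp
  have p: "pre @ os \<in> lists I" using Cons.prems(1) block_I[OF b] by simp
  have "omon (rootvecs (pre @ os) (concat oss)) (flat oss es') = blocks_prod (pre @ os) oss es'"
    using Cons.IH[OF p _ es(2)] Cons.prems(2) by simp
  moreover have "omon (rootvecs pre (concat (os # oss))) (flat (os # oss) es) = omon (rootvecs pre os) (map e os) * omon (rootvecs (pre @ os) (concat oss)) (flat oss es')"
    unfolding es by (simp add: rootvecs_app omon_app)
  ultimately show ?case using rootvecs_block[OF Cons.prems(1) b] es by (simp add: omon_block block_prod_def)
qed simp

lemma ex_exponents: "distinct os \<Longrightarrow> length bs = length os \<Longrightarrow> \<exists>e. map e os = bs"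
proof (induction os arbitrary: bs)
  case (Cons i os)
  then obtain b bs' where bs: "bs = b # bs'" "length bs' = length os" by (cases bs) auto
  then obtain e where "map e os = bs'" using Cons by auto
  then show ?case using Cons.prems bs by (intro exI[of _ "e(i := b)"]) (auto simp: map_eq_conv)
qed simp

lemma ex_flat:
  "(\<And>os. os \<in> set oss \<Longrightarrow> block os) \<Longrightarrow> length as = length (concat oss) \<Longrightarrow> \<exists>es. length es = length oss \<and> as = flat oss es"
proof (induction oss arbitrary: as)
  case (Cons os oss)
  have d: "distinct os" using Cons.prems(1)[of os] by (simp add: block_def)
  obtain e where e: "map e os = take (length os) as" using ex_exponents[OF d, of "take (length os) as"] Cons.prems(2) by auto
  obtain es where es: "length es = length oss" "drop (length os) as = flat oss es"
    using Cons.IH[of "drop (length os) as"] Cons.prems by auto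
  have "as = flat (os # oss) (e # es)" using e es append_take_drop_id[of "length os" as] by simp
  then show ?case using es by (intro exI[of _ "e # es"]) simp
qed simp

lemma block_prod_eU: "pre \<in> lists I \<Longrightarrow> os \<in> lists I \<Longrightarrow> block_prod pre os e \<in> eU"
  unfolding block_prod_def by (induction os) (auto simp: U_one U_mult U_power rootvec_eU)

lemma blocks_prod_eU: "pre \<in> lists I \<Longrightarrow> (\<And>os. os \<in> set oss \<Longrightarrow> block os) \<Longrightarrow> blocks_prod pre oss es \<in> eU"
proof (induction oss arbitrary: pre es)
  case (Cons os oss)
  have os: "os \<in> lists I" using Cons.prems(2)[of os] block_I by simp
  have "blocks_prod (pre @ os) oss (tl es) \<in> eU" by (rule Cons.IH) (use Cons.prems os in auto)
  then show ?case using block_prod_eU[OF Cons.prems(1) os] by (simp add: U_mult)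
qed (simp add: U_one)

abbreviation sinv where "sinv \<equiv> inv_into I \<sigma>"

lemma sinv_sigma: "i \<in> I \<Longrightarrow> sinv (\<sigma> i) = i"
  using sigma_inj by (rule inv_into_f_f)

text \<open>The factor of i becomes the factor of \<sigma> i with the exponent it had; the commuting
  factors are then put back into the order of the block.\<close>

lemma sg_block_prod:
  assumes o: "\<And>os. os \<in> set oss \<Longrightarrow> block os" and b: "block os"
  shows "sg (block_prod (concat oss) os e) = block_prod (concat oss) os (\<lambda>i. e (sinv i))"
proof -
  let ?p = "concat oss"
  have p: "?p \<in> lists I" by (rule blocks_I[OF o])
  have "sg (prod_list (map (\<lambda>i. rootvec ?p i ^ e i) us)) = prod_list (map (\<lambda>i. rootvec ?p i ^ e (sinv i)) (map \<sigma> us)) \<and> prod_list (map (\<lambda>i. rootvec ?p i ^ e i) us) \<in> eU"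
    if "us \<in> lists I" for us
    using that
  proof (induction us)
    case (Cons i us)
    then show ?case using sg_rootvec[of oss i, OF o] p sigma_I[of i]
      by (simp add: ahom_mult[OF ahom_sg] ahom_power[OF ahom_sg] U_power rootvec_eU U_mult sinv_sigma)
  qed (simp add: ahom_1[OF ahom_sg] U_one)
  then have "sg (block_prod ?p os e) = prod_list (map (\<lambda>i. rootvec ?p i ^ e (sinv i)) (map \<sigma> os))"
    using block_I[OF b] by (simp add: block_prod_def)
  also have "\<dots> = block_prod ?p os (\<lambda>i. e (sinv i))" unfolding block_prod_def
  proof (rule prod_list_perm)
    have bs: "block (map \<sigma> os)" "mset (map \<sigma> os) = mset os" using block_sigma[OF b] by auto
    show "mset (map \<sigma> os) = mset os" by (rule bs)
    fix i j assume "i \<in> set (map \<sigma> os)" "j \<in> set (map \<sigma> os)"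
    then have "rootvec ?p i * rootvec ?p j = rootvec ?p j * rootvec ?p i" using rootvec_comm[OF p bs(1)] by blast
    then show "rootvec ?p i ^ e (sinv i) * rootvec ?p j ^ e (sinv j) = rootvec ?p j ^ e (sinv j) * rootvec ?p i ^ e (sinv i)"
      by (metis power_commuting_commutes)
  qed
  finally show ?thesis .
qed

lemma sg_blocks_prod:
  "(\<And>os. os \<in> set pss \<Longrightarrow> block os) \<Longrightarrow> (\<And>os. os \<in> set oss \<Longrightarrow> block os) \<Longrightarrow> length es = length oss \<Longrightarrow>
    sg (blocks_prod (concat pss) oss es) = blocks_prod (concat pss) oss (map (\<lambda>e i. e (sinv i)) es)"
proof (induction oss arbitrary: pss es)
  case (Cons os oss)
  obtain e es' where es: "es = e # es'" "length es' = length oss" using Cons.prems(3) by (cases es) auto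
  have p: "concat pss \<in> lists I" by (rule blocks_I[OF Cons.prems(1)])
  have b: "block os" using Cons.prems by simp
  have pp: "concat (pss @ [os]) = concat pss @ os" by simp
  have pI: "concat pss @ os \<in> lists I" using p block_I[OF b] by simp
  have "sg (blocks_prod (concat (pss @ [os])) oss es') = blocks_prod (concat (pss @ [os])) oss (map (\<lambda>e i. e (sinv i)) es')"
    by (rule Cons.IH) (use Cons.prems b es in auto)
  then have 1: "sg (blocks_prod (concat pss @ os) oss es') = blocks_prod (concat pss @ os) oss (map (\<lambda>e i. e (sinv i)) es')"
    unfolding pp .
  have m: "blocks_prod (concat pss @ os) oss es' \<in> eU" by (rule blocks_prod_eU[OF pI]) (use Cons.prems in auto)
  show ?case using ahom_mult[OF ahom_sg block_prod_eU[OF p block_I[OF b]] m] sg_block_prod[OF Cons.prems(1) b] 1 by (simp add: es)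
qed (simp add: ahom_1[OF ahom_sg])

lemma block_prod_const:
  assumes "pre \<in> lists I" "block os"
  shows "block_prod pre os (\<lambda>_. c) = block_prod pre os (\<lambda>_. 1) ^ c"
  using prod_list_power_commute[of os "rootvec pre" c] rootvec_comm[OF assms] by (simp add: block_prod_def)

text \<open>By \<open>hat_gens\<close> these are the folded generators of the statement, read inside
  the operator algebra.\<close>

primrec block_vecs :: "'i list \<Rightarrow> 'i list list \<Rightarrow> 'i gen free_word lop list" where
  "block_vecs pre [] = []"
| "block_vecs pre (os # oss) = block_prod pre os (\<lambda>_. 1) # block_vecs (pre @ os) oss"

lemma block_vecs_map: "block_vecs pre oss = map (\<lambda>k. block_prod (pre @ concat (take k oss)) (oss ! k) (\<lambda>_. 1)) [0..<length oss]"
proof (induction oss arbitrary: pre)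
  case (Cons os oss)
  have "[0..<length (os # oss)] = 0 # map Suc [0..<length oss]"
    by (simp add: upt_conv_Cons map_Suc_upt del: upt_Suc)
  then show ?case using Cons[of "pre @ os"] by simp
qed simp

lemma block_vecs_omon:
  "pre \<in> lists I \<Longrightarrow> (\<And>os. os \<in> set oss \<Longrightarrow> block os) \<Longrightarrow> length cs = length oss \<Longrightarrow> omon (block_vecs pre oss) cs = blocks_prod pre oss (map (\<lambda>c _. c) cs)"
proof (induction oss arbitrary: pre cs)
  case (Cons os oss)
  obtain c cs' where cs: "cs = c # cs'" "length cs' = length oss" using Cons.prems(3) by (cases cs) auto
  have b: "block os" using Cons.prems by simp
  then have "omon (block_vecs (pre @ os) oss) cs' = blocks_prod (pre @ os) oss (map (\<lambda>c _. c) cs')"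
    using Cons block_I cs by auto
  then show ?case using block_prod_const[OF Cons.prems(1) b, of c] by (simp add: cs)
qed simp

end

section \<open>The folding map\<close>

context folded_action
begin

lemma orbit_list_block: "r \<in> Orb \<Longrightarrow> block (orbit_list r) \<and> set (orbit_list r) = r"
proof -
  assume r: "r \<in> Orb"
  obtain os where os: "distinct os \<and> set os = r" using finite_distinct_list[OF orb_fin[OF r]] by blast
  have "distinct (orbit_list r) \<and> set (orbit_list r) = r"
    unfolding orbit_list_def by (rule someI[of "\<lambda>os. distinct os \<and> set os = r", OF os])
  then show ?thesis using r by (simp add: block_def)
qed

lemma Phi_E_hat:
  assumes r: "r \<in> Orb"
  shows "E_hat G r \<in> C \<and> Phi (E_hat G r) = prod_list (map eE (orbit_list r))"
proof -
  have "foldr (\<lambda>i z. uE G i \<otimes>\<^bsub>Uq G\<^esub> z) os \<one>\<^bsub>Uq G\<^esub> \<in> C \<and>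
    Phi (foldr (\<lambda>i z. uE G i \<otimes>\<^bsub>Uq G\<^esub> z) os \<one>\<^bsub>Uq G\<^esub>) = prod_list (map eE os)" if "os \<in> lists I" for os
    using that by (induction os) (auto simp: Phi_one Phi_mult Phi_gens gens_carrier)
  then show ?thesis using block_I orbit_list_block[OF r] by (simp add: E_hat_def)
qed

lemma Tw_prod_list:
  "pre \<in> lists I \<Longrightarrow> os \<in> lists I \<Longrightarrow> foldr Tt pre (prod_list (map eE os)) = prod_list (map (\<lambda>i. foldr Tt pre (eE i)) os) \<and> prod_list (map eE os) \<in> eU"
  by (induction os) (auto simp: Tw_one Tw_mult U_one U_mult U_E)

end

locale lifted_word = folded_action G P T \<sigma> for G :: "'i cartan_datum" and P T \<sigma> +
  fixes rs :: "'i set list" and oss :: "'i list list"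
  assumes lift: "list_all2 (\<lambda>r os. distinct os \<and> set os = r) rs oss" and rs: "rs \<in> lists Orb"
    and red_lift: "red (concat oss)"
begin

lemma len_oss: "length oss = length rs"
  using list_all2_lengthD[OF lift] by simp

lemma blocks: "os \<in> set oss \<Longrightarrow> block os"
proof -
  assume "os \<in> set oss"
  then obtain k where k: "k < length oss" "os = oss ! k" by (auto simp: in_set_conv_nth)
  then show ?thesis using list_all2_nthD2[OF lift k(1)] rs len_oss by (auto simp: block_def in_lists_conv_set)
qed

lemma lift_I: "concat oss \<in> lists I"
  by (rule blocks_I[OF blocks])

lemma orbit_lists:
  "list_all2 (\<lambda>os os'. block os \<and> mset os = mset os') (map orbit_list (take k rs)) (take k oss)"
proof -
  have "block (orbit_list r) \<and> mset (orbit_list r) = mset os"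
    if "r \<in> set (take k rs)" "distinct os \<and> set os = r" for r os
  proof -
    have r: "r \<in> Orb" using that rs by (auto simp: in_lists_conv_set dest: in_set_takeD)
    then have "block os" using that by (simp add: block_def)
    then show ?thesis using orbit_list_block[OF r] block_mset[of "orbit_list r" os] that by auto
  qed
  then show ?thesis using list_all2_takeI[OF lift, of k] unfolding list.rel_map by (auto elim!: list.rel_mono_strong)
qed

text \<open>The folded coefficient is the product over the orbit of the coefficients of the single
  root vectors, so they cancel and no scalar remains. The arbitrary enumerations of the orbits are
  traded for those of the lifting, since everything belonging to one block commutes.\<close>

lemma Phi_hat_gen:
  assumes k: "k < length rs"
  shows "inverse (pbw_coeff_hat G rs k) \<odot>\<^bsub>Uq G\<^esub> foldr (T_hat T) (take k rs) (E_hat G (rs ! k)) \<in> C"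
    "Phi (inverse (pbw_coeff_hat G rs k) \<odot>\<^bsub>Uq G\<^esub> foldr (T_hat T) (take k rs) (E_hat G (rs ! k)))
      = block_prod (concat (take k oss)) (oss ! k) (\<lambda>_. 1)"
proof -
  let ?pre = "concat (take k oss)" and ?opre = "concat (map orbit_list (take k rs))" and ?r = "rs ! k"
  have r: "?r \<in> Orb" using k rs by (auto simp: in_lists_conv_set)
  note ol = orbit_list_block[OF r]
  have olI: "orbit_list ?r \<in> lists I" using ol block_I by blast
  have pre: "?pre \<in> lists I" using blocks_I[of "take k oss"] blocks in_set_takeD by metis
  have opre: "?opre \<in> lists I"
    by (rule blocks_I) (use orbit_list_block rs in \<open>auto simp: in_lists_conv_set dest: in_set_takeD\<close>)
  have T: "foldr (T_hat T) xs u = foldr T (concat (map orbit_list xs)) u" for xs u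
    by (induction xs) (simp_all add: T_hat_def)
  have Wo: "foldr (reflection_hat G) xs b = W (concat (map orbit_list xs)) b" for xs b
    by (induction xs) (simp_all add: reflection_hat_def weyl_word_def)
  have os: "block (oss ! k)" "set (oss ! k) = ?r" using blocks k len_oss list_all2_nthD[OF lift k] by auto
  have mset: "mset (orbit_list ?r) = mset (oss ! k)" using block_mset ol os by blast
  let ?g = "\<lambda>i. gamma G (\<lambda>j. W ?pre (simple_root i) j - simple_root i j)"
  have coeff: "pbw_coeff_hat G rs k = prod ?g ?r"
    unfolding pbw_coeff_hat_def Wo blocks_fold(2)[OF orbit_lists] ..
  have g: "prod ?g ?r = prod_list (map ?g (orbit_list ?r))"
    using prod.distinct_set_conv_list[of "orbit_list ?r" ?g] ol by (simp add: block_def)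
  note E = Phi_E_hat[OF r]
  show c: "inverse (pbw_coeff_hat G rs k) \<odot>\<^bsub>Uq G\<^esub> foldr (T_hat T) (take k rs) (E_hat G ?r) \<in> C"
    unfolding T using opre E by (intro Uq_smult_closed foldr_T_closed) auto
  have "Phi (foldr (T_hat T) (take k rs) (E_hat G ?r)) = foldr Tt ?opre (prod_list (map eE (orbit_list ?r)))"
    unfolding T using foldr_Tt[OF opre, of "E_hat G ?r"] E by simp
  also have "\<dots> = foldr Tt ?pre (prod_list (map eE (orbit_list ?r)))"
    using blocks_fold(1)[OF orbit_lists] Tw_prod_list[OF pre olI] by blast
  also have "\<dots> = prod_list (map (\<lambda>i. foldr Tt ?pre (eE i)) (orbit_list ?r))" using Tw_prod_list[OF pre olI] by blast
  also have "\<dots> = prod_list (map (\<lambda>i. lsc (?g i) (rootvec ?pre i)) (orbit_list ?r))" by (subst rootvec_scale) (rule refl)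
  also have "\<dots> = lsc (prod ?g ?r) (prod_list (map (rootvec ?pre) (orbit_list ?r)))" by (simp only: lo.prod_list_sc g)
  also have "prod_list (map (rootvec ?pre) (orbit_list ?r)) = prod_list (map (rootvec ?pre) (oss ! k))"
    using ol rootvec_comm[OF pre] by (intro prod_list_perm[OF mset]) blast
  finally have "Phi (foldr (T_hat T) (take k rs) (E_hat G ?r)) = lsc (prod ?g ?r) (block_prod ?pre (oss ! k) (\<lambda>_. 1))"
    by (simp add: block_prod_def)
  moreover have "prod ?g ?r \<noteq> 0" using gamma_nz orb_fin[OF r] by simp
  moreover have "foldr (T_hat T) (take k rs) (E_hat G ?r) \<in> C" unfolding T using opre E by (intro foldr_T_closed) auto
  ultimately show "Phi (inverse (pbw_coeff_hat G rs k) \<odot>\<^bsub>Uq G\<^esub> foldr (T_hat T) (take k rs) (E_hat G ?r)) = block_prod ?pre (oss ! k) (\<lambda>_. 1)"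
    by (simp add: Phi_smult coeff)
qed

lemma hat_gens: "set (pbw_gens_hat G T rs) \<subseteq> C" "map Phi (pbw_gens_hat G T rs) = block_vecs [] oss"
proof -
  show "set (pbw_gens_hat G T rs) \<subseteq> C" using Phi_hat_gen(1) by (auto simp: pbw_gens_hat_def)
  show "map Phi (pbw_gens_hat G T rs) = block_vecs [] oss"
    unfolding block_vecs_map pbw_gens_hat_def len_oss using Phi_hat_gen(2) by simp
qed

definition hat :: "nat list \<Rightarrow> 'i gen free_word lop" where
  "hat = omon (block_vecs [] oss)"

abbreviation N where "N \<equiv> {cs :: nat list. length cs = length rs}"

lemma Phi_hat_monomial:
  assumes "cs \<in> N"
  shows "ordered_monomial (Uq G) (pbw_gens_hat G T rs) cs \<in> C" "Phi (ordered_monomial (Uq G) (pbw_gens_hat G T rs) cs) = hat cs"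
  using Phi_ordered_monomial[OF hat_gens(1), of cs] assms hat_gens(2) by (auto simp: hat_def pbw_gens_hat_def)

lemma hat_flat:
  assumes "cs \<in> N"
  shows "hat cs = omon (rootvecs [] (concat oss)) (flat oss (map (\<lambda>c _. c) cs))"
    "length (flat oss (map (\<lambda>c _. c) cs)) = length (concat oss)"
proof -
  have l: "length cs = length oss" using assms len_oss by simp
  have "hat cs = blocks_prod [] oss (map (\<lambda>c _. c) cs)" unfolding hat_def using l blocks by (intro block_vecs_omon) auto
  also have "\<dots> = omon (rootvecs [] (concat oss)) (flat oss (map (\<lambda>c _. c) cs))" using l blocks by (intro blocks_prod_omon[symmetric]) auto
  finally show "hat cs = omon (rootvecs [] (concat oss)) (flat oss (map (\<lambda>c _. c) cs))" .
  show "length (flat oss (map (\<lambda>c _. c) cs)) = length (concat oss)" using l by (simp add: flat_length)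
qed

lemma sg_hat: "cs \<in> N \<Longrightarrow> sg (hat cs) = hat cs"
proof -
  assume cs: "cs \<in> N"
  have "hat cs = blocks_prod [] oss (map (\<lambda>c _. c) cs)" unfolding hat_def using cs len_oss blocks by (intro block_vecs_omon) auto
  moreover have "sg (blocks_prod (concat []) oss (map (\<lambda>c _. c) cs)) = blocks_prod (concat []) oss (map (\<lambda>e i. e (sinv i)) (map (\<lambda>c _. c) cs))"
    by (rule sg_blocks_prod) (use blocks cs len_oss in auto)
  ultimately show ?thesis by (simp add: comp_def)
qed

lemma flat_const_inj:
  "(\<And>os. os \<in> set pss \<Longrightarrow> block os) \<Longrightarrow> length cs = length pss \<Longrightarrow> length ds = length pss \<Longrightarrow>
    flat pss (map (\<lambda>c _. c) cs) = flat pss (map (\<lambda>c _. c) ds) \<Longrightarrow> cs = ds"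
proof (induction pss arbitrary: cs ds)
  case (Cons os pss)
  obtain c cs' where cs: "cs = c # cs'" "length cs' = length pss" using Cons.prems(2) by (cases cs) auto
  obtain d ds' where ds: "ds = d # ds'" "length ds' = length pss" using Cons.prems(3) by (cases ds) auto
  have "set os \<in> Orb" using Cons.prems(1)[of os] by (simp add: block_def)
  then obtain i us where "os = i # us" using orb_ne[of "set os"] by (cases os) auto
  moreover have "map (\<lambda>_. c) os = map (\<lambda>_. d) os \<and> flat pss (map (\<lambda>c _. c) cs') = flat pss (map (\<lambda>c _. c) ds')"
    using Cons.prems(4) by (simp add: cs ds)
  ultimately show ?case using Cons.IH[of cs' ds'] Cons.prems(1) cs ds by auto
qed simp

text \<open>A block is one whole orbit, so exponents invariant under \<sigma> are constant on it;
  the constant is read off at any of its elements.\<close>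

lemma flat_fixed:
  "(\<And>os. os \<in> set pss \<Longrightarrow> block os) \<Longrightarrow> length es = length pss \<Longrightarrow> flat pss (map (\<lambda>e i. e (sinv i)) es) = flat pss es \<Longrightarrow>
    \<exists>cs. length cs = length pss \<and> flat pss es = flat pss (map (\<lambda>c _. c) cs)"
proof (induction pss arbitrary: es)
  case (Cons os pss)
  obtain e es' where es: "es = e # es'" "length es' = length pss" using Cons.prems(2) by (cases es) auto
  have fl: "map (\<lambda>i. e (sinv i)) os = map e os" "flat pss (map (\<lambda>e i. e (sinv i)) es') = flat pss es'"
    using Cons.prems(3) by (simp_all add: es)
  obtain cs where cs: "length cs = length pss" "flat pss es' = flat pss (map (\<lambda>c _. c) cs)"
    using Cons.IH[OF _ es(2) fl(2)] Cons.prems(1) by auto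
  have r: "set os \<in> Orb" using Cons.prems(1)[of os] by (simp add: block_def)
  then obtain i where i: "i \<in> set os" using orb_ne by blast
  have "e (\<sigma> k) = e k" if k: "k \<in> set os" for k
  proof -
    have "e (sinv (\<sigma> k)) = e (\<sigma> k)" using fl(1) orb_sigma[OF r k] by simp
    moreover have "sinv (\<sigma> k) = k" using orb_sub'[OF r] k by (intro sinv_sigma) blast
    ultimately show ?thesis by simp
  qed
  then have "map e os = map (\<lambda>_. e i) os" by (intro map_cong refl) (rule orb_const[OF r i, of e])
  then show ?case using cs by (intro exI[of _ "e i # cs"]) (simp add: es)
qed simp

text \<open>Distinct exponents give distinct monomials, so invariance of the monomial becomes
  invariance of its exponents, to which \<open>flat_fixed\<close> applies.\<close>

lemma fixed_monomial:
  assumes as: "length as = length (concat oss)" and fx: "sg (omon (rootvecs [] (concat oss)) as) = omon (rootvecs [] (concat oss)) as"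
  shows "\<exists>cs\<in>N. omon (rootvecs [] (concat oss)) as = hat cs"
proof -
  obtain es where es: "length es = length oss" "as = flat oss es" using ex_flat[OF blocks as] by blast
  let ?es = "map (\<lambda>e i. e (sinv i)) es"
  have M: "omon (rootvecs [] (concat oss)) (flat oss fs) = blocks_prod [] oss fs" if "length fs = length oss" for fs
    using blocks that by (intro blocks_prod_omon) auto
  have "sg (blocks_prod (concat []) oss es) = blocks_prod (concat []) oss ?es" by (rule sg_blocks_prod) (use blocks es in auto)
  then have "omon (rootvecs [] (concat oss)) (flat oss ?es) = omon (rootvecs [] (concat oss)) (flat oss es)"
    using fx es M[of es] M[of ?es] by simp
  then have "flat oss ?es = flat oss es"
    using inj_onD[OF rootvecs_basis(1)[OF red_lift], of "flat oss ?es" "flat oss es"] es(1) by (simp add: flat_length)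
  then obtain cs where cs: "length cs = length oss" "flat oss es = flat oss (map (\<lambda>c _. c) cs)"
    using flat_fixed[of oss es, OF blocks es(1)] by blast
  then show ?thesis using hat_flat(1)[of cs] es(2) len_oss by (intro bexI[of _ cs]) auto
qed

lemma hat_inj: "inj_on hat N"
proof (rule inj_onI)
  fix cs ds assume c: "cs \<in> N" "ds \<in> N" "hat cs = hat ds"
  then have "flat oss (map (\<lambda>c _. c) cs) = flat oss (map (\<lambda>c _. c) ds)"
    using inj_onD[OF rootvecs_basis(1)[OF red_lift], of "flat oss (map (\<lambda>c _. c) cs)" "flat oss (map (\<lambda>c _. c) ds)"]
      hat_flat[OF c(1)] hat_flat[OF c(2)] by simp
  then show "cs = ds" using flat_const_inj[of oss cs ds, OF blocks] c len_oss by auto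
qed

lemma hat_sub: "hat ` N \<subseteq> omon (rootvecs [] (concat oss)) ` {as. length as = length (concat oss)}"
  using hat_flat by blast

lemma hat_independent: "lo.independent (hat ` N)"
  by (rule lo.independent_mono[OF rootvecs_basis(2)[OF red_lift] hat_sub])

lemma hat_Up_mem: "cs \<in> N \<Longrightarrow> hat cs \<in> Up"
  unfolding hat_flat(1) by (rule rootvecs_Up[OF red_lift hat_flat(2)])

lemma hat_Up: "lo.span (hat ` N) \<subseteq> Up"
proof (rule lo.span_minimal)
  show "hat ` N \<subseteq> Up" using hat_Up_mem by blast
qed (simp add: Up_def)

lemma sg_span_hat: "x \<in> lo.span (hat ` N) \<Longrightarrow> sg x = x"
proof -
  have "x \<in> eU \<and> sg x = x" if "x \<in> lo.span (hat ` N)"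
    using that
  proof (induction rule: lo.span_induct_alt)
    case base
    show ?case using ahom_0[OF ahom_sg] Up_U[OF Up_0] by simp
  next
    case (step c b z)
    then obtain cs where "b = hat cs" "cs \<in> N" by blast
    then have b: "sg b = b" "b \<in> eU" using sg_hat Up_U[OF hat_Up_mem] by simp_all
    then show ?case using step by (simp add: ahom_add[OF ahom_sg] ahom_sc[OF ahom_sg] U_sc U_add)
  qed
  then show "x \<in> lo.span (hat ` N) \<Longrightarrow> sg x = x" by blast
qed

lemma fixed_iff: "u \<in> C \<Longrightarrow> uq_aut \<sigma> u = u \<longleftrightarrow> sg (Phi u) = Phi u"
  using sg_Phi[of u] inj_onD[OF Phi_inj, of "uq_aut \<sigma> u" u] by auto

lemma fixed_monomials:
  "fixed_points (uq_aut \<sigma>) (ordered_monomials (Uq G) (pbw_gens G T (concat oss)))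
    = (\<lambda>cs. ordered_monomial (Uq G) (pbw_gens_hat G T rs) cs) ` N"
proof -
  have m: "ordered_monomial (Uq G) (pbw_gens G T (concat oss)) as \<in> C \<and>
    Phi (ordered_monomial (Uq G) (pbw_gens G T (concat oss)) as) = omon (rootvecs [] (concat oss)) as"
    if "length as = length (concat oss)" for as
    using Phi_ordered_monomial[OF pbw_gens_closed[OF lift_I], of as] Phi_pbw_gens[OF lift_I] that
    by (simp add: pbw_gens_def)
  have l: "length (pbw_gens G T (concat oss)) = length (concat oss)" by (simp add: pbw_gens_def)
  show ?thesis unfolding fixed_points_def ordered_monomials_def l
  proof (intro Set.set_eqI iffI)
    fix u assume "u \<in> {u \<in> {ordered_monomial (Uq G) (pbw_gens G T (concat oss)) as |as. length as = length (concat oss)}. uq_aut \<sigma> u = u}"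
    then obtain as where as: "length as = length (concat oss)" "u = ordered_monomial (Uq G) (pbw_gens G T (concat oss)) as" "uq_aut \<sigma> u = u" by blast
    then obtain cs where cs: "cs \<in> N" "Phi u = hat cs" using fixed_monomial[OF as(1)] m[OF as(1)] fixed_iff[of u] by auto
    then have "u = ordered_monomial (Uq G) (pbw_gens_hat G T rs) cs"
      using inj_onD[OF Phi_inj, of u] Phi_hat_monomial[OF cs(1)] m[OF as(1)] as(2) by simp
    then show "u \<in> (\<lambda>cs. ordered_monomial (Uq G) (pbw_gens_hat G T rs) cs) ` N" using cs by blast
  next
    fix u assume "u \<in> (\<lambda>cs. ordered_monomial (Uq G) (pbw_gens_hat G T rs) cs) ` N"
    then obtain cs where cs: "cs \<in> N" "u = ordered_monomial (Uq G) (pbw_gens_hat G T rs) cs" by blast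
    let ?as = "flat oss (map (\<lambda>c _. c) cs)"
    have u: "u \<in> C" "Phi u = hat cs" using Phi_hat_monomial[OF cs(1)] cs(2) by auto
    then have "uq_aut \<sigma> u = u" using fixed_iff sg_hat[OF cs(1)] by simp
    moreover have "u = ordered_monomial (Uq G) (pbw_gens G T (concat oss)) ?as"
      using inj_onD[OF Phi_inj, of u] u m[OF hat_flat(2)[OF cs(1)]] hat_flat(1)[OF cs(1)] by simp
    ultimately show "u \<in> {u \<in> {ordered_monomial (Uq G) (pbw_gens G T (concat oss)) as |as. length as = length (concat oss)}. uq_aut \<sigma> u = u}"
      using hat_flat(2)[OF cs(1)] by blast
  qed
qed

end

locale folding_map = lifted_word G P T \<sigma> rs oss + D: uq_action "folded G \<sigma>" P' T'
  for G :: "'i cartan_datum" and P T \<sigma> rs oss P' T' +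
  assumes rs_longest: "D.longest rs"
begin

interpretation vp: vector_space_pair "lsc :: Cq \<Rightarrow> 'i set gen free_word lop \<Rightarrow> _" "lsc :: Cq \<Rightarrow> 'i gen free_word lop \<Rightarrow> _"
  by unfold_locales

abbreviation X' where "X' \<equiv> omon (D.rootvecs [] rs)"
abbreviation mono_folded where "mono_folded \<equiv> ordered_monomial (Uq (folded G \<sigma>)) (pbw_gens (folded G \<sigma>) T' rs)"
abbreviation mono_hat where "mono_hat \<equiv> ordered_monomial (Uq G) (pbw_gens_hat G T rs)"

lemma rs_red: "D.red rs"
  using rs_longest by (simp add: D.longest_def)

lemma rs_lists: "rs \<in> lists (idx (folded G \<sigma>))"
  using rs by simp

lemma mono_folded: "as \<in> N \<Longrightarrow> mono_folded as \<in> Uq_plus (folded G \<sigma>) \<and> D.Phi (mono_folded as) = X' as"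
proof -
  assume as: "as \<in> N"
  have o: "mono_folded as \<in> carrier (Uq (folded G \<sigma>)) \<and> D.Phi (mono_folded as) = X' as"
    using D.Phi_ordered_monomial[OF D.pbw_gens_closed[OF rs_lists], of as] D.Phi_pbw_gens[OF rs_lists] as
    by (simp add: pbw_gens_def)
  moreover have "X' as \<in> D.Up" using as by (intro D.rootvecs_Up[OF rs_red]) simp
  ultimately show ?thesis using D.Psi_Up[of "X' as"] D.Psi_Phi[of "mono_folded as"] by auto
qed

text \<open>The folding map transported to the two operator algebras, extended linearly from the PBW
  basis of the source.\<close>

definition \<phi> :: "'i set gen free_word lop \<Rightarrow> 'i gen free_word lop" where
  "\<phi> = vp.construct (X' ` N) (\<lambda>x. hat (the_inv_into N X' x))"

lemma phi_linear: "Vector_Spaces.linear lsc lsc \<phi>"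
  unfolding \<phi>_def by (rule vp.linear_construct[OF D.rootvecs_basis(2)[OF rs_red]])

lemma phi_X: "as \<in> N \<Longrightarrow> \<phi> (X' as) = hat as"
  unfolding \<phi>_def using D.rootvecs_basis[OF rs_red]
  by (subst vp.construct_basis) (auto simp: the_inv_into_f_f)

lemma phi_span: "\<phi> ` lo.span (X' ` N) = lo.span (hat ` N)"
proof -
  have "\<phi> ` (X' ` N) = hat ` N" using phi_X by (auto simp: image_image)
  then show ?thesis using vp.linear_span_image[OF phi_linear, of "X' ` N"] by simp
qed

lemma phi_inj: "inj_on \<phi> (lo.span (X' ` N))"
proof (rule vp.linear_inj_on_span_independent_image[OF phi_linear])
  have e: "\<phi> ` (X' ` N) = hat ` N" using phi_X by (auto simp: image_image)
  show "lo.independent (\<phi> ` (X' ` N))" unfolding e by (rule hat_independent)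
  show "inj_on \<phi> (X' ` N)" using phi_X hat_inj by (auto simp: inj_on_def)
qed

lemma Up'_span: "D.Up = lo.span (X' ` N)"
  by (rule D.rootvecs_span[OF rs_longest])

lemma phi_Up: "x \<in> D.Up \<Longrightarrow> \<phi> x \<in> lo.span (hat ` N) \<and> \<phi> x \<in> Up"
  using phi_span hat_Up unfolding Up'_span by blast

lemma Phi'_Up: "u \<in> Uq_plus (folded G \<sigma>) \<Longrightarrow> u \<in> carrier (Uq (folded G \<sigma>)) \<and> D.Phi u \<in> D.Up"
  by (rule D.Uq_plus_props)

lemma ex_iota: "\<exists>\<iota>. is_iota G \<sigma> T T' rs \<iota>"
proof
  let ?V = "Uq_plus (folded G \<sigma>)"
  \<comment> \<open>The value outside the positive part is the one prescribed by the extensional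
    function space in \<open>is_iota\<close>.\<close>
  let ?\<iota> = "\<lambda>u. if u \<in> ?V then Psi (\<phi> (D.Phi u)) else undefined"
  have i: "?\<iota> u \<in> Uq_plus G \<and> Phi (?\<iota> u) = \<phi> (D.Phi u)" if "u \<in> ?V" for u
    using Psi_Up[of "\<phi> (D.Phi u)"] phi_Up[of "D.Phi u"] Phi'_Up[OF that] that by simp
  have eq: "?\<iota> u = v" if "u \<in> ?V" "v \<in> C" "Phi v = \<phi> (D.Phi u)" for u v
    using i[OF that(1)] Uq_plus_sub that by (intro inj_onD[OF Phi_inj]) auto
  show "is_iota G \<sigma> T T' rs ?\<iota>"
    unfolding is_iota_def linear_map_on_def
  proof (intro conjI allI ballI impI)
    show "?\<iota> \<in> ?V \<rightarrow>\<^sub>E Uq_plus G" using i by auto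
  next
    fix u v assume uv: "u \<in> ?V" "v \<in> ?V"
    have c: "?\<iota> u \<in> C" "?\<iota> v \<in> C" using i uv Uq_plus_sub by blast+
    show "?\<iota> (u \<oplus>\<^bsub>Uq (folded G \<sigma>)\<^esub> v) = ?\<iota> u \<oplus>\<^bsub>Uq G\<^esub> ?\<iota> v"
    proof (rule eq)
      show "u \<oplus>\<^bsub>Uq (folded G \<sigma>)\<^esub> v \<in> ?V" by (rule D.Uq_plus_add[OF uv])
      show "?\<iota> u \<oplus>\<^bsub>Uq G\<^esub> ?\<iota> v \<in> C" by (rule Q.a_closed[OF c])
      have "D.Phi (u \<oplus>\<^bsub>Uq (folded G \<sigma>)\<^esub> v) = D.Phi u + D.Phi v"
        using uv Phi'_Up by (intro D.Phi_add) auto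
      then show "Phi (?\<iota> u \<oplus>\<^bsub>Uq G\<^esub> ?\<iota> v) = \<phi> (D.Phi (u \<oplus>\<^bsub>Uq (folded G \<sigma>)\<^esub> v))"
        using Phi_add[OF c] i[OF uv(1)] i[OF uv(2)] by (simp only: vp.linear_add[OF phi_linear])
    qed
  next
    fix c u assume u: "u \<in> ?V"
    have cu: "?\<iota> u \<in> C" using i u Uq_plus_sub by blast
    show "?\<iota> (c \<odot>\<^bsub>Uq (folded G \<sigma>)\<^esub> u) = c \<odot>\<^bsub>Uq G\<^esub> ?\<iota> u"
    proof (rule eq)
      show "c \<odot>\<^bsub>Uq (folded G \<sigma>)\<^esub> u \<in> ?V" by (rule D.Uq_plus_smult[OF u])
      show "c \<odot>\<^bsub>Uq G\<^esub> ?\<iota> u \<in> C" by (rule Uq_smult_closed[OF cu])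
      have "D.Phi (c \<odot>\<^bsub>Uq (folded G \<sigma>)\<^esub> u) = lsc c (D.Phi u)"
        using u Phi'_Up by (intro D.Phi_smult) auto
      then show "Phi (c \<odot>\<^bsub>Uq G\<^esub> ?\<iota> u) = \<phi> (D.Phi (c \<odot>\<^bsub>Uq (folded G \<sigma>)\<^esub> u))"
        using Phi_smult[OF cu, of c] i[OF u] by (simp only: vp.linear_scale[OF phi_linear])
    qed
  next
    fix as :: "nat list" assume "length as = length rs"
    then have as: "as \<in> N" by simp
    show "?\<iota> (mono_folded as) = mono_hat as"
      using mono_folded[OF as] Phi_hat_monomial[OF as] phi_X[OF as] by (intro eq) auto
  qed
qed

text \<open>Any map with the defining property corresponds to \<open>\<phi>\<close> because the
  monomials span the positive part. This gives uniqueness and reduces the remaining claims to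
  \<open>\<phi>\<close>.\<close>

lemma iota_Phi:
  assumes i: "is_iota G \<sigma> T T' rs \<iota>" and u: "u \<in> Uq_plus (folded G \<sigma>)"
  shows "\<iota> u \<in> Uq_plus G" "Phi (\<iota> u) = \<phi> (D.Phi u)"
proof -
  let ?V = "Uq_plus (folded G \<sigma>)" and ?R = "Uq (folded G \<sigma>)"
  have add: "\<iota> (v \<oplus>\<^bsub>?R\<^esub> w) = \<iota> v \<oplus>\<^bsub>Uq G\<^esub> \<iota> w" and sc: "\<iota> (c \<odot>\<^bsub>?R\<^esub> v) = c \<odot>\<^bsub>Uq G\<^esub> \<iota> v"
    and mem: "\<iota> v \<in> Uq_plus G" and memC: "\<iota> v \<in> C" if "v \<in> ?V" "w \<in> ?V" for v w c
    using i that Uq_plus_sub unfolding is_iota_def linear_map_on_def by auto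
  have mon: "\<iota> (mono_folded as) = mono_hat as" if "as \<in> N" for as using i that unfolding is_iota_def by simp
  show "\<iota> u \<in> Uq_plus G" by (rule mem[OF u u])
  have "D.Phi u \<in> lo.span (X' ` N)" using Phi'_Up[OF u] Up'_span by simp
  \<comment> \<open>The induction runs over elements of the operator algebra, so a preimage v is
    carried along; in the end it equals u by injectivity of \<open>D.Phi\<close>.\<close>
  then have "\<exists>v\<in>?V. D.Phi v = D.Phi u \<and> Phi (\<iota> v) = \<phi> (D.Phi u)"
  proof (induction rule: lo.span_induct_alt)
    case base
    have o: "\<one>\<^bsub>?R\<^esub> \<in> ?V" by (rule D.Uq_plus_one)
    have "D.Phi (0 \<odot>\<^bsub>?R\<^esub> \<one>\<^bsub>?R\<^esub>) = 0" using D.Phi_smult[of "\<one>\<^bsub>?R\<^esub>" 0] Phi'_Up[OF o] by simp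
    moreover have "Phi (\<iota> (0 \<odot>\<^bsub>?R\<^esub> \<one>\<^bsub>?R\<^esub>)) = 0" unfolding sc[OF o o] using Phi_smult[OF memC[OF o o], of 0] by simp
    ultimately show ?case using D.Uq_plus_smult[OF o, of 0] vp.linear_0[OF phi_linear] by auto
  next
    case (step c b x)
    then obtain as v where as: "as \<in> N" "b = X' as" and v: "v \<in> ?V" "D.Phi v = x" "Phi (\<iota> v) = \<phi> x" by blast
    note o = mono_folded[OF as(1)]
    have co: "c \<odot>\<^bsub>?R\<^esub> mono_folded as \<in> ?V" using D.Uq_plus_smult o by blast
    have C': "mono_folded as \<in> carrier ?R" "c \<odot>\<^bsub>?R\<^esub> mono_folded as \<in> carrier ?R" "v \<in> carrier ?R" using o co v Phi'_Up by auto
    have oC: "mono_hat as \<in> C" "c \<odot>\<^bsub>Uq G\<^esub> mono_hat as \<in> C" using Phi_hat_monomial(1)[OF as(1)] Uq_smult_closed by auto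
    have "D.Phi (c \<odot>\<^bsub>?R\<^esub> mono_folded as \<oplus>\<^bsub>?R\<^esub> v) = lsc c b + x"
      using D.Phi_add[OF C'(2,3)] D.Phi_smult[OF C'(1)] o as(2) v(2) by simp
    moreover have "Phi (\<iota> (c \<odot>\<^bsub>?R\<^esub> mono_folded as \<oplus>\<^bsub>?R\<^esub> v)) = \<phi> (lsc c b + x)"
    proof -
      have "\<iota> (c \<odot>\<^bsub>?R\<^esub> mono_folded as \<oplus>\<^bsub>?R\<^esub> v) = c \<odot>\<^bsub>Uq G\<^esub> mono_hat as \<oplus>\<^bsub>Uq G\<^esub> \<iota> v"
        using add[OF co v(1)] sc[OF conjunct1[OF o] v(1), of c] mon[OF as(1)] by simp
      then have "Phi (\<iota> (c \<odot>\<^bsub>?R\<^esub> mono_folded as \<oplus>\<^bsub>?R\<^esub> v)) = lsc c (hat as) + \<phi> x"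
        using Phi_add[OF oC(2) memC[OF v(1) v(1)]] Phi_smult[OF oC(1)] Phi_hat_monomial(2)[OF as(1)] v(3) by simp
      then show ?thesis using phi_X[OF as(1)] as(2) by (simp only: vp.linear_add[OF phi_linear] vp.linear_scale[OF phi_linear])
    qed
    ultimately show ?case using D.Uq_plus_add[OF co v(1)] by blast
  qed
  then obtain v where v: "v \<in> ?V" "D.Phi v = D.Phi u" "Phi (\<iota> v) = \<phi> (D.Phi u)" by blast
  then have "v = u" using inj_onD[OF D.Phi_inj, of v u] Phi'_Up u by blast
  then show "Phi (\<iota> u) = \<phi> (D.Phi u)" using v by simp
qed

lemma iota_unique:
  assumes "is_iota G \<sigma> T T' rs \<iota>" "is_iota G \<sigma> T T' rs \<iota>'"
  shows "\<iota> = \<iota>'"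
proof (rule extensionalityI[of _ "Uq_plus (folded G \<sigma>)"])
  show "\<iota> \<in> extensional (Uq_plus (folded G \<sigma>))" "\<iota>' \<in> extensional (Uq_plus (folded G \<sigma>))"
    using assms unfolding is_iota_def by (auto simp: PiE_def)
  fix u assume u: "u \<in> Uq_plus (folded G \<sigma>)"
  show "\<iota> u = \<iota>' u"
    using iota_Phi[OF assms(1) u] iota_Phi[OF assms(2) u] Uq_plus_sub by (intro inj_onD[OF Phi_inj]) auto
qed

lemma iota_inj:
  assumes "is_iota G \<sigma> T T' rs \<iota>"
  shows "inj_on \<iota> (Uq_plus (folded G \<sigma>))"
proof (rule inj_onI)
  fix u v assume uv: "u \<in> Uq_plus (folded G \<sigma>)" "v \<in> Uq_plus (folded G \<sigma>)" "\<iota> u = \<iota> v"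
  then have "\<phi> (D.Phi u) = \<phi> (D.Phi v)" using iota_Phi(2)[OF assms uv(1)] iota_Phi(2)[OF assms uv(2)] by simp
  then have "D.Phi u = D.Phi v" using inj_onD[OF phi_inj] Phi'_Up uv Up'_span by blast
  then show "u = v" using inj_onD[OF D.Phi_inj] Phi'_Up uv by blast
qed

lemma iota_fixed:
  assumes "is_iota G \<sigma> T T' rs \<iota>"
  shows "\<iota> ` Uq_plus (folded G \<sigma>) \<subseteq> fixed_points (uq_aut \<sigma>) (Uq_plus G)"
proof
  fix w assume "w \<in> \<iota> ` Uq_plus (folded G \<sigma>)"
  then obtain u where u: "u \<in> Uq_plus (folded G \<sigma>)" "w = \<iota> u" by blast
  note i = iota_Phi[OF assms u(1)]
  have "sg (Phi w) = Phi w" unfolding u(2) i(2) using phi_Up Phi'_Up[OF u(1)] sg_span_hat by blast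
  then show "w \<in> fixed_points (uq_aut \<sigma>) (Uq_plus G)"
    using i(1) u(2) fixed_iff[of w] Uq_plus_sub by (auto simp: fixed_points_def)
qed

lemma iota_bij:
  assumes i: "is_iota G \<sigma> T T' rs \<iota>"
  shows "bij_betw \<iota> (ordered_monomials (Uq (folded G \<sigma>)) (pbw_gens (folded G \<sigma>) T' rs))
    (fixed_points (uq_aut \<sigma>) (ordered_monomials (Uq G) (pbw_gens G T (concat oss))))"
  unfolding bij_betw_def
proof
  have s: "ordered_monomials (Uq (folded G \<sigma>)) (pbw_gens (folded G \<sigma>) T' rs) = mono_folded ` N"
    by (auto simp: ordered_monomials_def pbw_gens_def)
  show "inj_on \<iota> (ordered_monomials (Uq (folded G \<sigma>)) (pbw_gens (folded G \<sigma>) T' rs))"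
    unfolding s using mono_folded by (intro inj_on_subset[OF iota_inj[OF i]]) blast
  have "\<iota> (mono_folded as) = mono_hat as" if "as \<in> N" for as using i that unfolding is_iota_def by simp
  then have "\<iota> ` mono_folded ` N = mono_hat ` N" by (simp add: image_image)
  then show "\<iota> ` ordered_monomials (Uq (folded G \<sigma>)) (pbw_gens (folded G \<sigma>) T' rs)
    = fixed_points (uq_aut \<sigma>) (ordered_monomials (Uq G) (pbw_gens G T (concat oss)))"
    unfolding s fixed_monomials .
qed

end

theorem proposition1p19:
  fixes G :: "'i cartan_datum"
    and \<sigma> :: "'i \<Rightarrow> 'i"
    and T :: "'i \<Rightarrow> 'i free_alg set \<Rightarrow> 'i free_alg set"
    and T' :: "'i set \<Rightarrow> 'i set free_alg set \<Rightarrow> 'i set free_alg set"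
    and rs :: "'i set list"
    and js :: "'i list"
    and w0 :: "('i set \<Rightarrow> int) \<Rightarrow> ('i set \<Rightarrow> int)"
    and w0_hat :: "('i \<Rightarrow> int) \<Rightarrow> ('i \<Rightarrow> int)"
  assumes "finite_type G" and "simply_laced G"
    and "diagram_automorphism G \<sigma>" and "admissible G \<sigma>"
    and "lusztig_action G T" and "lusztig_action (folded G \<sigma>) T'"
    and "longest_element (folded G \<sigma>) w0" and "rs \<in> reduced_words (folded G \<sigma>) w0"
    and "longest_element G w0_hat" and "js \<in> reduced_words G w0_hat"
    and "is_lifting rs js"
  shows "(\<exists>!\<iota>. is_iota G \<sigma> T T' rs \<iota>) \<and>
    (\<forall>\<iota>. is_iota G \<sigma> T T' rs \<iota> \<longrightarrow>
       inj_on \<iota> (Uq_plus (folded G \<sigma>)) \<and>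
       \<iota> ` Uq_plus (folded G \<sigma>) \<subseteq> fixed_points (uq_aut \<sigma>) (Uq_plus G) \<and>
       bij_betw \<iota>
         (ordered_monomials (Uq (folded G \<sigma>)) (pbw_gens (folded G \<sigma>) T' rs))
         (fixed_points (uq_aut \<sigma>) (ordered_monomials (Uq G) (pbw_gens G T js))))"
proof -
  interpret c: cartan G using assms(1) by unfold_locales
  obtain P where P: "embed G P" using c.ex_embed by blast
  interpret f: folding G \<sigma> using assms by unfold_locales
  interpret c': cartan "folded G \<sigma>" using f.folded_finite_type by unfold_locales
  obtain P' where P': "embed (folded G \<sigma>) P'" using c'.ex_embed by blast
  interpret A: uq_action G P T using P assms(5) by (simp add: uq_action_def uq_action_axioms_def)
  interpret D: uq_action "folded G \<sigma>" P' T' using P' assms(6) by (simp add: uq_action_def uq_action_axioms_def)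
  obtain oss where oss: "list_all2 (\<lambda>r os. distinct os \<and> set os = r) rs oss" "js = concat oss"
    using assms(11) unfolding is_lifting_def by blast
  have "rs \<in> lists (orbit \<sigma> ` idx G)" using assms(8) by (simp add: reduced_words_def)
  \<comment> \<open>Reducedness of the lifted word gives independence of the target monomials; that
    \<open>rs\<close> is a longest word makes the source monomials a basis.\<close>
  moreover have "c.red (concat oss)" using A.reduced_words_red assms(10) oss(2) by blast
  moreover have "c'.longest rs" using D.reduced_words_longest assms(7,8) by blast
  ultimately interpret M: folding_map G P T \<sigma> rs oss P' T' using oss(1) by unfold_locales
  show ?thesis unfolding oss(2) using M.ex_iota M.iota_unique M.iota_inj M.iota_fixed M.iota_bij by blast
qed

end
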